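(* Let $\Omega\subset\mathbb R^2$ be a bounded Lipschitz domain with connected complement $\mathbb R^2\setminus\overline\Omega$, let $\mathbf 0\in\partial\Omega$, and suppose that $\Omega\cap B_h=W\cap B_h=:S_h$ for some $h>0$, where $W$ is the open sector with angles $\theta_m<\theta_M$. Let $(\mathbf v,\mathbf w)\in H^1(\Omega)^2\times H^1(\Omega)^2$ be a pair of generalized elastic transmission eigenfunctions associated with $\omega\in\mathbb R_+$, i.e. a solution of $$\mathcal L\mathbf v+\omega^2\mathbf v=\mathbf 0\ \text{in }\Omega,\qquad \mathcal L\mathbf w+\omega^2(1+V)\mathbf w=\mathbf 0\ \text{in }\Omega,\qquad \mathbf w=\mathbf v,\ \ T_\nu\mathbf v+\eta\mathbf v=T_\nu\mathbf w\ \text{on }\Gamma,$$ where $\Gamma\subset\partial\Omega$ is an open subset containing $\Gamma_h^+\cup\Gamma_h^-$. Let $q:=1+V$ and suppose that, for some $0<\alpha<1$, $q\mathbf w\in C^\alpha(\overline{S_h})^2$ and $\eta\in C^\alpha(\overline{\Gamma_h^\pm})$. Assume: (a) for given constants $\gamma,\beta_1,\beta_2$ with $\gamma>\max\{\beta_1,\beta_2\}>0$, there is a sequence of elastic Herglotz wave functions $\{\mathbf v_j\}_{j=1}^\infty$ with kernels $(g_{jp},g_{js})$ such that for all $j$ $$\|\mathbf v-\mathbf v_j\|_{H^1(S_h)^2}\le j^{-\gamma},\quad \|g_{jp}\|_{L^2(\mathbb S^1)}\le j^{\beta_1},\quad \|g_{js}\|_{L^2(\mathbb S^1)}\le j^{\beta_2};$$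 (b) $\eta(\mathbf 0)\neq 0$; (c) $-\pi<\theta_m<\theta_M<\pi$ and $\theta_M-\theta_m\neq\pi$. Then $$\lim_{\rho\to+0}\frac{1}{m(B(\mathbf 0,\rho)\cap\Omega)}\int_{B(\mathbf 0,\rho)\cap\Omega}|\mathbf v(\mathbf x)|\,\mathrm d\mathbf x=0,$$ where $m(\cdot)$ denotes Lebesgue measure.
   Context: Real constants $\lambda,\mu$ satisfy $\mu>0$ and $2\lambda+2\mu>0$. The Lamé operator is $\mathcal L\mathbf u=\mu\Delta\mathbf u+(\lambda+\mu)\nabla(\nabla\cdot\mathbf u)$. $V\in L^\infty(\Omega)$ is real-valued and nontrivial; $\eta\in L^\infty(\partial\Omega)$ is real-valued. Functions $\mathbf v,\mathbf w$ are $\mathbb C^2$-valued; the equations hold in the distributional sense and boundary values in the trace sense. With $\nu$ the outward unit normal and $\nu^\perp$ its anticlockwise rotation by $\pi/2$, the boundary traction is $T_\nu\mathbf v=2\mu\,\partial_\nu\mathbf v+\lambda\nu(\nabla\cdot\mathbf v)+\mu(\partial_2v_1-\partial_1v_2)\nu^\perp$. Sector: $W=\{\mathbf x\in\mathbb R^2:\mathbf x\ne\mathbf 0,\ \theta_m<\arg(x_1+\mathrm ix_2)<\theta_M\}$; its sides are $\Gamma^-=\{\mathbf x\ne\mathbf 0:\arg(x_1+\mathrm ix_2)=\theta_m\}$ and $\Gamma^+=\{\mathbf x\ne\mathbf 0:\arg(x_1+\mathrm ix_2)=\theta_M\}$. $B_h$ is the open disk of radius $h$ centred at $\mathbf 0$;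 $S_h=W\cap B_h$; $\Gamma_h^\pm=\Gamma^\pm\cap B_h$. Set $k_p=\omega/\sqrt{\lambda+2\mu}$, $k_s=\omega/\sqrt\mu$. The elastic Herglotz wave function with kernel $(g_{jp},g_{js})\in L^2(\mathbb S^1)^2$ is $$\mathbf v_j(\mathbf x)=e^{-\mathrm i\pi/4}\int_{\mathbb S^1}\Big\{\sqrt{\tfrac{k_p}{\omega}}\,e^{\mathrm ik_p\mathbf d\cdot\mathbf x}g_{jp}(\mathbf d)\,\mathbf d+\sqrt{\tfrac{k_s}{\omega}}\,e^{\mathrm ik_s\mathbf d\cdot\mathbf x}g_{js}(\mathbf d)\,\mathbf d^\perp\Big\}\mathrm d\sigma(\mathbf d),$$ where $\mathbf d^\perp\in\mathbb S^1$ is perpendicular to $\mathbf d$ (rotation of $\mathbf d$ by $\pi/2$). *)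

theory Defs
  imports "HOL-Analysis.Analysis"
begin

section \<open>Lebesgue spaces\<close>

definition L2 :: "'a measure \<Rightarrow> ('a \<Rightarrow> 'b::euclidean_space) \<Rightarrow> bool" where
  "L2 M f \<longleftrightarrow> f \<in> borel_measurable M \<and> integrable M (\<lambda>x. (norm (f x))\<^sup>2)"

definition L2_norm :: "'a measure \<Rightarrow> ('a \<Rightarrow> 'b::euclidean_space) \<Rightarrow> real" where
  "L2_norm M f = sqrt (LINT x|M. (norm (f x))\<^sup>2)"

definition Linfty :: "'a measure \<Rightarrow> ('a \<Rightarrow> 'b::euclidean_space) \<Rightarrow> bool" where
  "Linfty M f \<longleftrightarrow> f \<in> borel_measurable M \<and> (\<exists>C. AE x in M. norm (f x) \<le> C)"

definition holder_on ::
  "real \<Rightarrow> 'a::metric_space set \<Rightarrow> ('a \<Rightarrow> 'b::metric_space) \<Rightarrow> bool" where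
  "holder_on \<alpha> S f \<longleftrightarrow> (\<exists>C. \<forall>x\<in>S. \<forall>y\<in>S. dist (f x) (f y) \<le> C * dist x y powr \<alpha>)"


section \<open>Arc length\<close>

text \<open>The one-dimensional Hausdorff measure on the Borel sets.  With the normalisation below it
  is arc length on Lipschitz curves, hence the surface measure on the boundary of a planar
  Lipschitz domain.  Boundedness is required because \<open>diameter\<close> is meaningless on unbounded
  sets; covers may contain empty sets, whose diameter is 0.\<close>

definition hausdorff1_outer :: "'a::metric_space set \<Rightarrow> ennreal" where
  "hausdorff1_outer A =
     (SUP \<delta>\<in>{0<..}. INF U\<in>{U::nat \<Rightarrow> 'a set.
        A \<subseteq> (\<Union>n. U n) \<and> (\<forall>n. bounded (U n) \<and> diameter (U n) \<le> \<delta>)}.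
        (\<Sum>n. ennreal (diameter (U n))))"

definition hausdorff1 :: "'a::metric_space measure" where
  "hausdorff1 = measure_of UNIV (sets borel) hausdorff1_outer"

definition arclength_on :: "(real^2) set \<Rightarrow> (real^2) measure" where
  "arclength_on A = restrict_space hausdorff1 A"

text \<open>The measure \<open>d\<sigma>\<close> on the unit circle, in the angular parametrisation.\<close>

definition circle_measure :: "(real^2) measure" where
  "circle_measure = distr (lebesgue_on {0..2 * pi}) borel (\<lambda>t. vector [cos t, sin t])"


section \<open>Smooth functions and test functions\<close>

definition partial :: "2 \<Rightarrow> (real^2 \<Rightarrow> 'a::real_normed_vector) \<Rightarrow> real^2 \<Rightarrow> 'a" where
  "partial k f x = frechet_derivative f (at x) (axis k 1)"

fun C_k :: "nat \<Rightarrow> (real^2 \<Rightarrow> 'a::real_normed_vector) \<Rightarrow> bool" where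
  "C_k 0 f \<longleftrightarrow> continuous_on UNIV f"
| "C_k (Suc n) f \<longleftrightarrow> (\<forall>x. f differentiable (at x)) \<and> (\<forall>k. C_k n (partial k f))"

definition smooth :: "(real^2 \<Rightarrow> 'a::real_normed_vector) \<Rightarrow> bool" where
  "smooth f \<longleftrightarrow> (\<forall>n. C_k n f)"

definition tsupport :: "(real^2 \<Rightarrow> 'a::real_normed_vector) \<Rightarrow> (real^2) set" where
  "tsupport f = closure {x. f x \<noteq> 0}"

definition test_function :: "(real^2) set \<Rightarrow> (real^2 \<Rightarrow> 'a::real_normed_vector) \<Rightarrow> bool" where
  "test_function \<Omega> \<phi> \<longleftrightarrow> smooth \<phi> \<and> compact (tsupport \<phi>) \<and> tsupport \<phi> \<subseteq> \<Omega>"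


section \<open>The Sobolev space \<open>H\<^sup>1\<close>\<close>

definition has_weak_partial ::
  "(real^2) set \<Rightarrow> 2 \<Rightarrow> (real^2 \<Rightarrow> 'a::euclidean_space) \<Rightarrow> (real^2 \<Rightarrow> 'a) \<Rightarrow> bool" where
  "has_weak_partial \<Omega> k u g \<longleftrightarrow>
     (\<forall>\<phi>::real^2 \<Rightarrow> real. test_function \<Omega> \<phi> \<longrightarrow>
        (LINT x|lebesgue_on \<Omega>. partial k \<phi> x *\<^sub>R u x) = - (LINT x|lebesgue_on \<Omega>. \<phi> x *\<^sub>R g x))"

definition H1 :: "(real^2) set \<Rightarrow> (real^2 \<Rightarrow> 'a::euclidean_space) \<Rightarrow> bool" where
  "H1 \<Omega> u \<longleftrightarrow> L2 (lebesgue_on \<Omega>) u \<and>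
     (\<forall>k. \<exists>g. L2 (lebesgue_on \<Omega>) g \<and> has_weak_partial \<Omega> k u g)"

text \<open>A representative of the weak derivative; it is determined up to null sets when
  \<open>H1 \<Omega> u\<close> holds, and only then is it meaningful.\<close>

definition weak_partial ::
  "(real^2) set \<Rightarrow> 2 \<Rightarrow> (real^2 \<Rightarrow> 'a::euclidean_space) \<Rightarrow> real^2 \<Rightarrow> 'a" where
  "weak_partial \<Omega> k u = (SOME g. L2 (lebesgue_on \<Omega>) g \<and> has_weak_partial \<Omega> k u g)"

definition H1_norm :: "(real^2) set \<Rightarrow> (real^2 \<Rightarrow> 'a::euclidean_space) \<Rightarrow> real" where
  "H1_norm \<Omega> u =
     sqrt ((L2_norm (lebesgue_on \<Omega>) u)\<^sup>2
           + (\<Sum>k\<in>UNIV. (L2_norm (lebesgue_on \<Omega>) (weak_partial \<Omega> k u))\<^sup>2))"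

text \<open>The trace on \<open>\<partial>\<Omega>\<close>, as the closure of the restriction map on smooth functions.  On a
  bounded Lipschitz domain, by density and the trace theorem, every \<open>H\<^sup>1\<close> function has exactly
  one trace up to null sets.\<close>

definition has_trace ::
  "(real^2) set \<Rightarrow> (real^2 \<Rightarrow> 'a::euclidean_space) \<Rightarrow> (real^2 \<Rightarrow> 'a) \<Rightarrow> bool" where
  "has_trace \<Omega> u g \<longleftrightarrow> L2 (arclength_on (frontier \<Omega>)) g \<and>
     (\<exists>\<phi>::nat \<Rightarrow> real^2 \<Rightarrow> 'a. (\<forall>n. smooth (\<phi> n)) \<and>
        (\<lambda>n. H1_norm \<Omega> (\<lambda>x. \<phi> n x - u x)) \<longlonglongrightarrow> 0 \<and>
        (\<lambda>n. L2_norm (arclength_on (frontier \<Omega>)) (\<lambda>x. \<phi> n x - g x)) \<longlonglongrightarrow> 0)"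


section \<open>Planar domains\<close>

definition bounded_lipschitz_domain :: "(real^2) set \<Rightarrow> bool" where
  "bounded_lipschitz_domain \<Omega> \<longleftrightarrow>
     bounded \<Omega> \<and> open \<Omega> \<and> connected \<Omega> \<and> \<Omega> \<noteq> {} \<and>
     (\<forall>p\<in>frontier \<Omega>. \<exists>r>0. \<exists>R::real^2 \<Rightarrow> real^2. \<exists>f::real \<Rightarrow> real. \<exists>L.
        orthogonal_transformation R \<and> L-lipschitz_on UNIV f \<and>
        \<Omega> \<inter> ball p r = {x \<in> ball p r. f (R x $ 1) < R x $ 2})"

text \<open>\<open>Arg\<close> is the principal value, in \<open>(-\<pi>, \<pi>]\<close>.\<close>

definition angle :: "real^2 \<Rightarrow> real" where
  "angle x = Arg (Complex (x $ 1) (x $ 2))"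

definition sector :: "real \<Rightarrow> real \<Rightarrow> (real^2) set" where
  "sector \<theta>m \<theta>M = {x. x \<noteq> 0 \<and> \<theta>m < angle x \<and> angle x < \<theta>M}"

definition ray :: "real \<Rightarrow> (real^2) set" where
  "ray \<theta> = {x. x \<noteq> 0 \<and> angle x = \<theta>}"


section \<open>The Lame system\<close>

text \<open>All pairings are bilinear, without complex conjugation.\<close>

definition cdot :: "complex^2 \<Rightarrow> complex^2 \<Rightarrow> complex" where
  "cdot a b = (\<Sum>i\<in>UNIV. a $ i * b $ i)"

definition perp :: "real^2 \<Rightarrow> real^2" where
  "perp d = vector [- d $ 2, d $ 1]"

definition divg :: "(real^2 \<Rightarrow> complex^2) \<Rightarrow> real^2 \<Rightarrow> complex" where
  "divg u x = (\<Sum>k\<in>UNIV. partial k u x $ k)"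

definition lame :: "real \<Rightarrow> real \<Rightarrow> (real^2 \<Rightarrow> complex^2) \<Rightarrow> real^2 \<Rightarrow> complex^2" where
  "lame lam \<mu> u x =
     \<mu> *\<^sub>R (\<Sum>k\<in>UNIV. partial k (partial k u) x) + (lam + \<mu>) *\<^sub>R (\<chi> i. partial i (divg u) x)"

text \<open>The equation \<open>\<L>u = f\<close> in the sense of distributions; \<open>\<L>\<close> is its own formal transpose.\<close>

definition lame_distr ::
  "real \<Rightarrow> real \<Rightarrow> (real^2) set \<Rightarrow> (real^2 \<Rightarrow> complex^2) \<Rightarrow> (real^2 \<Rightarrow> complex^2) \<Rightarrow> bool" where
  "lame_distr lam \<mu> \<Omega> u f \<longleftrightarrow>
     (\<forall>\<phi>. test_function \<Omega> \<phi> \<longrightarrow>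
        (LINT x|lebesgue_on \<Omega>. cdot (u x) (lame lam \<mu> \<phi> x)) = (LINT x|lebesgue_on \<Omega>. cdot (f x) (\<phi> x)))"

text \<open>The traction in direction \<open>\<nu>\<close> of a field whose partial derivatives at the point
  considered are \<open>D 1\<close> and \<open>D 2\<close>.\<close>

definition traction :: "real \<Rightarrow> real \<Rightarrow> real^2 \<Rightarrow> (2 \<Rightarrow> complex^2) \<Rightarrow> complex^2" where
  "traction lam \<mu> \<nu> D =
     (2 * \<mu>) *\<^sub>R (\<Sum>k\<in>UNIV. \<nu> $ k *\<^sub>R D k)
     + lam *\<^sub>R (\<chi> i. of_real (\<nu> $ i) * (D 1 $ 1 + D 2 $ 2))
     + \<mu> *\<^sub>R (\<chi> i. of_real (perp \<nu> $ i) * (D 2 $ 1 - D 1 $ 2))"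

text \<open>For \<open>u\<close> in \<open>H\<^sup>1\<close> with \<open>\<L>u = f\<close> square integrable, the traction \<open>T\<^sub>\<nu>u\<close> on the boundary is
  the functional defined by Green's formula
  \<open>\<langle>T\<^sub>\<nu>u, \<phi>\<rangle> = \<integral>\<^sub>\<Omega> (\<Sum>k. T\<^sub>e\<^sub>k u \<cdot> \<partial>\<^sub>k\<phi>) + \<integral>\<^sub>\<Omega> f \<cdot> \<phi>\<close>
  (\<open>e\<^sub>k\<close> the coordinate directions, so that the \<open>T\<^sub>e\<^sub>k u\<close> are the columns of the stress tensor,
  \<open>T\<^sub>\<nu>\<close> is linear in \<open>\<nu>\<close>, and the divergence of the stress tensor is \<open>\<L>u\<close>).\<close>

definition traction_pairing ::
  "real \<Rightarrow> real \<Rightarrow> (real^2) set \<Rightarrow> (real^2 \<Rightarrow> complex^2) \<Rightarrow> (real^2 \<Rightarrow> complex^2)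
     \<Rightarrow> (real^2 \<Rightarrow> complex^2) \<Rightarrow> complex" where
  "traction_pairing lam \<mu> \<Omega> u f \<phi> =
     (LINT x|lebesgue_on \<Omega>.
        (\<Sum>k\<in>UNIV. cdot (traction lam \<mu> (axis k 1) (\<lambda>l. weak_partial \<Omega> l u x)) (partial k \<phi> x))
        + cdot (f x) (\<phi> x))"

text \<open>The equality of tractions on \<open>\<Gamma>\<close> is tested with smooth \<open>\<phi>\<close> whose support meets \<open>\<partial>\<Omega>\<close>
  only inside \<open>\<Gamma>\<close>, i.e. it holds in the sense of \<open>H\<^bsup>-1/2\<^esup>(\<Gamma>)\<close>.\<close>

definition generalized_elastic_transmission_pair ::
  "real \<Rightarrow> real \<Rightarrow> real \<Rightarrow> (real^2 \<Rightarrow> real) \<Rightarrow> (real^2 \<Rightarrow> real) \<Rightarrow> (real^2) set \<Rightarrow> (real^2) set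
     \<Rightarrow> (real^2 \<Rightarrow> complex^2) \<Rightarrow> (real^2 \<Rightarrow> complex^2) \<Rightarrow> bool" where
  "generalized_elastic_transmission_pair lam \<mu> \<omega> V \<eta> \<Omega> \<Gamma> v w \<longleftrightarrow>
     (let fv = (\<lambda>x. - (\<omega>\<^sup>2 *\<^sub>R v x)); fw = (\<lambda>x. - ((\<omega>\<^sup>2 * (1 + V x)) *\<^sub>R w x)) in
        H1 \<Omega> v \<and> H1 \<Omega> w \<and>
        lame_distr lam \<mu> \<Omega> v fv \<and> lame_distr lam \<mu> \<Omega> w fw \<and>
        (\<exists>tv tw. has_trace \<Omega> v tv \<and> has_trace \<Omega> w tw \<and>
           (AE x in arclength_on \<Gamma>. tw x = tv x) \<and>
           (\<forall>\<phi>. smooth \<phi> \<and> compact (tsupport \<phi>) \<and> tsupport \<phi> \<inter> frontier \<Omega> \<subseteq> \<Gamma> \<longrightarrow>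
              traction_pairing lam \<mu> \<Omega> v fv \<phi> + (LINT x|arclength_on \<Gamma>. of_real (\<eta> x) * cdot (tv x) (\<phi> x))
              = traction_pairing lam \<mu> \<Omega> w fw \<phi>)))"


section \<open>Elastic Herglotz waves\<close>

definition herglotz ::
  "real \<Rightarrow> real \<Rightarrow> real \<Rightarrow> (real^2 \<Rightarrow> complex) \<Rightarrow> (real^2 \<Rightarrow> complex) \<Rightarrow> real^2 \<Rightarrow> complex^2" where
  "herglotz lam \<mu> \<omega> gp gs x =
     (let kp = \<omega> / sqrt (lam + 2 * \<mu>); ks = \<omega> / sqrt \<mu> in
      \<chi> i. exp (- (\<i> * of_real pi / 4)) *
        (LINT d|circle_measure.
             of_real (sqrt (kp / \<omega>)) * exp (\<i> * of_real (kp * (d \<bullet> x))) * gp d * of_real (d $ i)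
           + of_real (sqrt (ks / \<omega>)) * exp (\<i> * of_real (ks * (d \<bullet> x))) * gs d * of_real (perp d $ i)))"

end

theory Submission
  imports Defs
begin

text \<open>The test field is \<open>(1 + t z)\<close> to the power \<open>-3\<close> times the vector \<open>(1, I)\<close>, where \<open>z = x\<^sub>1 + I x\<^sub>2\<close> and
  \<open>I = \<plusminus>\<i>\<close>. It has vanishing divergence and Laplacian, its pole lies off the closed sector because
  the angles lie strictly between \<open>-\<pi>\<close> and \<open>\<pi>\<close>, and it concentrates at the vertex at scale \<open>1/t\<close>. Cut
  off and inserted into the two Green formulas, it turns the transmission conditions into an
  integral of \<open>\<eta> v\<close> over the two edges; the volume terms, multiplied by \<open>t\<close>, tend to 0. On the edges
  \<open>v\<close> may be replaced by the Herglotz wave \<open>v\<^sub>j\<close> with \<open>t = j powr \<gamma>\<close>, by the trace inequality, and then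
  by \<open>v\<^sub>j 0\<close>. What remains is \<open>\<eta> 0\<close> times a component of \<open>v\<^sub>j 0\<close> times the sum of
  \<open>1 / (2 (cos \<theta> + I sin \<theta>))\<close> over the two angles, which is nonzero as the angles do not differ by \<open>\<pi>\<close>.
  So \<open>v\<^sub>j 0\<close> tends to 0, and so do the averages of \<open>v\<close>: on the ball of radius \<open>\<rho>\<close>, compare \<open>v\<close> with \<open>v\<^sub>j\<close>
  for \<open>j\<close> close to \<open>\<rho> powr (- 2 / (\<beta> + \<gamma>))\<close>, where \<open>\<beta> = max \<beta>1 \<beta>2\<close>.\<close>

section \<open>Calculus of the classes \<open>C_k\<close>\<close>

text \<open>A plane exponential decays in a half plane only and would exclude reflex sectors; a
  negative power of \<open>1 + t z\<close> asks only that the negative real axis be avoided. The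
  third power sets the rates: two factors have \<open>L\<^sup>2\<close> norm of order
  \<open>1/t\<close> on the sector and integral at most \<open>1/t\<close> along an edge, and the
  third supplies the smallness. It is indispensable in the volume, where the right-hand sides are
  merely square integrable.

  Tractions exist only through Green's formula. A second integration by parts therefore moves the
  derivatives of \<open>v\<close> and \<open>w\<close> onto the stress of the test field; it leaves
  no edge term because \<open>v\<close> and \<open>w\<close> share their trace. It is carried out
  along the two edge directions, since a derivative along one edge produces a boundary term on the
  other edge only.

  With \<open>t = j powr \<gamma>\<close> the trace error is
  \<open>sqrt t * j powr (- \<gamma>)\<close> and the variation of the wave costs
  \<open>j powr (\<beta> - \<gamma>)\<close>; both vanish in the limit. The error from freezing
  \<open>\<eta>\<close> carries the factor \<open>norm (v\<^sub>j 0)\<close>, not known to be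
  bounded beforehand, and is absorbed into the left side.\<close>

lemma partial_eq:
  "(f has_derivative f') (at x) \<Longrightarrow> partial k f x = f' (axis k 1)"
  unfolding partial_def using frechet_derivative_at by metis

lemma has_derivative_partial:
  fixes f :: "real^2 \<Rightarrow> 'a::real_normed_vector"
  assumes "f differentiable (at x)"
  shows "(f has_derivative (\<lambda>d. d$1 *\<^sub>R partial 1 f x + d$2 *\<^sub>R partial 2 f x)) (at x)"
proof -
  obtain f' where f': "(f has_derivative f') (at x)" using assms differentiable_def by blast
  interpret bounded_linear f' using f' has_derivative_bounded_linear by blast
  have "f' d = d$1 *\<^sub>R partial 1 f x + d$2 *\<^sub>R partial 2 f x" for d
  proof -
    have "d = d$1 *\<^sub>R axis 1 1 + d$2 *\<^sub>R axis 2 1"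
      by (simp add: vec_eq_iff forall_2 axis_def)
    then have "f' d = f' (d$1 *\<^sub>R axis 1 1 + d$2 *\<^sub>R axis 2 1)" by simp
    then show ?thesis by (simp add: add scaleR partial_eq[OF f'])
  qed
  then have "f' = (\<lambda>d. d$1 *\<^sub>R partial 1 f x + d$2 *\<^sub>R partial 2 f x)" by auto
  with f' show ?thesis by simp
qed

lemma partial_cong_open:
  fixes f g :: "real^2 \<Rightarrow> 'a::real_normed_vector"
  assumes "open S" "x \<in> S" "\<And>y. y \<in> S \<Longrightarrow> f y = g y" "g differentiable (at x)"
  shows "partial k f x = partial k g x" "f differentiable (at x)"
proof -
  obtain g' where g': "(g has_derivative g') (at x)" using assms(4) differentiable_def by blast
  have f: "(f has_derivative g') (at x)"
    using has_derivative_transform_within_open[OF g' assms(1,2)] assms(3) by metis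
  show "partial k f x = partial k g x" using partial_eq[OF f] partial_eq[OF g'] by simp
  show "f differentiable (at x)" using f differentiable_def by blast
qed

lemma C_k_differentiable: "C_k (Suc n) f \<Longrightarrow> f differentiable (at x)"
  by simp

lemma C_k_partial: "C_k (Suc n) f \<Longrightarrow> C_k n (partial k f)"
  by simp

lemma C_k_SucI:
  assumes "\<And>x. (f has_derivative f' x) (at x)" "\<And>k. C_k n (\<lambda>x. f' x (axis k 1))"
  shows "C_k (Suc n) f"
proof -
  have "partial k f = (\<lambda>x. f' x (axis k 1))" for k
    using partial_eq[OF assms(1)] by (simp add: fun_eq_iff)
  then show ?thesis using assms by (auto simp: differentiable_def)
qed

lemma C_k_Suc_imp: "C_k (Suc n) f \<Longrightarrow> C_k n f"
proof (induction n arbitrary: f)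
  case 0
  then show ?case
    by (auto simp: continuous_on_eq_continuous_at differentiable_imp_continuous_within)
next
  case (Suc n)
  from Suc.prems have "\<And>k. C_k (Suc n) (partial k f)" by (rule C_k_partial)
  then have "\<And>k. C_k n (partial k f)" using Suc.IH by blast
  then show ?case using C_k_differentiable[OF Suc.prems] by simp
qed

lemma C_k_continuous: "C_k n f \<Longrightarrow> continuous_on UNIV f"
  by (induction n) (use C_k_Suc_imp in auto)

lemma C_k_const [simp]: "C_k n (\<lambda>_. c)"
proof (induction n arbitrary: c)
  case (Suc n)
  show ?case by (rule C_k_SucI[where f' = "\<lambda>_ _. 0"]) (use Suc in auto)
qed simp

lemma C_k_add: "C_k n f \<Longrightarrow> C_k n g \<Longrightarrow> C_k n (\<lambda>x. f x + g x)"
proof (induction n arbitrary: f g)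
  case 0
  then show ?case by (auto intro: continuous_intros)
next
  case (Suc n)
  note d = C_k_differentiable[OF Suc.prems(1)] C_k_differentiable[OF Suc.prems(2)]
  show ?case
    by (rule C_k_SucI[OF has_derivative_add[OF frechet_derivative_works[THEN iffD1, OF d(1)]
          frechet_derivative_works[THEN iffD1, OF d(2)]]])
       (use Suc C_k_partial in \<open>auto simp: partial_def[symmetric]\<close>)
qed

lemma C_k_bounded_linear:
  assumes "bounded_linear h" "C_k n f" shows "C_k n (\<lambda>x. h (f x))"
  using assms(2)
proof (induction n arbitrary: f)
  case 0
  then show ?case using bounded_linear.continuous_on[OF assms(1)] by auto
next
  case (Suc n)
  note d = C_k_differentiable[OF Suc.prems]
  show ?case
    by (rule C_k_SucI[OF bounded_linear.has_derivative[OF assms(1) frechet_derivative_works[THEN iffD1, OF d]]])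
       (use Suc C_k_partial in \<open>auto simp: partial_def[symmetric]\<close>)
qed

lemma C_k_bounded_bilinear:
  assumes "bounded_bilinear h" "C_k n f" "C_k n g" shows "C_k n (\<lambda>x. h (f x) (g x))"
  using assms(2,3)
proof (induction n arbitrary: f g)
  case 0
  then show ?case using bounded_bilinear.continuous_on[OF assms(1)] by auto
next
  case (Suc n)
  note d = C_k_differentiable[OF Suc.prems(1)] C_k_differentiable[OF Suc.prems(2)]
  have fg: "C_k n f" "C_k n g" using Suc.prems C_k_Suc_imp by blast+
  show ?case
    by (rule C_k_SucI[OF bounded_bilinear.FDERIV[OF assms(1) frechet_derivative_works[THEN iffD1, OF d(1)]
          frechet_derivative_works[THEN iffD1, OF d(2)]]])
       (use Suc fg C_k_partial in \<open>auto simp: partial_def[symmetric] intro!: C_k_add\<close>)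
qed

lemmas C_k_mult = C_k_bounded_bilinear[OF bounded_bilinear_mult]
lemmas C_k_scaleR = C_k_bounded_bilinear[OF bounded_bilinear_scaleR]
lemmas C_k_inner = C_k_bounded_bilinear[OF bounded_bilinear_inner]
lemmas C_k_of_real = C_k_bounded_linear[OF bounded_linear_of_real]
lemmas C_k_uminus = C_k_bounded_linear[OF bounded_linear_minus[OF bounded_linear_ident]]

lemma C_k_diff: "C_k n f \<Longrightarrow> C_k n g \<Longrightarrow> C_k n (\<lambda>x. f x - g x)"
  using C_k_add[OF _ C_k_uminus, of n f g] by simp

lemma C_k_power: "C_k n f \<Longrightarrow> C_k n (\<lambda>x. f x ^ m :: 'a::real_normed_field)"
  by (induction m) (auto intro: C_k_mult)

lemma C_k_coord: "C_k n (\<lambda>x::real^2. x $ i)"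
proof (cases n)
  case (Suc m)
  have "C_k (Suc m) (\<lambda>x::real^2. x $ i)"
    by (rule C_k_SucI[where f' = "\<lambda>x d. d $ i"])
      (auto intro: bounded_linear.has_derivative[OF bounded_linear_vec_nth has_derivative_ident])
  with Suc show ?thesis by simp
qed (auto intro: continuous_intros)

lemma C_k_inverse:
  fixes f :: "real^2 \<Rightarrow> 'a::real_normed_field"
  assumes "C_k n f" "\<And>x. f x \<noteq> 0" shows "C_k n (\<lambda>x. inverse (f x))"
  using assms(1)
proof (induction n)
  case 0
  then show ?case using assms(2) by (auto intro!: continuous_intros)
next
  case (Suc n)
  note d = C_k_differentiable[OF Suc.prems]
  show ?case
    by (rule C_k_SucI[OF Deriv.has_derivative_inverse[OF assms(2) frechet_derivative_works[THEN iffD1, OF d]]])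
       (use Suc C_k_Suc_imp[OF Suc.prems] C_k_partial[OF Suc.prems]
          in \<open>auto simp: partial_def[symmetric] intro!: C_k_mult C_k_uminus\<close>)
qed

text \<open>The outer function comes as a whole tower of derivatives \<open>D 0\<close>,
  \<open>D 1\<close>, ..., so that the induction runs over all levels at once: differentiating at
  level \<open>m\<close> lands on level \<open>Suc m\<close>.\<close>

lemma C_k_compose_real:
  fixes D :: "nat \<Rightarrow> real \<Rightarrow> real"
  assumes "\<And>m x. (D m has_real_derivative D (Suc m) x) (at x)" "C_k n f"
  shows "C_k n (\<lambda>x. D m (f x))"
  using assms(2)
proof (induction n arbitrary: m)
  case 0
  have "continuous_on UNIV (D m)"
    using assms(1) DERIV_isCont continuous_at_imp_continuous_on by blast
  with 0 show ?case using continuous_on_compose2[of UNIV "D m" UNIV f] by auto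
next
  case (Suc n)
  note d = frechet_derivative_works[THEN iffD1, OF C_k_differentiable[OF Suc.prems]]
  have "((\<lambda>x. D m (f x)) has_derivative (\<lambda>y. D (Suc m) (f x) * frechet_derivative f (at x) y)) (at x)" for x
    using has_derivative_compose[OF d assms(1)[unfolded has_field_derivative_def]] by simp
  then show ?case
    by (rule C_k_SucI)
      (use Suc.IH C_k_Suc_imp[OF Suc.prems] C_k_partial[OF Suc.prems]
          in \<open>auto simp: partial_def[symmetric] intro!: C_k_mult\<close>)
qed

lemma smoothI: "(\<And>n. C_k n f) \<Longrightarrow> smooth f" by (simp add: smooth_def)
lemma smoothD: "smooth f \<Longrightarrow> C_k n f" by (simp add: smooth_def)

lemma smooth_partial: "smooth f \<Longrightarrow> smooth (partial k f)"
  using C_k_partial smooth_def by blast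

section \<open>Bump functions\<close>

definition bump :: "real \<Rightarrow> real" where
  "bump x = (if x \<le> 0 then 0 else exp (- inverse x))"

text \<open>Functions of this shape are closed under differentiation, so one family contains
  \<open>bump\<close> (the case \<open>p = 1\<close>) and all its derivatives.\<close>

definition bump_poly :: "real poly \<Rightarrow> real \<Rightarrow> real" where
  "bump_poly p x = (if x \<le> 0 then 0 else poly p (inverse x) * exp (- inverse x))"

text \<open>The chain rule for \<open>inverse x\<close> contributes the square of
  \<open>inverse x\<close>, that is the polynomial \<open>[:0,0,1:]\<close>; the difference collects
  the derivatives of the exponential and of the polynomial factor.\<close>

definition bump_step :: "real poly \<Rightarrow> real poly" where
  "bump_step p = [:0,0,1:] * (p - pderiv p)"

lemma bump_poly_tendsto: "((\<lambda>x. poly p (inverse x) * exp (- inverse x)) \<longlongrightarrow> 0) (at_right (0::real))"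
proof -
  have "((\<lambda>x. poly p x / exp x) \<longlongrightarrow> 0) at_top"
  proof (induction p)
    case (pCons a p)
    have "((\<lambda>x::real. x ^ k / exp x) \<longlongrightarrow> 0) at_top" for k by (rule tendsto_power_div_exp_0)
    then have l: "((\<lambda>x::real. x ^ k / exp x) \<longlongrightarrow> 0) at_top" for k .
    have "((\<lambda>x. \<Sum>i\<le>degree (pCons a p). coeff (pCons a p) i * (x ^ i / exp x)) \<longlongrightarrow>
        (\<Sum>i\<le>degree (pCons a p). coeff (pCons a p) i * 0)) at_top"
      by (intro tendsto_intros l)
    then show ?case by (simp add: poly_altdef sum_divide_distrib)
  qed simp
  then have "((\<lambda>x. poly p (inverse x) / exp (inverse x)) \<longlongrightarrow> 0) (at_right (0::real))"
    using filterlim_compose[OF _ filterlim_inverse_at_top_right] by blast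
  then show ?thesis by (simp add: exp_minus field_simps)
qed

lemma bump_poly_deriv: "(bump_poly p has_real_derivative bump_poly (bump_step p) x) (at x)"
proof -
  consider "x < 0" | "x = 0" | "x > 0" by linarith
  then show ?thesis
  proof cases
    case 1
    have "((\<lambda>_. 0) has_real_derivative bump_poly (bump_step p) x) (at x)"
      using 1 by (auto simp: bump_poly_def)
    moreover have "open {..<(0::real)}" by simp
    ultimately show ?thesis
      by (rule has_field_derivative_transform_within_open) (use 1 in \<open>auto simp: bump_poly_def\<close>)
  next
    case 3
    have "((\<lambda>x. poly p (inverse x) * exp (- inverse x)) has_real_derivative bump_poly (bump_step p) x) (at x)"
      using 3 by (auto intro!: derivative_eq_intros DERIV_chain2[OF poly_DERIV]
        simp: bump_poly_def bump_step_def field_simps power2_eq_square)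
    moreover have "open {(0::real)<..}" by simp
    ultimately show ?thesis
      by (rule has_field_derivative_transform_within_open) (use 3 in \<open>auto simp: bump_poly_def\<close>)
  next
    case 2
    have "((\<lambda>h. bump_poly p h / h) \<longlongrightarrow> 0) (at_right 0)"
      \<comment> \<open>Prepending 0 multiplies the polynomial by its variable, which absorbs the
        division by \<open>h\<close>.\<close>
      using bump_poly_tendsto[of "pCons 0 p"]
      by (rule Lim_transform_eventually)
        (auto simp: eventually_at_right_field bump_poly_def field_simps intro: exI[of _ 1])
    moreover have "((\<lambda>h. bump_poly p h / h) \<longlongrightarrow> 0) (at_left 0)"
      by (rule Lim_transform_eventually[of "\<lambda>_. 0"])
        (auto simp: eventually_at_left_field bump_poly_def intro: exI[of _ "-1"])
    ultimately have "((\<lambda>h. bump_poly p h / h) \<longlongrightarrow> 0) (at 0)"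
      by (simp add: filterlim_split_at)
    then show ?thesis using 2 by (simp add: DERIV_def bump_poly_def)
  qed
qed

lemma C_k_bump: assumes "C_k n f" shows "C_k n (\<lambda>x. bump (f x))"
proof -
  have "bump = bump_poly ((bump_step ^^ 0) 1)" by (auto simp: bump_def bump_poly_def fun_eq_iff)
  then show ?thesis
    using C_k_compose_real[of "\<lambda>m. bump_poly ((bump_step ^^ m) 1)", OF _ assms, of 0] bump_poly_deriv
    by simp
qed

lemma bump_nonneg: "bump x \<ge> 0" and bump_le_1: "bump x \<le> 1"
  and bump_pos_iff: "bump x > 0 \<longleftrightarrow> x > 0" and bump_eq_0_iff: "bump x = 0 \<longleftrightarrow> x \<le> 0"
  by (auto simp: bump_def)

lemma C_k_norm2: "C_k n (\<lambda>x::real^2. (norm x)\<^sup>2)"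
proof -
  have "(\<lambda>x::real^2. (norm x)\<^sup>2) = (\<lambda>x. x$1 * x$1 + x$2 * x$2)"
    by (simp add: power2_norm_eq_inner inner_vec_def UNIV_2)
  then show ?thesis by (auto intro!: C_k_add C_k_mult C_k_coord)
qed

text \<open>A bump that is positive inside radius \<open>R\<close> is divided by its sum with a bump
  that is positive outside radius \<open>r\<close>; as \<open>r < R\<close>, one of the two is
  positive at every point and the denominator never vanishes. Squared norms keep the arguments
  smooth at 0.\<close>

lemma cutoff_exists:
  assumes "0 < r" "r < R"
  obtains c :: "real^2 \<Rightarrow> real" where "smooth c" "\<And>x. norm x \<le> r \<Longrightarrow> c x = 1"
    "\<And>x. norm x \<ge> R \<Longrightarrow> c x = 0" "\<And>x. 0 \<le> c x" "\<And>x. c x \<le> 1"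
proof
  let ?a = "\<lambda>x::real^2. bump (R\<^sup>2 - (norm x)\<^sup>2)" and ?b = "\<lambda>x::real^2. bump ((norm x)\<^sup>2 - r\<^sup>2)"
  let ?c = "\<lambda>x. ?a x * inverse (?a x + ?b x)"
  have rR: "r\<^sup>2 < R\<^sup>2" using assms by (simp add: power_strict_mono)
  have pos: "?a x + ?b x > 0" for x
  proof (cases "(norm x)\<^sup>2 < R\<^sup>2")
    case True
    then have "?a x > 0" by (simp add: bump_pos_iff)
    then show ?thesis using bump_nonneg[of "(norm x)\<^sup>2 - r\<^sup>2"] by linarith
  next
    case False
    then have "?b x > 0" using rR by (simp add: bump_pos_iff)
    then show ?thesis using bump_nonneg[of "R\<^sup>2 - (norm x)\<^sup>2"] by linarith
  qed
  then have nz: "?a x + ?b x \<noteq> 0" for x by (metis less_irrefl)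
  show "smooth ?c"
    by (intro smoothI C_k_mult C_k_inverse nz C_k_add C_k_bump C_k_diff C_k_norm2 C_k_const)
  show "?c x = 1" if "norm x \<le> r" for x
  proof -
    have "(norm x)\<^sup>2 \<le> r\<^sup>2" using that by (simp add: power_mono)
    then have "?b x = 0" by (simp add: bump_eq_0_iff)
    then show ?thesis using nz[of x] by simp
  qed
  show "?c x = 0" if "norm x \<ge> R" for x
    using that assms by (simp add: bump_eq_0_iff power_mono)
  show "0 \<le> ?c x" for x using pos[of x] bump_nonneg by simp
  show "?c x \<le> 1" for x using pos[of x] bump_nonneg[of "(norm x)\<^sup>2 - r\<^sup>2"]
    by (simp add: field_simps)
qed

section \<open>Arc length\<close>

definition hpre :: "real \<Rightarrow> 'a::metric_space set \<Rightarrow> ennreal" where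
  "hpre \<delta> A = (INF U\<in>{U::nat \<Rightarrow> 'a set.
        A \<subseteq> (\<Union>n. U n) \<and> (\<forall>n. bounded (U n) \<and> diameter (U n) \<le> \<delta>)}.
        (\<Sum>n. ennreal (diameter (U n))))"

lemma hausdorff1_outer_hpre: "hausdorff1_outer A = (SUP \<delta>\<in>{0<..}. hpre \<delta> A)"
  by (simp add: hausdorff1_outer_def hpre_def)

lemma hpre_le:
  assumes "A \<subseteq> (\<Union>n. U n)" "\<And>n::nat. bounded (U n)" "\<And>n. diameter (U n) \<le> \<delta>"
  shows "hpre \<delta> A \<le> (\<Sum>n. ennreal (diameter (U n)))"
  unfolding hpre_def using assms by (intro INF_lower) auto

lemma hpre_mono: "A \<subseteq> B \<Longrightarrow> hpre \<delta> A \<le> hpre \<delta> B"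
  unfolding hpre_def by (intro INF_superset_mono) auto

lemma hpre_antimono: "\<delta> \<le> \<delta>' \<Longrightarrow> hpre \<delta>' A \<le> hpre \<delta> A"
  unfolding hpre_def by (intro INF_superset_mono) (auto intro: order_trans)

lemma hpre_empty: "0 \<le> \<delta> \<Longrightarrow> hpre \<delta> {} = 0"
  using hpre_le[of "{}" "\<lambda>_. {}" \<delta>] by simp

lemma hpre_le_hausdorff1: "0 < \<delta> \<Longrightarrow> hpre \<delta> A \<le> hausdorff1_outer A"
  unfolding hausdorff1_outer_hpre by (rule SUP_upper) auto

lemma hpre_subadditive:
  assumes "0 \<le> \<delta>"
  shows "hpre \<delta> (\<Union>i::nat. A i) \<le> (\<Sum>i. hpre \<delta> (A i))"
proof (rule ennreal_le_epsilon)
  fix e :: real assume fin: "(\<Sum>i. hpre \<delta> (A i)) < top" and "0 < e"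
  have "\<exists>U. A i \<subseteq> (\<Union>n. U n) \<and> (\<forall>n. bounded (U n) \<and> diameter (U n) \<le> \<delta>) \<and>
      (\<Sum>n::nat. ennreal (diameter (U n))) \<le> hpre \<delta> (A i) + ennreal (e * (1/2)^Suc i)" for i
  proof -
    define c where "c = hpre \<delta> (A i) + ennreal (e * (1/2)^Suc i)"
    have "hpre \<delta> (A i) < top" using fin ennreal_suminf_lessD by blast
    moreover have "0 < ennreal (e * (1/2)^Suc i)" using \<open>0 < e\<close> by simp
    ultimately have "hpre \<delta> (A i) < c"
      unfolding c_def using ennreal_add_left_cancel_less[of "hpre \<delta> (A i)" 0] by (simp add: less_top)
    then obtain U where "A i \<subseteq> (\<Union>n. U n)" "\<forall>n. bounded (U n) \<and> diameter (U n) \<le> \<delta>"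
      "(\<Sum>n::nat. ennreal (diameter (U n))) < c"
      unfolding hpre_def INF_less_iff by blast
    then show ?thesis unfolding c_def[symmetric] using less_imp_le by blast
  qed
  then obtain U where U: "\<And>i. A i \<subseteq> (\<Union>n. U i n)" "\<And>i n. bounded (U i n)"
      "\<And>i n. diameter (U i n) \<le> \<delta>"
      "\<And>i. (\<Sum>n::nat. ennreal (diameter (U i n))) \<le> hpre \<delta> (A i) + ennreal (e * (1/2)^Suc i)"
    by metis
  let ?V = "\<lambda>k. case prod_decode k of (i, n) \<Rightarrow> U i n"
  have "hpre \<delta> (\<Union>i. A i) \<le> (\<Sum>k. ennreal (diameter (?V k)))"
  proof (rule hpre_le)
    show "(\<Union>i. A i) \<subseteq> (\<Union>k. ?V k)"
    proof
      fix x assume "x \<in> (\<Union>i. A i)"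
      then obtain i n where "x \<in> U i n" using U(1) by blast
      then have "x \<in> ?V (prod_encode (i, n))" by simp
      then show "x \<in> (\<Union>k. ?V k)" by (rule UN_I[OF UNIV_I])
    qed
  qed (auto simp: U(2,3) split: prod.split)
  also have "\<dots> = (\<Sum>k. (\<lambda>(i,n). ennreal (diameter (U i n))) (prod_decode k))"
    by (simp add: case_prod_beta)
  also have "\<dots> = (\<Sum>i. \<Sum>n. ennreal (diameter (U i n)))"
    by (rule suminf_ennreal_2dimen) simp
  also have "\<dots> \<le> (\<Sum>i. hpre \<delta> (A i) + ennreal (e * (1/2)^Suc i))"
    by (intro suminf_le U(4)) auto
  also have "\<dots> = (\<Sum>i. hpre \<delta> (A i)) + (\<Sum>i. ennreal (e * (1/2)^Suc i))"
    by (rule suminf_add[symmetric]) auto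
  also have "(\<Sum>i. ennreal (e * (1/2)^Suc i)) = ennreal e"
    using \<open>0 < e\<close> sums_mult[OF power_half_series, of e]
    by (intro sums_unique[symmetric] sums_ennreal[THEN iffD2]) auto
  finally show "hpre \<delta> (\<Union>i. A i) \<le> (\<Sum>i. hpre \<delta> (A i)) + ennreal e" .
qed

lemma hausdorff1_outer_mono: "A \<subseteq> B \<Longrightarrow> hausdorff1_outer A \<le> hausdorff1_outer B"
  unfolding hausdorff1_outer_hpre by (intro SUP_mono') (rule hpre_mono)

lemma hausdorff1_outer_empty: "hausdorff1_outer {} = 0"
  unfolding hausdorff1_outer_hpre by (simp add: hpre_empty)

lemma hausdorff1_outer_subadditive:
  "hausdorff1_outer (\<Union>i::nat. A i) \<le> (\<Sum>i. hausdorff1_outer (A i))"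
proof -
  have "hpre \<delta> (\<Union>i. A i) \<le> (\<Sum>i. hausdorff1_outer (A i))" if "\<delta> > 0" for \<delta>
    using hpre_subadditive[of \<delta> A] that
    by (rule_tac order_trans[OF hpre_subadditive]) (auto intro!: suminf_le hpre_le_hausdorff1)
  then show ?thesis unfolding hausdorff1_outer_hpre[of "\<Union>i. A i"] by (intro SUP_least) auto
qed

lemma hausdorff1_outer_Un:
  "hausdorff1_outer (A \<union> B) \<le> hausdorff1_outer A + hausdorff1_outer B"
proof -
  have "hausdorff1_outer (\<Union>i. (binaryset A B) i) \<le> (\<Sum>i. hausdorff1_outer (binaryset A B i))"
    by (rule hausdorff1_outer_subadditive)
  then show ?thesis
    by (simp add: UN_binaryset_eq suminf_binaryset_eq hausdorff1_outer_empty)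
qed

text \<open>A set of diameter at most \<open>\<delta>\<close> cannot meet both \<open>A\<close> and
  \<open>B\<close>, so every admissible cover splits into a cover of \<open>A\<close> and one of
  \<open>B\<close>; discarded members are replaced by the empty set, of diameter 0.\<close>

lemma hpre_separated:
  assumes "\<And>x y. x \<in> A \<Longrightarrow> y \<in> B \<Longrightarrow> \<delta> < dist x y" and "0 \<le> \<delta>"
  shows "hpre \<delta> A + hpre \<delta> B \<le> hpre \<delta> (A \<union> B)"
proof -
  have "hpre \<delta> A + hpre \<delta> B \<le> (\<Sum>n. ennreal (diameter (U n)))"
    if U: "A \<union> B \<subseteq> (\<Union>n. U n)" "\<And>n. bounded (U n)" "\<And>n. diameter (U n) \<le> \<delta>" for U :: "nat \<Rightarrow> 'a set"
  proof -
    define V where "V C n = (if U n \<inter> C = {} then {} else U n)" for C n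
    have V: "hpre \<delta> C \<le> (\<Sum>n. ennreal (diameter (V C n)))" if "C \<subseteq> A \<union> B" for C
    proof (rule hpre_le)
      show "C \<subseteq> (\<Union>n. V C n)" using that U(1) by (fastforce simp: V_def)
    qed (use U assms in \<open>auto simp: V_def\<close>)
    have "ennreal (diameter (V A n)) + ennreal (diameter (V B n)) \<le> ennreal (diameter (U n))" for n
    proof (cases "U n \<inter> A = {} \<or> U n \<inter> B = {}")
      case False
      then obtain x y where xy: "x \<in> U n" "x \<in> A" "y \<in> U n" "y \<in> B" by auto
      have "dist x y \<le> diameter (U n)" using diameter_bounded_bound[OF U(2)] xy by blast
      then show ?thesis using assms(1)[OF xy(2,4)] U(3)[of n] by linarith
    qed (auto simp: V_def)
    then have "(\<Sum>n. ennreal (diameter (V A n)) + ennreal (diameter (V B n))) \<le> (\<Sum>n. ennreal (diameter (U n)))"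
      by (intro suminf_le) auto
    then have "(\<Sum>n. ennreal (diameter (V A n))) + (\<Sum>n. ennreal (diameter (V B n))) \<le> (\<Sum>n. ennreal (diameter (U n)))"
      by (subst suminf_add) auto
    then show ?thesis using add_mono[OF V[of A] V[of B]] by (auto intro: order_trans)
  qed
  then show ?thesis unfolding hpre_def[of \<delta> "A \<union> B"] by (intro INF_greatest) auto
qed

lemma hausdorff1_outer_separated:
  assumes "\<And>x y. x \<in> A \<Longrightarrow> y \<in> B \<Longrightarrow> e \<le> dist x y" and "0 < e"
  shows "hausdorff1_outer A + hausdorff1_outer B \<le> hausdorff1_outer (A \<union> B)"
proof -
  have *: "hpre a A + hpre b B \<le> hausdorff1_outer (A \<union> B)" if "0 < a" "0 < b" for a b
  proof -
    \<comment> \<open>Half of \<open>e\<close>, because \<open>hpre_separated\<close> needs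
      distances strictly above the scale.\<close>
    define m where "m = Min {a, b, e/2}"
    have m: "0 < m" "m \<le> a" "m \<le> b" "m < e" using that assms(2) by (auto simp: m_def)
    have "hpre a A + hpre b B \<le> hpre m A + hpre m B" by (intro add_mono hpre_antimono m)
    also have "\<dots> \<le> hpre m (A \<union> B)"
      by (rule hpre_separated) (use assms m in \<open>force+\<close>)
    also have "\<dots> \<le> hausdorff1_outer (A \<union> B)" by (rule hpre_le_hausdorff1[OF m(1)])
    finally show ?thesis .
  qed
  have ne: "{0::real<..} \<noteq> {}" by (metis greaterThan_iff empty_iff zero_less_one)
  have "hpre a A + hausdorff1_outer B \<le> hausdorff1_outer (A \<union> B)" if "0 < a" for a
    unfolding hausdorff1_outer_hpre[of B] ennreal_SUP_add_right[OF ne]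
    by (intro SUP_least *) (use that in auto)
  then show ?thesis
    unfolding hausdorff1_outer_hpre[of A] ennreal_SUP_add_left[OF ne, symmetric]
    by (intro SUP_least) auto
qed

text \<open>The induction separates the last set from the union of all earlier ones, so a gap
  depending on the later index is enough. It may shrink along the sequence, as it does for shells
  accumulating at a closed set.\<close>

lemma hausdorff1_outer_sum_separated:
  assumes "\<And>i j x y. i < j \<Longrightarrow> x \<in> B i \<Longrightarrow> y \<in> B j \<Longrightarrow> e j \<le> dist x y" "\<And>j. 0 < e j"
  shows "(\<Sum>i<(n::nat). hausdorff1_outer (B i)) \<le> hausdorff1_outer (\<Union>i<n. B i)"
proof (induction n)
  case (Suc n)
  have "(\<Sum>i<Suc n. hausdorff1_outer (B i)) \<le> hausdorff1_outer (\<Union>i<n. B i) + hausdorff1_outer (B n)"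
    using Suc by (auto intro: add_right_mono)
  also have "\<dots> \<le> hausdorff1_outer ((\<Union>i<n. B i) \<union> B n)"
    by (rule hausdorff1_outer_separated[of _ _ "e n"]) (use assms in auto)
  finally show ?case by (simp add: lessThan_Suc Un_commute)
qed simp

text \<open>Caratheodory's criterion for a metric outer measure: the part of \<open>A\<close> outside the set is
  exhausted by the shells \<open>B k\<close>, and shells that are two apart are separated.\<close>

lemma hausdorff1_outer_split:
  fixes g :: "'a::metric_space \<Rightarrow> real"
  assumes g: "\<And>x y. \<bar>g x - g y\<bar> \<le> dist x y"
  shows "hausdorff1_outer (A \<inter> {x. g x \<le> 0}) + hausdorff1_outer (A - {x. g x \<le> 0}) \<le> hausdorff1_outer A"
proof (cases "hausdorff1_outer A = top")
  case False
  define B where "B k = A \<inter> {x. 1 / real (k+2) \<le> g x \<and> g x < 1 / real (k+1)}" for k :: nat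
  define C where "C k = A \<inter> {x. 1 / real (k+1) \<le> g x}" for k :: nat
  have BA: "hausdorff1_outer (B k) \<le> hausdorff1_outer A" for k
    by (rule hausdorff1_outer_mono) (auto simp: B_def)
  define c where "c k = enn2real (hausdorff1_outer (B k))" for k
  have c: "hausdorff1_outer (B k) = ennreal (c k)" "0 \<le> c k" for k
    using BA[of k] False by (auto simp: c_def less_top[symmetric] top_unique intro!: ennreal_enn2real[symmetric])
  have half: "summable (\<lambda>i. c (2*i+p))" for p
  proof (rule summableI_nonneg_bounded)
    fix n
    have "(\<Sum>i<n. hausdorff1_outer (B (2*i+p))) \<le> hausdorff1_outer (\<Union>i<n. B (2*i+p))"
    \<comment> \<open>The gap is the width of the omitted shell \<open>2*j+p-1\<close>. At index 0
      division by zero gives 0 and the difference is negative; the summand 2 restores positivity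
      there, a case with no earlier shell to be separated from.\<close>
    proof (rule hausdorff1_outer_sum_separated[where e = "\<lambda>j. 1 / real (2*j+p) - 1 / real (2*j+p+1) + (if 2*j+p = 0 then 2 else 0)"])
      fix i j x y assume ij: "i < j" and x: "x \<in> B (2*i+p)" and y: "y \<in> B (2*j+p)"
      have "1 / real (2*j+p) \<le> 1 / real (2*i+p+2)" using ij by (intro divide_left_mono) auto
      also have "\<dots> \<le> g x" using x by (simp add: B_def)
      finally have "1 / real (2*j+p) \<le> g x" .
      moreover have "g y < 1 / real (2*j+p+1)" using y by (simp add: B_def)
      ultimately show "1 / real (2*j+p) - 1 / real (2*j+p+1) + (if 2*j+p = 0 then 2 else 0) \<le> dist x y"
        using g[of x y] ij by auto
    next
      fix j show "0 < 1 / real (2*j+p) - 1 / real (2*j+p+1) + (if 2*j+p = 0 then 2 else (0::real))"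
        by (cases "2*j+p = 0") (auto simp: field_simps)
    qed
    also have "\<dots> \<le> hausdorff1_outer A" by (rule hausdorff1_outer_mono) (auto simp: B_def)
    finally have "ennreal (\<Sum>i<n. c (2*i+p)) \<le> hausdorff1_outer A"
      by (simp add: c sum_ennreal)
    then show "(\<Sum>i<n. c (2*i+p)) \<le> enn2real (hausdorff1_outer A)"
      using False enn2real_mono[of "ennreal (\<Sum>i<n. c (2*i+p))" "hausdorff1_outer A"]
      by (simp add: less_top sum_nonneg c)
  qed (rule c)
  have sum: "summable c"
  proof (rule summableI_nonneg_bounded)
    fix n
    have "(\<Sum>i<n. c i) \<le> (\<Sum>i<2*n. c i)" by (intro sum_mono2) (auto simp: c)
    also have "(\<Sum>i<2*n. c i) = (\<Sum>i<n. c (2*i+0)) + (\<Sum>i<n. c (2*i+1))"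
      by (induction n) auto
    also have "\<dots> \<le> (\<Sum>i. c (2*i+0)) + (\<Sum>i. c (2*i+1))"
      by (intro add_mono sum_le_suminf half) (auto simp: c)
    finally show "(\<Sum>i<n. c i) \<le> (\<Sum>i. c (2*i+0)) + (\<Sum>i. c (2*i+1))" .
  qed (rule c)
  show ?thesis
  proof (rule ennreal_le_epsilon)
    fix e :: real assume "0 < e"
    obtain n where n: "norm (\<Sum>i. c (i+n)) < e"
      using suminf_exist_split[OF \<open>0 < e\<close> sum] by blast
    have "A - {x. g x \<le> 0} \<subseteq> C n \<union> (\<Union>i. B (i+n))"
    proof
      fix x assume x: "x \<in> A - {x. g x \<le> 0}"
      then have gx: "0 < g x" by auto
      show "x \<in> C n \<union> (\<Union>i. B (i+n))"
      proof (cases "1 / real (n+1) \<le> g x")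
        case False
        \<comment> \<open>The first threshold reached by \<open>g x\<close>: one index before it the
          threshold is missed, so \<open>x\<close> lies in shell \<open>m - 1\<close>.\<close>
        define m where "m = (LEAST m. 1 / real (m+1) \<le> g x)"
        have ex: "\<exists>m. 1 / real (m+1) \<le> g x"
          using reals_Archimedean[OF gx] by (auto simp: inverse_eq_divide intro: less_imp_le)
        have m: "1 / real (m+1) \<le> g x" unfolding m_def by (rule LeastI_ex[OF ex])
        have "n < m"
        proof (rule ccontr)
          assume "\<not> n < m"
          then have "1 / real (n+1) \<le> 1 / real (m+1)" by (intro divide_left_mono) auto
          then show False using False m by simp
        qed
        then obtain i where i: "m = Suc (i + n)" using less_iff_Suc_add by (auto simp: add.commute)
        have "\<not> 1 / real (i+n+1) \<le> g x"
          using not_less_Least[of "i+n" "\<lambda>m. 1 / real (m+1) \<le> g x"] i by (simp add: m_def)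
        then have "x \<in> B (i+n)" using x m i by (auto simp: B_def)
        then show ?thesis by blast
      qed (use x in \<open>auto simp: C_def\<close>)
    qed
    then have "hausdorff1_outer (A - {x. g x \<le> 0}) \<le> hausdorff1_outer (C n \<union> (\<Union>i. B (i+n)))"
      by (rule hausdorff1_outer_mono)
    also have "\<dots> \<le> hausdorff1_outer (C n) + hausdorff1_outer (\<Union>i. B (i+n))"
      by (rule hausdorff1_outer_Un)
    also have "\<dots> \<le> hausdorff1_outer (C n) + (\<Sum>i. hausdorff1_outer (B (i+n)))"
      by (rule add_left_mono[OF hausdorff1_outer_subadditive])
    finally have "hausdorff1_outer (A - {x. g x \<le> 0})
        \<le> hausdorff1_outer (C n) + (\<Sum>i. hausdorff1_outer (B (i+n)))" .
    also have "(\<Sum>i. hausdorff1_outer (B (i+n))) = ennreal (\<Sum>i. c (i+n))"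
      unfolding c(1) using sum by (intro suminf_ennreal2) (auto simp: c summable_iff_shift)
    also have "hausdorff1_outer (C n) + \<dots> \<le> hausdorff1_outer (C n) + ennreal e"
      using n by (intro add_left_mono ennreal_leI) auto
    finally have "hausdorff1_outer (A - {x. g x \<le> 0}) \<le> hausdorff1_outer (C n) + ennreal e" .
    moreover have "hausdorff1_outer (A \<inter> {x. g x \<le> 0}) + hausdorff1_outer (C n) \<le> hausdorff1_outer A"
    proof (rule order_trans[OF hausdorff1_outer_separated[of _ _ "1 / real (n+1)"]])
      fix x y assume "x \<in> A \<inter> {x. g x \<le> 0}" "y \<in> C n"
      then show "1 / real (n+1) \<le> dist x y" using g[of x y] by (auto simp: C_def)
    qed (auto intro!: hausdorff1_outer_mono simp: C_def)
    ultimately have "hausdorff1_outer (A \<inter> {x. g x \<le> 0}) + hausdorff1_outer (A - {x. g x \<le> 0})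
        \<le> (hausdorff1_outer (A \<inter> {x. g x \<le> 0}) + hausdorff1_outer (C n)) + ennreal e"
      unfolding add.assoc by (intro add_left_mono)
    also have "\<dots> \<le> hausdorff1_outer A + ennreal e"
      by (intro add_right_mono) fact
    finally show "hausdorff1_outer (A \<inter> {x. g x \<le> 0}) + hausdorff1_outer (A - {x. g x \<le> 0})
        \<le> hausdorff1_outer A + ennreal e" .
  qed
qed simp

text \<open>The function \<open>infdist\<close> to a closed set is 1-Lipschitz and vanishes exactly
  on the set, so \<open>hausdorff1_outer_split\<close> puts closed sets, hence all Borel sets, into
  the Caratheodory system. This matters because \<open>measure_of\<close> falls back to the zero
  measure when the given set function is not a measure.\<close>

lemma measure_space_hausdorff1: "measure_space UNIV (sets borel) (hausdorff1_outer :: 'a::metric_space set \<Rightarrow> ennreal)"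
proof -
  let ?f = "hausdorff1_outer :: 'a set \<Rightarrow> ennreal"
  interpret P: sigma_algebra UNIV "UNIV :: 'a set set" using sigma_algebra_Pow[of UNIV] by simp
  have oms: "outer_measure_space UNIV ?f"
    unfolding outer_measure_space_def positive_def increasing_def countably_subadditive_def
    using hausdorff1_outer_mono hausdorff1_outer_subadditive hausdorff1_outer_empty by blast
  let ?L = "lambda_system UNIV UNIV ?f"
  have L: "measure_space UNIV ?L ?f" by (rule P.caratheodory_lemma[OF oms])
  have "F \<in> ?L" if F: "closed F" for F :: "'a set"
  proof (cases "F = {}")
    case False
    have eq: "F = {x. infdist x F \<le> 0}"
      using in_closed_iff_infdist_zero[OF F False] infdist_nonneg[of _ F] by (auto intro: antisym)
    have "?f (x \<inter> F) + ?f (x - F) = ?f x" for x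
    proof (rule antisym)
      show "?f (x \<inter> F) + ?f (x - F) \<le> ?f x"
        using hausdorff1_outer_split[of "\<lambda>x. infdist x F" x] infdist_triangle_abs eq by metis
      show "?f x \<le> ?f (x \<inter> F) + ?f (x - F)"
        using hausdorff1_outer_Un[of "x \<inter> F" "x - F"] by (simp add: Int_Diff_Un)
    qed
    then show ?thesis by (simp add: P.lambda_system_eq)
  qed (use P.lambda_system_empty[of ?f] oms in \<open>auto simp: outer_measure_space_def\<close>)
  moreover have "sigma_algebra UNIV ?L" using L by (simp add: measure_space_def)
  ultimately have "sets borel \<subseteq> ?L"
    using sigma_algebra.sigma_sets_subset[of UNIV ?L "Collect closed"] by (auto simp: borel_eq_closed)
  moreover have "positive ?L ?f" "countably_additive ?L ?f" using L by (auto simp: measure_space_def)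
  ultimately have "countably_additive (sets borel) ?f" "positive (sets borel) ?f"
    by (auto simp: positive_def countably_additive_def)
  then show ?thesis
    using sets.sigma_algebra_axioms[of "borel :: 'a measure"] by (simp add: measure_space_def)
qed

lemma sets_hausdorff1 [simp, measurable_cong]: "sets hausdorff1 = sets borel"
  and space_hausdorff1 [simp]: "space hausdorff1 = UNIV"
  using sigma_algebra.sigma_sets_eq[OF sets.sigma_algebra_axioms[of borel]]
  by (simp_all add: hausdorff1_def sets_measure_of_conv space_measure_of_conv)

lemma emeasure_hausdorff1: "A \<in> sets borel \<Longrightarrow> emeasure hausdorff1 A = hausdorff1_outer A"
  unfolding hausdorff1_def using measure_space_hausdorff1
  by (intro emeasure_measure_of_sigma) (auto simp: measure_space_def)

section \<open>Lengths of Lipschitz curves, segments and Lipschitz boundaries\<close>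

lemma bounded_diameter_le:
  fixes S :: "'a::metric_space set"
  assumes "\<And>x y. x \<in> S \<Longrightarrow> y \<in> S \<Longrightarrow> dist x y \<le> d" "0 \<le> d"
  shows "bounded S \<and> diameter S \<le> d"
proof (cases "S = {}")
  case False
  then obtain x where "x \<in> S" by blast
  then have "bounded S" using assms unfolding bounded_def by blast
  then show ?thesis using False assms(1) by (auto simp: diameter_def intro!: cSUP_least)
qed (use assms in auto)

text \<open>Cutting the parameter interval into equal pieces covers the image by sets whose
  diameters add up to at most \<open>L * (b - a)\<close>, however fine the subdivision.\<close>

lemma hausdorff1_outer_lipschitz_image:
  fixes f :: "real \<Rightarrow> 'a::metric_space"
  assumes f: "\<And>x y. x \<in> {a..b} \<Longrightarrow> y \<in> {a..b} \<Longrightarrow> dist (f x) (f y) \<le> L * \<bar>x - y\<bar>"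
    and "0 \<le> L" "a \<le> b"
  shows "hausdorff1_outer (f ` {a..b}) \<le> ennreal (L * (b - a))"
proof -
  have "hpre \<delta> (f ` {a..b}) \<le> ennreal (L * (b - a))" if "\<delta> > 0" for \<delta>
  proof -
    \<comment> \<open>So many pieces that each image has diameter at most
      \<open>\<delta>\<close>.\<close>
    obtain N :: nat where N: "L * (b - a) / \<delta> < real N" using reals_Archimedean2 by blast
    moreover have "0 \<le> L * (b - a) / \<delta>" using assms that by simp
    ultimately have "0 < N" by (metis le_less_trans of_nat_0_less_iff)
    define w where "w = (b - a) / real N"
    have w: "0 \<le> w" "real N * w = b - a" using assms \<open>0 < N\<close> by (auto simp: w_def)
    have "L * w \<le> \<delta>" using N \<open>0 < N\<close> that by (simp add: w_def field_simps)
    define U where "U n = (if n < N then f ` ({a + real n * w .. a + real (Suc n) * w} \<inter> {a..b}) else {})" for n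
    have U: "bounded (U n) \<and> diameter (U n) \<le> L * w" for n
    proof (rule bounded_diameter_le)
      fix u v assume "u \<in> U n" "v \<in> U n"
      then obtain x y where xy: "u = f x" "v = f y" "x \<in> {a..b}" "y \<in> {a..b}"
        "x \<in> {a + real n * w .. a + real (Suc n) * w}" "y \<in> {a + real n * w .. a + real (Suc n) * w}"
        by (auto simp: U_def split: if_splits)
      have "\<bar>x - y\<bar> \<le> w" using xy(5,6) by (auto simp: algebra_simps abs_le_iff)
      then show "dist u v \<le> L * w" using f[OF xy(3,4)] xy(1,2) \<open>0 \<le> L\<close> mult_left_mono order_trans by metis
    qed (use w \<open>0 \<le> L\<close> in auto)
    have cov: "f ` {a..b} \<subseteq> (\<Union>n. U n)"
    proof (rule image_subsetI)
      fix x assume x: "x \<in> {a..b}"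
      have "\<exists>n<N. x \<in> {a + real n * w .. a + real (Suc n) * w}"
      proof (cases "w = 0")
        case True
        then show ?thesis using w x \<open>0 < N\<close> by auto
      next
        case False
        then have wp: "0 < w" using w by simp
        show ?thesis
        proof (cases "x = b")
          case True
          have "b = a + real (Suc (N-1)) * w" using w \<open>0 < N\<close> by simp
          then show ?thesis using True \<open>0 < N\<close> w by (intro exI[of _ "N-1"]) (auto simp: algebra_simps)
        next
          case xb: False
          define n where "n = nat \<lfloor>(x - a) / w\<rfloor>"
          have 0: "0 \<le> (x - a) / w" using x wp by simp
          have n: "real n \<le> (x - a) / w" "(x - a) / w < real n + 1"
            using 0 by (auto simp: n_def floor_less_iff)
          have "real n * w \<le> x - a" "x - a < (real n + 1) * w" using n wp by (auto simp: field_simps)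
          moreover have "real n * w < real N * w" using w x xb calculation by auto
          ultimately show ?thesis using wp by (intro exI[of _ n]) (auto simp: algebra_simps)
        qed
      qed
      then show "f x \<in> (\<Union>n. U n)" using x by (auto simp: U_def)
    qed
    have "hpre \<delta> (f ` {a..b}) \<le> (\<Sum>n. ennreal (diameter (U n)))"
      using U \<open>L * w \<le> \<delta>\<close> by (intro hpre_le cov) (auto intro: order_trans)
    also have "\<dots> = (\<Sum>n<N. ennreal (diameter (U n)))"
      by (intro suminf_finite) (auto simp: U_def)
    also have "\<dots> \<le> (\<Sum>n<N. ennreal (L * w))"
      using U by (intro sum_mono ennreal_leI) auto
    also have "\<dots> = ennreal (real N * (L * w))" using w \<open>0 \<le> L\<close> by (simp add: ennreal_mult ennreal_of_nat_eq_real_of_nat)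
    also have "real N * (L * w) = L * (b - a)" using w(2) by (simp add: mult.left_commute)
    finally show ?thesis .
  qed
  then show ?thesis unfolding hausdorff1_outer_hpre by (intro SUP_least) auto
qed

text \<open>A 1-Lipschitz function does not increase diameters: each covering set is replaced by the
  interval spanned by its values, and countable subadditivity of Lebesgue measure bounds the total
  from below.\<close>

lemma hausdorff1_outer_ge:
  fixes g :: "'a::metric_space \<Rightarrow> real"
  assumes g: "\<And>x y. \<bar>g x - g y\<bar> \<le> dist x y" and "{l<..<u} \<subseteq> g ` A" "l \<le> u"
  shows "ennreal (u - l) \<le> hausdorff1_outer A"
proof -
  have "ennreal (u - l) \<le> (\<Sum>n. ennreal (diameter (U n)))"
    if U: "A \<subseteq> (\<Union>n. U n)" "\<And>n. bounded (U n)" for U :: "nat \<Rightarrow> 'a set"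
  proof -
    define I where "I n = (if U n = {} then {} else {Inf (g ` U n) .. Sup (g ` U n)})" for n
    have d: "g x - g y \<le> diameter (U n)" if "x \<in> U n" "y \<in> U n" for x y n
      using g[of x y] diameter_bounded_bound[OF U(2) that] by linarith
    have bd: "bdd_above (g ` U n)" "bdd_below (g ` U n)" for n
    proof -
      have "g x \<le> g y + diameter (U n) \<and> g y - diameter (U n) \<le> g x" if "x \<in> U n" "y \<in> U n" for x y
        using d[OF that] d[OF that(2,1)] by linarith
      then show "bdd_above (g ` U n)" "bdd_below (g ` U n)"
        by (cases "U n = {}"; fastforce simp: bdd_above_def bdd_below_def)+
    qed
    have "ennreal (u - l) = emeasure lborel {l<..<u}" using assms by simp
    also have "\<dots> \<le> emeasure lborel (\<Union>n. I n)"
    proof (rule emeasure_mono)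
      show "{l<..<u} \<subseteq> (\<Union>n. I n)"
      proof
        fix r assume "r \<in> {l<..<u}"
        then obtain n x where "x \<in> U n" "r = g x" using assms(2) U(1) by blast
        then have "r \<in> I n" using bd by (auto simp: I_def intro!: cINF_lower cSUP_upper)
        then show "r \<in> (\<Union>n. I n)" by blast
      qed
    qed (auto simp: I_def)
    also have "\<dots> \<le> (\<Sum>n. emeasure lborel (I n))"
      by (rule emeasure_subadditive_countably) (auto simp: I_def)
    also have "\<dots> \<le> (\<Sum>n. ennreal (diameter (U n)))"
    proof (intro suminf_le)
      fix n
      show "emeasure lborel (I n) \<le> ennreal (diameter (U n))"
      proof (cases "U n = {}")
        case False
        have "Sup (g ` U n) \<le> Inf (g ` U n) + diameter (U n)"
        proof (intro cSUP_least False)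
          fix x assume x: "x \<in> U n"
          have "g x - diameter (U n) \<le> Inf (g ` U n)"
            using d[OF x] by (intro cINF_greatest False) (simp add: algebra_simps)
          then show "g x \<le> Inf (g ` U n) + diameter (U n)" by simp
        qed
        moreover have "Inf (g ` U n) \<le> Sup (g ` U n)"
          using bd False by (meson cINF_lower cSUP_upper ex_in_conv order_trans)
        ultimately show ?thesis using False by (auto simp: I_def intro!: ennreal_leI)
      qed (simp add: I_def)
    qed auto
    finally show ?thesis .
  qed
  then have "ennreal (u - l) \<le> hpre 1 A" unfolding hpre_def by (intro INF_greatest) auto
  then show ?thesis using hpre_le_hausdorff1[of 1 A] by simp
qed

lemma closed_line: "closed (range (\<lambda>r. r *\<^sub>R (e::'a::euclidean_space)))"
  using closed_span[of "{e}"] by (simp add: span_singleton)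

text \<open>The parametrisation of the line is an isometry, which bounds the length of a segment
  from above; the projection onto \<open>e\<close> is 1-Lipschitz, which bounds it from below.
  Agreement on intervals determines the measure.\<close>

lemma lborel_eq_distr_hausdorff1:
  fixes e :: "'a::euclidean_space"
  assumes e: "norm e = 1"
  shows "lborel = distr (restrict_space hausdorff1 (range (\<lambda>r. r *\<^sub>R e))) borel (\<lambda>x. x \<bullet> e)"
proof (rule lborel_eqI)
  let ?\<iota> = "\<lambda>r. r *\<^sub>R e"
  have ee: "e \<bullet> e = 1" using e by (simp add: dot_square_norm)
  fix l u :: real assume "\<And>b. b \<in> Basis \<Longrightarrow> l \<bullet> b \<le> u \<bullet> b"
  then have lu: "l \<le> u" by simp
  have meas: "(\<lambda>x. x \<bullet> e) \<in> restrict_space hausdorff1 (range ?\<iota>) \<rightarrow>\<^sub>M borel"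
    by (intro measurable_restrict_space1) simp
  have eq: "(\<lambda>x. x \<bullet> e) -` {l<..<u} \<inter> range ?\<iota> = ?\<iota> ` {l<..<u}"
    using ee by auto
  have b: "?\<iota> ` {l<..<u} \<in> sets borel"
    unfolding eq[symmetric]
    by (intro sets.Int borel_closed[OF closed_line] borel_open open_vimage)
      (auto intro!: continuous_intros)
  have "emeasure (distr (restrict_space hausdorff1 (range ?\<iota>)) borel (\<lambda>x. x \<bullet> e)) {l<..<u}
      = emeasure (restrict_space hausdorff1 (range ?\<iota>)) (?\<iota> ` {l<..<u})"
    by (subst emeasure_distr[OF meas]) (auto simp: space_restrict_space eq)
  also have "\<dots> = hausdorff1_outer (?\<iota> ` {l<..<u})"
    using b borel_closed[OF closed_line[of e]] by (subst emeasure_restrict_space) (auto simp: emeasure_hausdorff1 borel_closed)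
  also have "\<dots> = ennreal (u - l)"
  proof (rule antisym)
    have "hausdorff1_outer (?\<iota> ` {l<..<u}) \<le> hausdorff1_outer (?\<iota> ` {l..u})"
      by (rule hausdorff1_outer_mono) auto
    also have "\<dots> \<le> ennreal (1 * (u - l))"
      using e lu by (intro hausdorff1_outer_lipschitz_image) (auto simp: dist_norm scaleR_diff_left[symmetric])
    finally show "hausdorff1_outer (?\<iota> ` {l<..<u}) \<le> ennreal (u - l)" by simp
    show "ennreal (u - l) \<le> hausdorff1_outer (?\<iota> ` {l<..<u})"
    proof (rule hausdorff1_outer_ge[of "\<lambda>x. x \<bullet> e"])
      show "\<bar>x \<bullet> e - y \<bullet> e\<bar> \<le> dist x y" for x y
        using Cauchy_Schwarz_ineq2[of "x - y" e] e by (simp add: inner_diff_left dist_norm)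
    qed (use ee lu in \<open>auto simp: image_image\<close>)
  qed
  finally show "emeasure (distr (restrict_space hausdorff1 (range ?\<iota>)) borel (\<lambda>x. x \<bullet> e)) (box l u)
      = (\<Prod>b\<in>Basis. (u - l) \<bullet> b)" by (simp add: box_real)
qed simp

lemma integral_hausdorff1_line:
  fixes e :: "'a::euclidean_space" and f :: "'a \<Rightarrow> 'b::{banach, second_countable_topology}"
  assumes e: "norm e = 1" and f: "f \<in> borel_measurable borel"
  shows "(LINT x|hausdorff1. indicator (range (\<lambda>r. r *\<^sub>R e)) x *\<^sub>R f x) = (LINT r|lborel. f (r *\<^sub>R e))"
proof -
  let ?L = "range (\<lambda>r. r *\<^sub>R e)"
  have ee: "e \<bullet> e = 1" using e by (simp add: dot_square_norm)
  have meas: "(\<lambda>x. x \<bullet> e) \<in> restrict_space hausdorff1 ?L \<rightarrow>\<^sub>M borel"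
    by (intro measurable_restrict_space1) simp
  have fm: "(\<lambda>r. f (r *\<^sub>R e)) \<in> borel_measurable borel"
    by (rule measurable_compose[OF _ f]) simp
  have L: "?L \<inter> space hausdorff1 \<in> sets hausdorff1" using borel_closed[OF closed_line[of e]] by simp
  have eq: "f ((x \<bullet> e) *\<^sub>R e) = f x" if "x \<in> space (restrict_space hausdorff1 ?L)" for x
    using that ee by (auto simp: space_restrict_space)
  have "(LINT r|lborel. f (r *\<^sub>R e)) = (LINT x|restrict_space hausdorff1 ?L. f ((x \<bullet> e) *\<^sub>R e))"
    by (subst lborel_eq_distr_hausdorff1[OF e]) (rule integral_distr[OF meas fm])
  also have "\<dots> = (LINT x|restrict_space hausdorff1 ?L. f x)" by (rule Bochner_Integration.integral_cong[OF refl eq])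
  also have "\<dots> = (LINT x|hausdorff1. indicator ?L x *\<^sub>R f x)" by (rule integral_restrict_space[OF L])
  finally show "(LINT x|hausdorff1. indicator ?L x *\<^sub>R f x) = (LINT r|lborel. f (r *\<^sub>R e))" by simp
qed

text \<open>Near each of its points the frontier lies on a Lipschitz graph over a bounded interval,
  which has finite length; compactness leaves finitely many such pieces. Finiteness is what makes
  continuous functions square integrable on the boundary.\<close>

lemma hausdorff1_frontier_finite:
  assumes "bounded_lipschitz_domain \<Omega>"
  shows "hausdorff1_outer (frontier \<Omega>) < top"
proof -
  have \<Omega>: "bounded \<Omega>" "open \<Omega>" using assms by (auto simp: bounded_lipschitz_domain_def)
  have loc: "\<exists>r>0. hausdorff1_outer (frontier \<Omega> \<inter> ball p r) < top" if p: "p \<in> frontier \<Omega>" for p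
  proof -
    obtain r L and R :: "real^2 \<Rightarrow> real^2" and f :: "real \<Rightarrow> real" where r: "0 < r" and R: "orthogonal_transformation R"
      and f: "L-lipschitz_on UNIV f" and eq: "\<Omega> \<inter> ball p r = {x \<in> ball p r. f (R x $ 1) < R x $ 2}"
      using p assms unfolding bounded_lipschitz_domain_def by blast
    have mem: "y \<in> \<Omega> \<longleftrightarrow> f (R y $ 1) < R y $ 2" if "y \<in> ball p r" for y
    proof -
      have "y \<in> \<Omega> \<inter> ball p r \<longleftrightarrow> y \<in> {x \<in> ball p r. f (R x $ 1) < R x $ 2}" by (simp only: eq)
      with that show ?thesis by simp
    qed
    have L: "0 \<le> L" using f by (rule lipschitz_on_nonneg)
    have contf: "continuous_on UNIV f" using f by (rule lipschitz_on_continuous_on)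
    have linR: "linear R" and nR: "\<And>x. norm (R x) = norm x"
      using R by (auto simp: orthogonal_transformation)
    have contR: "continuous_on UNIV R" using linR by (simp add: linear_continuous_on linear_linear)
    define S where "S = inv R"
    have bij: "bij R" by (rule orthogonal_transformation_bij[OF R])
    have "orthogonal_transformation S"
      unfolding S_def by (rule orthogonal_transformation_inv[OF R])
    then have S: "S (R x) = x" "R (S x) = x" "norm (S x) = norm x" "linear S" for x
      using bij_is_inj[OF bij] surj_f_inv_f[OF bij_is_surj[OF bij], of x]
      by (auto simp: orthogonal_transformation S_def)
    define g where "g t = S (vector [t, f t])" for t
    let ?a = "R p $ 1 - r" and ?b = "R p $ 1 + r"
    have "frontier \<Omega> \<inter> ball p r \<subseteq> g ` {?a..?b}"
    proof
      fix x assume x: "x \<in> frontier \<Omega> \<inter> ball p r"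
      have "x \<notin> \<Omega>" using x \<Omega>(2) frontier_disjoint_eq[of \<Omega>] by blast
      then have ge: "R x $ 2 \<le> f (R x $ 1)" using mem[of x] x by simp
      \<comment> \<open>A frontier point strictly below the graph would have a neighbourhood below
        the graph, free of points of \<open>\<Omega>\<close>.\<close>
      have le: "f (R x $ 1) \<le> R x $ 2"
      proof (rule ccontr)
        assume "\<not> f (R x $ 1) \<le> R x $ 2"
        define N where "N = ball p r \<inter> {y. R y $ 2 < f (R y $ 1)}"
        have "continuous_on UNIV (\<lambda>y. f (R y $ 1))"
          by (rule continuous_on_compose2[OF contf]) (auto intro!: continuous_intros contR)
        then have "open N" unfolding N_def
          by (intro open_Int open_ball open_Collect_less) (auto intro!: continuous_intros contR)
        moreover have "x \<in> N" using x \<open>\<not> f (R x $ 1) \<le> R x $ 2\<close> by (auto simp: N_def)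
        moreover have "x \<in> closure \<Omega>" using x by (simp add: frontier_def)
        ultimately have "N \<inter> \<Omega> \<noteq> {}" using open_Int_closure_eq_empty by blast
        then obtain y where "y \<in> N" "y \<in> \<Omega>" by blast
        then show False using mem[of y] by (simp add: N_def)
      qed
      have "R x = vector [R x $ 1, f (R x $ 1)]" using ge le by (simp add: vec_eq_iff forall_2)
      then have "x = g (R x $ 1)" using S(1) unfolding g_def by metis
      moreover have "\<bar>R x $ 1 - R p $ 1\<bar> \<le> r"
      proof -
        have "\<bar>R x $ 1 - R p $ 1\<bar> = \<bar>R (x - p) $ 1\<bar>" by (simp add: linear_diff[OF linR])
        also have "\<dots> \<le> norm (x - p)" using component_le_norm_cart[of "R (x - p)" 1] nR by simp
        finally show ?thesis using x by (simp add: dist_norm norm_minus_commute)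
      qed
      ultimately show "x \<in> g ` {?a..?b}" by (auto simp: abs_le_iff intro!: image_eqI[of x g "R x $ 1"])
    qed
    then have "hausdorff1_outer (frontier \<Omega> \<inter> ball p r) \<le> hausdorff1_outer (g ` {?a..?b})"
      by (rule hausdorff1_outer_mono)
    also have "\<dots> \<le> ennreal ((1 + L) * (?b - ?a))"
    proof (rule hausdorff1_outer_lipschitz_image)
      fix s t
      have "dist (g s) (g t) = norm (S (vector [s, f s] - vector [t, f t]))"
        by (simp add: g_def dist_norm linear_diff[OF S(4)])
      also have "\<dots> = norm (vector [s, f s] - vector [t, f t] :: real^2)" by (rule S)
      also have "\<dots> \<le> (\<Sum>i\<in>UNIV. \<bar>(vector [s, f s] - vector [t, f t] :: real^2) $ i\<bar>)" by (rule norm_le_l1_cart)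
      also have "\<dots> = \<bar>s - t\<bar> + \<bar>f s - f t\<bar>" by (simp add: UNIV_2)
      also have "\<dots> \<le> (1 + L) * \<bar>s - t\<bar>"
        using lipschitz_onD[OF f, of s t] by (simp add: dist_real_def algebra_simps)
      finally show "dist (g s) (g t) \<le> (1 + L) * \<bar>s - t\<bar>" .
    qed (use L r in auto)
    finally show ?thesis using r by (auto simp: less_top[symmetric] top_unique le_less_trans)
  qed
  then obtain r where r: "\<And>p. p \<in> frontier \<Omega> \<Longrightarrow> 0 < r p"
      "\<And>p. p \<in> frontier \<Omega> \<Longrightarrow> hausdorff1_outer (frontier \<Omega> \<inter> ball p (r p)) < top" by metis
  have "compact (frontier \<Omega>)" using \<Omega>(1) by (rule compact_frontier_bounded)
  then obtain C where C: "C \<subseteq> frontier \<Omega>" "finite C" "frontier \<Omega> \<subseteq> (\<Union>p\<in>C. ball p (r p))"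
    by (rule compactE_image[of _ "frontier \<Omega>" "\<lambda>p. ball p (r p)"]) (use r in force)+
  have fin: "hausdorff1_outer (\<Union>p\<in>D. frontier \<Omega> \<inter> ball p (r p)) < top" if "finite D" "D \<subseteq> C" for D
    using that
  proof (induction D rule: finite_induct)
    case (insert p D)
    have "hausdorff1_outer (\<Union>p\<in>insert p D. frontier \<Omega> \<inter> ball p (r p))
        \<le> hausdorff1_outer (frontier \<Omega> \<inter> ball p (r p)) + hausdorff1_outer (\<Union>p\<in>D. frontier \<Omega> \<inter> ball p (r p))"
      using hausdorff1_outer_Un by simp
    also have "\<dots> < top" using insert r(2) C(1) by auto
    finally show ?case .
  qed (simp add: hausdorff1_outer_empty)
  have "hausdorff1_outer (frontier \<Omega>) \<le> hausdorff1_outer (\<Union>p\<in>C. frontier \<Omega> \<inter> ball p (r p))"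
    by (rule hausdorff1_outer_mono) (use C in auto)
  also have "\<dots> < top" by (rule fin) (use C in auto)
  finally show ?thesis .
qed

section \<open>Integration over sectors in skew coordinates\<close>

lemma Basis_real2: "(Basis :: (real^2) set) = {axis 1 1, axis 2 1}"
  by (auto simp: Basis_vec_def UNIV_2)

lemma axis_12_neq: "axis 1 (1::real) \<noteq> (axis 2 1 :: real^2)"
  by (simp add: axis_eq_axis)

definition skew :: "real^2 \<Rightarrow> real^2 \<Rightarrow> real \<times> real \<Rightarrow> real^2" where
  "skew p q z = fst z *\<^sub>R p + snd z *\<^sub>R q"

definition cross2 :: "real^2 \<Rightarrow> real^2 \<Rightarrow> real" where
  "cross2 p q = p $ 1 * q $ 2 - p $ 2 * q $ 1"

lemma continuous_skew: "continuous_on S (skew p q)"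
  unfolding skew_def by (intro continuous_intros)

lemma measurable_skew [measurable]: "skew p q \<in> borel_measurable (lborel \<Otimes>\<^sub>M lborel)"
proof -
  have "skew p q \<in> borel_measurable borel"
    by (rule borel_measurable_continuous_onI[OF continuous_skew])
  then show ?thesis by (simp add: lborel_prod)
qed

text \<open>Links the vector type with the product measure, to which Fubini applies.\<close>

lemma lborel_eq_distr_axes:
  "lborel = distr (lborel \<Otimes>\<^sub>M lborel) borel (skew (axis 1 1) (axis 2 1))"
proof (rule lborel_eqI)
  fix l u :: "real^2" assume lu: "\<And>b. b \<in> Basis \<Longrightarrow> l \<bullet> b \<le> u \<bullet> b"
  then have le: "l $ 1 \<le> u $ 1" "l $ 2 \<le> u $ 2"
    using lu[of "axis 1 1"] lu[of "axis 2 1"] by (auto simp: Basis_real2 inner_axis)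
  have eq: "skew (axis 1 1) (axis 2 1) -` box l u \<inter> space (lborel \<Otimes>\<^sub>M lborel) = {l$1<..<u$1} \<times> {l$2<..<u$2}"
    by (auto simp: skew_def mem_box_cart forall_2 axis_def space_pair_measure)
  have "emeasure (distr (lborel \<Otimes>\<^sub>M lborel) borel (skew (axis 1 1) (axis 2 1))) (box l u)
      = emeasure (lborel \<Otimes>\<^sub>M lborel) ({l$1<..<u$1} \<times> {l$2<..<u$2})"
    by (subst emeasure_distr) (auto simp: eq)
  also have "\<dots> = ennreal ((u$1 - l$1) * (u$2 - l$2))"
    using le by (subst lborel.emeasure_pair_measure_Times) (auto simp: ennreal_mult)
  finally show "emeasure (distr (lborel \<Otimes>\<^sub>M lborel) borel (skew (axis 1 1) (axis 2 1))) (box l u)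
      = (\<Prod>b\<in>Basis. (u - l) \<bullet> b)"
    by (simp add: Basis_real2 axis_12_neq inner_axis)
qed simp

text \<open>The preimage of a box under \<open>skew p q\<close> is the preimage, in standard
  coordinates, of the image of the box under a linear map of determinant
  \<open>1 / cross2 p q\<close>. The effect of linear maps on Lebesgue measure thus reduces the
  claim to the standard axes.\<close>

lemma lborel_eq_distr_skew:
  assumes "cross2 p q \<noteq> 0"
  shows "lborel = distr (density (lborel \<Otimes>\<^sub>M lborel) (\<lambda>_. ennreal \<bar>cross2 p q\<bar>)) borel (skew p q)"
proof (rule lborel_eqI)
  let ?D = "cross2 p q"
  \<comment> \<open>Cramer's rule: the coefficients of \<open>x\<close> in the basis
    \<open>p\<close>, \<open>q\<close>.\<close>
  define g :: "real^2 \<Rightarrow> real^2" where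
    "g x = (cross2 x q / ?D) *\<^sub>R axis 1 1 + (cross2 p x / ?D) *\<^sub>R axis 2 1" for x
  have ling: "linear g"
    by (rule linearI) (auto simp: g_def cross2_def vec_eq_iff forall_2 axis_def algebra_simps diff_divide_distrib add_divide_distrib)
  have pq: "skew p q (r, s) = x \<longleftrightarrow> skew (axis 1 1) (axis 2 1) (r, s) = g x" for r s x
  proof -
    have "skew p q (cross2 x q / ?D, cross2 p x / ?D) = x"
    proof -
      have "cross2 x q * p $ i + cross2 p x * q $ i = x $ i * ?D" for i
        using exhaust_2[of i] by (auto simp: cross2_def algebra_simps)
      then show ?thesis using assms
        by (simp add: skew_def vec_eq_iff add_divide_distrib[symmetric])
    qed
    moreover have "cross2 (skew p q (r, s)) q = r * ?D" "cross2 p (skew p q (r, s)) = s * ?D"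
      by (auto simp: skew_def cross2_def algebra_simps)
    moreover have "skew (axis 1 1) (axis 2 1) (r, s) = g x \<longleftrightarrow> r = cross2 x q / ?D \<and> s = cross2 p x / ?D"
      by (auto simp: skew_def g_def vec_eq_iff forall_2 axis_def)
    moreover have "skew p q (r, s) = x \<longleftrightarrow> r = cross2 x q / ?D \<and> s = cross2 p x / ?D"
    proof
      assume "skew p q (r, s) = x"
      then show "r = cross2 x q / ?D \<and> s = cross2 p x / ?D" using calculation(2,3) assms by auto
    next
      assume "r = cross2 x q / ?D \<and> s = cross2 p x / ?D"
      then show "skew p q (r, s) = x" using calculation(1) by simp
    qed
    ultimately show ?thesis by simp
  qed
  have detg: "\<bar>det (matrix g)\<bar> = 1 / \<bar>?D\<bar>"
  proof -
    have c: "cross2 (axis 1 1) q = q $ 2" "cross2 (axis 2 1) q = - q $ 1"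
        "cross2 p (axis 1 1) = - p $ 2" "cross2 p (axis 2 1) = p $ 1"
      by (simp_all add: cross2_def axis_def)
    have "det (matrix g) = (q $ 2 / ?D) * (p $ 1 / ?D) - (- q $ 1 / ?D) * (- p $ 2 / ?D)"
      by (simp add: det_2 matrix_def g_def c) (simp add: axis_def)
    also have "\<dots> = ?D / (?D * ?D)"
      by (simp add: diff_divide_distrib[symmetric] mult.commute cross2_def)
    finally have "det (matrix g) = 1 / ?D" using assms by simp
    then show ?thesis by (simp add: abs_divide)
  qed
  fix l u :: "real^2" assume lu: "\<And>b. b \<in> Basis \<Longrightarrow> l \<bullet> b \<le> u \<bullet> b"
  have meas: "g ` box l u \<in> lmeasurable" "measure lebesgue (g ` box l u) = 1 / \<bar>?D\<bar> * measure lebesgue (box l u)"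
    using measurable_linear_image[OF ling lmeasurable_box] measure_linear_image[OF ling lmeasurable_box] detg by auto
  have vim: "skew p q -` box l u = skew (axis 1 1) (axis 2 1) -` (g ` box l u)"
    using pq by (auto simp: image_iff)
  have pre: "open (g ` box l u)"
  proof -
    have "g ` box l u = (\<lambda>x. skew p q (x $ 1, x $ 2)) -` box l u"
    proof -
      have ax: "skew (axis 1 1) (axis 2 1) (x$1, x$2) = x" for x
        by (simp add: skew_def vec_eq_iff forall_2 axis_def)
      have "x = g y \<longleftrightarrow> skew p q (x$1, x$2) = y" for x y
        using pq[of "x$1" "x$2" y] by (simp add: ax)
      then show ?thesis by (auto simp: image_iff)
    qed
    moreover have "open \<dots>"
      by (intro open_vimage open_box) (auto simp: skew_def intro!: continuous_intros)
    ultimately show ?thesis by simp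
  qed
  have "emeasure (distr (density (lborel \<Otimes>\<^sub>M lborel) (\<lambda>_. ennreal \<bar>?D\<bar>)) borel (skew p q)) (box l u)
      = emeasure (density (lborel \<Otimes>\<^sub>M lborel) (\<lambda>_. ennreal \<bar>?D\<bar>)) (skew p q -` box l u \<inter> space (lborel \<Otimes>\<^sub>M lborel))"
    by (subst emeasure_distr) auto
  also have "\<dots> = ennreal \<bar>?D\<bar> * emeasure (lborel \<Otimes>\<^sub>M lborel) (skew p q -` box l u \<inter> space (lborel \<Otimes>\<^sub>M lborel))"
    by (rule emeasure_density_const) (use measurable_sets[OF measurable_skew] in auto)
  also have "emeasure (lborel \<Otimes>\<^sub>M lborel) (skew p q -` box l u \<inter> space (lborel \<Otimes>\<^sub>M lborel))
      = emeasure (distr (lborel \<Otimes>\<^sub>M lborel) borel (skew (axis 1 1) (axis 2 1))) (g ` box l u)"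
    using pre by (subst emeasure_distr) (auto simp: vim)
  also have "\<dots> = emeasure lborel (g ` box l u)" by (simp only: lborel_eq_distr_axes[symmetric])
  also have "\<dots> = emeasure lebesgue (g ` box l u)" using pre by (simp add: borel_open)
  also have "\<dots> = ennreal (measure lebesgue (g ` box l u))"
    by (rule emeasure_eq_ennreal_measure[OF fmeasurableD2[OF meas(1)]])
  also have "ennreal \<bar>?D\<bar> * \<dots> = ennreal (measure lebesgue (box l u))"
    unfolding meas(2) using assms by (subst ennreal_mult[symmetric]) auto
  finally show "emeasure (distr (density (lborel \<Otimes>\<^sub>M lborel) (\<lambda>_. ennreal \<bar>?D\<bar>)) borel (skew p q)) (box l u)
      = (\<Prod>b\<in>Basis. (u - l) \<bullet> b)" using lu by (simp add: measure_lborel_box_eq)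
qed simp

lemma integrable_scaleR_nonzero:
  fixes f :: "'b \<Rightarrow> 'a::{banach, second_countable_topology}"
  assumes "c \<noteq> 0"
  shows "integrable M (\<lambda>x. c *\<^sub>R f x) \<longleftrightarrow> integrable M f"
  using integrable_scaleR_right[of "1 / c" M "\<lambda>x. c *\<^sub>R f x"] assms by auto

lemma
  fixes f :: "real^2 \<Rightarrow> 'a::{banach, second_countable_topology}"
  assumes "cross2 p q \<noteq> 0" "f \<in> borel_measurable borel"
  shows integral_skew: "(LINT x|lborel. f x) = \<bar>cross2 p q\<bar> *\<^sub>R (LINT z|(lborel \<Otimes>\<^sub>M lborel). f (skew p q z))"
    and integrable_skew: "integrable lborel f \<longleftrightarrow> integrable (lborel \<Otimes>\<^sub>M lborel) (\<lambda>z. f (skew p q z))"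
proof -
  have m: "(\<lambda>z. f (skew p q z)) \<in> borel_measurable (lborel \<Otimes>\<^sub>M lborel)"
    by (rule measurable_compose[OF measurable_skew assms(2)])
  have "(LINT x|lborel. f x) = (LINT z|(density (lborel \<Otimes>\<^sub>M lborel) (\<lambda>_. ennreal \<bar>cross2 p q\<bar>)). f (skew p q z))"
    by (subst lborel_eq_distr_skew[OF assms(1)]) (rule integral_distr, use assms in auto)
  also have "\<dots> = (LINT z|(lborel \<Otimes>\<^sub>M lborel). \<bar>cross2 p q\<bar> *\<^sub>R f (skew p q z))"
    by (rule integral_density) (use m in auto)
  finally show "(LINT x|lborel. f x) = \<bar>cross2 p q\<bar> *\<^sub>R (LINT z|(lborel \<Otimes>\<^sub>M lborel). f (skew p q z))" by simp
  have "integrable lborel f \<longleftrightarrow> integrable (density (lborel \<Otimes>\<^sub>M lborel) (\<lambda>_. ennreal \<bar>cross2 p q\<bar>)) (\<lambda>z. f (skew p q z))"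
    by (subst lborel_eq_distr_skew[OF assms(1)]) (rule integrable_distr_eq, use assms in auto)
  also have "\<dots> \<longleftrightarrow> integrable (lborel \<Otimes>\<^sub>M lborel) (\<lambda>z. \<bar>cross2 p q\<bar> *\<^sub>R f (skew p q z))"
    by (rule integrable_density) (use m in auto)
  finally show "integrable lborel f \<longleftrightarrow> integrable (lborel \<Otimes>\<^sub>M lborel) (\<lambda>z. f (skew p q z))"
    using assms(1) by (simp add: integrable_scaleR_nonzero)
qed

lemma lborel_Fubini:
  fixes F :: "real \<times> real \<Rightarrow> 'a::{banach, second_countable_topology}"
  assumes "integrable (lborel \<Otimes>\<^sub>M lborel) F"
  shows "(LINT z|(lborel \<Otimes>\<^sub>M lborel). F z) = (LINT s|lborel. LINT r|lborel. F (r, s))"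
  using lborel_pair.integral_snd[of "\<lambda>r s. F (r, s)"] assms by simp

section \<open>Directional derivatives integrated over cones\<close>

definition dird :: "real^2 \<Rightarrow> (real^2 \<Rightarrow> 'a::real_normed_vector) \<Rightarrow> real^2 \<Rightarrow> 'a" where
  "dird p f x = p $ 1 *\<^sub>R partial 1 f x + p $ 2 *\<^sub>R partial 2 f x"

lemma dird_continuous: "C_k 1 f \<Longrightarrow> continuous_on S (dird p f)"
  unfolding dird_def
  by (rule continuous_on_subset[OF _ subset_UNIV]) (auto intro!: continuous_intros)

lemma dird_has_vector_derivative:
  assumes "C_k 1 f"
  shows "((\<lambda>r. f (r *\<^sub>R p + y)) has_vector_derivative dird p f (r *\<^sub>R p + y)) (at r within S)"
proof -
  have 1: "((\<lambda>r. r *\<^sub>R p + y) has_derivative (\<lambda>t. t *\<^sub>R p)) (at r within S)"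
    by (auto intro!: derivative_eq_intros)
  have 2: "(f has_derivative (\<lambda>d. d$1 *\<^sub>R partial 1 f (r *\<^sub>R p + y) + d$2 *\<^sub>R partial 2 f (r *\<^sub>R p + y))) (at (r *\<^sub>R p + y))"
    using assms by (intro has_derivative_partial) simp
  show ?thesis
    using has_derivative_compose[OF 1 2]
    by (simp add: has_vector_derivative_def dird_def scaleR_add_right)
qed

lemma dird_eq_0:
  assumes "C_k 1 f" "\<And>x. norm x \<ge> R \<Longrightarrow> f x = 0" "norm x > R"
  shows "dird p f x = 0"
proof -
  have "open {x::real^2. R < norm x}" by (intro open_Collect_less continuous_intros)
  then have "partial k f x = partial k (\<lambda>_. 0) x" for k
    by (rule partial_cong_open(1)) (use assms in auto)
  moreover have "partial k (\<lambda>_::real^2. 0::'a) x = 0" for k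
    by (subst partial_eq[OF has_derivative_const]) simp
  ultimately show ?thesis by (simp add: dird_def)
qed

lemma integrable_compact_support:
  fixes f :: "'b::euclidean_space \<Rightarrow> 'a::euclidean_space"
  assumes "continuous_on UNIV f" "\<And>x. norm x > R \<Longrightarrow> f x = 0"
  shows "integrable lborel f"
proof -
  have "integrable lborel (\<lambda>x. indicator (cball 0 R) x *\<^sub>R f x)"
    by (rule borel_integrable_compact[OF compact_cball continuous_on_subset[OF assms(1)]]) simp
  moreover have "(\<lambda>x. indicator (cball 0 R) x *\<^sub>R f x) = f"
    using assms(2) by (auto simp: fun_eq_iff indicator_def)
  ultimately show ?thesis by simp
qed

lemma FTC_halfline:
  fixes f g :: "real \<Rightarrow> 'a::euclidean_space"
  assumes f: "\<And>r. (f has_vector_derivative g r) (at r)" and g: "continuous_on UNIV g"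
    and "\<And>r. \<bar>r\<bar> > M \<Longrightarrow> f r = 0" "\<And>r. \<bar>r\<bar> > M \<Longrightarrow> g r = 0"
  shows "(LINT r|lborel. indicator {0<..} r *\<^sub>R g r) = - f 0" "(LINT r|lborel. g r) = 0"
proof -
  \<comment> \<open>The end point becomes positive and lies strictly outside the support, so the
    boundary values at both ends vanish.\<close>
  define K where "K = \<bar>M\<bar> + 1"
  have K: "0 < K" "f K = 0" "f (-K) = 0" "\<And>r. \<bar>r\<bar> > K \<Longrightarrow> g r = 0"
    using assms(3,4) by (auto simp: K_def)
  have ftc: "(LINT r|lborel. indicator {a..K} r *\<^sub>R g r) = f K - f a" if "a \<le> K" for a
    using that by (intro integral_FTC_Icc)
      (auto intro: has_vector_derivative_at_within f continuous_on_subset[OF g])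
  have "(LINT r|lborel. indicator {0<..} r *\<^sub>R g r) = (LINT r|lborel. indicator {0..K} r *\<^sub>R g r)"
  proof (rule integral_cong_AE)
    have "g \<in> borel_measurable borel" using g by (rule borel_measurable_continuous_onI)
    then show "(\<lambda>r. indicator {0<..} r *\<^sub>R g r) \<in> borel_measurable lborel"
      "(\<lambda>r. indicator {0..K} r *\<^sub>R g r) \<in> borel_measurable lborel" by measurable
    show "AE r in lborel. indicator {0<..} r *\<^sub>R g r = indicator {0..K} r *\<^sub>R g r"
      using AE_lborel_singleton[of "0::real"] by eventually_elim (use K in \<open>auto simp: indicator_def\<close>)
  qed
  then show "(LINT r|lborel. indicator {0<..} r *\<^sub>R g r) = - f 0" using ftc[of 0] K by simp
  have "(\<lambda>r. indicator {-K..K} r *\<^sub>R g r) = g" using K(4) by (auto simp: fun_eq_iff indicator_def)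
  then show "(LINT r|lborel. g r) = 0" using ftc[of "-K"] K by simp
qed

text \<open>For independent \<open>p\<close> and \<open>q\<close> this is the open convex cone that
  they span. The factor \<open>cross2 p q\<close> in both conditions makes it independent of the
  orientation of the pair.\<close>

definition cone2 :: "real^2 \<Rightarrow> real^2 \<Rightarrow> (real^2) set" where
  "cone2 p q = {x. cross2 p q * cross2 x q > 0 \<and> cross2 p q * cross2 p x > 0}"

lemma cone2_commute: "cone2 q p = cone2 p q"
proof -
  have "cross2 q p * cross2 x p = cross2 p q * cross2 p x" "cross2 q p * cross2 q x = cross2 p q * cross2 x q" for x
    by (simp_all add: cross2_def algebra_simps)
  then show ?thesis by (auto simp: cone2_def)
qed

lemma skew_in_cone2_iff:
  "cross2 p q \<noteq> 0 \<Longrightarrow> skew p q z \<in> cone2 p q \<longleftrightarrow> fst z > 0 \<and> snd z > 0"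
proof -
  assume nz: "cross2 p q \<noteq> 0"
  have "cross2 p q * cross2 (skew p q z) q = (cross2 p q)\<^sup>2 * fst z"
    "cross2 p q * cross2 p (skew p q z) = (cross2 p q)\<^sup>2 * snd z"
    by (auto simp: skew_def cross2_def power2_eq_square algebra_simps)
  then have "skew p q z \<in> cone2 p q \<longleftrightarrow> (cross2 p q)\<^sup>2 * fst z > 0 \<and> (cross2 p q)\<^sup>2 * snd z > 0"
    by (simp only: cone2_def mem_Collect_eq)
  then show ?thesis using nz by (simp add: zero_less_mult_iff)
qed

lemma open_cone2: "open (cone2 p q)"
proof -
  have "open {x. cross2 p q * cross2 x q > 0}" "open {x. cross2 p q * cross2 p x > 0}"
    unfolding cross2_def by (auto intro!: open_Collect_less continuous_intros)
  then show ?thesis unfolding cone2_def Collect_conj_eq by blast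
qed

text \<open>Cramer's rule bounds both coordinates by a multiple of the norm, so fields of compact
  support also have bounded support in skew coordinates.\<close>

lemma skew_coercive:
  assumes "cross2 p q \<noteq> 0"
  obtains M where "\<And>r s. norm (skew p q (r, s)) \<le> R \<Longrightarrow> \<bar>r\<bar> \<le> M \<and> \<bar>s\<bar> \<le> M"
proof -
  let ?D = "cross2 p q"
  have b: "\<bar>cross2 x y\<bar> \<le> 2 * (norm x * norm y)" for x y
  proof -
    have "\<bar>x $ 1 * y $ 2\<bar> \<le> norm x * norm y" "\<bar>x $ 2 * y $ 1\<bar> \<le> norm x * norm y"
      by (auto simp: abs_mult intro!: mult_mono component_le_norm_cart)
    then show ?thesis unfolding cross2_def by linarith
  qed
  define M where "M = 2 * (\<bar>R\<bar> * (norm p + norm q)) / \<bar>?D\<bar>"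
  have "\<bar>r\<bar> \<le> M \<and> \<bar>s\<bar> \<le> M" if "norm (skew p q (r, s)) \<le> R" for r s
  proof -
    have e: "cross2 (skew p q (r, s)) q = r * ?D" "cross2 p (skew p q (r, s)) = s * ?D"
      by (auto simp: skew_def cross2_def algebra_simps)
    have "norm (skew p q (r, s)) * norm q \<le> \<bar>R\<bar> * (norm p + norm q)"
      "norm p * norm (skew p q (r, s)) \<le> \<bar>R\<bar> * (norm p + norm q)"
      using that by (auto simp: mult.commute[of "norm p"] intro!: mult_mono)
    then have "\<bar>r * ?D\<bar> \<le> 2 * (\<bar>R\<bar> * (norm p + norm q))" "\<bar>s * ?D\<bar> \<le> 2 * (\<bar>R\<bar> * (norm p + norm q))"
      using b[of "skew p q (r, s)" q] b[of p "skew p q (r, s)"] unfolding e by linarith+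
    then show ?thesis using assms by (simp add: M_def abs_mult field_simps)
  qed
  then show ?thesis using that by blast
qed

text \<open>In skew coordinates the derivative along \<open>p\<close> is the derivative in the first
  coordinate, so the inner integral collapses to the value on the ray along \<open>q\<close>. The
  ray along \<open>p\<close> contributes nothing, which is how a single edge is isolated.\<close>

lemma
  fixes G :: "real^2 \<Rightarrow> 'a::euclidean_space"
  assumes nz: "cross2 p q \<noteq> 0" and G: "C_k 1 G" "\<And>x. norm x \<ge> R \<Longrightarrow> G x = 0"
  shows integral_dird_cone2: "(LINT x|lborel. indicator (cone2 p q) x *\<^sub>R dird p G x)
      = - \<bar>cross2 p q\<bar> *\<^sub>R (LINT s|lborel. indicator {0<..} s *\<^sub>R G (s *\<^sub>R q))"
    and integral_dird_UNIV: "(LINT x|lborel. dird p G x) = 0"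
proof -
  obtain M where M: "\<And>r s. norm (skew p q (r, s)) \<le> R \<Longrightarrow> \<bar>r\<bar> \<le> M \<and> \<bar>s\<bar> \<le> M"
    using skew_coercive[OF nz] by metis
  have contd: "continuous_on UNIV (dird p G)" using G(1) by (rule dird_continuous)
  have int: "integrable lborel (dird p G)"
    by (rule integrable_compact_support[OF contd]) (use dird_eq_0[OF G] in auto)
  have intc: "integrable lborel (\<lambda>x. indicator (cone2 p q) x *\<^sub>R dird p G x)"
    by (rule integrable_mult_indicator[OF _ int]) (simp add: open_cone2 borel_open)
  have ftc: "(LINT r|lborel. indicator {0<..} r *\<^sub>R dird p G (skew p q (r, s))) = - G (s *\<^sub>R q)"
    "(LINT r|lborel. dird p G (skew p q (r, s))) = 0" for s
  proof -
    have *: "((\<lambda>r. G (skew p q (r, s))) has_vector_derivative dird p G (skew p q (r, s))) (at r)" for r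
      unfolding skew_def using dird_has_vector_derivative[OF G(1)] by simp
    have "continuous_on UNIV (\<lambda>r. skew p q (r, s))" unfolding skew_def by (auto intro!: continuous_intros)
    then have c: "continuous_on UNIV (\<lambda>r. dird p G (skew p q (r, s)))"
      using continuous_on_compose2[OF contd] by blast
    have z: "G (skew p q (r, s)) = 0" "dird p G (skew p q (r, s)) = 0" if "\<bar>r\<bar> > M" for r
    proof -
      have "norm (skew p q (r, s)) > R" using M[of r s] that by force
      then show "G (skew p q (r, s)) = 0" "dird p G (skew p q (r, s)) = 0" using G dird_eq_0[OF G] by auto
    qed
    show "(LINT r|lborel. indicator {0<..} r *\<^sub>R dird p G (skew p q (r, s))) = - G (s *\<^sub>R q)"
      "(LINT r|lborel. dird p G (skew p q (r, s))) = 0"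
      using FTC_halfline[OF * c z] by (auto simp: skew_def)
  qed
  have "(LINT x|lborel. dird p G x) = \<bar>cross2 p q\<bar> *\<^sub>R (LINT z|(lborel \<Otimes>\<^sub>M lborel). dird p G (skew p q z))"
    using int by (intro integral_skew[OF nz]) auto
  also have "(LINT z|(lborel \<Otimes>\<^sub>M lborel). dird p G (skew p q z)) = (LINT s|lborel. LINT r|lborel. dird p G (skew p q (r, s)))"
    using int integrable_skew[OF nz, of "dird p G"]
    by (intro lborel_Fubini) auto
  finally show "(LINT x|lborel. dird p G x) = 0" by (simp add: ftc)
  have "(LINT x|lborel. indicator (cone2 p q) x *\<^sub>R dird p G x)
      = \<bar>cross2 p q\<bar> *\<^sub>R (LINT z|(lborel \<Otimes>\<^sub>M lborel). indicator (cone2 p q) (skew p q z) *\<^sub>R dird p G (skew p q z))"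
    using intc by (intro integral_skew[OF nz]) auto
  also have "(LINT z|(lborel \<Otimes>\<^sub>M lborel). indicator (cone2 p q) (skew p q z) *\<^sub>R dird p G (skew p q z))
      = (LINT s|lborel. LINT r|lborel. indicator (cone2 p q) (skew p q (r, s)) *\<^sub>R dird p G (skew p q (r, s)))"
    using intc integrable_skew[OF nz, of "\<lambda>x. indicator (cone2 p q) x *\<^sub>R dird p G x"]
    by (intro lborel_Fubini) auto
  also have "\<dots> = (LINT s|lborel. LINT r|lborel. indicator {0<..} s *\<^sub>R (indicator {0<..} r *\<^sub>R dird p G (skew p q (r, s))))"
    using skew_in_cone2_iff[OF nz] by (intro Bochner_Integration.integral_cong refl) (auto simp: indicator_def)
  also have "\<dots> = - (LINT s|lborel. indicator {0<..} s *\<^sub>R G (s *\<^sub>R q))"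
    by (simp add: ftc del: scaleR_scaleR)
  finally show "(LINT x|lborel. indicator (cone2 p q) x *\<^sub>R dird p G x)
      = - \<bar>cross2 p q\<bar> *\<^sub>R (LINT s|lborel. indicator {0<..} s *\<^sub>R G (s *\<^sub>R q))" by simp
qed

section \<open>Angles, sectors and their relation to cones\<close>

definition dir :: "real \<Rightarrow> real^2" where "dir t = vector [cos t, sin t]"

lemma dir_nth [simp]: "dir t $ 1 = cos t" "dir t $ 2 = sin t"
  by (simp_all add: dir_def)

lemma norm_dir [simp]: "norm (dir t) = 1"
  by (simp add: norm_vec_def L2_set_def UNIV_2)

lemma cross2_dir: "cross2 (dir a) (dir b) = sin (b - a)"
  by (simp add: cross2_def sin_diff)

lemma polar_angle: "x = norm x *\<^sub>R dir (angle x)"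
proof -
  let ?z = "Complex (x $ 1) (x $ 2)"
  have "norm x = cmod ?z" by (simp add: norm_vec_def L2_set_def UNIV_2 cmod_def)
  moreover have "x $ 1 = cmod ?z * cos (Arg ?z)" "x $ 2 = cmod ?z * sin (Arg ?z)"
    using arg_cong[OF rcis_cmod_Arg[of ?z], of Re] arg_cong[OF rcis_cmod_Arg[of ?z], of Im] by simp_all
  ultimately show ?thesis by (simp add: vec_eq_iff forall_2 angle_def)
qed

lemma angle_bounds: "- pi < angle x" "angle x \<le> pi"
  using Arg_bounded[of "Complex (x $ 1) (x $ 2)"] by (auto simp: angle_def)

lemma cross2_angle:
  "cross2 x (dir b) = norm x * sin (b - angle x)" "cross2 (dir a) x = norm x * sin (angle x - a)"
proof -
  have "x $ 1 = norm x * cos (angle x)" "x $ 2 = norm x * sin (angle x)"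
    using arg_cong[OF polar_angle[of x], of "\<lambda>y. y $ 1"] arg_cong[OF polar_angle[of x], of "\<lambda>y. y $ 2"] by auto
  then show "cross2 x (dir b) = norm x * sin (b - angle x)" "cross2 (dir a) x = norm x * sin (angle x - a)"
    by (simp_all add: cross2_def sin_diff right_diff_distrib mult_ac)
qed

lemma sin_pos_imp_range:
  assumes "0 < sin x" "- (2 * pi) < x" "x < 2 * pi"
  shows "(0 < x \<and> x < pi) \<or> (- (2 * pi) < x \<and> x < - pi)"
proof (rule ccontr)
  assume "\<not> ?thesis"
  then consider "pi \<le> x" | "- pi \<le> x \<and> x \<le> 0" using assms by linarith
  then show False
  proof cases
    case 1
    then have "sin (x - pi) \<ge> 0" using assms by (intro sin_ge_zero) auto
    then show False using assms(1) by simp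
  next
    case 2
    then have "sin (x + pi) \<ge> 0" by (intro sin_ge_zero) auto
    then show False using assms(1) by simp
  qed
qed

lemma sin_neg_imp_range:
  assumes "sin x < 0" "- (2 * pi) < x" "x < 2 * pi"
  shows "(- pi < x \<and> x < 0) \<or> (pi < x \<and> x < 2 * pi)"
  using sin_pos_imp_range[of "- x"] assms by auto

text \<open>With aperture below pi the sector is the cone spanned by its sides; beyond pi it is the
  complement of that cone. The lines carrying the sides are left out, since strict and weak
  inequalities differ there; they are null sets.\<close>

lemma sector_iff_cone2:
  assumes "- pi < a" "a < b" "b < pi" "b - a \<noteq> pi"
    and x: "cross2 x (dir b) \<noteq> 0" "cross2 (dir a) x \<noteq> 0"
  shows "x \<in> sector a b \<longleftrightarrow> (if 0 < sin (b - a) then x \<in> cone2 (dir a) (dir b) else x \<notin> cone2 (dir a) (dir b))"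
proof -
  have nx: "0 < norm x" "x \<noteq> 0" using x by (auto simp: cross2_def)
  let ?A = "b - angle x" and ?B = "angle x - a"
  have nz: "sin ?A \<noteq> 0" "sin ?B \<noteq> 0" using x by (auto simp: cross2_angle)
  have r: "- (2 * pi) < ?A" "?A < 2 * pi" "- (2 * pi) < ?B" "?B < 2 * pi"
    using assms angle_bounds[of x] by auto
  have W: "x \<in> sector a b \<longleftrightarrow> 0 < ?A \<and> 0 < ?B" using nx by (auto simp: sector_def)
  have pA: "0 < sin ?A" if "0 < ?A" "?A < pi" using that by (rule sin_gt_zero)
  have pB: "0 < sin ?B" if "0 < ?B" "?B < pi" using that by (rule sin_gt_zero)
  have "sin (b - a) \<noteq> 0"
  proof (cases "b - a < pi")
    case True
    then have "0 < sin (b - a)" using assms by (intro sin_gt_zero) auto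
    then show ?thesis by simp
  next
    case False
    then have "sin (b - a) < 0" using assms by (intro sin_lt_zero) auto
    then show ?thesis by simp
  qed
  then consider "0 < sin (b - a)" | "sin (b - a) < 0" by linarith
  then show ?thesis
  proof cases
    case 1
    then have d: "b - a < pi" using sin_pos_imp_range[of "b - a"] assms by auto
    have "x \<in> cone2 (dir a) (dir b) \<longleftrightarrow> 0 < sin ?A \<and> 0 < sin ?B"
      unfolding cone2_def mem_Collect_eq cross2_dir cross2_angle(1)[of x b] cross2_angle(2)[of a x]
      using 1 nx by (simp add: zero_less_mult_iff)
    also have "\<dots> \<longleftrightarrow> 0 < ?A \<and> 0 < ?B"
    proof
      assume "0 < sin ?A \<and> 0 < sin ?B"
      then show "0 < ?A \<and> 0 < ?B" using sin_pos_imp_range[of ?A] sin_pos_imp_range[of ?B] r d assms by linarith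
    next
      assume "0 < ?A \<and> 0 < ?B"
      then show "0 < sin ?A \<and> 0 < sin ?B" using pA pB d by linarith
    qed
    finally show ?thesis using 1 W by simp
  next
    case 2
    then have d: "pi < b - a" using sin_neg_imp_range[of "b - a"] assms by auto
    have "x \<in> cone2 (dir a) (dir b) \<longleftrightarrow> sin ?A < 0 \<and> sin ?B < 0"
      unfolding cone2_def mem_Collect_eq cross2_dir cross2_angle(1)[of x b] cross2_angle(2)[of a x]
      using 2 nx by (simp add: zero_less_mult_iff mult_less_0_iff)
    also have "\<dots> \<longleftrightarrow> \<not> (0 < ?A \<and> 0 < ?B)"
    proof
      assume "sin ?A < 0 \<and> sin ?B < 0"
      then show "\<not> (0 < ?A \<and> 0 < ?B)"
        using sin_neg_imp_range[of ?A] sin_neg_imp_range[of ?B] r assms by linarith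
    next
      assume n: "\<not> (0 < ?A \<and> 0 < ?B)"
      have nn: "?A \<noteq> 0" "?B \<noteq> 0" using nz by auto
      show "sin ?A < 0 \<and> sin ?B < 0"
      proof (cases "?A < 0")
        case True
        then have B: "pi < ?B" "- pi < ?A" using d r by linarith+
        have "sin ?B < 0" using B r by (intro sin_lt_zero) auto
        moreover have "0 < sin (- ?A)" using B True by (intro sin_gt_zero) auto
        ultimately show ?thesis using sin_minus[of ?A] by linarith
      next
        case False
        then have "?B < 0" using n nn by linarith
        then have B: "pi < ?A" "- pi < ?B" using d r by linarith+
        have "sin ?A < 0" using B r by (intro sin_lt_zero) auto
        moreover have "0 < sin (- ?B)" using B \<open>?B < 0\<close> by (intro sin_gt_zero) auto
        ultimately show ?thesis using sin_minus[of ?B] by linarith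
      qed
    qed
    finally show ?thesis using 2 W by auto
  qed
qed

lemma AE_cross2:
  assumes "q \<noteq> 0"
  shows "AE x in lborel. cross2 x q \<noteq> 0" "AE x in lborel. cross2 q x \<noteq> 0"
proof -
  let ?n = "vector [q $ 2, - q $ 1] :: real^2"
  have n: "?n \<noteq> 0" using assms by (auto simp: vec_eq_iff forall_2)
  have eq: "cross2 x q = ?n \<bullet> x" for x by (simp add: cross2_def inner_vec_def UNIV_2)
  have "negligible {x. ?n \<bullet> x = 0}" using n by (intro negligible_hyperplane) auto
  then have "AE x in lebesgue. \<not> (?n \<bullet> x = 0)"
    by (intro AE_I'[of "{x. ?n \<bullet> x = 0}"]) (auto simp: negligible_iff_null_sets)
  then show *: "AE x in lborel. cross2 x q \<noteq> 0" unfolding eq by (simp add: AE_completion_iff)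
  have "cross2 q x = - cross2 x q" for x by (simp add: cross2_def)
  with * show "AE x in lborel. cross2 q x \<noteq> 0" by simp
qed

text \<open>\<open>Arg\<close> is continuous off the closed negative real axis, and
  \<open>b < pi\<close> keeps the sector away from that axis, on which \<open>Arg\<close> equals
  pi.\<close>

lemma open_sector:
  assumes "- pi < a" "b < pi" shows "open (sector a b)"
proof -
  let ?f = "\<lambda>x::real^2. Complex (x $ 1) (x $ 2)"
  have "continuous_on UNIV ?f"
    unfolding continuous_on_def by (auto intro!: tendsto_Complex tendsto_intros)
  moreover have "sector a b = ?f -` ({z. z \<notin> \<real>\<^sub>\<le>\<^sub>0} \<inter> {z. a < Arg z \<and> Arg z < b})"
  proof -
    have "?f x \<notin> \<real>\<^sub>\<le>\<^sub>0" if "x \<noteq> 0" "angle x < b" for x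
    proof
      assume "?f x \<in> \<real>\<^sub>\<le>\<^sub>0"
      moreover have "?f x \<noteq> 0" using that(1) by (auto simp: vec_eq_iff forall_2 complex_eq_iff)
      ultimately have "Arg (?f x) = pi" by (auto simp: complex_nonpos_Reals_iff Arg_eq_pi complex_eq_iff)
      then show False using that assms by (simp add: angle_def)
    qed
    moreover have "x \<noteq> 0" if "?f x \<notin> \<real>\<^sub>\<le>\<^sub>0" for x using that by (auto simp: complex_nonpos_Reals_iff)
    ultimately show ?thesis by (auto simp: sector_def angle_def)
  qed
  moreover have "open ({z. z \<notin> \<real>\<^sub>\<le>\<^sub>0} \<inter> {z. a < Arg z \<and> Arg z < b})"
  proof -
    have "open ({z. z \<notin> \<real>\<^sub>\<le>\<^sub>0} :: complex set)"
      using closed_nonpos_Reals_complex by (simp add: closed_def Collect_neg_eq[symmetric] Compl_eq)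
    moreover have "continuous_on {z. z \<notin> \<real>\<^sub>\<le>\<^sub>0} Arg"
      by (auto intro!: continuous_at_imp_continuous_on continuous_at_Arg)
    ultimately have "open ({z. z \<notin> \<real>\<^sub>\<le>\<^sub>0} \<inter> Arg -` {a<..<b})"
      by (metis open_greaterThanLessThan continuous_on_open_vimage Int_commute)
    then show ?thesis by (simp add: vimage_def)
  qed
  ultimately show ?thesis using open_vimage[of _ ?f] by (simp only:)
qed

text \<open>For a reflex sector the integral is the one over the plane, which vanishes, minus the
  one over the complementary cone. The resulting change of sign is the sign of
  \<open>sin (b - a)\<close>, so one formula serves both cases.\<close>

lemma integral_dird_sector:
  fixes G :: "real^2 \<Rightarrow> 'a::euclidean_space"
  assumes ab: "- pi < a" "a < b" "b < pi" "b - a \<noteq> pi"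
    and G: "C_k 1 G" "\<And>x. norm x \<ge> R \<Longrightarrow> G x = 0"
  shows "(LINT x|lborel. indicator (sector a b) x *\<^sub>R dird (dir a) G x)
      = - sin (b - a) *\<^sub>R (LINT s|lborel. indicator {0<..} s *\<^sub>R G (s *\<^sub>R dir b))"
    and "(LINT x|lborel. indicator (sector a b) x *\<^sub>R dird (dir b) G x)
      = - sin (b - a) *\<^sub>R (LINT s|lborel. indicator {0<..} s *\<^sub>R G (s *\<^sub>R dir a))"
proof -
  have sn: "sin (b - a) \<noteq> 0"
  proof
    assume "sin (b - a) = 0"
    moreover have "sin (b - a) < 0" if "b - a > pi" using ab that by (intro sin_lt_zero) auto
    moreover have "sin (b - a) > 0" if "b - a < pi" using ab that by (intro sin_gt_zero) auto
    ultimately show False using ab by linarith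
  qed
  have ne: "dir t \<noteq> 0" for t using norm_dir[of t] by force
  have main: "(LINT x|lborel. indicator (sector a b) x *\<^sub>R dird p G x)
      = - sin (b - a) *\<^sub>R (LINT s|lborel. indicator {0<..} s *\<^sub>R G (s *\<^sub>R q))"
    if nz: "cross2 p q \<noteq> 0" and D: "\<bar>cross2 p q\<bar> = \<bar>sin (b - a)\<bar>" and c: "cone2 p q = cone2 (dir a) (dir b)" for p q
  proof -
    let ?I = "\<lambda>x. indicator (sector a b) x *\<^sub>R dird p G x" and ?C = "\<lambda>x. indicator (cone2 p q) x *\<^sub>R dird p G x"
    have contd: "continuous_on UNIV (dird p G)" using G(1) by (rule dird_continuous)
    have int: "integrable lborel (dird p G)"
      by (rule integrable_compact_support[OF contd]) (use dird_eq_0[OF G] in auto)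
    have intC: "integrable lborel ?C"
      by (rule integrable_mult_indicator[OF _ int]) (simp add: open_cone2 borel_open)
    have mI: "?I \<in> borel_measurable lborel"
      using integrable_mult_indicator[OF _ int, of "sector a b"] open_sector[of a b] ab by (simp add: borel_open)
    have m: "dird p G \<in> borel_measurable lborel" "?C \<in> borel_measurable lborel" using int intC by auto
    have val: "(LINT x|lborel. ?C x) = - \<bar>sin (b - a)\<bar> *\<^sub>R (LINT s|lborel. indicator {0<..} s *\<^sub>R G (s *\<^sub>R q))"
      using integral_dird_cone2[OF nz G] D by simp
    show ?thesis
    proof (cases "0 < sin (b - a)")
      case True
      have "AE x in lborel. ?I x = ?C x"
        using AE_cross2(1)[OF ne[of b]] AE_cross2(2)[OF ne[of a]]
        by eventually_elim (use sector_iff_cone2[OF ab] True c in \<open>auto simp: indicator_def\<close>)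
      then have "(LINT x|lborel. ?I x) = (LINT x|lborel. ?C x)"
        by (rule integral_cong_AE[OF mI m(2)])
      with val True show ?thesis by simp
    next
      case False
      have "AE x in lborel. ?I x = dird p G x - ?C x"
        using AE_cross2(1)[OF ne[of b]] AE_cross2(2)[OF ne[of a]]
        by eventually_elim (use sector_iff_cone2[OF ab] False c in \<open>auto simp: indicator_def\<close>)
      then have "(LINT x|lborel. ?I x) = (LINT x|lborel. dird p G x - ?C x)"
        by (rule integral_cong_AE[OF mI borel_measurable_diff[OF m]])
      also have "\<dots> = - (LINT x|lborel. ?C x)"
        using integral_dird_UNIV[OF nz G] int intC by simp
      finally show ?thesis using val False by simp
    qed
  qed
  show "(LINT x|lborel. indicator (sector a b) x *\<^sub>R dird (dir a) G x)
      = - sin (b - a) *\<^sub>R (LINT s|lborel. indicator {0<..} s *\<^sub>R G (s *\<^sub>R dir b))"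
    by (rule main) (use sn in \<open>auto simp: cross2_dir\<close>)
  have sw: "cross2 x y = - cross2 y x" for x y by (simp add: cross2_def)
  show "(LINT x|lborel. indicator (sector a b) x *\<^sub>R dird (dir b) G x)
      = - sin (b - a) *\<^sub>R (LINT s|lborel. indicator {0<..} s *\<^sub>R G (s *\<^sub>R dir a))"
  proof (rule main)
    show "cross2 (dir b) (dir a) \<noteq> 0" "\<bar>cross2 (dir b) (dir a)\<bar> = \<bar>sin (b - a)\<bar>"
      using sn sw[of "dir b" "dir a"] by (auto simp: cross2_dir)
    show "cone2 (dir b) (dir a) = cone2 (dir a) (dir b)" by (rule cone2_commute)
  qed
qed

section \<open>Square integrable functions\<close>

lemma L2_measurable: "L2 M f \<Longrightarrow> f \<in> borel_measurable M"
  by (simp add: L2_def)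

lemma L2_integrable_norm2: "L2 M f \<Longrightarrow> integrable M (\<lambda>x. (norm (f x))\<^sup>2)"
  by (simp add: L2_def)

lemma L2_norm_sq: "(L2_norm M f)\<^sup>2 = (LINT x|M. (norm (f x))\<^sup>2)"
  by (simp add: L2_norm_def)

lemma integrable_bilinear_L2:
  fixes h :: "'b::euclidean_space \<Rightarrow> 'c::euclidean_space \<Rightarrow> 'd::euclidean_space"
  assumes h: "bounded_bilinear h" and f: "L2 M f" and g: "L2 M g"
  shows "integrable M (\<lambda>x. h (f x) (g x))"
proof -
  obtain K where "0 < K" "\<forall>a b. norm (h a b) \<le> norm a * norm b * K"
    using bounded_bilinear.pos_bounded[OF h] by auto
  then have K: "norm (h a b) \<le> norm a * norm b * K" "0 < K" for a b by auto
  note [measurable] = L2_measurable[OF f] L2_measurable[OF g]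
  have "continuous_on UNIV (\<lambda>x. h (fst x) (snd x))"
    by (intro bounded_bilinear.continuous_on[OF h] continuous_intros)
  then have m: "(\<lambda>x. h (f x) (g x)) \<in> borel_measurable M"
    by (rule borel_measurable_continuous_Pair[where H = h, rotated 2]) measurable
  have "integrable M (\<lambda>x. K * ((norm (f x))\<^sup>2 + (norm (g x))\<^sup>2))"
    using f g by (intro integrable_mult_right Bochner_Integration.integrable_add L2_integrable_norm2)
  then show ?thesis
  proof (rule Bochner_Integration.integrable_bound[OF _ m])
    have "norm (h a b) \<le> norm (K * ((norm a)\<^sup>2 + (norm b)\<^sup>2))" for a b
    proof -
      have "2 * (norm a * norm b) \<le> (norm a)\<^sup>2 + (norm b)\<^sup>2"
        using sum_squares_bound[of "norm a" "norm b"] by (simp add: power2_eq_square)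
      moreover have "0 \<le> norm a * norm b" by simp
      ultimately have "norm a * norm b \<le> (norm a)\<^sup>2 + (norm b)\<^sup>2" by linarith
      then have "norm a * norm b * K \<le> K * ((norm a)\<^sup>2 + (norm b)\<^sup>2)" using K(2) by (simp add: mult.commute)
      also have "\<dots> \<le> norm (K * ((norm a)\<^sup>2 + (norm b)\<^sup>2))" by simp
      finally show ?thesis using K(1)[of a b] by linarith
    qed
    then show "AE x in M. norm (h (f x) (g x)) \<le> norm (K * ((norm (f x))\<^sup>2 + (norm (g x))\<^sup>2))" by simp
  qed
qed

lemma L2_add:
  assumes "L2 M f" "L2 M g" shows "L2 M (\<lambda>x. f x + g x)"
proof -
  note [measurable] = L2_measurable[OF assms(1)] L2_measurable[OF assms(2)]
  have "integrable M (\<lambda>x. 2 * (norm (f x))\<^sup>2 + 2 * (norm (g x))\<^sup>2)"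
    using assms by (intro integrable_mult_right Bochner_Integration.integrable_add L2_integrable_norm2)
  then have "integrable M (\<lambda>x. (norm (f x + g x))\<^sup>2)"
  proof (rule Bochner_Integration.integrable_bound)
    have "(norm (a + b))\<^sup>2 \<le> 2 * (norm a)\<^sup>2 + 2 * (norm b)\<^sup>2" for a b :: 'b
    proof -
      have "(norm (a + b))\<^sup>2 \<le> (norm a + norm b)\<^sup>2" by (intro power_mono norm_triangle_ineq) auto
      also have "\<dots> \<le> 2 * (norm a)\<^sup>2 + 2 * (norm b)\<^sup>2"
        using sum_squares_bound[of "norm a" "norm b"] by (simp add: power2_sum)
      finally show ?thesis .
    qed
    then show "AE x in M. norm ((norm (f x + g x))\<^sup>2) \<le> norm (2 * (norm (f x))\<^sup>2 + 2 * (norm (g x))\<^sup>2)"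
      by (intro AE_I2) (smt (verit) real_norm_def zero_le_power2)
  qed measurable
  then show ?thesis unfolding L2_def by simp
qed

lemma L2_bound:
  fixes f :: "'a \<Rightarrow> 'b::euclidean_space" and g :: "'a \<Rightarrow> 'c::euclidean_space"
  assumes g: "L2 M g" and m: "f \<in> borel_measurable M" and b: "AE x in M. norm (f x) \<le> C * norm (g x)"
  shows "L2 M f"
proof -
  note [measurable] = m
  have "integrable M (\<lambda>x. C\<^sup>2 * (norm (g x))\<^sup>2)" using L2_integrable_norm2[OF g] by simp
  then have "integrable M (\<lambda>x. (norm (f x))\<^sup>2)"
  proof (rule Bochner_Integration.integrable_bound)
    show "AE x in M. norm ((norm (f x))\<^sup>2) \<le> norm (C\<^sup>2 * (norm (g x))\<^sup>2)"
      using b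
    proof eventually_elim
      case (elim x)
      then have "(norm (f x))\<^sup>2 \<le> (C * norm (g x))\<^sup>2" by (intro power_mono) auto
      then show ?case by (simp add: power_mult_distrib)
    qed
  qed measurable
  then show ?thesis using m by (simp add: L2_def)
qed

lemma L2_bounded_linear:
  fixes h :: "'b::euclidean_space \<Rightarrow> 'c::euclidean_space"
  assumes h: "bounded_linear h" and f: "L2 M f"
  shows "L2 M (\<lambda>x. h (f x))"
proof -
  obtain K where K: "\<And>a. norm (h a) \<le> norm a * K" using bounded_linear.bounded[OF h] by blast
  have "h \<in> borel_measurable borel"
    by (intro borel_measurable_continuous_onI linear_continuous_on h)
  then have "(\<lambda>x. h (f x)) \<in> borel_measurable M" using L2_measurable[OF f] by (rule measurable_compose[rotated])
  then show ?thesis by (rule L2_bound[OF f, of _ K]) (use K in \<open>auto simp: mult.commute\<close>)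
qed

lemma L2_diff: "L2 M f \<Longrightarrow> L2 M g \<Longrightarrow> L2 M (\<lambda>x. f x - g x)"
  using L2_add[of M f "\<lambda>x. - g x"] L2_bounded_linear[OF bounded_linear_minus[OF bounded_linear_ident], of M g] by simp

lemmas L2_vec_nth = L2_bounded_linear[OF bounded_linear_vec_nth]

lemma L2_sum: "finite A \<Longrightarrow> (\<And>i. i \<in> A \<Longrightarrow> L2 M (f i)) \<Longrightarrow> L2 M (\<lambda>x. \<Sum>i\<in>A. f i x)"
proof (induction A rule: finite_induct)
  case empty then show ?case by (simp add: L2_def)
next
  case (insert a A) then show ?case by (simp add: L2_add)
qed

lemma L2_vecI:
  fixes f :: "'a \<Rightarrow> complex^2"
  assumes "\<And>i. L2 M (\<lambda>x. f x $ i)" shows "L2 M f"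
proof -
  have "f x = (\<Sum>i\<in>UNIV. axis i (f x $ i))" for x
    by (simp add: vec_eq_iff axis_def)
  moreover have "bounded_linear (\<lambda>c::complex. axis i c :: complex^2)" for i
    by (rule linear_conv_bounded_linear[THEN iffD1], rule linearI) (auto simp: axis_def vec_eq_iff)
  then have "L2 M (\<lambda>x. \<Sum>i\<in>UNIV. axis i (f x $ i))"
    by (intro L2_sum L2_bounded_linear[OF _ assms]) auto
  ultimately show ?thesis by simp
qed

lemma Cauchy_Schwarz_L2:
  fixes f g :: "'a \<Rightarrow> real"
  assumes f: "L2 M f" and g: "L2 M g"
  shows "\<bar>LINT x|M. f x * g x\<bar> \<le> L2_norm M f * L2_norm M g"
proof -
  note [measurable] = L2_measurable[OF f] L2_measurable[OF g]
  define F G where "F = (LINT x|M. (f x)\<^sup>2)" and "G = (LINT x|M. (g x)\<^sup>2)"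
  have i: "integrable M (\<lambda>x. (f x)\<^sup>2)" "integrable M (\<lambda>x. (g x)\<^sup>2)"
    using L2_integrable_norm2[OF f] L2_integrable_norm2[OF g] by auto
  have p: "integrable M (\<lambda>x. \<bar>f x * g x\<bar>)"
    using integrable_bilinear_L2[OF bounded_bilinear_mult f g] by simp
  have "(\<integral>\<^sup>+x. ennreal \<bar>f x\<bar> * ennreal \<bar>g x\<bar> \<partial>M)\<^sup>2
      \<le> (\<integral>\<^sup>+x. ennreal \<bar>f x\<bar> ^ 2 \<partial>M) * (\<integral>\<^sup>+x. ennreal \<bar>g x\<bar> ^ 2 \<partial>M)"
    by (rule Cauchy_Schwarz_nn_integral) measurable
  also have "(\<integral>\<^sup>+x. ennreal \<bar>f x\<bar> ^ 2 \<partial>M) = ennreal F"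
    using nn_integral_eq_integral[OF i(1)] by (simp add: F_def ennreal_power)
  also have "(\<integral>\<^sup>+x. ennreal \<bar>g x\<bar> ^ 2 \<partial>M) = ennreal G"
    using nn_integral_eq_integral[OF i(2)] by (simp add: G_def ennreal_power)
  also have "(\<integral>\<^sup>+x. ennreal \<bar>f x\<bar> * ennreal \<bar>g x\<bar> \<partial>M) = ennreal (LINT x|M. \<bar>f x * g x\<bar>)"
    using nn_integral_eq_integral[OF p] by (simp add: ennreal_mult[symmetric] abs_mult)
  finally have "ennreal ((LINT x|M. \<bar>f x * g x\<bar>)\<^sup>2) \<le> ennreal (F * G)"
    by (simp add: ennreal_power ennreal_mult F_def G_def)
  then have "(LINT x|M. \<bar>f x * g x\<bar>)\<^sup>2 \<le> F * G" by (simp add: F_def G_def ennreal_le_iff)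
  then have "(LINT x|M. \<bar>f x * g x\<bar>) \<le> sqrt (F * G)" by (rule real_le_rsqrt)
  moreover have "\<bar>LINT x|M. f x * g x\<bar> \<le> (LINT x|M. \<bar>f x * g x\<bar>)" by (rule integral_abs_bound)
  ultimately have "\<bar>LINT x|M. f x * g x\<bar> \<le> sqrt (F * G)" by (rule order_trans[rotated])
  then show ?thesis by (simp add: L2_norm_def F_def G_def real_sqrt_mult)
qed

lemma norm_integral_bilinear_L2_le:
  fixes h :: "'b::euclidean_space \<Rightarrow> 'c::euclidean_space \<Rightarrow> 'd::euclidean_space"
  assumes h: "bounded_bilinear h" and f: "L2 M f" and g: "L2 M g"
    and K: "\<And>a b. norm (h a b) \<le> K * (norm a * norm b)" "0 \<le> K"
  shows "norm (LINT x|M. h (f x) (g x)) \<le> K * (L2_norm M f * L2_norm M g)"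
proof -
  have n: "L2 M (\<lambda>x. norm (f x))" "L2 M (\<lambda>x. norm (g x))"
    using L2_bound[OF f measurable_compose[OF L2_measurable[OF f] borel_measurable_norm], of 1]
      L2_bound[OF g measurable_compose[OF L2_measurable[OF g] borel_measurable_norm], of 1] by auto
  have int: "integrable M (\<lambda>x. norm (f x) * norm (g x))"
    by (rule integrable_bilinear_L2[OF bounded_bilinear_mult n])
  have "norm (LINT x|M. h (f x) (g x)) \<le> (LINT x|M. K * (norm (f x) * norm (g x)))"
    using integral_norm_bound[of M "\<lambda>x. h (f x) (g x)"]
    by (rule order_trans) (rule integral_mono; use int integrable_bilinear_L2[OF h f g] K in auto)
  also have "\<dots> = K * (LINT x|M. norm (f x) * norm (g x))" by simp
  also have "\<dots> \<le> K * (L2_norm M f * L2_norm M g)"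
    using Cauchy_Schwarz_L2[OF n] K(2) by (intro mult_left_mono) (auto simp: L2_norm_def)
  finally show ?thesis .
qed

lemma L2_const_finite: "finite_measure M \<Longrightarrow> L2 M (\<lambda>_. c)"
  by (simp add: L2_def finite_measure.integrable_const)

lemma L2_bounded_finite:
  assumes "finite_measure M" "f \<in> borel_measurable M" "AE x in M. norm (f x) \<le> C"
  shows "L2 M f"
  using L2_bound[OF L2_const_finite[OF assms(1), of "1::real"] assms(2), of C] assms(3) by simp

lemma L2_integrable:
  assumes "finite_measure M" "L2 M f" shows "integrable M f"
  using integrable_bilinear_L2[OF bounded_bilinear_scaleR L2_const_finite[OF assms(1), of 1] assms(2)] by simp

lemma finite_measure_lebesgue_on_bounded:
  "bounded S \<Longrightarrow> open S \<Longrightarrow> finite_measure (lebesgue_on (S :: 'a::euclidean_space set))"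
  using emeasure_bounded_finite[of S]
  by (intro finite_measureI) (simp add: space_restrict_space emeasure_restrict_space borel_open)

lemma open_in_lebesgue: "open S \<Longrightarrow> S \<inter> space lebesgue \<in> sets lebesgue"
  by (simp add: borel_open)

lemma continuous_measurable_lebesgue_on:
  fixes f :: "'a::euclidean_space \<Rightarrow> 'b::euclidean_space"
  shows "continuous_on UNIV f \<Longrightarrow> f \<in> borel_measurable (lebesgue_on S)"
  by (intro measurable_restrict_space1 measurable_completion) (simp add: borel_measurable_continuous_onI)

lemma continuous_L2_lebesgue_on:
  fixes f :: "'a::euclidean_space \<Rightarrow> 'b::euclidean_space"
  assumes "continuous_on UNIV f" "bounded S" "open S"
  shows "L2 (lebesgue_on S) f"
proof -
  have "compact (f ` closure S)"
    using assms by (intro compact_continuous_image continuous_on_subset[OF assms(1)]) auto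
  then obtain C where C: "\<And>x. x \<in> closure S \<Longrightarrow> norm (f x) \<le> C"
    using compact_imp_bounded bounded_iff by (metis imageI)
  show ?thesis
    by (rule L2_bounded_finite[OF finite_measure_lebesgue_on_bounded[OF assms(2,3)] continuous_measurable_lebesgue_on[OF assms(1)], of C])
      (rule AE_I2, use C closure_subset[of S] in \<open>auto simp: space_restrict_space\<close>)
qed

lemma L2_restrict:
  assumes "L2 (lebesgue_on S) f" "T \<subseteq> S" "open T" "open S"
  shows "L2 (lebesgue_on T) f"
proof -
  have eq: "lebesgue_on T = restrict_space (lebesgue_on S) T"
    using assms(2) by (simp add: restrict_restrict_space open_in_lebesgue assms Int_absorb1)
  have T: "T \<inter> space (lebesgue_on S) \<in> sets (lebesgue_on S)"
    using assms by (auto simp: space_restrict_space sets_restrict_space borel_open image_iff intro!: bexI[of _ T])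
  have "integrable (lebesgue_on S) (\<lambda>x. indicator T x *\<^sub>R (norm (f x))\<^sup>2)"
    using T L2_integrable_norm2[OF assms(1)] assms(2)
    by (intro integrable_mult_indicator) (auto simp: Int_absorb2 space_restrict_space)
  then show ?thesis unfolding L2_def eq
    using L2_measurable[OF assms(1)] T by (auto simp: integrable_restrict_space measurable_restrict_space1)
qed

lemma L2_norm_restrict_le:
  assumes "L2 (lebesgue_on S) f" "T \<subseteq> S" "open T" "open S"
  shows "(L2_norm (lebesgue_on T) f)\<^sup>2 \<le> (L2_norm (lebesgue_on S) f)\<^sup>2"
proof -
  have "(LINT x|lebesgue. indicator T x *\<^sub>R (norm (f x))\<^sup>2) \<le> (LINT x|lebesgue. indicator S x *\<^sub>R (norm (f x))\<^sup>2)"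
  proof (rule integral_mono)
    show "integrable lebesgue (\<lambda>x. indicator T x *\<^sub>R (norm (f x))\<^sup>2)" "integrable lebesgue (\<lambda>x. indicator S x *\<^sub>R (norm (f x))\<^sup>2)"
      using L2_integrable_norm2[OF L2_restrict[OF assms]] L2_integrable_norm2[OF assms(1)] assms
      by (auto simp: integrable_restrict_space open_in_lebesgue)
  qed (use assms in \<open>auto simp: indicator_def\<close>)
  then show ?thesis using assms
    by (simp add: L2_norm_sq integral_restrict_space open_in_lebesgue)
qed

section \<open>Weak derivatives\<close>

lemma test_function_bounded:
  fixes \<phi> :: "real^2 \<Rightarrow> 'a::real_normed_vector"
  assumes "test_function \<Omega> \<phi>"
  shows "smooth \<phi>" "continuous_on UNIV \<phi>" "\<And>x. x \<notin> \<Omega> \<Longrightarrow> \<phi> x = 0" "\<exists>R. \<forall>x. norm x \<ge> R \<longrightarrow> \<phi> x = 0"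
proof -
  show "smooth \<phi>" using assms by (simp add: test_function_def)
  then show "continuous_on UNIV \<phi>" using C_k_continuous smoothD by blast
  have sub: "{x. \<phi> x \<noteq> 0} \<subseteq> tsupport \<phi>" by (simp add: tsupport_def closure_subset)
  then show "\<And>x. x \<notin> \<Omega> \<Longrightarrow> \<phi> x = 0" using assms by (auto simp: test_function_def)
  have "bounded (tsupport \<phi>)" using assms by (auto simp: test_function_def compact_imp_bounded)
  then obtain R where "\<And>x. x \<in> tsupport \<phi> \<Longrightarrow> norm x \<le> R" by (auto simp: bounded_iff)
  then have "\<forall>x. norm x \<ge> R + 1 \<longrightarrow> \<phi> x = 0" using sub by force
  then show "\<exists>R. \<forall>x. norm x \<ge> R \<longrightarrow> \<phi> x = 0" by blast
qed

text \<open>Sobolev notions are stated for \<open>lebesgue_on\<close>, while Fubini and skew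
  coordinates live on \<open>lborel\<close>; Borel integrands pass between the two.\<close>

lemma integral_lebesgue_on_eq_lborel:
  fixes f :: "'b::euclidean_space \<Rightarrow> 'a::euclidean_space"
  assumes "f \<in> borel_measurable borel" "open S"
  shows "(LINT x|lebesgue_on S. f x) = (LINT x|lborel. indicator S x *\<^sub>R f x)"
    "integrable (lebesgue_on S) f \<longleftrightarrow> integrable lborel (\<lambda>x. indicator S x *\<^sub>R f x)"
proof -
  have m: "(\<lambda>x. indicator S x *\<^sub>R f x) \<in> borel_measurable lborel"
    using assms by (auto intro!: borel_measurable_scaleR borel_measurable_indicator simp: borel_open)
  show "(LINT x|lebesgue_on S. f x) = (LINT x|lborel. indicator S x *\<^sub>R f x)"
    using integral_completion[OF m] by (simp add: integral_restrict_space open_in_lebesgue assms)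
  show "integrable (lebesgue_on S) f \<longleftrightarrow> integrable lborel (\<lambda>x. indicator S x *\<^sub>R f x)"
    using integrable_completion[OF m] by (simp add: integrable_restrict_space open_in_lebesgue assms)
qed

lemma partial_eq_dird: "partial k f = dird (axis k 1) f"
  using exhaust_2[of k] by (auto simp: fun_eq_iff dird_def axis_def)

lemma integral_partial_UNIV:
  fixes G :: "real^2 \<Rightarrow> 'a::euclidean_space"
  assumes "C_k 1 G" "\<And>x. norm x \<ge> R \<Longrightarrow> G x = 0"
  shows "(LINT x|lborel. partial k G x) = 0"
proof -
  have "cross2 (axis k 1) (axis (if k = 1 then 2 else 1) 1) \<noteq> 0"
    using exhaust_2[of k] by (auto simp: cross2_def axis_def)
  then show ?thesis unfolding partial_eq_dird using assms by (rule integral_dird_UNIV)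
qed

lemma partial_bilinear:
  assumes "bounded_bilinear h" "f differentiable (at x)" "g differentiable (at x)"
  shows "partial k (\<lambda>x. h (f x) (g x)) x = h (f x) (partial k g x) + h (partial k f x) (g x)"
  using partial_eq[OF bounded_bilinear.FDERIV[OF assms(1) frechet_derivative_works[THEN iffD1, OF assms(2)]
      frechet_derivative_works[THEN iffD1, OF assms(3)]]]
  by (simp add: partial_def)

lemma partial_linear:
  assumes "bounded_linear h" "f differentiable (at x)"
  shows "partial k (\<lambda>x. h (f x)) x = h (partial k f x)"
  using partial_eq[OF bounded_linear.has_derivative[OF assms(1) frechet_derivative_works[THEN iffD1, OF assms(2)]]]
  by (simp add: partial_def)

lemma partial_add:
  assumes "f differentiable (at x)" "g differentiable (at x)"
  shows "partial k (\<lambda>x. f x + g x) x = partial k f x + partial k g x"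
  using partial_eq[OF has_derivative_add[OF frechet_derivative_works[THEN iffD1, OF assms(1)]
      frechet_derivative_works[THEN iffD1, OF assms(2)]]]
  by (simp add: partial_def)

lemma partial_diff:
  assumes "f differentiable (at x)" "g differentiable (at x)"
  shows "partial k (\<lambda>x. f x - g x) x = partial k f x - partial k g x"
  using partial_eq[OF has_derivative_diff[OF frechet_derivative_works[THEN iffD1, OF assms(1)]
      frechet_derivative_works[THEN iffD1, OF assms(2)]]]
  by (simp add: partial_def)

lemma partial_off_tsupport:
  fixes \<phi> :: "real^2 \<Rightarrow> 'a::real_normed_vector"
  assumes "x \<notin> tsupport \<phi>" shows "partial k \<phi> x = 0"
proof -
  have "open (- tsupport \<phi>)" by (simp add: tsupport_def open_Compl)
  moreover have "x \<in> - tsupport \<phi>" using assms by simp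
  moreover have "\<And>y. y \<in> - tsupport \<phi> \<Longrightarrow> \<phi> y = 0"
    using closure_subset[of "{x. \<phi> x \<noteq> 0}"] by (auto simp: tsupport_def)
  ultimately have "partial k \<phi> x = partial k (\<lambda>_. 0) x"
    by (rule partial_cong_open(1)) (auto intro: differentiable_const)
  also have "\<dots> = 0" by (rule partial_eq[OF has_derivative_const])
  finally show ?thesis .
qed

lemma test_function_partial_L2:
  fixes \<phi> :: "real^2 \<Rightarrow> 'a::euclidean_space"
  assumes "smooth \<phi>" "open \<Omega>" "bounded \<Omega>"
  shows "L2 (lebesgue_on \<Omega>) \<phi>" "L2 (lebesgue_on \<Omega>) (partial k \<phi>)"
  by (rule continuous_L2_lebesgue_on[OF C_k_continuous[OF smoothD[of _ 0]]];
      use assms smooth_partial in blast)+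

text \<open>The product of \<open>a\<close> with a test function has compact support, so the
  integral of its partial derivative over the plane is 0. This integrates by parts without any
  regularity of the boundary.\<close>

lemma has_weak_partial_C1:
  fixes a :: "real^2 \<Rightarrow> 'a::euclidean_space"
  assumes a: "C_k 1 a" and \<Omega>: "open \<Omega>" "bounded \<Omega>"
  shows "L2 (lebesgue_on \<Omega>) (partial k a)" "has_weak_partial \<Omega> k a (partial k a)"
proof -
  have ca: "continuous_on UNIV a" "continuous_on UNIV (partial k a)"
    using C_k_continuous[OF a] a by auto
  show L: "L2 (lebesgue_on \<Omega>) (partial k a)" by (rule continuous_L2_lebesgue_on[OF ca(2) \<Omega>(2,1)])
  have La: "L2 (lebesgue_on \<Omega>) a" by (rule continuous_L2_lebesgue_on[OF ca(1) \<Omega>(2,1)])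
  show "has_weak_partial \<Omega> k a (partial k a)"
    unfolding has_weak_partial_def
  proof (intro allI impI)
    fix \<phi> :: "real^2 \<Rightarrow> real" assume \<phi>: "test_function \<Omega> \<phi>"
    note t = test_function_bounded[OF \<phi>]
    note L\<phi> = test_function_partial_L2[OF t(1) \<Omega>]
    obtain R where R: "\<And>x. norm x \<ge> R \<Longrightarrow> \<phi> x = 0" using t(4) by blast
    have \<phi>1: "C_k 1 \<phi>" using t(1) smoothD by blast
    have p0: "partial k \<phi> x = 0" if "x \<notin> \<Omega>" for x
      using partial_off_tsupport[of x \<phi>] that \<phi> by (auto simp: test_function_def)
    let ?G = "\<lambda>x. \<phi> x *\<^sub>R a x"
    have G: "C_k 1 ?G" using \<phi>1 a by (rule C_k_scaleR)
    have pG: "partial k ?G x = \<phi> x *\<^sub>R partial k a x + partial k \<phi> x *\<^sub>R a x" for x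
      by (rule partial_bilinear[OF bounded_bilinear_scaleR]) (use \<phi>1 a in auto)
    have cG: "continuous_on UNIV (partial k ?G)" using G by auto
    have "0 = (LINT x|lborel. partial k ?G x)"
      using integral_partial_UNIV[OF G, of R k] R by simp
    also have "\<dots> = (LINT x|lborel. indicator \<Omega> x *\<^sub>R partial k ?G x)"
      using t(3) p0 by (intro Bochner_Integration.integral_cong refl) (auto simp: pG indicator_def)
    also have "\<dots> = (LINT x|lebesgue_on \<Omega>. partial k ?G x)"
      by (rule integral_lebesgue_on_eq_lborel(1)[symmetric]) (use cG \<Omega> in \<open>auto intro: borel_measurable_continuous_onI\<close>)
    also have "\<dots> = (LINT x|lebesgue_on \<Omega>. \<phi> x *\<^sub>R partial k a x) + (LINT x|lebesgue_on \<Omega>. partial k \<phi> x *\<^sub>R a x)"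
      unfolding pG
      by (rule Bochner_Integration.integral_add) (auto intro!: integrable_bilinear_L2[OF bounded_bilinear_scaleR] L\<phi> L La)
    finally show "(LINT x|lebesgue_on \<Omega>. partial k \<phi> x *\<^sub>R a x) = - (LINT x|lebesgue_on \<Omega>. \<phi> x *\<^sub>R partial k a x)"
      by (simp add: eq_neg_iff_add_eq_0 add.commute)
  qed
qed

lemma has_weak_partial_diff:
  fixes u v :: "real^2 \<Rightarrow> 'a::euclidean_space"
  assumes \<Omega>: "open \<Omega>" "bounded \<Omega>"
    and "L2 (lebesgue_on \<Omega>) u" "L2 (lebesgue_on \<Omega>) v" "L2 (lebesgue_on \<Omega>) g" "L2 (lebesgue_on \<Omega>) h"
    and "has_weak_partial \<Omega> k u g" "has_weak_partial \<Omega> k v h"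
  shows "has_weak_partial \<Omega> k (\<lambda>x. u x - v x) (\<lambda>x. g x - h x)"
  unfolding has_weak_partial_def
proof (intro allI impI)
  fix \<phi> :: "real^2 \<Rightarrow> real" assume \<phi>: "test_function \<Omega> \<phi>"
  note L\<phi> = test_function_partial_L2[OF test_function_bounded(1)[OF \<phi>] \<Omega>]
  note int = integrable_bilinear_L2[OF bounded_bilinear_scaleR]
  show "(LINT x|lebesgue_on \<Omega>. partial k \<phi> x *\<^sub>R (u x - v x)) = - (LINT x|lebesgue_on \<Omega>. \<phi> x *\<^sub>R (g x - h x))"
    using assms(7,8) \<phi> int[OF L\<phi>(2) assms(3)] int[OF L\<phi>(2) assms(4)] int[OF L\<phi>(1) assms(5)] int[OF L\<phi>(1) assms(6)]
    by (simp add: scaleR_diff_right has_weak_partial_def)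
qed

lemma has_weak_partial_subset:
  fixes u :: "real^2 \<Rightarrow> 'a::euclidean_space"
  assumes "has_weak_partial \<Omega> k u g" "S \<subseteq> \<Omega>" "open S" "open \<Omega>"
  shows "has_weak_partial S k u g"
  unfolding has_weak_partial_def
proof (intro allI impI)
  fix \<phi> :: "real^2 \<Rightarrow> real" assume \<phi>: "test_function S \<phi>"
  then have \<phi>': "test_function \<Omega> \<phi>" using assms(2) by (auto simp: test_function_def)
  have z: "\<phi> x = 0 \<and> partial k \<phi> x = 0" if "x \<notin> S" for x
    using test_function_bounded(3)[OF \<phi>] partial_off_tsupport[of x \<phi>] that \<phi>
    by (auto simp: test_function_def)
  have "(\<lambda>x. indicator S x *\<^sub>R (f x *\<^sub>R w x)) = (\<lambda>x. indicator \<Omega> x *\<^sub>R (f x *\<^sub>R w x))"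
    if "\<And>x. x \<notin> S \<Longrightarrow> f x = (0::real)" for f and w :: "real^2 \<Rightarrow> 'a"
    using assms(2) that by (auto simp: fun_eq_iff indicator_def)
  then have eq: "(LINT x|lebesgue_on S. f x *\<^sub>R w x) = (LINT x|lebesgue_on \<Omega>. f x *\<^sub>R w x)"
    if "\<And>x. x \<notin> S \<Longrightarrow> f x = (0::real)" for f and w :: "real^2 \<Rightarrow> 'a"
    using that by (simp add: integral_restrict_space open_in_lebesgue assms)
  show "(LINT x|lebesgue_on S. partial k \<phi> x *\<^sub>R u x) = - (LINT x|lebesgue_on S. \<phi> x *\<^sub>R g x)"
    using assms(1) \<phi>' z by (simp add: eq has_weak_partial_def)
qed

section \<open>The fundamental lemma of the calculus of variations\<close>

lemma box_indicator_limit: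
  fixes a b :: "real^2"
  assumes "cbox a b \<subseteq> \<Omega>" "box a b \<noteq> {}"
  obtains \<phi> :: "nat \<Rightarrow> real^2 \<Rightarrow> real" where "\<And>n. test_function \<Omega> (\<phi> n)"
    "\<And>x. (\<lambda>n. \<phi> n x) \<longlonglongrightarrow> indicator (box a b) x" "\<And>n x. \<bar>\<phi> n x\<bar> \<le> 1"
proof
  \<comment> \<open>\<open>\<tau> i\<close> is positive exactly between the two faces in direction
    \<open>i\<close>; as the factor in front of it grows, \<open>bump\<close> rises to 1 there and
    stays 0 elsewhere.\<close>
  define \<tau> where "\<tau> i x = (x $ i - a $ i) * (b $ i - x $ i)" for i and x :: "real^2"
  define \<phi> where "\<phi> n x = bump (real (Suc n) * \<tau> 1 x) * bump (real (Suc n) * \<tau> 2 x)" for n x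
  have ab: "a $ i < b $ i" for i
    using assms(2) by (auto simp: mem_box_cart) (metis order.strict_trans)
  have \<tau>: "\<tau> i x > 0 \<longleftrightarrow> a $ i < x $ i \<and> x $ i < b $ i" for i x
    using ab[of i] by (auto simp: \<tau>_def zero_less_mult_iff)
  have box: "x \<in> box a b \<longleftrightarrow> \<tau> 1 x > 0 \<and> \<tau> 2 x > 0" for x
    by (simp add: \<tau> mem_box_cart forall_2)
  have sm: "smooth (\<phi> n)" for n
    unfolding \<phi>_def \<tau>_def
    by (intro smoothI C_k_mult C_k_bump C_k_diff C_k_coord C_k_const)
  have z: "\<phi> n x = 0" if "x \<notin> box a b" for n x
    using that unfolding box \<phi>_def by (auto simp: bump_eq_0_iff mult_le_0_iff not_less)
  have sup: "tsupport (\<phi> n) \<subseteq> cbox a b" for n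
    unfolding tsupport_def using z box_subset_cbox[of a b] by (intro closure_minimal) auto
  have "compact (tsupport (\<phi> n))" for n
    using compact_Int_closed[OF compact_cbox[of a b], of "tsupport (\<phi> n)"] sup[of n]
    by (simp add: tsupport_def Int_absorb1)
  then show "test_function \<Omega> (\<phi> n)" for n
    using sm sup[of n] assms(1) by (auto simp: test_function_def)
  show "\<bar>\<phi> n x\<bar> \<le> 1" for n x
    unfolding \<phi>_def using bump_nonneg bump_le_1 by (simp add: abs_mult mult_le_one)
  show "(\<lambda>n. \<phi> n x) \<longlonglongrightarrow> indicator (box a b) x" for x
  proof (cases "x \<in> box a b")
    case True
    have 1: "(\<lambda>n. bump (real (Suc n) * t)) \<longlonglongrightarrow> 1" if "t > 0" for t
    proof -
      have "(\<lambda>n. exp (- (inverse (real (Suc n)) * inverse t))) \<longlonglongrightarrow> exp (- (0 * inverse t))"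
        by (intro tendsto_intros LIMSEQ_inverse_real_of_nat)
      then show ?thesis using that by (simp add: bump_def not_le mult_le_0_iff del: of_nat_Suc)
    qed
    have "(\<lambda>n. \<phi> n x) \<longlonglongrightarrow> 1 * 1"
      unfolding \<phi>_def using True unfolding box by (intro tendsto_mult 1) auto
    then show ?thesis using True by simp
  qed (simp add: z)
qed

lemma integral_box_eq_0:
  fixes g :: "real^2 \<Rightarrow> 'a::euclidean_space"
  assumes \<Omega>: "open \<Omega>" "bounded \<Omega>" and g: "L2 (lebesgue_on \<Omega>) g"
    and z: "\<And>\<phi>::real^2 \<Rightarrow> real. test_function \<Omega> \<phi> \<Longrightarrow> (LINT x|lebesgue_on \<Omega>. \<phi> x *\<^sub>R g x) = 0"
    and "cbox a b \<subseteq> \<Omega>"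
  shows "(LINT x|lebesgue_on \<Omega>. indicator (box a b) x *\<^sub>R g x) = 0"
proof (cases "box a b = {}")
  case False
  obtain \<phi> :: "nat \<Rightarrow> real^2 \<Rightarrow> real" where \<phi>: "\<And>n. test_function \<Omega> (\<phi> n)"
    "\<And>x. (\<lambda>n. \<phi> n x) \<longlonglongrightarrow> indicator (box a b) x" "\<And>n x. \<bar>\<phi> n x\<bar> \<le> 1"
    using box_indicator_limit[OF assms(5) False] by metis
  have int: "integrable (lebesgue_on \<Omega>) g"
    by (rule L2_integrable[OF finite_measure_lebesgue_on_bounded[OF \<Omega>(2,1)] g])
  note [measurable] = L2_measurable[OF g]
  have m: "\<phi> n \<in> borel_measurable (lebesgue_on \<Omega>)" for n
    by (rule continuous_measurable_lebesgue_on[OF test_function_bounded(2)[OF \<phi>(1)]])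
  have mi: "(indicator (box a b) :: real^2 \<Rightarrow> real) \<in> borel_measurable (lebesgue_on \<Omega>)"
    by (intro measurable_restrict_space1 measurable_completion) (auto intro: borel_measurable_indicator)
  have "(\<lambda>n. LINT x|lebesgue_on \<Omega>. \<phi> n x *\<^sub>R g x) \<longlonglongrightarrow> (LINT x|lebesgue_on \<Omega>. indicator (box a b) x *\<^sub>R g x)"
  proof (rule integral_dominated_convergence[where w = "\<lambda>x. norm (g x)"])
    show "AE x in lebesgue_on \<Omega>. (\<lambda>n. \<phi> n x *\<^sub>R g x) \<longlonglongrightarrow> indicator (box a b) x *\<^sub>R g x"
      by (intro AE_I2 tendsto_scaleR \<phi> tendsto_const)
    show "AE x in lebesgue_on \<Omega>. norm (\<phi> n x *\<^sub>R g x) \<le> norm (g x)" for n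
      using \<phi>(3)[of n] by (intro AE_I2) (simp add: mult_left_le_one_le)
  qed (use int m mi in auto)
  then show ?thesis using z[OF \<phi>(1)] by (simp add: LIMSEQ_const_iff)
qed simp

text \<open>Open boxes form an intersection-stable generator of the Borel sets, so the vanishing of
  integrals spreads to all of these; \<open>all\<close> provides the step to complements. Lebesgue
  sets differ from Borel sets by null sets only.\<close>

lemma AE_eq_0_if_box_integrals_0:
  fixes f :: "real^2 \<Rightarrow> 'a::euclidean_space"
  assumes \<Omega>: "open \<Omega>" "bounded \<Omega>" and f: "integrable (lebesgue_on \<Omega>) f"
    and box: "\<And>c d. (LINT x|lebesgue_on \<Omega>. indicator (box c d) x *\<^sub>R f x) = 0"
    and all: "(LINT x|lebesgue_on \<Omega>. f x) = 0"
  shows "AE x in lebesgue_on \<Omega>. f x = 0"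
proof -
  let ?M = "lebesgue_on \<Omega>"
  interpret finite_measure ?M by (rule finite_measure_lebesgue_on_bounded[OF \<Omega>(2,1)])
  have bm: "(indicator A :: real^2 \<Rightarrow> real) \<in> borel_measurable ?M" if "A \<in> sets borel" for A
    by (intro measurable_restrict_space1 measurable_completion) (use that in \<open>auto intro: borel_measurable_indicator\<close>)
  have int: "integrable ?M (\<lambda>x. indicator A x *\<^sub>R f x)" if "A \<in> sets borel" for A
    by (rule Bochner_Integration.integrable_bound[OF f])
      (use bm[OF that] f in \<open>auto split: split_indicator\<close>)
  have borel0: "(LINT x|?M. indicator A x *\<^sub>R f x) = 0" if "A \<in> sets borel" for A
  proof -
    have "Int_stable (range (\<lambda>(c, d). box c d :: (real^2) set))"
      by (auto simp: Int_stable_def box_Int_box)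
    moreover have "range (\<lambda>(c, d). box c d :: (real^2) set) \<subseteq> Pow UNIV" by simp
    moreover have "A \<in> sigma_sets UNIV (range (\<lambda>(c, d). box c d :: (real^2) set))"
      using that by (simp add: borel_eq_box)
    ultimately show ?thesis
    proof (induction rule: sigma_sets_induct_disjoint)
      case (compl A)
      then have A: "A \<in> sets borel" by (simp add: borel_eq_box)
      have "(\<lambda>x. indicator (UNIV - A) x *\<^sub>R f x) = (\<lambda>x. f x - indicator A x *\<^sub>R f x)"
        by (auto simp: fun_eq_iff indicator_def)
      then show ?case using compl int[OF A] f all by simp
    next
      case (union A)
      then have A: "A i \<in> sets borel" for i by (auto simp: borel_eq_box)
      have "(\<lambda>n. LINT x|?M. (\<Sum>i<n. indicator (A i) x *\<^sub>R f x)) \<longlonglongrightarrow> (LINT x|?M. indicator (\<Union>i. A i) x *\<^sub>R f x)"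
      proof (rule integral_dominated_convergence[where w = "\<lambda>x. norm (f x)"])
        have s: "(\<lambda>i. indicator (A i) x *\<^sub>R f x) sums (indicator (\<Union>i. A i) x *\<^sub>R f x)" for x
        proof -
          have "(\<lambda>i. indicator (A i) x :: real) sums indicator (\<Union>i. A i) x"
            by (rule indicator_sums) (use union(1) in \<open>auto simp: disjoint_family_on_def\<close>)
          then show ?thesis by (rule sums_scaleR_left)
        qed
        then show "AE x in ?M. (\<lambda>n. \<Sum>i<n. indicator (A i) x *\<^sub>R f x) \<longlonglongrightarrow> indicator (\<Union>i. A i) x *\<^sub>R f x"
          by (simp add: sums_def)
        have "(\<Sum>i<n. indicator (A i) x *\<^sub>R f x) = indicator (\<Union>i<n. A i) x *\<^sub>R f x" for n x
        proof -
          have "(\<Sum>i<n. indicator (A i) x :: real) = indicator (\<Union>i<n. A i) x"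
            using union(1) by (intro indicator_UN_disjoint[symmetric]) (auto simp: disjoint_family_on_def)
          then show ?thesis by (simp add: scaleR_left.sum[symmetric])
        qed
        then show "AE x in ?M. norm (\<Sum>i<n. indicator (A i) x *\<^sub>R f x) \<le> norm (f x)" for n
          by (auto simp: indicator_def)
        show "(\<lambda>x. \<Sum>i<n. indicator (A i) x *\<^sub>R f x) \<in> borel_measurable ?M" for n
          by (intro borel_measurable_sum borel_measurable_integrable int A)
      qed (use f int[of "\<Union>i. A i"] A in auto)
      moreover have "(LINT x|?M. (\<Sum>i<n. indicator (A i) x *\<^sub>R f x)) = 0" for n
        using union(3) by (subst Bochner_Integration.integral_sum[OF int[OF A]]) simp
      ultimately show ?case by (simp only: LIMSEQ_const_iff)
    qed (use box in auto)
  qed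
  show ?thesis
  proof (rule density_zero[OF f])
    fix A assume "A \<in> sets ?M"
    then obtain A' where A': "A' \<in> sets lebesgue" "A = \<Omega> \<inter> A'" by (auto simp: sets_restrict_space)
    obtain S N N' where S: "A' = S \<union> N" "N \<subseteq> N'" "N' \<in> null_sets lborel" "S \<in> sets lborel"
      using sets_completionE[OF A'(1)] .
    have "AE x in lebesgue. x \<notin> N'"
      using S(3) by (intro AE_completion AE_not_in)
    then have "AE x in lebesgue. x \<in> \<Omega> \<longrightarrow> x \<notin> N'" by eventually_elim simp
    then have "AE x in ?M. x \<notin> N'"
      unfolding AE_restrict_space_iff[OF open_in_lebesgue[OF \<Omega>(1)]] .
    then have "AE x in ?M. indicator A x *\<^sub>R f x = indicator S x *\<^sub>R f x"
      using AE_space by eventually_elim (use S A' in \<open>auto simp: indicator_def space_restrict_space\<close>)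
    then have "(LINT x|?M. indicator A x *\<^sub>R f x) = (LINT x|?M. indicator S x *\<^sub>R f x)"
      using f S \<open>A \<in> sets ?M\<close> int[of S] by (intro integral_cong_AE) auto
    then show "set_lebesgue_integral ?M A f = 0"
      using borel0[of S] S by (simp add: set_lebesgue_integral_def)
  qed
qed

text \<open>Test functions only reach boxes whose closure lies in \<open>\<Omega>\<close>. Cutting
  \<open>g\<close> off to such a box makes every box integral accessible, as two boxes meet in a
  box; countably many such boxes exhaust \<open>\<Omega>\<close>.\<close>

lemma fundamental_lemma:
  fixes g :: "real^2 \<Rightarrow> 'a::euclidean_space"
  assumes \<Omega>: "open \<Omega>" "bounded \<Omega>" and g: "L2 (lebesgue_on \<Omega>) g"
    and z: "\<And>\<phi>::real^2 \<Rightarrow> real. test_function \<Omega> \<phi> \<Longrightarrow> (LINT x|lebesgue_on \<Omega>. \<phi> x *\<^sub>R g x) = 0"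
  shows "AE x in lebesgue_on \<Omega>. g x = 0"
proof -
  let ?M = "lebesgue_on \<Omega>"
  have int: "integrable ?M g"
    by (rule L2_integrable[OF finite_measure_lebesgue_on_bounded[OF \<Omega>(2,1)] g])
  have loc: "AE x in ?M. x \<in> cbox a b \<longrightarrow> g x = 0" if ab: "cbox a b \<subseteq> \<Omega>" for a b
  proof -
    have bm: "(indicator (box a b) :: real^2 \<Rightarrow> real) \<in> borel_measurable ?M"
      by (intro measurable_restrict_space1 measurable_completion) (auto intro: borel_measurable_indicator)
    have "AE x in ?M. indicator (box a b) x *\<^sub>R g x = 0"
    proof (rule AE_eq_0_if_box_integrals_0[OF \<Omega>])
      show "integrable ?M (\<lambda>x. indicator (box a b) x *\<^sub>R g x)"
        by (rule Bochner_Integration.integrable_bound[OF int]) (use bm int in \<open>auto split: split_indicator\<close>)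
      show "(LINT x|?M. indicator (box a b) x *\<^sub>R g x) = 0"
        by (rule integral_box_eq_0[OF \<Omega> g z ab])
      fix c d :: "real^2"
      obtain e f :: "real^2" where ef: "box c d \<inter> box a b = box e f" "cbox c d \<inter> cbox a b = cbox e f"
        using box_Int_box[of c d a b] Int_interval[of c d a b] by blast
      have "(LINT x|?M. indicator (box c d) x *\<^sub>R indicator (box a b) x *\<^sub>R g x) = (LINT x|?M. indicator (box e f) x *\<^sub>R g x)"
        by (intro Bochner_Integration.integral_cong refl) (auto simp: ef(1)[symmetric] indicator_def)
      also have "\<dots> = 0" by (rule integral_box_eq_0[OF \<Omega> g z]) (use ef(2) ab in auto)
      finally show "(LINT x|?M. indicator (box c d) x *\<^sub>R indicator (box a b) x *\<^sub>R g x) = 0" .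
    qed
    moreover have "AE x in lebesgue. x \<notin> cbox a b - box a b"
      using negligible_frontier_interval[of a b] by (intro AE_not_in) (simp add: negligible_iff_null_sets)
    then have "AE x in lebesgue. x \<in> \<Omega> \<longrightarrow> x \<notin> cbox a b - box a b" by eventually_elim simp
    then have "AE x in ?M. x \<notin> cbox a b - box a b"
      unfolding AE_restrict_space_iff[OF open_in_lebesgue[OF \<Omega>(1)]] .
    ultimately show ?thesis by eventually_elim (auto simp: indicator_def split: if_splits)
  qed
  obtain \<D> where D: "countable \<D>" "\<D> \<subseteq> Pow \<Omega>" "\<And>X. X \<in> \<D> \<Longrightarrow> \<exists>a b. X = cbox a b" "\<Union>\<D> = \<Omega>"
    using open_countable_Union_open_cbox[OF \<Omega>(1)] by metis
  have "AE x in ?M. \<forall>X\<in>\<D>. x \<in> X \<longrightarrow> g x = 0"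
    unfolding AE_ball_countable[OF D(1)]
  proof
    fix X assume "X \<in> \<D>"
    then obtain a b where "X = cbox a b" "cbox a b \<subseteq> \<Omega>" using D(2,3) by blast
    then show "AE x in ?M. x \<in> X \<longrightarrow> g x = 0" using loc by simp
  qed
  then show ?thesis
    using AE_space by eventually_elim (use D(4) in \<open>auto simp: space_restrict_space\<close>)
qed

section \<open>Uniqueness of weak derivatives and the norm of a difference\<close>

lemma weak_partial_unique:
  fixes u :: "real^2 \<Rightarrow> 'a::euclidean_space"
  assumes \<Omega>: "open \<Omega>" "bounded \<Omega>"
    and "L2 (lebesgue_on \<Omega>) g" "L2 (lebesgue_on \<Omega>) h" "has_weak_partial \<Omega> k u g" "has_weak_partial \<Omega> k u h"
  shows "AE x in lebesgue_on \<Omega>. g x = h x"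
proof -
  have "AE x in lebesgue_on \<Omega>. g x - h x = 0"
  proof (rule fundamental_lemma[OF \<Omega> L2_diff[OF assms(3,4)]])
    fix \<phi> :: "real^2 \<Rightarrow> real" assume \<phi>: "test_function \<Omega> \<phi>"
    note L\<phi> = test_function_partial_L2[OF test_function_bounded(1)[OF \<phi>] \<Omega>]
    note int = integrable_bilinear_L2[OF bounded_bilinear_scaleR L\<phi>(1)]
    show "(LINT x|lebesgue_on \<Omega>. \<phi> x *\<^sub>R (g x - h x)) = 0"
      using assms(5,6) \<phi> int[OF assms(3)] int[OF assms(4)]
      by (simp add: scaleR_diff_right has_weak_partial_def)
  qed
  then show ?thesis by simp
qed

lemma H1_weak_partial:
  assumes "H1 \<Omega> u"
  shows "L2 (lebesgue_on \<Omega>) (weak_partial \<Omega> k u)" "has_weak_partial \<Omega> k u (weak_partial \<Omega> k u)"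
proof -
  have "\<exists>g. L2 (lebesgue_on \<Omega>) g \<and> has_weak_partial \<Omega> k u g" using assms by (simp add: H1_def)
  then have "L2 (lebesgue_on \<Omega>) (weak_partial \<Omega> k u) \<and> has_weak_partial \<Omega> k u (weak_partial \<Omega> k u)"
    unfolding weak_partial_def by (rule someI_ex)
  then show "L2 (lebesgue_on \<Omega>) (weak_partial \<Omega> k u)" "has_weak_partial \<Omega> k u (weak_partial \<Omega> k u)" by auto
qed

lemma weak_partial_AE_eq:
  fixes u :: "real^2 \<Rightarrow> 'a::euclidean_space"
  assumes "open \<Omega>" "bounded \<Omega>" "L2 (lebesgue_on \<Omega>) g" "has_weak_partial \<Omega> k u g"
  shows "AE x in lebesgue_on \<Omega>. weak_partial \<Omega> k u x = g x" "L2 (lebesgue_on \<Omega>) (weak_partial \<Omega> k u)"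
proof -
  have "\<exists>g. L2 (lebesgue_on \<Omega>) g \<and> has_weak_partial \<Omega> k u g" using assms by blast
  then have "L2 (lebesgue_on \<Omega>) (weak_partial \<Omega> k u) \<and> has_weak_partial \<Omega> k u (weak_partial \<Omega> k u)"
    unfolding weak_partial_def by (rule someI_ex)
  then show "AE x in lebesgue_on \<Omega>. weak_partial \<Omega> k u x = g x" "L2 (lebesgue_on \<Omega>) (weak_partial \<Omega> k u)"
    using weak_partial_unique[OF assms(1,2) _ assms(3) _ assms(4)] by blast+
qed

lemma L2_norm_cong_AE:
  fixes f g :: "'a \<Rightarrow> 'b::euclidean_space"
  assumes "L2 M f" "L2 M g" "AE x in M. f x = g x"
  shows "L2_norm M f = L2_norm M g"
proof -
  note [measurable] = L2_measurable[OF assms(1)] L2_measurable[OF assms(2)]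
  have "(LINT x|M. (norm (f x))\<^sup>2) = (LINT x|M. (norm (g x))\<^sup>2)"
    by (rule integral_cong_AE) (use assms(3) in auto)
  then show ?thesis by (simp add: L2_norm_def)
qed

text \<open>\<open>weak_partial\<close> picks a representative for each function separately, so the
  choice for a difference is not the difference of the choices; uniqueness almost everywhere repairs
  this inside the norms.\<close>

lemma H1_norm_diff_sq:
  fixes u v :: "real^2 \<Rightarrow> 'a::euclidean_space"
  assumes \<Omega>: "open \<Omega>" "bounded \<Omega>" and L: "L2 (lebesgue_on \<Omega>) u" "L2 (lebesgue_on \<Omega>) v"
    "\<And>k. L2 (lebesgue_on \<Omega>) (g k)" "\<And>k. L2 (lebesgue_on \<Omega>) (h k)"
    and w: "\<And>k. has_weak_partial \<Omega> k u (g k)" "\<And>k. has_weak_partial \<Omega> k v (h k)"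
  shows "(H1_norm \<Omega> (\<lambda>x. u x - v x))\<^sup>2 = (L2_norm (lebesgue_on \<Omega>) (\<lambda>x. u x - v x))\<^sup>2
      + (\<Sum>k\<in>UNIV. (L2_norm (lebesgue_on \<Omega>) (\<lambda>x. g k x - h k x))\<^sup>2)"
proof -
  have "L2_norm (lebesgue_on \<Omega>) (weak_partial \<Omega> k (\<lambda>x. u x - v x)) = L2_norm (lebesgue_on \<Omega>) (\<lambda>x. g k x - h k x)" for k
    using weak_partial_AE_eq[OF \<Omega> L2_diff[OF L(3,4)] has_weak_partial_diff[OF \<Omega> L w]]
    by (intro L2_norm_cong_AE L2_diff L)
  then show ?thesis by (simp add: H1_norm_def sum_nonneg)
qed

section \<open>Green's formula with traces near the corner\<close>

lemma angle_dir:
  assumes "0 < r" "- pi < t" "t \<le> pi"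
  shows "angle (r *\<^sub>R dir t) = t"
  unfolding angle_def
  by (rule Arg_unique[of r]) (use assms in \<open>auto simp: complex_eq_iff Re_exp Im_exp\<close>)

lemma ray_eq:
  assumes "- pi < t" "t \<le> pi"
  shows "ray t = {r *\<^sub>R dir t |r. 0 < r}"
proof -
  have "\<exists>r. x = r *\<^sub>R dir t \<and> 0 < r" if "x \<in> ray t" for x
  proof (intro exI conjI)
    have x: "angle x = t" "x \<noteq> 0" using that by (auto simp: ray_def)
    show "x = norm x *\<^sub>R dir t" using polar_angle[of x] unfolding x(1) .
    show "0 < norm x" using x(2) by simp
  qed
  moreover have "r *\<^sub>R dir t \<in> ray t" if "0 < r" for r
    using that angle_dir[OF that assms] norm_dir[of t] by (auto simp: ray_def simp del: norm_dir)
  ultimately show ?thesis by blast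
qed

lemma integral_bilinear_L2_tendsto:
  fixes h :: "'b::euclidean_space \<Rightarrow> 'c::euclidean_space \<Rightarrow> 'd::euclidean_space"
  assumes h: "bounded_bilinear h" and f: "L2 M f" and g: "L2 M g" "\<And>n. L2 M (G n)"
    and lim: "(\<lambda>n. L2_norm M (\<lambda>x. G n x - g x)) \<longlonglongrightarrow> 0"
  shows "(\<lambda>n. LINT x|M. h (f x) (G n x)) \<longlonglongrightarrow> (LINT x|M. h (f x) (g x))"
proof -
  obtain K where "0 < K" "\<forall>a b. norm (h a b) \<le> norm a * norm b * K"
    using bounded_bilinear.pos_bounded[OF h] by auto
  then have K: "norm (h a b) \<le> K * (norm a * norm b)" "0 \<le> K" for a b by (auto simp: mult.commute)
  have le: "norm ((LINT x|M. h (f x) (G n x)) - (LINT x|M. h (f x) (g x))) \<le> K * (L2_norm M f * L2_norm M (\<lambda>x. G n x - g x))" for n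
  proof -
    have "(LINT x|M. h (f x) (G n x)) - (LINT x|M. h (f x) (g x)) = (LINT x|M. h (f x) (G n x - g x))"
      using integrable_bilinear_L2[OF h f g(1)] integrable_bilinear_L2[OF h f g(2)]
      by (simp add: bounded_bilinear.diff_right[OF h])
    then show ?thesis using norm_integral_bilinear_L2_le[OF h f L2_diff[OF g(2) g(1)] K] by simp
  qed
  have "(\<lambda>n. K * (L2_norm M f * L2_norm M (\<lambda>x. G n x - g x))) \<longlonglongrightarrow> K * (L2_norm M f * 0)"
    by (intro tendsto_intros lim)
  then have "(\<lambda>n. K * (L2_norm M f * L2_norm M (\<lambda>x. G n x - g x))) \<longlonglongrightarrow> 0" by simp
  then have "(\<lambda>n. (LINT x|M. h (f x) (G n x)) - (LINT x|M. h (f x) (g x))) \<longlonglongrightarrow> 0"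
    by (rule Lim_null_comparison[OF always_eventually[OF allI[OF le]]])
  then show ?thesis by (simp add: LIM_zero_iff)
qed

text \<open>Packs the product of a scalar with the \<open>i\<close>-th component of a field as one
  bilinear map, so that the \<open>L2\<close> lemmas for bilinear pairings apply to it.\<close>

definition mult_nth :: "2 \<Rightarrow> complex \<Rightarrow> complex^2 \<Rightarrow> complex" where
  "mult_nth i c u = c * u $ i"

lemma bounded_bilinear_mult_nth: "bounded_bilinear (mult_nth i)"
  unfolding mult_nth_def
  by (rule bounded_bilinear.comp[OF bounded_bilinear_mult bounded_linear_ident bounded_linear_vec_nth])

lemma sum_sq_bound: "(norm (x + y :: 'a::real_normed_vector))\<^sup>2 \<le> 2 * (norm x)\<^sup>2 + 2 * (norm y)\<^sup>2"
proof -
  have "(norm (x + y))\<^sup>2 \<le> (norm x + norm y)\<^sup>2" by (intro power_mono norm_triangle_ineq) auto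
  also have "\<dots> \<le> 2 * (norm x)\<^sup>2 + 2 * (norm y)\<^sup>2"
    using sum_squares_bound[of "norm x" "norm y"] by (simp add: power2_sum)
  finally show ?thesis .
qed

lemma L2_norm_sq_add_le:
  assumes "L2 M f" "L2 M g"
  shows "(L2_norm M (\<lambda>x. f x + g x))\<^sup>2 \<le> 2 * (L2_norm M f)\<^sup>2 + 2 * (L2_norm M g)\<^sup>2"
proof -
  have "(LINT x|M. (norm (f x + g x))\<^sup>2) \<le> (LINT x|M. 2 * (norm (f x))\<^sup>2 + 2 * (norm (g x))\<^sup>2)"
    by (rule integral_mono)
      (use L2_integrable_norm2[OF L2_add[OF assms]] assms[THEN L2_integrable_norm2] sum_sq_bound in auto)
  also have "\<dots> = 2 * (LINT x|M. (norm (f x))\<^sup>2) + 2 * (LINT x|M. (norm (g x))\<^sup>2)"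
    using assms[THEN L2_integrable_norm2] by simp
  finally show ?thesis by (simp add: L2_norm_sq)
qed

lemma bounded_if_zero_outside:
  fixes f :: "real^2 \<Rightarrow> 'a::real_normed_vector"
  assumes "continuous_on UNIV f" "\<And>x. norm x \<ge> R \<Longrightarrow> f x = 0"
  obtains C where "0 \<le> C" "\<And>x. norm (f x) \<le> C"
proof -
  have "compact (f ` cball 0 R)"
    by (intro compact_continuous_image continuous_on_subset[OF assms(1)]) auto
  then obtain C where C: "\<And>x. x \<in> cball 0 R \<Longrightarrow> norm (f x) \<le> C"
    using compact_imp_bounded bounded_iff by (metis imageI)
  have "norm (f x) \<le> max C 0" for x
    using C[of x] assms(2)[of x] by (cases "norm x \<le> R") auto
  then show ?thesis by (rule that[OF max.cobounded2])
qed

section \<open>Geometry of the boundary near the corner\<close>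

locale corner =
  fixes \<Omega> \<Gamma> :: "(real^2) set" and a b h :: real
  assumes lip: "bounded_lipschitz_domain \<Omega>" and h: "0 < h"
    and loc: "\<Omega> \<inter> ball 0 h = sector a b \<inter> ball 0 h"
    and ab: "- pi < a" "a < b" "b < pi" "b - a \<noteq> pi"
    and \<Gamma>: "openin (top_of_set (frontier \<Omega>)) \<Gamma>" "ray a \<inter> ball 0 h \<subseteq> \<Gamma>" "ray b \<inter> ball 0 h \<subseteq> \<Gamma>"
begin

lemma open_\<Omega>: "open \<Omega>" and bounded_\<Omega>: "bounded \<Omega>"
  using lip by (simp_all add: bounded_lipschitz_domain_def)

definition S where "S = sector a b \<inter> ball 0 h"

lemma open_S: "open S"
  unfolding S_def using open_sector[of a b] ab by (intro open_Int open_ball) auto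

lemma bounded_S: "bounded S"
  unfolding S_def by (rule bounded_subset[OF bounded_ball Int_lower2])

lemma S_subset: "S \<subseteq> \<Omega>"
  unfolding S_def loc[symmetric] by (rule Int_lower1)

lemma S_iff:
  assumes "norm x < h"
  shows "x \<in> S \<longleftrightarrow> x \<in> \<Omega>" "x \<in> S \<longleftrightarrow> x \<in> sector a b"
proof -
  have "x \<in> ball 0 h" using assms by simp
  moreover have "x \<in> \<Omega> \<inter> ball 0 h \<longleftrightarrow> x \<in> sector a b \<inter> ball 0 h" by (simp only: loc)
  ultimately show "x \<in> S \<longleftrightarrow> x \<in> \<Omega>" "x \<in> S \<longleftrightarrow> x \<in> sector a b"
    unfolding S_def by blast+
qed

lemma sin_neq_0: "sin (b - a) \<noteq> 0"
proof
  assume "sin (b - a) = 0"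
  moreover have "sin (b - a) < 0" if "b - a > pi" using ab that by (intro sin_lt_zero) auto
  moreover have "sin (b - a) > 0" if "b - a < pi" using ab that by (intro sin_gt_zero) auto
  ultimately show False using ab by linarith
qed

definition edge :: "real \<Rightarrow> (real^2) set" where
  "edge t = {r *\<^sub>R dir t |r. 0 < r \<and> r < h}"

lemma edge_eq: "t \<in> {a, b} \<Longrightarrow> edge t = ray t \<inter> ball 0 h"
proof -
  assume "t \<in> {a, b}"
  then have r: "ray t = {r *\<^sub>R dir t |r. 0 < r}" using ab by (intro ray_eq) auto
  show ?thesis
  proof
    show "edge t \<subseteq> ray t \<inter> ball 0 h" unfolding r by (auto simp: edge_def)
    show "ray t \<inter> ball 0 h \<subseteq> edge t"
    proof
      fix x assume "x \<in> ray t \<inter> ball 0 h"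
      then have "x \<in> {r *\<^sub>R dir t |r. 0 < r}" "norm x < h" unfolding r by auto
      then obtain r where "x = r *\<^sub>R dir t" "0 < r" "norm x < h" by blast
      then have "x = r *\<^sub>R dir t \<and> 0 < r \<and> r < h" by simp
      then show "x \<in> edge t" unfolding edge_def by blast
    qed
  qed
qed

lemma \<Gamma>_subset: "\<Gamma> \<subseteq> frontier \<Omega>"
  using openin_subset[OF \<Gamma>(1)] by simp

lemma edge_subset:
  assumes t: "t \<in> {a, b}"
  shows "edge t \<subseteq> \<Gamma>" "edge t \<subseteq> frontier \<Omega>"
proof -
  show "edge t \<subseteq> \<Gamma>" unfolding edge_eq[OF t] using t \<Gamma>(2,3) by blast
  then show "edge t \<subseteq> frontier \<Omega>" using \<Gamma>_subset by (rule subset_trans)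
qed

lemma edge_borel: "edge t \<in> sets borel"
proof -
  have dd: "dir t \<bullet> dir t = 1" by (simp add: dot_square_norm)
  have "edge t = range (\<lambda>r. r *\<^sub>R dir t) \<inter> {x. 0 < x \<bullet> dir t} \<inter> {x. x \<bullet> dir t < h}"
    using dd by (auto simp: edge_def)
  moreover have "{x. 0 < x \<bullet> dir t} \<in> sets borel" "{x. x \<bullet> dir t < h} \<in> sets borel"
    by (intro borel_open open_Collect_less continuous_intros)+
  ultimately show ?thesis using borel_closed[OF closed_line[of "dir t"]] by auto
qed

text \<open>In polar coordinates the truncated sector lies in the image of a compact rectangle, and
  so does its closure. A boundary point is therefore a multiple of \<open>dir t\<close> with
  \<open>t\<close> between \<open>a\<close> and \<open>b\<close>; an interior angle would put it
  into the open set \<open>\<Omega>\<close>.\<close>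

lemma frontier_near_corner:
  assumes x: "x \<in> frontier \<Omega>" "norm x < h" "x \<noteq> 0"
  shows "x \<in> edge a \<union> edge b"
proof -
  have "x \<notin> \<Omega>" using x(1) open_\<Omega> frontier_disjoint_eq[of \<Omega>] by blast
  then have nW: "x \<notin> sector a b" using S_iff[OF x(2)] by simp
  let ?K = "(\<lambda>z. fst z *\<^sub>R dir (snd z)) ` ({0..h} \<times> {a..b})"
  have "continuous_on ({0..h} \<times> {a..b}) (\<lambda>z. fst z *\<^sub>R dir (snd z))"
  proof -
    have "(\<lambda>z::real\<times>real. fst z *\<^sub>R dir (snd z)) = (\<lambda>z. (fst z * cos (snd z)) *\<^sub>R axis 1 1 + (fst z * sin (snd z)) *\<^sub>R axis 2 1)"
      by (simp add: fun_eq_iff vec_eq_iff forall_2 axis_def)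
    then show ?thesis by (simp only:) (intro continuous_intros)
  qed
  then have "compact ?K" by (intro compact_continuous_image compact_Times) auto
  have "\<Omega> \<inter> ball 0 h \<subseteq> ?K"
  proof
    fix y assume "y \<in> \<Omega> \<inter> ball 0 h"
    then have "y \<in> sector a b" "norm y < h" using S_iff[of y] by auto
    then have "(norm y, angle y) \<in> {0..h} \<times> {a..b}" by (auto simp: sector_def)
    moreover have "y = fst (norm y, angle y) *\<^sub>R dir (snd (norm y, angle y))"
      unfolding fst_conv snd_conv by (rule polar_angle)
    ultimately show "y \<in> ?K" by (rule image_eqI[rotated])
  qed
  then have "closure (\<Omega> \<inter> ball 0 h) \<subseteq> ?K"
    using \<open>compact ?K\<close> by (intro closure_minimal compact_imp_closed)
  moreover have "x \<in> closure (\<Omega> \<inter> ball 0 h)"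
    using open_Int_closure_subset[of "ball 0 h" \<Omega>] x by (auto simp: frontier_def Int_commute dist_norm)
  ultimately obtain r t where rt: "x = r *\<^sub>R dir t" "0 \<le> r" "a \<le> t" "t \<le> b" by auto
  have r: "0 < r" "r < h" using rt x by (auto simp: less_le)
  have "angle x = t" using angle_dir[of r t] rt r ab by auto
  then have "t = a \<or> t = b" using nW x(3) rt by (auto simp: sector_def)
  then show ?thesis using r rt by (auto simp: edge_def)
qed

abbreviation bd where "bd \<equiv> arclength_on (frontier \<Omega>)"

lemma bd_sets: "frontier \<Omega> \<inter> space hausdorff1 \<in> sets (hausdorff1 :: (real^2) measure)"
  by (simp add: borel_closed)

lemma finite_measure_bd: "finite_measure bd"
  by (rule finite_measureI)
    (use hausdorff1_frontier_finite[OF lip] in \<open>simp add: arclength_on_def space_restrict_space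
      emeasure_restrict_space[OF bd_sets] emeasure_hausdorff1 borel_closed less_top\<close>)

lemma continuous_measurable_bd:
  fixes f :: "real^2 \<Rightarrow> 'c::topological_space"
  assumes "continuous_on UNIV f" shows "f \<in> borel_measurable bd"
  unfolding arclength_on_def
  by (intro measurable_restrict_space1) (use borel_measurable_continuous_onI[OF assms] in simp)

lemma continuous_L2_bd:
  fixes f :: "real^2 \<Rightarrow> 'c::euclidean_space"
  assumes "continuous_on UNIV f" shows "L2 bd f"
proof -
  have "compact (f ` frontier \<Omega>)"
    using bounded_\<Omega> by (intro compact_continuous_image continuous_on_subset[OF assms(1)] compact_frontier_bounded) auto
  then obtain C where C: "\<And>x. x \<in> frontier \<Omega> \<Longrightarrow> norm (f x) \<le> C"
    using compact_imp_bounded bounded_iff by (metis imageI)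
  show ?thesis
    by (rule L2_bounded_finite[OF finite_measure_bd continuous_measurable_bd[OF assms], of C])
      (rule AE_I2, use C in \<open>auto simp: arclength_on_def space_restrict_space\<close>)
qed

lemma integral_edge:
  fixes F :: "real^2 \<Rightarrow> 'c::euclidean_space"
  assumes t: "t \<in> {a, b}" and F: "F \<in> borel_measurable bd"
  shows "(LINT x|bd. indicator (edge t) x *\<^sub>R F x) = (LINT s|lborel. indicator {0<..<h} s *\<^sub>R F (s *\<^sub>R dir t))"
proof -
  let ?L = "range (\<lambda>r. r *\<^sub>R dir t)"
  define f where "f x = indicator (edge t) x *\<^sub>R F x" for x
  have dd: "dir t \<bullet> dir t = 1" by (simp add: dot_square_norm)
  \<comment> \<open>\<open>F\<close> is measurable on the boundary only; multiplied by the indicator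
    it becomes a Borel function on the plane, as the integral along a line requires.\<close>
  have "(\<lambda>x. indicator (frontier \<Omega>) x *\<^sub>R F x) \<in> borel_measurable hausdorff1"
    using F unfolding arclength_on_def by (subst (asm) borel_measurable_restrict_space_iff[OF bd_sets]) simp
  then have "(\<lambda>x. indicator (edge t) x *\<^sub>R indicator (frontier \<Omega>) x *\<^sub>R F x) \<in> borel_measurable borel"
    by (intro borel_measurable_scaleR[OF borel_measurable_indicator[OF edge_borel]])
      (simp cong: measurable_cong_sets)
  moreover have "(\<lambda>x. indicator (edge t) x *\<^sub>R indicator (frontier \<Omega>) x *\<^sub>R F x) = f"
    using edge_subset(2)[OF t] by (auto simp: f_def fun_eq_iff indicator_def)
  ultimately have fm: "f \<in> borel_measurable borel" by simp
  have 1: "(\<lambda>x. indicator ?L x *\<^sub>R f x) = (\<lambda>x. indicator (frontier \<Omega>) x *\<^sub>R (indicator (edge t) x *\<^sub>R F x))"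
    using edge_subset(2)[OF t] by (auto simp: f_def fun_eq_iff indicator_def edge_def)
  have 2: "f (s *\<^sub>R dir t) = indicator {0<..<h} s *\<^sub>R F (s *\<^sub>R dir t)" for s
  proof -
    have "s *\<^sub>R dir t \<in> edge t \<longleftrightarrow> s \<in> {0<..<h}"
    proof
      assume "s *\<^sub>R dir t \<in> edge t"
      then obtain r where r: "s *\<^sub>R dir t = r *\<^sub>R dir t" "0 < r" "r < h" by (auto simp: edge_def)
      then have "s = r" using arg_cong[OF r(1), of "\<lambda>x. x \<bullet> dir t"] dd by simp
      then show "s \<in> {0<..<h}" using r by simp
    qed (auto simp: edge_def)
    then show ?thesis by (simp add: f_def indicator_def)
  qed
  show "(LINT x|bd. indicator (edge t) x *\<^sub>R F x) = (LINT s|lborel. indicator {0<..<h} s *\<^sub>R F (s *\<^sub>R dir t))"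
    using integral_hausdorff1_line[OF norm_dir fm, of t] unfolding 1 2
    by (simp add: arclength_on_def integral_restrict_space[OF bd_sets])
qed

text \<open>The pairs \<open>(s, t)\<close> encode the two choices: differentiate along one side,
  obtain the integral along the other. Since the support stays inside the ball, the sector can
  replace \<open>\<Omega>\<close>.\<close>

lemma integral_dird_\<Omega>:
  fixes G :: "real^2 \<Rightarrow> 'c::euclidean_space"
  assumes st: "(s, t) \<in> {(a, b), (b, a)}" and G: "C_k 1 G" "\<And>x. norm x \<ge> R \<Longrightarrow> G x = 0" and R: "R < h"
  shows "(LINT x|lebesgue_on \<Omega>. dird (dir s) G x) = - sin (b - a) *\<^sub>R (LINT r|lborel. indicator {0<..} r *\<^sub>R G (r *\<^sub>R dir t))"
    "(LINT x|lebesgue_on S. dird (dir s) G x) = - sin (b - a) *\<^sub>R (LINT r|lborel. indicator {0<..} r *\<^sub>R G (r *\<^sub>R dir t))"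
proof -
  have m: "dird (dir s) G \<in> borel_measurable borel"
    using dird_continuous[OF G(1)] by (rule borel_measurable_continuous_onI)
  have z: "dird (dir s) G x = 0" if "norm x \<ge> h" for x
    using dird_eq_0[OF G] that R by auto
  have "(LINT x|lborel. indicator (sector a b) x *\<^sub>R dird (dir s) G x)
      = - sin (b - a) *\<^sub>R (LINT r|lborel. indicator {0<..} r *\<^sub>R G (r *\<^sub>R dir t))"
    using st integral_dird_sector[OF ab G] by auto
  moreover have "(\<lambda>x. indicator \<Omega> x *\<^sub>R dird (dir s) G x) = (\<lambda>x. indicator (sector a b) x *\<^sub>R dird (dir s) G x)"
    "(\<lambda>x. indicator S x *\<^sub>R dird (dir s) G x) = (\<lambda>x. indicator (sector a b) x *\<^sub>R dird (dir s) G x)"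
    using z S_iff by (auto simp: fun_eq_iff indicator_def not_le[symmetric])
  ultimately show "(LINT x|lebesgue_on \<Omega>. dird (dir s) G x) = - sin (b - a) *\<^sub>R (LINT r|lborel. indicator {0<..} r *\<^sub>R G (r *\<^sub>R dir t))"
    "(LINT x|lebesgue_on S. dird (dir s) G x) = - sin (b - a) *\<^sub>R (LINT r|lborel. indicator {0<..} r *\<^sub>R G (r *\<^sub>R dir t))"
    using integral_lebesgue_on_eq_lborel(1)[OF m open_\<Omega>] integral_lebesgue_on_eq_lborel(1)[OF m open_S] by auto
qed

section \<open>Green's formula and the trace inequality on the edges\<close>

lemma trace_approximation:
  fixes v :: "real^2 \<Rightarrow> complex^2"
  assumes v: "H1 \<Omega> v" and tv: "has_trace \<Omega> v tv"
  obtains \<phi> where "\<And>n. smooth (\<phi> n)"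
    "(\<lambda>n. L2_norm (lebesgue_on \<Omega>) (\<lambda>x. \<phi> n x - v x)) \<longlonglongrightarrow> 0"
    "\<And>k. (\<lambda>n. L2_norm (lebesgue_on \<Omega>) (\<lambda>x. partial k (\<phi> n) x - weak_partial \<Omega> k v x)) \<longlonglongrightarrow> 0"
    "(\<lambda>n. L2_norm bd (\<lambda>x. \<phi> n x - tv x)) \<longlonglongrightarrow> 0"
proof -
  have "\<exists>\<phi>. (\<forall>n. smooth (\<phi> n)) \<and> (\<lambda>n. H1_norm \<Omega> (\<lambda>x. \<phi> n x - v x)) \<longlonglongrightarrow> 0 \<and>
      (\<lambda>n. L2_norm bd (\<lambda>x. \<phi> n x - tv x)) \<longlonglongrightarrow> 0"
    using tv unfolding has_trace_def by (rule conjunct2)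
  then obtain \<phi> where conj: "(\<forall>n. smooth (\<phi> n)) \<and> (\<lambda>n. H1_norm \<Omega> (\<lambda>x. \<phi> n x - v x)) \<longlonglongrightarrow> 0 \<and>
      (\<lambda>n. L2_norm bd (\<lambda>x. \<phi> n x - tv x)) \<longlonglongrightarrow> 0" by (rule exE)
  note \<phi> = conj[THEN conjunct1, rule_format] conj[THEN conjunct2, THEN conjunct1] conj[THEN conjunct2, THEN conjunct2]
  have v2: "L2 (lebesgue_on \<Omega>) v" using v by (simp add: H1_def)
  have C1: "C_k 1 (\<phi> n)" for n using \<phi>(1) smoothD by blast
  have L: "L2 (lebesgue_on \<Omega>) (\<phi> n)" for n
    by (rule continuous_L2_lebesgue_on[OF C_k_continuous[OF C1] bounded_\<Omega> open_\<Omega>])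
  have eq: "(H1_norm \<Omega> (\<lambda>x. \<phi> n x - v x))\<^sup>2 = (L2_norm (lebesgue_on \<Omega>) (\<lambda>x. \<phi> n x - v x))\<^sup>2
      + (\<Sum>k\<in>UNIV. (L2_norm (lebesgue_on \<Omega>) (\<lambda>x. partial k (\<phi> n) x - weak_partial \<Omega> k v x))\<^sup>2)" for n
    by (rule H1_norm_diff_sq[OF open_\<Omega> bounded_\<Omega> L v2 has_weak_partial_C1(1)[OF C1 open_\<Omega> bounded_\<Omega>] H1_weak_partial(1)[OF v]
        has_weak_partial_C1(2)[OF C1 open_\<Omega> bounded_\<Omega>] H1_weak_partial(2)[OF v]])
  have pos: "0 \<le> H1_norm \<Omega> u" "0 \<le> L2_norm M w" for u :: "real^2 \<Rightarrow> complex^2" and M and w :: "real^2 \<Rightarrow> complex^2"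
    by (auto simp: H1_norm_def L2_norm_def sum_nonneg)
  have b0: "L2_norm (lebesgue_on \<Omega>) (\<lambda>x. \<phi> n x - v x) \<le> H1_norm \<Omega> (\<lambda>x. \<phi> n x - v x)" for n
    by (rule power2_le_imp_le[OF _ pos(1)]) (simp add: eq sum_nonneg)
  have bk: "L2_norm (lebesgue_on \<Omega>) (\<lambda>x. partial k (\<phi> n) x - weak_partial \<Omega> k v x) \<le> H1_norm \<Omega> (\<lambda>x. \<phi> n x - v x)" for n k
  proof (rule power2_le_imp_le[OF _ pos(1)])
    have "(L2_norm (lebesgue_on \<Omega>) (\<lambda>x. partial k (\<phi> n) x - weak_partial \<Omega> k v x))\<^sup>2
        \<le> (\<Sum>k\<in>UNIV. (L2_norm (lebesgue_on \<Omega>) (\<lambda>x. partial k (\<phi> n) x - weak_partial \<Omega> k v x))\<^sup>2)"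
      by (rule member_le_sum) auto
    then show "(L2_norm (lebesgue_on \<Omega>) (\<lambda>x. partial k (\<phi> n) x - weak_partial \<Omega> k v x))\<^sup>2 \<le> (H1_norm \<Omega> (\<lambda>x. \<phi> n x - v x))\<^sup>2"
      unfolding eq by (simp add: add_increasing)
  qed
  show ?thesis
  proof (rule that[OF \<phi>(1) _ _ \<phi>(3)])
    show "(\<lambda>n. L2_norm (lebesgue_on \<Omega>) (\<lambda>x. \<phi> n x - v x)) \<longlonglongrightarrow> 0"
      by (rule tendsto_sandwich[OF _ _ tendsto_const \<phi>(2)]) (use b0 pos in auto)
    show "(\<lambda>n. L2_norm (lebesgue_on \<Omega>) (\<lambda>x. partial k (\<phi> n) x - weak_partial \<Omega> k v x)) \<longlonglongrightarrow> 0" for k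
      by (rule tendsto_sandwich[OF _ _ tendsto_const \<phi>(2)]) (use bk pos in auto)
  qed
qed

end

context corner begin

lemma bd_indicator_measurable: "(indicator (edge t) :: _ \<Rightarrow> real) \<in> borel_measurable bd"
  unfolding arclength_on_def
  by (intro measurable_restrict_space1) (use edge_borel in \<open>auto intro: borel_measurable_indicator\<close>)

lemma indicator_edge_L2:
  fixes \<psi> :: "real^2 \<Rightarrow> 'c::euclidean_space"
  assumes "L2 bd \<psi>"
  shows "L2 bd (\<lambda>x. indicator (edge t) x *\<^sub>R \<psi> x)"
proof (rule L2_bound[OF assms, of _ 1])
  show "(\<lambda>x. indicator (edge t) x *\<^sub>R \<psi> x) \<in> borel_measurable bd"
    by (intro borel_measurable_scaleR[OF bd_indicator_measurable L2_measurable[OF assms]])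
  show "AE x in bd. norm (indicator (edge t) x *\<^sub>R \<psi> x) \<le> 1 * norm (\<psi> x)"
    by (intro AE_I2) (simp split: split_indicator)
qed

text \<open>For smooth fields this is \<open>integral_dird_\<Omega>\<close>; the
  \<open>L\<^sup>2\<close> limits of the fields, of their derivatives and of their boundary values
  carry it over to \<open>v\<close> and \<open>tv\<close>.\<close>

lemma Green_trace:
  fixes v :: "real^2 \<Rightarrow> complex^2" and \<psi> :: "real^2 \<Rightarrow> complex"
  assumes st: "(s, t) \<in> {(a, b), (b, a)}" and v: "H1 \<Omega> v" and tv: "has_trace \<Omega> v tv"
    and \<psi>: "C_k 1 \<psi>" "\<And>x. norm x \<ge> R \<Longrightarrow> \<psi> x = 0" and R: "R < h"
  shows "of_real (cos s) * (LINT x|lebesgue_on \<Omega>. \<psi> x * weak_partial \<Omega> 1 v x $ i) + of_real (sin s) * (LINT x|lebesgue_on \<Omega>. \<psi> x * weak_partial \<Omega> 2 v x $ i)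
      + (LINT x|lebesgue_on \<Omega>. dird (dir s) \<psi> x * v x $ i)
    = - sin (b - a) *\<^sub>R (LINT x|bd. (indicator (edge t) x *\<^sub>R \<psi> x) * tv x $ i)"
proof -
  obtain \<phi> where \<phi>: "\<And>n. smooth (\<phi> n)"
    "(\<lambda>n. L2_norm (lebesgue_on \<Omega>) (\<lambda>x. \<phi> n x - v x)) \<longlonglongrightarrow> 0"
    "\<And>k. (\<lambda>n. L2_norm (lebesgue_on \<Omega>) (\<lambda>x. partial k (\<phi> n) x - weak_partial \<Omega> k v x)) \<longlonglongrightarrow> 0"
    "(\<lambda>n. L2_norm bd (\<lambda>x. \<phi> n x - tv x)) \<longlonglongrightarrow> 0"
    by (rule trace_approximation[OF v tv], rule that)
  have v2: "L2 (lebesgue_on \<Omega>) v" using v by (simp add: H1_def)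
  have t2: "L2 bd tv" using tv by (simp add: has_trace_def)
  have C1: "C_k 1 (\<phi> n)" for n using \<phi>(1) smoothD by blast
  note cont = C_k_continuous[OF C1] C_k_continuous[OF \<psi>(1)]
  have L: "L2 (lebesgue_on \<Omega>) (\<phi> n)" "L2 (lebesgue_on \<Omega>) (partial k (\<phi> n))" "L2 (lebesgue_on \<Omega>) \<psi>"
    "L2 (lebesgue_on \<Omega>) (dird (dir s) \<psi>)" for n k
    using has_weak_partial_C1(1)[OF C1 open_\<Omega> bounded_\<Omega>] cont dird_continuous[OF \<psi>(1)]
    by (auto intro!: continuous_L2_lebesgue_on bounded_\<Omega> open_\<Omega>)
  have e2: "L2 bd (\<lambda>x. indicator (edge t) x *\<^sub>R \<psi> x)" by (rule indicator_edge_L2[OF continuous_L2_bd[OF cont(2)]])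
  note lim = integral_bilinear_L2_tendsto[OF bounded_bilinear_mult_nth[of i]]
  have l1: "(\<lambda>n. cos s * (LINT x|lebesgue_on \<Omega>. mult_nth i (\<psi> x) (partial 1 (\<phi> n) x))
        + sin s * (LINT x|lebesgue_on \<Omega>. mult_nth i (\<psi> x) (partial 2 (\<phi> n) x))
        + (LINT x|lebesgue_on \<Omega>. mult_nth i (dird (dir s) \<psi> x) (\<phi> n x)))
      \<longlonglongrightarrow> cos s * (LINT x|lebesgue_on \<Omega>. mult_nth i (\<psi> x) (weak_partial \<Omega> 1 v x))
        + sin s * (LINT x|lebesgue_on \<Omega>. mult_nth i (\<psi> x) (weak_partial \<Omega> 2 v x))
        + (LINT x|lebesgue_on \<Omega>. mult_nth i (dird (dir s) \<psi> x) (v x))"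
    by (intro tendsto_add tendsto_mult tendsto_const lim L v2 \<phi> H1_weak_partial(1)[OF v])
  have l2: "(\<lambda>n. - sin (b - a) *\<^sub>R (LINT x|bd. mult_nth i (indicator (edge t) x *\<^sub>R \<psi> x) (\<phi> n x)))
      \<longlonglongrightarrow> - sin (b - a) *\<^sub>R (LINT x|bd. mult_nth i (indicator (edge t) x *\<^sub>R \<psi> x) (tv x))"
    by (intro tendsto_scaleR tendsto_const lim e2 t2 \<phi> continuous_L2_bd cont)
  have eq: "cos s * (LINT x|lebesgue_on \<Omega>. mult_nth i (\<psi> x) (partial 1 (\<phi> n) x))
        + sin s * (LINT x|lebesgue_on \<Omega>. mult_nth i (\<psi> x) (partial 2 (\<phi> n) x))
        + (LINT x|lebesgue_on \<Omega>. mult_nth i (dird (dir s) \<psi> x) (\<phi> n x))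
      = - sin (b - a) *\<^sub>R (LINT x|bd. mult_nth i (indicator (edge t) x *\<^sub>R \<psi> x) (\<phi> n x))" for n
  proof -
    let ?G = "\<lambda>x. mult_nth i (\<psi> x) (\<phi> n x)"
    have G: "C_k 1 ?G" by (rule C_k_bounded_bilinear[OF bounded_bilinear_mult_nth \<psi>(1) C1])
    have G0: "?G x = 0" if "norm x \<ge> R" for x using \<psi>(2)[OF that] by (simp add: mult_nth_def)
    have dG: "dird (dir s) ?G x = cos s * mult_nth i (\<psi> x) (partial 1 (\<phi> n) x)
        + sin s * mult_nth i (\<psi> x) (partial 2 (\<phi> n) x) + mult_nth i (dird (dir s) \<psi> x) (\<phi> n x)" for x
    proof -
      have "partial k ?G x = mult_nth i (\<psi> x) (partial k (\<phi> n) x) + mult_nth i (partial k \<psi> x) (\<phi> n x)" for k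
        by (rule partial_bilinear[OF bounded_bilinear_mult_nth]) (use \<psi>(1) C1 in auto)
      then show ?thesis
        by (simp add: dird_def mult_nth_def scaleR_conv_of_real algebra_simps)
    qed
    note int = integrable_bilinear_L2[OF bounded_bilinear_mult_nth[of i]]
    have "(LINT x|lebesgue_on \<Omega>. dird (dir s) ?G x) = cos s * (LINT x|lebesgue_on \<Omega>. mult_nth i (\<psi> x) (partial 1 (\<phi> n) x))
        + sin s * (LINT x|lebesgue_on \<Omega>. mult_nth i (\<psi> x) (partial 2 (\<phi> n) x))
        + (LINT x|lebesgue_on \<Omega>. mult_nth i (dird (dir s) \<psi> x) (\<phi> n x))"
      unfolding dG using int[OF L(3) L(2)] int[OF L(4) L(1)] by simp
    moreover have "(LINT r|lborel. indicator {0<..} r *\<^sub>R ?G (r *\<^sub>R dir t)) = (LINT x|bd. mult_nth i (indicator (edge t) x *\<^sub>R \<psi> x) (\<phi> n x))"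
    proof -
      have "(LINT r|lborel. indicator {0<..} r *\<^sub>R ?G (r *\<^sub>R dir t)) = (LINT r|lborel. indicator {0<..<h} r *\<^sub>R ?G (r *\<^sub>R dir t))"
        using G0 R by (intro Bochner_Integration.integral_cong refl) (auto simp: indicator_def)
      also have "\<dots> = (LINT x|bd. indicator (edge t) x *\<^sub>R ?G x)"
        by (rule integral_edge[symmetric]) (use st C_k_continuous[OF G] continuous_measurable_bd in auto)
      finally show ?thesis by (simp add: mult_nth_def)
    qed
    ultimately show ?thesis using integral_dird_\<Omega>(1)[OF st G G0 R] by simp
  qed
  show ?thesis using LIMSEQ_unique[OF l1[unfolded eq] l2] unfolding mult_nth_def .
qed

text \<open>The derivative of \<open>c\<close> times the squared norm of \<open>u\<close>, taken
  along the other edge, integrates to the edge integral, and Cauchy-Schwarz bounds it by the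
  \<open>H\<^sup>1\<close> density. The volume side is taken over \<open>S\<close>, where the
  approximation by Herglotz waves is controlled.\<close>

lemma edge_trace_inequality:
  fixes c :: "real^2 \<Rightarrow> real"
  assumes c: "C_k 1 c" "\<And>x. norm x \<ge> R \<Longrightarrow> c x = 0" and R: "R < h"
  obtains K where "0 \<le> K"
    "\<And>(u :: real^2 \<Rightarrow> complex^2) t. C_k 1 u \<Longrightarrow> t \<in> {a, b} \<Longrightarrow>
      (LINT r|lborel. indicator {0<..} r *\<^sub>R (c (r *\<^sub>R dir t) * (norm (u (r *\<^sub>R dir t)))\<^sup>2))
      \<le> K * ((L2_norm (lebesgue_on S) u)\<^sup>2 + (\<Sum>k\<in>UNIV. (L2_norm (lebesgue_on S) (partial k u))\<^sup>2))"
proof -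
  have cc: "continuous_on UNIV c" "\<And>k. continuous_on UNIV (partial k c)"
    using C_k_continuous[OF c(1)] c(1) by auto
  have p0: "partial k c x = 0" if "norm x \<ge> h" for k x
    using dird_eq_0[OF c, where x = x and p = "axis k 1"] that R by (simp add: partial_eq_dird)
  obtain A0 where A0: "0 \<le> A0" "\<And>x. norm (c x) \<le> A0" by (rule bounded_if_zero_outside[OF cc(1)], erule c(2), rule that)
  obtain A1 where A1: "0 \<le> A1" "\<And>x. norm (partial 1 c x) \<le> A1" by (rule bounded_if_zero_outside[OF cc(2)[of 1]], erule p0, rule that)
  obtain A2 where A2: "0 \<le> A2" "\<And>x. norm (partial 2 c x) \<le> A2" by (rule bounded_if_zero_outside[OF cc(2)[of 2]], erule p0, rule that)
  define C where "C = A0 + A1 + A2"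
  have C: "0 \<le> C" "\<bar>c x\<bar> \<le> C" "\<bar>partial 1 c x\<bar> \<le> C" "\<bar>partial 2 c x\<bar> \<le> C" for x
    using A0(1) A1(1) A2(1) A0(2)[of x] A1(2)[of x] A2(2)[of x] by (auto simp: C_def)
  have main: "\<bar>sin (b - a)\<bar> * (LINT r|lborel. indicator {0<..} r *\<^sub>R (c (r *\<^sub>R dir t) * (norm (u (r *\<^sub>R dir t)))\<^sup>2))
      \<le> 4 * C * ((L2_norm (lebesgue_on S) u)\<^sup>2 + (\<Sum>k\<in>UNIV. (L2_norm (lebesgue_on S) (partial k u))\<^sup>2))"
    if u: "C_k 1 u" and t: "t \<in> {a, b}" for u :: "real^2 \<Rightarrow> complex^2" and t
  proof -
    obtain s where st: "(s, t) \<in> {(a, b), (b, a)}" using t by auto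
    let ?G = "\<lambda>x. c x * (u x \<bullet> u x)"
    have G: "C_k 1 ?G" by (intro C_k_mult c C_k_inner u)
    have G0: "?G x = 0" if "norm x \<ge> R" for x using c(2)[OF that] by simp
    have L: "L2 (lebesgue_on S) u" "L2 (lebesgue_on S) (partial k u)" for k
      using has_weak_partial_C1(1)[OF u open_S bounded_S] C_k_continuous[OF u]
      by (auto intro!: continuous_L2_lebesgue_on bounded_S open_S)
    have dG: "norm (dird (dir s) ?G x) \<le> 4 * C * ((norm (u x))\<^sup>2 + ((norm (partial 1 u x))\<^sup>2 + (norm (partial 2 u x))\<^sup>2))" for x
    proof -
      have d: "c differentiable (at x)" "u differentiable (at x)" "(\<lambda>x. u x \<bullet> u x) differentiable (at x)"
        using c(1) u C_k_inner[OF u u] by auto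
      have pk: "partial k ?G x = 2 * c x * (u x \<bullet> partial k u x) + partial k c x * (u x \<bullet> u x)" for k
        using partial_bilinear[OF bounded_bilinear_mult d(1,3), of k] partial_bilinear[OF bounded_bilinear_inner d(2,2), of k]
        by (simp add: inner_commute)
      have le: "\<bar>partial k ?G x\<bar> \<le> C * (2 * (norm (u x))\<^sup>2 + (norm (partial k u x))\<^sup>2)" if k: "\<bar>partial k c x\<bar> \<le> C" for k
      proof -
        have "\<bar>2 * (u x \<bullet> partial k u x)\<bar> \<le> (norm (u x))\<^sup>2 + (norm (partial k u x))\<^sup>2"
          using Cauchy_Schwarz_ineq2[of "u x" "partial k u x"] sum_squares_bound[of "norm (u x)" "norm (partial k u x)"] by (simp add: abs_mult)
        then have "\<bar>c x * (2 * (u x \<bullet> partial k u x))\<bar> \<le> C * ((norm (u x))\<^sup>2 + (norm (partial k u x))\<^sup>2)"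
          unfolding abs_mult[of "c x"] using C by (intro mult_mono) auto
        moreover have "\<bar>partial k c x * (u x \<bullet> u x)\<bar> \<le> C * (norm (u x))\<^sup>2"
          unfolding abs_mult using k by (intro mult_mono) (auto simp: C power2_norm_eq_inner)
        ultimately show ?thesis unfolding pk by (simp add: algebra_simps)
      qed
      have "norm (dird (dir s) ?G x) \<le> \<bar>partial 1 ?G x\<bar> + \<bar>partial 2 ?G x\<bar>"
      proof -
        have "\<bar>cos s * partial 1 ?G x\<bar> \<le> 1 * \<bar>partial 1 ?G x\<bar>" "\<bar>sin s * partial 2 ?G x\<bar> \<le> 1 * \<bar>partial 2 ?G x\<bar>"
          unfolding abs_mult by (intro mult_right_mono; simp)+
        then show ?thesis unfolding dird_def dir_nth real_scaleR_def real_norm_def by linarith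
      qed
      also have "\<dots> \<le> C * (2 * (norm (u x))\<^sup>2 + (norm (partial 1 u x))\<^sup>2) + C * (2 * (norm (u x))\<^sup>2 + (norm (partial 2 u x))\<^sup>2)"
        by (intro add_mono le C)
      also have "\<dots> \<le> 4 * C * ((norm (u x))\<^sup>2 + ((norm (partial 1 u x))\<^sup>2 + (norm (partial 2 u x))\<^sup>2))"
        using C(1) by (simp add: algebra_simps)
      finally show ?thesis .
    qed
    have int: "integrable (lebesgue_on S) (\<lambda>x. (norm (u x))\<^sup>2 + ((norm (partial 1 u x))\<^sup>2 + (norm (partial 2 u x))\<^sup>2))"
      using L by (intro Bochner_Integration.integrable_add L2_integrable_norm2)
    have "\<bar>sin (b - a)\<bar> * (LINT r|lborel. indicator {0<..} r *\<^sub>R ?G (r *\<^sub>R dir t)) \<le> norm (LINT x|lebesgue_on S. dird (dir s) ?G x)"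
    proof -
      have "(LINT x|lebesgue_on S. dird (dir s) ?G x) = - sin (b - a) *\<^sub>R (LINT r|lborel. indicator {0<..} r *\<^sub>R ?G (r *\<^sub>R dir t))"
        by (rule integral_dird_\<Omega>(2)[OF st G _ R]) (rule G0)
      then show ?thesis by (simp add: abs_mult mult_left_mono)
    qed
    also have "\<dots> \<le> (LINT x|lebesgue_on S. norm (dird (dir s) ?G x))" by (rule integral_norm_bound)
    also have "\<dots> \<le> (LINT x|lebesgue_on S. 4 * C * ((norm (u x))\<^sup>2 + ((norm (partial 1 u x))\<^sup>2 + (norm (partial 2 u x))\<^sup>2)))"
    proof (rule integral_mono)
      have "integrable (lebesgue_on S) (dird (dir s) ?G)"
        by (intro L2_integrable finite_measure_lebesgue_on_bounded continuous_L2_lebesgue_on dird_continuous G bounded_S open_S)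
      then show "integrable (lebesgue_on S) (\<lambda>x. norm (dird (dir s) ?G x))" by simp
    qed (use int dG in auto)
    also have "\<dots> = 4 * C * ((L2_norm (lebesgue_on S) u)\<^sup>2 + (\<Sum>k\<in>UNIV. (L2_norm (lebesgue_on S) (partial k u))\<^sup>2))"
      using L by (simp add: L2_norm_sq UNIV_2 L2_integrable_norm2)
    finally show ?thesis by (simp add: power2_norm_eq_inner)
  qed
  show ?thesis
  proof (rule that[of "4 * C / \<bar>sin (b - a)\<bar>"])
    fix u :: "real^2 \<Rightarrow> complex^2" and t assume "C_k 1 u" "t \<in> {a, b}"
    from main[OF this] show "(LINT r|lborel. indicator {0<..} r *\<^sub>R (c (r *\<^sub>R dir t) * (norm (u (r *\<^sub>R dir t)))\<^sup>2))
      \<le> 4 * C / \<bar>sin (b - a)\<bar> * ((L2_norm (lebesgue_on S) u)\<^sup>2 + (\<Sum>k\<in>UNIV. (L2_norm (lebesgue_on S) (partial k u))\<^sup>2))"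
      using sin_neq_0 by (simp add: field_simps)
  qed (use C in simp)
qed

text \<open>\<open>edge_trace_inequality\<close> is applied to the difference of a smooth
  approximation of \<open>v\<close> and \<open>w\<close>, followed by the limit. The squared
  triangle inequality is spent twice, on the edge and in the volume, hence the factor 4 in the
  proof.\<close>

lemma trace_diff_bound:
  fixes c :: "real^2 \<Rightarrow> real"
  assumes c: "C_k 1 c" "\<And>x. norm x \<ge> R \<Longrightarrow> c x = 0" and R: "R < h" and c01: "\<And>x. 0 \<le> c x" "\<And>x. c x \<le> 1"
    and v: "H1 \<Omega> v" and tv: "has_trace \<Omega> v tv"
  obtains K where "0 \<le> K"
    "\<And>(w :: real^2 \<Rightarrow> complex^2) t. C_k 1 w \<Longrightarrow> t \<in> {a, b} \<Longrightarrow>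
      (LINT x|bd. indicator (edge t) x *\<^sub>R (c x * (norm (tv x - w x))\<^sup>2)) \<le> K * (H1_norm S (\<lambda>x. v x - w x))\<^sup>2"
proof -
  obtain K where K: "0 \<le> K" "\<And>(u :: real^2 \<Rightarrow> complex^2) t. C_k 1 u \<Longrightarrow> t \<in> {a, b} \<Longrightarrow>
      (LINT r|lborel. indicator {0<..} r *\<^sub>R (c (r *\<^sub>R dir t) * (norm (u (r *\<^sub>R dir t)))\<^sup>2))
      \<le> K * ((L2_norm (lebesgue_on S) u)\<^sup>2 + (\<Sum>k\<in>UNIV. (L2_norm (lebesgue_on S) (partial k u))\<^sup>2))"
    by (rule edge_trace_inequality[OF c(1) _ R], erule c(2), rule that)
  obtain \<phi> where \<phi>: "\<And>n. smooth (\<phi> n)"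
    "(\<lambda>n. L2_norm (lebesgue_on \<Omega>) (\<lambda>x. \<phi> n x - v x)) \<longlonglongrightarrow> 0"
    "\<And>k. (\<lambda>n. L2_norm (lebesgue_on \<Omega>) (\<lambda>x. partial k (\<phi> n) x - weak_partial \<Omega> k v x)) \<longlonglongrightarrow> 0"
    "(\<lambda>n. L2_norm bd (\<lambda>x. \<phi> n x - tv x)) \<longlonglongrightarrow> 0"
    by (rule trace_approximation[OF v tv], rule that)
  have v2: "L2 (lebesgue_on \<Omega>) v" using v by (simp add: H1_def)
  have t2: "L2 bd tv" using tv by (simp add: has_trace_def)
  have C1: "C_k 1 (\<phi> n)" for n using \<phi>(1) smoothD by blast
  note toS = L2_restrict[OF _ S_subset open_S open_\<Omega>]
  note leS = L2_norm_restrict_le[OF _ S_subset open_S open_\<Omega>]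
  have main: "(LINT x|bd. indicator (edge t) x *\<^sub>R (c x * (norm (tv x - w x))\<^sup>2)) \<le> 4 * K * (H1_norm S (\<lambda>x. v x - w x))\<^sup>2"
    if w: "C_k 1 w" and t: "t \<in> {a, b}" for w :: "real^2 \<Rightarrow> complex^2" and t
  proof -
    have w2: "L2 (lebesgue_on S) w" "\<And>k. L2 (lebesgue_on S) (partial k w)" "\<And>k. has_weak_partial S k w (partial k w)"
      using has_weak_partial_C1[OF w open_S bounded_S] C_k_continuous[OF w]
      by (auto intro!: continuous_L2_lebesgue_on bounded_S open_S)
    have H: "(H1_norm S (\<lambda>x. v x - w x))\<^sup>2 = (L2_norm (lebesgue_on S) (\<lambda>x. v x - w x))\<^sup>2
      + (\<Sum>k\<in>UNIV. (L2_norm (lebesgue_on S) (\<lambda>x. weak_partial \<Omega> k v x - partial k w x))\<^sup>2)"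
      by (rule H1_norm_diff_sq[OF open_S bounded_S toS[OF v2] w2(1) toS[OF H1_weak_partial(1)[OF v]] w2(2)
          has_weak_partial_subset[OF H1_weak_partial(2)[OF v] S_subset open_S open_\<Omega>] w2(3)])
    define E where "E n = (L2_norm (lebesgue_on \<Omega>) (\<lambda>x. \<phi> n x - v x))\<^sup>2
      + (\<Sum>k\<in>UNIV. (L2_norm (lebesgue_on \<Omega>) (\<lambda>x. partial k (\<phi> n) x - weak_partial \<Omega> k v x))\<^sup>2)" for n
    have E: "E \<longlonglongrightarrow> 0"
    proof -
      have "E \<longlonglongrightarrow> 0\<^sup>2 + (\<Sum>k\<in>(UNIV :: 2 set). 0\<^sup>2)"
        unfolding E_def by (intro tendsto_intros \<phi>)
      then show ?thesis by simp
    qed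
    have step: "(LINT x|bd. indicator (edge t) x *\<^sub>R (c x * (norm (tv x - w x))\<^sup>2))
      \<le> 2 * (L2_norm bd (\<lambda>x. \<phi> n x - tv x))\<^sup>2 + 2 * (K * (2 * E n + 2 * (H1_norm S (\<lambda>x. v x - w x))\<^sup>2))" for n
    proof -
      let ?d = "\<lambda>x. \<phi> n x - w x"
      have d: "C_k 1 ?d" by (intro C_k_diff C1 w)
      have \<phi>2: "L2 (lebesgue_on \<Omega>) (\<phi> n)" "\<And>k. L2 (lebesgue_on \<Omega>) (partial k (\<phi> n))"
        using has_weak_partial_C1(1)[OF C1 open_\<Omega> bounded_\<Omega>] C_k_continuous[OF C1]
        by (auto intro!: continuous_L2_lebesgue_on bounded_\<Omega> open_\<Omega>)
      have pd: "partial k ?d x = partial k (\<phi> n) x - partial k w x" for k x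
        by (rule partial_diff) (use C1 w in auto)
      have b0: "(L2_norm (lebesgue_on S) ?d)\<^sup>2 \<le> 2 * (L2_norm (lebesgue_on \<Omega>) (\<lambda>x. \<phi> n x - v x))\<^sup>2 + 2 * (L2_norm (lebesgue_on S) (\<lambda>x. v x - w x))\<^sup>2"
        using L2_norm_sq_add_le[OF toS[OF L2_diff[OF \<phi>2(1) v2]] L2_diff[OF toS[OF v2] w2(1)]] leS[OF L2_diff[OF \<phi>2(1) v2]] by simp
      have bk: "(L2_norm (lebesgue_on S) (partial k ?d))\<^sup>2 \<le> 2 * (L2_norm (lebesgue_on \<Omega>) (\<lambda>x. partial k (\<phi> n) x - weak_partial \<Omega> k v x))\<^sup>2
          + 2 * (L2_norm (lebesgue_on S) (\<lambda>x. weak_partial \<Omega> k v x - partial k w x))\<^sup>2" for k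
      proof -
        have "partial k ?d = (\<lambda>x. (partial k (\<phi> n) x - weak_partial \<Omega> k v x) + (weak_partial \<Omega> k v x - partial k w x))"
          by (simp add: fun_eq_iff pd)
        then show ?thesis
          using L2_norm_sq_add_le[OF toS[OF L2_diff[OF \<phi>2(2)[of k] H1_weak_partial(1)[OF v, of k]]] L2_diff[OF toS[OF H1_weak_partial(1)[OF v, of k]] w2(2)[of k]]]
            leS[OF L2_diff[OF \<phi>2(2)[of k] H1_weak_partial(1)[OF v, of k]]] by simp
      qed
      have "(L2_norm (lebesgue_on S) ?d)\<^sup>2 + (\<Sum>k\<in>UNIV. (L2_norm (lebesgue_on S) (partial k ?d))\<^sup>2) \<le> 2 * E n + 2 * (H1_norm S (\<lambda>x. v x - w x))\<^sup>2"
        unfolding E_def H using b0 bk[of 1] bk[of 2] by (simp add: UNIV_2)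
      then have 1: "(LINT r|lborel. indicator {0<..} r *\<^sub>R (c (r *\<^sub>R dir t) * (norm (?d (r *\<^sub>R dir t)))\<^sup>2)) \<le> K * (2 * E n + 2 * (H1_norm S (\<lambda>x. v x - w x))\<^sup>2)"
        using K(2)[OF d t] K(1) by (meson mult_left_mono order_trans)
      let ?g = "\<lambda>x. c x * (norm (?d x))\<^sup>2"
      have cg: "continuous_on UNIV ?g"
        using C_k_continuous[OF c(1)] C_k_continuous[OF C1] C_k_continuous[OF w] by (intro continuous_intros) auto
      have "(LINT r|lborel. indicator {0<..} r *\<^sub>R ?g (r *\<^sub>R dir t)) = (LINT r|lborel. indicator {0<..<h} r *\<^sub>R ?g (r *\<^sub>R dir t))"
        using c(2) R by (intro Bochner_Integration.integral_cong refl) (auto simp: indicator_def)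
      also have "\<dots> = (LINT x|bd. indicator (edge t) x *\<^sub>R ?g x)"
        by (rule integral_edge[OF t continuous_measurable_bd[OF cg], symmetric])
      finally have 2: "(LINT x|bd. indicator (edge t) x *\<^sub>R ?g x) \<le> K * (2 * E n + 2 * (H1_norm S (\<lambda>x. v x - w x))\<^sup>2)"
        using 1 by simp
      have \<phi>b: "L2 bd (\<phi> n)" "L2 bd w" "L2 bd ?d"
        using C_k_continuous[OF C1] C_k_continuous[OF w] C_k_continuous[OF d] continuous_L2_bd by auto
      have cm: "(\<lambda>x. indicator (edge t) x * c x) \<in> borel_measurable bd"
        by (intro borel_measurable_times bd_indicator_measurable continuous_measurable_bd C_k_continuous[OF c(1)])
      have int: "integrable bd (\<lambda>x. indicator (edge t) x *\<^sub>R (c x * (norm (f x))\<^sup>2))" if f: "L2 bd f" for f :: "real^2 \<Rightarrow> complex^2"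
      proof (rule Bochner_Integration.integrable_bound[OF L2_integrable_norm2[OF f]])
        have "(\<lambda>x. (indicator (edge t) x * c x) * (norm (f x))\<^sup>2) \<in> borel_measurable bd"
          using L2_measurable[OF f] by (intro borel_measurable_times[OF cm]) measurable
        then show "(\<lambda>x. indicator (edge t) x *\<^sub>R (c x * (norm (f x))\<^sup>2)) \<in> borel_measurable bd" by (simp add: mult.assoc)
        show "AE x in bd. norm (indicator (edge t) x *\<^sub>R (c x * (norm (f x))\<^sup>2)) \<le> norm ((norm (f x))\<^sup>2)"
          using c01 by (intro AE_I2) (auto simp: abs_mult mult_left_le_one_le split: split_indicator)
      qed
      have "(LINT x|bd. indicator (edge t) x *\<^sub>R (c x * (norm (tv x - w x))\<^sup>2))
          \<le> (LINT x|bd. 2 * (norm (\<phi> n x - tv x))\<^sup>2 + 2 * (indicator (edge t) x *\<^sub>R ?g x))"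
      proof (rule integral_mono)
        show "integrable bd (\<lambda>x. 2 * (norm (\<phi> n x - tv x))\<^sup>2 + 2 * (indicator (edge t) x *\<^sub>R ?g x))"
          by (intro Bochner_Integration.integrable_add integrable_mult_right L2_integrable_norm2 L2_diff int \<phi>b t2)
        show "integrable bd (\<lambda>x. indicator (edge t) x *\<^sub>R (c x * (norm (tv x - w x))\<^sup>2))"
          by (intro int L2_diff t2 \<phi>b)
        fix x
        have sq: "(norm (tv x - w x))\<^sup>2 \<le> 2 * (norm (\<phi> n x - tv x))\<^sup>2 + 2 * (norm (?d x))\<^sup>2"
          using sum_sq_bound[of "tv x - \<phi> n x" "?d x"] by (simp add: norm_minus_commute)
        have "c x * (norm (tv x - w x))\<^sup>2 \<le> c x * (2 * (norm (\<phi> n x - tv x))\<^sup>2) + 2 * (c x * (norm (?d x))\<^sup>2)"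
          using mult_left_mono[OF sq c01(1)[of x]] by (simp add: algebra_simps)
        moreover have "c x * (2 * (norm (\<phi> n x - tv x))\<^sup>2) \<le> 2 * (norm (\<phi> n x - tv x))\<^sup>2"
          using c01[of x] by (intro mult_left_le_one_le) auto
        ultimately show "indicator (edge t) x *\<^sub>R (c x * (norm (tv x - w x))\<^sup>2) \<le> 2 * (norm (\<phi> n x - tv x))\<^sup>2 + 2 * (indicator (edge t) x *\<^sub>R ?g x)"
          by (auto split: split_indicator)
      qed
      also have "\<dots> = 2 * (L2_norm bd (\<lambda>x. \<phi> n x - tv x))\<^sup>2 + 2 * (LINT x|bd. indicator (edge t) x *\<^sub>R ?g x)"
        using int[OF \<phi>b(3)] L2_integrable_norm2[OF L2_diff[OF \<phi>b(1) t2]] by (simp add: L2_norm_sq)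
      finally show ?thesis using 2 by linarith
    qed
    have "(\<lambda>n. 2 * (L2_norm bd (\<lambda>x. \<phi> n x - tv x))\<^sup>2 + 2 * (K * (2 * E n + 2 * (H1_norm S (\<lambda>x. v x - w x))\<^sup>2)))
      \<longlonglongrightarrow> 2 * 0\<^sup>2 + 2 * (K * (2 * 0 + 2 * (H1_norm S (\<lambda>x. v x - w x))\<^sup>2))"
      by (intro tendsto_intros \<phi> E)
    then have "(LINT x|bd. indicator (edge t) x *\<^sub>R (c x * (norm (tv x - w x))\<^sup>2))
      \<le> 2 * 0\<^sup>2 + 2 * (K * (2 * 0 + 2 * (H1_norm S (\<lambda>x. v x - w x))\<^sup>2))"
      by (rule LIMSEQ_le_const) (use step in blast)
    then show ?thesis by simp
  qed
  show ?thesis by (rule that[OF _ main]) (use K in auto)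
qed

end

text \<open>The factors \<open>A n\<close> are bounded in \<open>L\<^sup>2\<close> without becoming
  small. The smallness comes from \<open>B n\<close> times the fixed function \<open>G\<close>,
  which tends to 0 in \<open>L\<^sup>2\<close> by dominated convergence; Cauchy-Schwarz combines the
  two.\<close>

lemma L2_concentrating:
  fixes G :: "'a \<Rightarrow> real" and A B :: "nat \<Rightarrow> 'a \<Rightarrow> real"
  assumes G: "L2 M G" and A: "\<And>n. L2 M (A n)" "\<And>n. L2_norm M (A n) \<le> C"
    and B: "\<And>n. B n \<in> borel_measurable M" "\<And>n x. \<bar>B n x\<bar> \<le> 1" "AE x in M. (\<lambda>n. B n x) \<longlonglongrightarrow> 0"
  shows "(\<lambda>n. LINT x|M. A n x * (B n x * G x)) \<longlonglongrightarrow> 0"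
proof -
  note [measurable] = B(1) L2_measurable[OF G]
  have BG: "L2 M (\<lambda>x. B n x * G x)" for n
    by (rule L2_bound[OF G, of _ 1])
      (use B(2)[of n] in \<open>auto simp: abs_mult mult_left_le_one_le\<close>)
  have "(\<lambda>n. LINT x|M. (B n x * G x)\<^sup>2) \<longlonglongrightarrow> (LINT x|M. 0)"
  proof (rule integral_dominated_convergence[where w = "\<lambda>x. (G x)\<^sup>2"])
    show "AE x in M. (\<lambda>n. (B n x * G x)\<^sup>2) \<longlonglongrightarrow> 0"
      using B(3)
    proof eventually_elim
      case (elim x)
      have "(\<lambda>n. (B n x * G x)\<^sup>2) \<longlonglongrightarrow> (0 * G x)\<^sup>2" by (intro tendsto_intros elim)
      then show ?case by simp
    qed
    show "AE x in M. norm ((B n x * G x)\<^sup>2) \<le> (G x)\<^sup>2" for n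
    proof (rule AE_I2)
      fix x
      have "(B n x)\<^sup>2 \<le> 1" using B(2)[of n x] by (simp add: abs_square_le_1)
      then show "norm ((B n x * G x)\<^sup>2) \<le> (G x)\<^sup>2" by (simp add: power_mult_distrib mult_left_le_one_le)
    qed
  qed (use L2_integrable_norm2[OF G] in auto)
  then have "(\<lambda>n. sqrt (LINT x|M. (B n x * G x)\<^sup>2)) \<longlonglongrightarrow> sqrt 0" by (intro tendsto_real_sqrt) simp
  then have "(\<lambda>n. C * L2_norm M (\<lambda>x. B n x * G x)) \<longlonglongrightarrow> C * 0"
    by (intro tendsto_mult tendsto_const) (simp add: L2_norm_def)
  then have lim: "(\<lambda>n. C * L2_norm M (\<lambda>x. B n x * G x)) \<longlonglongrightarrow> 0" by simp
  have le: "norm (LINT x|M. A n x * (B n x * G x)) \<le> C * L2_norm M (\<lambda>x. B n x * G x)" for n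
  proof -
    have "\<bar>LINT x|M. A n x * (B n x * G x)\<bar> \<le> L2_norm M (A n) * L2_norm M (\<lambda>x. B n x * G x)"
      by (rule Cauchy_Schwarz_L2[OF A(1) BG])
    also have "\<dots> \<le> C * L2_norm M (\<lambda>x. B n x * G x)"
      by (rule mult_right_mono[OF A(2)]) (simp add: L2_norm_def)
    finally show ?thesis by simp
  qed
  show ?thesis by (rule Lim_null_comparison[OF always_eventually[OF allI[OF le]] lim])
qed

section \<open>The integral identity at the corner\<close>

lemma traction_axis:
  "traction lam \<mu> (axis 1 1) D $ 1 = of_real (2 * \<mu> + lam) * D 1 $ 1 + of_real lam * D 2 $ 2"
  "traction lam \<mu> (axis 1 1) D $ 2 = of_real \<mu> * D 1 $ 2 + of_real \<mu> * D 2 $ 1"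
  "traction lam \<mu> (axis 2 1) D $ 1 = of_real \<mu> * D 1 $ 2 + of_real \<mu> * D 2 $ 1"
  "traction lam \<mu> (axis 2 1) D $ 2 = of_real lam * D 1 $ 1 + of_real (2 * \<mu> + lam) * D 2 $ 2"
  by (simp_all add: traction_def UNIV_2 axis_def perp_def) (simp_all add: scaleR_conv_of_real algebra_simps)

lemma bounded_bilinear_cdot: "bounded_bilinear cdot"
  unfolding bilinear_conv_bounded_bilinear[symmetric] bilinear_def
  by (auto intro!: linearI simp: cdot_def sum.distrib algebra_simps scaleR_sum_right)

lemma norm_cdot_le: "norm (cdot a b) \<le> 2 * (norm a * norm b)"
proof -
  have "norm (cdot a b) \<le> norm (a $ 1) * norm (b $ 1) + norm (a $ 2) * norm (b $ 2)"
    unfolding cdot_def by (simp add: UNIV_2 norm_mult[symmetric] norm_triangle_ineq)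
  also have "\<dots> \<le> norm a * norm b + norm a * norm b"
    by (intro add_mono mult_mono Finite_Cartesian_Product.norm_nth_le) auto
  finally show ?thesis by simp
qed

lemma integral_ball_measure: "measure lborel (ball (0::real^2) r) \<le> 4 * r\<^sup>2" if "0 \<le> r"
proof -
  have "ball (0::real^2) r \<subseteq> cbox (\<chi> i. - r) (\<chi> i. r)"
  proof
    fix x :: "real^2" assume "x \<in> ball 0 r"
    then have "\<bar>x $ i\<bar> \<le> r" for i using component_le_norm_cart[of x i] by simp
    then show "x \<in> cbox (\<chi> i. - r) (\<chi> i. r)" by (simp add: mem_box_cart abs_le_iff minus_le_iff)
  qed
  then have "measure lborel (ball (0::real^2) r) \<le> measure lborel (cbox (\<chi> i. - r) (\<chi> i. r) :: (real^2) set)"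
    by (intro measure_mono_fmeasurable) auto
  also have "\<dots> = 4 * r\<^sup>2"
    using that by (simp add: measure_lborel_cbox_eq Basis_real2 axis_12_neq inner_axis power2_eq_square)
  finally show ?thesis .
qed

text \<open>Of the right-hand sides \<open>fv\<close> and \<open>fw\<close> only the square
  integrability is recorded, so the potential has to be dealt with just once, when the locale is
  entered.\<close>

locale transmission = corner \<Omega> \<Gamma> a b h
  for \<Omega> \<Gamma> :: "(real^2) set" and a b h :: real +
  fixes lam \<mu> :: real and \<eta> :: "real^2 \<Rightarrow> real" and v w fv fw tv tw :: "real^2 \<Rightarrow> complex^2"
  assumes v: "H1 \<Omega> v" and w: "H1 \<Omega> w" and fv: "L2 (lebesgue_on \<Omega>) fv" and fw: "L2 (lebesgue_on \<Omega>) fw"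
    and tv: "has_trace \<Omega> v tv" and tw: "has_trace \<Omega> w tw"
    and tvw: "AE x in arclength_on \<Gamma>. tw x = tv x"
    and \<eta>: "Linfty bd \<eta>"
    and weak: "\<And>\<phi>. smooth \<phi> \<Longrightarrow> compact (tsupport \<phi>) \<Longrightarrow> tsupport \<phi> \<inter> frontier \<Omega> \<subseteq> \<Gamma> \<Longrightarrow>
      traction_pairing lam \<mu> \<Omega> v fv \<phi> + (LINT x|arclength_on \<Gamma>. of_real (\<eta> x) * cdot (tv x) (\<phi> x))
        = traction_pairing lam \<mu> \<Omega> w fw \<phi>"
begin

lemma \<Gamma>_borel: "\<Gamma> \<in> sets borel"
proof -
  obtain T where "open T" "\<Gamma> = frontier \<Omega> \<inter> T" using \<Gamma>(1) by (auto simp: openin_open)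
  then show ?thesis by (auto simp: borel_closed borel_open)
qed

lemma AE_\<Gamma>_imp_bd:
  assumes "AE x in arclength_on \<Gamma>. P x"
  shows "AE x in bd. x \<in> \<Gamma> \<longrightarrow> P x"
proof -
  have "AE x in hausdorff1. x \<in> \<Gamma> \<longrightarrow> P x"
    using assms \<Gamma>_borel unfolding arclength_on_def by (subst (asm) AE_restrict_space_iff) auto
  then have "AE x in hausdorff1. x \<in> frontier \<Omega> \<longrightarrow> (x \<in> \<Gamma> \<longrightarrow> P x)" by eventually_elim simp
  then show ?thesis unfolding arclength_on_def by (subst AE_restrict_space_iff[OF bd_sets])
qed

lemma AE_bd_nonzero: "AE x in bd. x \<noteq> 0"
proof -
  have "hausdorff1_outer ((\<lambda>_. 0 :: real^2) ` {0..0::real}) \<le> ennreal (0 * (0 - 0))"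
    by (rule hausdorff1_outer_lipschitz_image) auto
  then have "emeasure hausdorff1 {0 :: real^2} = 0" by (simp add: emeasure_hausdorff1)
  then have "{0 :: real^2} \<in> null_sets hausdorff1" by (auto simp: null_sets_def)
  then have "AE x in hausdorff1. x \<noteq> (0 :: real^2)" using AE_not_in by fastforce
  then have "AE x in hausdorff1. x \<in> frontier \<Omega> \<longrightarrow> x \<noteq> 0" by eventually_elim simp
  then show ?thesis unfolding arclength_on_def by (subst AE_restrict_space_iff[OF bd_sets])
qed

text \<open>Within the ball the boundary consists of the two edges and possibly the vertex, which
  has length 0; for fields supported in the ball the part of \<open>\<Gamma>\<close> away from the
  corner drops out.\<close>

lemma boundary_form_eq:
  fixes \<phi> :: "real^2 \<Rightarrow> complex^2"
  assumes z: "\<And>x. norm x \<ge> h \<Longrightarrow> \<phi> x = 0" and c: "continuous_on UNIV \<phi>"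
  shows "(LINT x|arclength_on \<Gamma>. of_real (\<eta> x) * cdot (tv x) (\<phi> x))
      = (LINT x|bd. indicator (edge a \<union> edge b) x *\<^sub>R (of_real (\<eta> x) * cdot (tv x) (\<phi> x)))"
    and "integrable bd (\<lambda>x. of_real (\<eta> x) * cdot (tv x) (\<phi> x))"
proof -
  let ?f = "\<lambda>x. of_real (\<eta> x) * cdot (tv x) (\<phi> x)"
  have t2: "L2 bd tv" using tv by (simp add: has_trace_def)
  have \<phi>2: "L2 bd \<phi>" by (rule continuous_L2_bd[OF c])
  obtain C where C: "AE x in bd. \<bar>\<eta> x\<bar> \<le> C" and \<eta>m: "\<eta> \<in> borel_measurable bd" using \<eta> by (auto simp: Linfty_def)
  have cd: "integrable bd (\<lambda>x. cdot (tv x) (\<phi> x))" by (rule integrable_bilinear_L2[OF bounded_bilinear_cdot t2 \<phi>2])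
  note [measurable] = \<eta>m borel_measurable_integrable[OF cd]
  have m: "?f \<in> borel_measurable bd" by measurable
  show "integrable bd ?f"
  proof (rule Bochner_Integration.integrable_bound[OF integrable_mult_right[OF cd, of C] m])
    show "AE x in bd. norm (?f x) \<le> norm (C * cdot (tv x) (\<phi> x))"
      using C by eventually_elim (auto simp: norm_mult intro!: mult_right_mono)
  qed
  have im: "(indicator A :: real^2 \<Rightarrow> real) \<in> borel_measurable bd" if "A \<in> sets borel" for A
    unfolding arclength_on_def by (intro measurable_restrict_space1) (use that in \<open>auto intro: borel_measurable_indicator\<close>)
  have "(LINT x|arclength_on \<Gamma>. ?f x) = (LINT x|hausdorff1. indicator \<Gamma> x *\<^sub>R ?f x)"
    unfolding arclength_on_def by (rule integral_restrict_space) (simp add: \<Gamma>_borel)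
  also have "\<dots> = (LINT x|hausdorff1. indicator (frontier \<Omega>) x *\<^sub>R (indicator \<Gamma> x *\<^sub>R ?f x))"
    using \<Gamma>_subset by (intro Bochner_Integration.integral_cong refl) (auto simp: indicator_def)
  also have "\<dots> = (LINT x|bd. indicator \<Gamma> x *\<^sub>R ?f x)"
    unfolding arclength_on_def by (rule integral_restrict_space[OF bd_sets, symmetric])
  also have "\<dots> = (LINT x|bd. indicator (edge a \<union> edge b) x *\<^sub>R ?f x)"
  proof (rule integral_cong_AE)
    show "AE x in bd. indicator \<Gamma> x *\<^sub>R ?f x = indicator (edge a \<union> edge b) x *\<^sub>R ?f x"
      using AE_bd_nonzero AE_space
    proof eventually_elim
      case (elim x)
      then have x: "x \<noteq> 0" "x \<in> frontier \<Omega>" by (auto simp: arclength_on_def space_restrict_space)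
      show ?case
      proof (cases "norm x < h")
        case True
        then have "x \<in> edge a \<union> edge b" using frontier_near_corner x by blast
        then show ?thesis using edge_subset(1)[of a] edge_subset(1)[of b] by (auto simp: indicator_def)
      qed (simp add: z cdot_def)
    qed
  qed (use m edge_borel \<Gamma>_borel in \<open>auto intro!: borel_measurable_scaleR im\<close>)
  finally show "(LINT x|arclength_on \<Gamma>. ?f x) = (LINT x|bd. indicator (edge a \<union> edge b) x *\<^sub>R ?f x)" .
qed

lemma traction_L2:
  assumes "H1 \<Omega> u"
  shows "L2 (lebesgue_on \<Omega>) (\<lambda>x. traction lam \<mu> (axis k 1) (\<lambda>l. weak_partial \<Omega> l u x))"
proof (rule L2_vecI)
  fix i
  note wp = H1_weak_partial(1)[OF assms]
  have "L2 (lebesgue_on \<Omega>) (\<lambda>x. of_real c * weak_partial \<Omega> l u x $ m)" for c l m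
    using L2_bounded_linear[OF bounded_linear_scaleR_right[of c] L2_vec_nth[OF wp, of l m]]
    by (simp add: scaleR_conv_of_real)
  then show "L2 (lebesgue_on \<Omega>) (\<lambda>x. traction lam \<mu> (axis k 1) (\<lambda>l. weak_partial \<Omega> l u x) $ i)"
    using exhaust_2[of k] exhaust_2[of i] by (auto simp: traction_axis simp del: of_real_add of_real_mult intro!: L2_add)
qed

lemma traction_pairing_integrable:
  assumes u: "H1 \<Omega> u" and f: "L2 (lebesgue_on \<Omega>) f" and \<phi>: "C_k 1 \<phi>"
  shows "integrable (lebesgue_on \<Omega>) (\<lambda>x. \<Sum>k\<in>UNIV. cdot (traction lam \<mu> (axis k 1) (\<lambda>l. weak_partial \<Omega> l u x)) (partial k \<phi> x))"
    "integrable (lebesgue_on \<Omega>) (\<lambda>x. cdot (f x) (\<phi> x))"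
proof -
  have L: "L2 (lebesgue_on \<Omega>) (partial k \<phi>)" "L2 (lebesgue_on \<Omega>) \<phi>" for k
    using has_weak_partial_C1(1)[OF \<phi> open_\<Omega> bounded_\<Omega>] C_k_continuous[OF \<phi>]
    by (auto intro!: continuous_L2_lebesgue_on bounded_\<Omega> open_\<Omega>)
  show "integrable (lebesgue_on \<Omega>) (\<lambda>x. \<Sum>k\<in>UNIV. cdot (traction lam \<mu> (axis k 1) (\<lambda>l. weak_partial \<Omega> l u x)) (partial k \<phi> x))"
    by (rule Bochner_Integration.integrable_sum) (rule integrable_bilinear_L2[OF bounded_bilinear_cdot traction_L2[OF u] L(1)])
  show "integrable (lebesgue_on \<Omega>) (\<lambda>x. cdot (f x) (\<phi> x))"
    by (rule integrable_bilinear_L2[OF bounded_bilinear_cdot f L(2)])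
qed

lemma traction_pairing_diff:
  assumes u: "H1 \<Omega> u" and f: "L2 (lebesgue_on \<Omega>) f" and \<phi>: "C_k 1 \<phi>" "C_k 1 \<psi>"
  shows "traction_pairing lam \<mu> \<Omega> u f (\<lambda>x. \<phi> x - \<psi> x) = traction_pairing lam \<mu> \<Omega> u f \<phi> - traction_pairing lam \<mu> \<Omega> u f \<psi>"
proof -
  have p: "partial k (\<lambda>x. \<phi> x - \<psi> x) x = partial k \<phi> x - partial k \<psi> x" for k x
    by (rule partial_diff) (use \<phi> in auto)
  note i = traction_pairing_integrable[OF u f \<phi>(1)] traction_pairing_integrable[OF u f \<phi>(2)]
  show ?thesis
    unfolding traction_pairing_def p bounded_bilinear.diff_right[OF bounded_bilinear_cdot] sum_subtractf
    using i by simp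
qed

end

section \<open>Admitting test fields that do not vanish at the vertex\<close>

lemma partial_scale:
  fixes f :: "real^2 \<Rightarrow> 'a::real_normed_vector"
  assumes "f differentiable (at (c *\<^sub>R x))"
  shows "((\<lambda>x. f (c *\<^sub>R x)) has_derivative (\<lambda>d. frechet_derivative f (at (c *\<^sub>R x)) (c *\<^sub>R d))) (at x)"
    "partial k (\<lambda>x. f (c *\<^sub>R x)) x = c *\<^sub>R partial k f (c *\<^sub>R x)"
proof -
  note d = frechet_derivative_works[THEN iffD1, OF assms]
  have s: "((\<lambda>x. c *\<^sub>R x) has_derivative (\<lambda>d. c *\<^sub>R d)) (at x)"
    by (intro bounded_linear_imp_has_derivative bounded_linear_scaleR_right)
  show *: "((\<lambda>x. f (c *\<^sub>R x)) has_derivative (\<lambda>d. frechet_derivative f (at (c *\<^sub>R x)) (c *\<^sub>R d))) (at x)"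
    using has_derivative_compose[OF s d] .
  interpret bounded_linear "frechet_derivative f (at (c *\<^sub>R x))"
    using d by (rule has_derivative_bounded_linear)
  show "partial k (\<lambda>x. f (c *\<^sub>R x)) x = c *\<^sub>R partial k f (c *\<^sub>R x)"
    unfolding partial_eq[OF *] by (simp add: scaleR partial_def)
qed

lemma C_k_scale:
  fixes f :: "real^2 \<Rightarrow> 'a::real_normed_vector"
  shows "C_k n f \<Longrightarrow> C_k n (\<lambda>x. f (c *\<^sub>R x))"
proof (induction n arbitrary: f)
  case 0
  then show ?case by (auto intro!: continuous_on_compose2[of UNIV f] continuous_intros)
next
  case (Suc n)
  have d: "f differentiable (at y)" for y using Suc.prems by simp
  have "partial k (\<lambda>x. f (c *\<^sub>R x)) = (\<lambda>x. c *\<^sub>R partial k f (c *\<^sub>R x))" for k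
    by (rule ext) (rule partial_scale(2)[OF d])
  moreover have "C_k n (\<lambda>x. c *\<^sub>R partial k f (c *\<^sub>R x))" for k
    using Suc.prems by (intro C_k_bounded_linear[OF bounded_linear_scaleR_right] Suc.IH) simp
  moreover have "(\<lambda>x. f (c *\<^sub>R x)) differentiable (at x)" for x
    using partial_scale(1)[OF d] by (auto simp: differentiable_def)
  ultimately show ?case by simp
qed

lemma compact_tsupport:
  assumes "\<And>x. norm x \<ge> R \<Longrightarrow> f x = 0"
  shows "compact (tsupport f)" "tsupport f \<subseteq> cball 0 R"
proof -
  have "{x. f x \<noteq> 0} \<subseteq> cball 0 R" using assms by (auto simp: not_le[symmetric]) (metis linear)
  then show *: "tsupport f \<subseteq> cball 0 R" unfolding tsupport_def by (intro closure_minimal) auto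
  then show "compact (tsupport f)"
    using compact_Int_closed[OF compact_cball[of 0 R], of "tsupport f"] by (simp add: Int_absorb1 tsupport_def)
qed

lemma AE_lebesgue_on_nonzero: "open \<Omega> \<Longrightarrow> AE x in lebesgue_on (\<Omega> :: (real^2) set). x \<noteq> 0"
proof -
  assume o: "open \<Omega>"
  have "AE x in lebesgue. x \<noteq> (0 :: real^2)" by (rule AE_completion[OF AE_lborel_singleton])
  then have "AE x in lebesgue. x \<in> \<Omega> \<longrightarrow> x \<noteq> 0" by eventually_elim simp
  then show ?thesis unfolding AE_restrict_space_iff[OF open_in_lebesgue[OF o]] .
qed

text \<open>A non-integrable \<open>f\<close> has integral 0 by convention, so the bound also covers
  integrands whose measurability has not been established.\<close>

lemma integral_norm_le:
  fixes f :: "'a \<Rightarrow> 'b::{banach, second_countable_topology}"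
  assumes "integrable M g" "\<And>x. x \<in> space M \<Longrightarrow> norm (f x) \<le> g x"
  shows "norm (integral\<^sup>L M f) \<le> integral\<^sup>L M g"
proof (cases "integrable M f")
  case True
  have "norm (integral\<^sup>L M f) \<le> (LINT x|M. norm (f x))" by (rule integral_norm_bound)
  also have "\<dots> \<le> integral\<^sup>L M g" by (rule integral_mono) (use True assms in auto)
  finally show ?thesis .
next
  case False
  then have "integral\<^sup>L M f = 0" by (rule not_integrable_integral_eq)
  moreover have "0 \<le> integral\<^sup>L M g" by (rule integral_nonneg_AE) (use assms in \<open>auto intro!: AE_I2 order_trans[OF norm_ge_zero]\<close>)
  ultimately show ?thesis by simp
qed

context transmission
begin

text \<open>A cutoff at scale \<open>1/N\<close> has a gradient of order \<open>N\<close> on a disk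
  of area of order \<open>1/N\<^sup>2\<close>, so its gradient is bounded in
  \<open>L\<^sup>2\<close> but need not tend to 0. The pairing vanishes in the limit because the
  disks shrink to the vertex, which is the case treated by \<open>L2_concentrating\<close>.\<close>

lemma cutoff_pairing_tendsto_0:
  fixes \<kappa> :: "real^2 \<Rightarrow> real" and \<phi> :: "real^2 \<Rightarrow> complex^2"
  assumes u: "H1 \<Omega> u" and f: "L2 (lebesgue_on \<Omega>) f" and \<phi>: "C_k 1 \<phi>" "\<And>x. norm x \<ge> R \<Longrightarrow> \<phi> x = 0"
    and \<kappa>: "C_k 1 \<kappa>" "\<And>x. norm x \<ge> 2 \<Longrightarrow> \<kappa> x = 0" "\<And>x. \<bar>\<kappa> x\<bar> \<le> 1"
  shows "(\<lambda>n. traction_pairing lam \<mu> \<Omega> u f (\<lambda>x. \<kappa> (real (Suc n) *\<^sub>R x) *\<^sub>R \<phi> x)) \<longlonglongrightarrow> 0"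
proof -
  let ?T = "\<lambda>k x. traction lam \<mu> (axis k 1) (\<lambda>l. weak_partial \<Omega> l u x)"
  define G where "G x = norm (?T 1 x) + norm (?T 2 x) + norm (f x)" for x
  have nrm: "L2 (lebesgue_on \<Omega>) (\<lambda>x. norm (F x))" if "L2 (lebesgue_on \<Omega>) F" for F :: "real^2 \<Rightarrow> complex^2"
    by (rule L2_bound[OF that, of _ 1]) (use L2_measurable[OF that] in auto)
  have G: "L2 (lebesgue_on \<Omega>) G"
    unfolding G_def by (intro L2_add nrm traction_L2 u f)
  have c\<phi>: "continuous_on UNIV \<phi>" "\<And>k. continuous_on UNIV (partial k \<phi>)" and c\<kappa>: "\<And>k. continuous_on UNIV (partial k \<kappa>)"
    using C_k_continuous[OF \<phi>(1)] \<phi>(1) \<kappa>(1) by auto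
  have p\<phi>: "partial k \<phi> x = 0" if "norm x \<ge> R + 1" for k x
    using dird_eq_0[OF \<phi>, where x = x and p = "axis k 1"] that by (simp add: partial_eq_dird)
  have p\<kappa>: "partial k \<kappa> x = 0" if "norm x > 2" for k x
    using dird_eq_0[OF \<kappa>(1,2), where x = x and p = "axis k 1"] that by (simp add: partial_eq_dird)
  have p\<kappa>3: "partial k \<kappa> x = 0" if "norm x \<ge> 3" for k x using p\<kappa>[of x k] that by simp
  obtain A where A: "0 \<le> A" "\<And>x. norm (\<phi> x) \<le> A" by (rule bounded_if_zero_outside[OF c\<phi>(1)], erule \<phi>(2), rule that)
  obtain B1 where B1: "0 \<le> B1" "\<And>x. norm (partial 1 \<phi> x) \<le> B1" by (rule bounded_if_zero_outside[OF c\<phi>(2)[of 1]], erule p\<phi>, rule that)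
  obtain B2 where B2: "0 \<le> B2" "\<And>x. norm (partial 2 \<phi> x) \<le> B2" by (rule bounded_if_zero_outside[OF c\<phi>(2)[of 2]], erule p\<phi>, rule that)
  obtain D1 where D1: "0 \<le> D1" "\<And>x. norm (partial 1 \<kappa> x) \<le> D1" by (rule bounded_if_zero_outside[OF c\<kappa>[of 1]], erule p\<kappa>3, rule that)
  obtain D2 where D2: "0 \<le> D2" "\<And>x. norm (partial 2 \<kappa> x) \<le> D2" by (rule bounded_if_zero_outside[OF c\<kappa>[of 2]], erule p\<kappa>3, rule that)
  define B D where "B = B1 + B2" and "D = D1 + D2"
  have B: "norm (partial k \<phi> x) \<le> B" and D: "\<bar>partial k \<kappa> x\<bar> \<le> D" for k x
    using exhaust_2[of k] B1 B2(1) B2(2)[of x] B1(2)[of x] D1 D2(1) D2(2)[of x] D1(2)[of x]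
    by (auto simp: B_def D_def intro: add_increasing add_increasing2)
  have BD0: "0 \<le> B" "0 \<le> D" using B1 B2 D1 D2 by (auto simp: B_def D_def)
  define C where "C = A + B + A * D"
  have C0: "0 \<le> C" using A BD0 by (simp add: C_def)
  \<comment> \<open>Radius 3 instead of 2 leaves room: the derivatives of \<open>\<kappa>\<close>
    are known to vanish where the norm strictly exceeds 2.\<close>
  define Bn where "Bn n = ball (0::real^2) (3 / real (Suc n))" for n
  let ?\<phi> = "\<lambda>n x. \<kappa> (real (Suc n) *\<^sub>R x) *\<^sub>R \<phi> x"
  have b\<phi>: "norm (?\<phi> n x) \<le> C * real (Suc n) * indicator (Bn n) x"
    and bp: "norm (partial k (?\<phi> n) x) \<le> C * real (Suc n) * indicator (Bn n) x" for n k x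
  proof -
    let ?N = "real (Suc n)"
    have N: "1 \<le> ?N" by simp
    have out: "norm (?N *\<^sub>R x) \<ge> 3" if "x \<notin> Bn n"
      using that by (simp add: Bn_def not_less field_simps del: of_nat_Suc)
    have pk: "partial k (?\<phi> n) x = \<kappa> (?N *\<^sub>R x) *\<^sub>R partial k \<phi> x + (?N *\<^sub>R partial k \<kappa> (?N *\<^sub>R x)) *\<^sub>R \<phi> x"
    proof -
      have d: "\<kappa> differentiable (at y)" "\<phi> differentiable (at y)" for y using \<kappa>(1) \<phi>(1) by auto
      have "(\<lambda>x. \<kappa> (?N *\<^sub>R x)) differentiable (at x)"
        using partial_scale(1)[OF d(1)] by (auto simp: differentiable_def)
      then show ?thesis
        using partial_bilinear[OF bounded_bilinear_scaleR _ d(2), of "\<lambda>x. \<kappa> (?N *\<^sub>R x)" x k] partial_scale(2)[OF d(1), where c = ?N and x = x and k = k]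
        by simp
    qed
    show "norm (?\<phi> n x) \<le> C * ?N * indicator (Bn n) x"
    proof (cases "x \<in> Bn n")
      case True
      have "norm (?\<phi> n x) \<le> 1 * A" unfolding norm_scaleR by (intro mult_mono \<kappa> A) auto
      also have "\<dots> \<le> C * 1" using A BD0 by (simp add: C_def)
      also have "\<dots> \<le> C * ?N" using C0 N by (intro mult_left_mono) auto
      finally show ?thesis using True by simp
    next
      case False
      then have "\<kappa> (?N *\<^sub>R x) = 0" using out by (intro \<kappa>(2)) simp
      then show ?thesis using False by simp
    qed
    show "norm (partial k (?\<phi> n) x) \<le> C * ?N * indicator (Bn n) x"
    proof (cases "x \<in> Bn n")
      case True
      have "norm (partial k (?\<phi> n) x) \<le> norm (\<kappa> (?N *\<^sub>R x) *\<^sub>R partial k \<phi> x) + norm ((?N *\<^sub>R partial k \<kappa> (?N *\<^sub>R x)) *\<^sub>R \<phi> x)"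
        unfolding pk by (rule norm_triangle_ineq)
      also have "\<dots> \<le> 1 * B + (?N * D) * A"
        unfolding norm_scaleR real_scaleR_def real_norm_def abs_mult
        by (intro add_mono mult_mono \<kappa>(3) A(2) B D) (use A BD0 in auto)
      also have "\<dots> \<le> C * ?N"
      proof -
        have "1 * B \<le> B * ?N" using BD0 N mult_left_mono[of 1 ?N B] by simp
        moreover have "0 \<le> A * ?N" using A by simp
        ultimately show ?thesis by (simp add: C_def algebra_simps)
      qed
      finally show ?thesis using True by simp
    next
      case False
      then have n3: "norm (?N *\<^sub>R x) \<ge> 3" by (rule out)
      have "\<kappa> (?N *\<^sub>R x) = 0" using n3 by (intro \<kappa>(2)) simp
      moreover have "partial k \<kappa> (?N *\<^sub>R x) = 0" using n3 by (intro p\<kappa>) simp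
      ultimately show ?thesis using False unfolding pk by simp
    qed
  qed
  let ?A = "\<lambda>n x. real (Suc n) * indicator (Bn n) x"
  let ?B = "\<lambda>n x. indicator (Bn n) x :: real"
  have im: "?B n \<in> borel_measurable (lebesgue_on \<Omega>)" for n
    by (intro measurable_restrict_space1 measurable_completion) (auto simp: Bn_def intro: borel_measurable_indicator)
  note fm = finite_measure_lebesgue_on_bounded[OF bounded_\<Omega> open_\<Omega>]
  have A2: "L2 (lebesgue_on \<Omega>) (?A n)" for n
    by (rule L2_bounded_finite[OF fm, of _ "real (Suc n)"]) (use im in \<open>auto split: split_indicator\<close>)
  \<comment> \<open>The value 6 is the square root of \<open>N\<^sup>2\<close> times the bound
    \<open>4 * (3 / N)\<^sup>2\<close> for the area of the disk.\<close>
  have An: "L2_norm (lebesgue_on \<Omega>) (?A n) \<le> 6" for n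
  proof -
    let ?N = "real (Suc n)"
    have "(LINT x|lebesgue_on \<Omega>. (norm (?A n x))\<^sup>2) = (LINT x|lebesgue_on \<Omega>. ?N\<^sup>2 * indicator (Bn n) x)"
      by (intro Bochner_Integration.integral_cong refl) (auto split: split_indicator)
    also have "\<dots> = (LINT x|lborel. indicator \<Omega> x *\<^sub>R (?N\<^sup>2 * indicator (Bn n) x))"
      by (rule integral_lebesgue_on_eq_lborel(1)[OF _ open_\<Omega>])
        (intro borel_measurable_times borel_measurable_const borel_measurable_indicator, simp add: Bn_def)
    also have "\<dots> \<le> (LINT x|lborel. ?N\<^sup>2 * indicator (Bn n) x)"
    proof (rule integral_mono)
      have i: "integrable lborel (\<lambda>x. ?N\<^sup>2 * indicator (Bn n) x)"
      proof (intro integrable_mult_right integrable_real_indicator)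
        show "emeasure lborel (Bn n) < \<infinity>"
          unfolding Bn_def by (rule emeasure_bounded_finite) (rule bounded_ball)
      qed (simp add: Bn_def)
      then show "integrable lborel (\<lambda>x. ?N\<^sup>2 * indicator (Bn n) x)" .
      show "integrable lborel (\<lambda>x. indicator \<Omega> x *\<^sub>R (?N\<^sup>2 * indicator (Bn n) x))"
        by (rule integrable_mult_indicator[OF _ i]) (simp add: open_\<Omega> borel_open)
    qed (auto split: split_indicator)
    also have "\<dots> = ?N\<^sup>2 * measure lborel (Bn n)" by (simp add: Bn_def)
    also have "\<dots> \<le> ?N\<^sup>2 * (4 * (3 / ?N)\<^sup>2)"
      unfolding Bn_def by (intro mult_left_mono integral_ball_measure) auto
    also have "\<dots> = 6\<^sup>2" by (simp add: power_divide del: of_nat_Suc)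
    finally have "L2_norm (lebesgue_on \<Omega>) (?A n) \<le> sqrt (6\<^sup>2)" unfolding L2_norm_def by (rule real_sqrt_le_mono)
    then show ?thesis by simp
  qed
  have lim: "(\<lambda>n. LINT x|lebesgue_on \<Omega>. ?A n x * (?B n x * G x)) \<longlonglongrightarrow> 0"
  proof (rule L2_concentrating[OF G A2 An im])
    show "AE x in lebesgue_on \<Omega>. (\<lambda>n. ?B n x) \<longlonglongrightarrow> 0"
      using AE_lebesgue_on_nonzero[OF open_\<Omega>]
    proof eventually_elim
      case (elim x)
      then obtain m :: nat where m: "3 / norm x < real m" using reals_Archimedean2 by blast
      have "?B n x = 0" if "m \<le> n" for n
      proof -
        have "3 / norm x < real (Suc n)" using m that by simp
        then have "3 / real (Suc n) < norm x" using elim by (simp add: field_simps del: of_nat_Suc)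
        then show ?thesis by (simp add: Bn_def)
      qed
      then show ?case by (intro tendsto_eventually) (auto simp: eventually_sequentially)
    qed
  qed (auto split: split_indicator)
  have le: "norm (traction_pairing lam \<mu> \<Omega> u f (?\<phi> n)) \<le> 2 * C * (LINT x|lebesgue_on \<Omega>. ?A n x * (?B n x * G x))" for n
  proof -
    have "integrable (lebesgue_on \<Omega>) (\<lambda>x. ?A n x * (?B n x * G x))"
    proof -
      have "L2 (lebesgue_on \<Omega>) (\<lambda>x. ?B n x * G x)"
        by (rule L2_bound[OF G, of _ 1]) (use im L2_measurable[OF G] in \<open>auto split: split_indicator\<close>)
      then show ?thesis by (rule integrable_bilinear_L2[OF bounded_bilinear_mult A2])
    qed
    then have i: "integrable (lebesgue_on \<Omega>) (\<lambda>x. 2 * C * (?A n x * (?B n x * G x)))" by (rule integrable_mult_right)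
    have "norm (traction_pairing lam \<mu> \<Omega> u f (?\<phi> n)) \<le> (LINT x|lebesgue_on \<Omega>. 2 * C * (?A n x * (?B n x * G x)))"
      unfolding traction_pairing_def
    proof (rule integral_norm_le[OF i])
      fix x
      let ?b = "C * real (Suc n) * indicator (Bn n) x"
      have c: "norm (cdot y z) \<le> 2 * (norm y * ?b)" if "norm z \<le> ?b" for y z
      proof -
        have "norm y * norm z \<le> norm y * ?b" by (rule mult_left_mono[OF that]) simp
        then show ?thesis using norm_cdot_le[of y z] by linarith
      qed
      have "norm ((\<Sum>k\<in>UNIV. cdot (?T k x) (partial k (?\<phi> n) x)) + cdot (f x) (?\<phi> n x))
          \<le> norm (cdot (?T 1 x) (partial 1 (?\<phi> n) x)) + norm (cdot (?T 2 x) (partial 2 (?\<phi> n) x)) + norm (cdot (f x) (?\<phi> n x))"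
        unfolding UNIV_2 by (simp add: norm_triangle_le add_mono norm_triangle_ineq)
      also have "\<dots> \<le> 2 * (norm (?T 1 x) * ?b) + 2 * (norm (?T 2 x) * ?b) + 2 * (norm (f x) * ?b)"
        by (intro add_mono c bp b\<phi>)
      also have "\<dots> = 2 * C * (?A n x * (?B n x * G x))"
        by (auto simp: G_def algebra_simps split: split_indicator)
      finally show "norm ((\<Sum>k\<in>UNIV. cdot (?T k x) (partial k (?\<phi> n) x)) + cdot (f x) (?\<phi> n x)) \<le> 2 * C * (?A n x * (?B n x * G x))" .
    qed
    then show ?thesis by simp
  qed
  have "(\<lambda>n. 2 * C * (LINT x|lebesgue_on \<Omega>. ?A n x * (?B n x * G x))) \<longlonglongrightarrow> 2 * C * 0"
    by (intro tendsto_intros lim)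
  then have lim2: "(\<lambda>n. 2 * C * (LINT x|lebesgue_on \<Omega>. ?A n x * (?B n x * G x))) \<longlonglongrightarrow> 0" by simp
  show ?thesis by (rule Lim_null_comparison[OF always_eventually[OF allI[OF le]] lim2])
qed

text \<open>The boundary condition may be tested with fields that do not vanish at the vertex, although the
  vertex need not belong to \<open>\<Gamma>\<close>: scaled cutoffs have bounded gradients in \<open>L\<^sup>2\<close> and shrinking supports.\<close>

lemma weak_at_vertex:
  fixes \<phi> :: "real^2 \<Rightarrow> complex^2"
  assumes \<phi>: "smooth \<phi>" "\<And>x. norm x \<ge> R \<Longrightarrow> \<phi> x = 0" and R: "R < h"
  shows "traction_pairing lam \<mu> \<Omega> v fv \<phi>
      + (LINT x|bd. indicator (edge a \<union> edge b) x *\<^sub>R (of_real (\<eta> x) * cdot (tv x) (\<phi> x)))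
    = traction_pairing lam \<mu> \<Omega> w fw \<phi>"
proof -
  obtain \<kappa> :: "real^2 \<Rightarrow> real" where \<kappa>: "smooth \<kappa>" "\<And>x. norm x \<le> 1 \<Longrightarrow> \<kappa> x = 1" "\<And>x. norm x \<ge> 2 \<Longrightarrow> \<kappa> x = 0"
    "\<And>x. 0 \<le> \<kappa> x" "\<And>x. \<kappa> x \<le> 1" by (rule cutoff_exists[of 1 2], simp, simp, rule that)
  define f where "f n x = \<kappa> (real (Suc n) *\<^sub>R x) *\<^sub>R \<phi> x" for n x
  let ?J = "\<lambda>\<phi>. LINT x|bd. indicator (edge a \<union> edge b) x *\<^sub>R (of_real (\<eta> x) * cdot (tv x) (\<phi> x))"
  have sf: "smooth (f n)" for n
    unfolding f_def by (rule smoothI) (intro C_k_scaleR C_k_scale smoothD[OF \<kappa>(1)] smoothD[OF \<phi>(1)])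
  have C1: "C_k 1 \<phi>" "C_k 1 (f n)" "C_k 1 \<kappa>" for n using \<phi>(1) sf \<kappa>(1) smoothD by blast+
  have z: "\<phi> x = 0" "f n x = 0" if "norm x \<ge> h" for n x using \<phi>(2) that R by (auto simp: f_def)
  have k1: "\<bar>\<kappa> x\<bar> \<le> 1" for x using \<kappa>(4,5)[of x] by simp
  have lims: "(\<lambda>n. traction_pairing lam \<mu> \<Omega> v fv (f n)) \<longlonglongrightarrow> 0" "(\<lambda>n. traction_pairing lam \<mu> \<Omega> w fw (f n)) \<longlonglongrightarrow> 0"
    unfolding f_def
    by (rule cutoff_pairing_tendsto_0[OF v fv C1(1) _ C1(3) _ k1], erule \<phi>(2), erule \<kappa>(3))
       (rule cutoff_pairing_tendsto_0[OF w fw C1(1) _ C1(3) _ k1], erule \<phi>(2), erule \<kappa>(3))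
  have im: "(indicator (edge a \<union> edge b) :: real^2 \<Rightarrow> real) \<in> borel_measurable bd"
    unfolding arclength_on_def by (intro measurable_restrict_space1) (auto intro!: borel_measurable_indicator edge_borel)
  have ib: "integrable bd (\<lambda>x. indicator (edge a \<union> edge b) x *\<^sub>R (of_real (\<eta> x) * cdot (tv x) (\<psi> x)))"
    if \<psi>: "\<And>x. norm x \<ge> h \<Longrightarrow> \<psi> x = 0" "C_k 1 \<psi>" for \<psi>
  proof -
    have i: "integrable bd (\<lambda>x. of_real (\<eta> x) * cdot (tv x) (\<psi> x))"
      by (rule boundary_form_eq(2)[OF _ C_k_continuous[OF \<psi>(2)]]) (rule \<psi>(1))
    show ?thesis
      by (rule Bochner_Integration.integrable_bound[OF i])
        (use im borel_measurable_integrable[OF i] in \<open>auto split: split_indicator\<close>)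
  qed
  have ib1: "integrable bd (\<lambda>x. indicator (edge a \<union> edge b) x *\<^sub>R (of_real (\<eta> x) * cdot (tv x) (\<phi> x)))"
    by (rule ib, erule z(1), rule C1(1))
  have ib2: "integrable bd (\<lambda>x. indicator (edge a \<union> edge b) x *\<^sub>R (of_real (\<eta> x) * cdot (tv x) (f n x)))" for n
    by (rule ib, erule z(2), rule C1(2))
  have limJ: "(\<lambda>n. ?J (f n)) \<longlonglongrightarrow> (LINT x|bd. 0)"
  proof (rule integral_dominated_convergence[where w = "\<lambda>x. norm (indicator (edge a \<union> edge b) x *\<^sub>R (of_real (\<eta> x) * cdot (tv x) (\<phi> x)))"])
    show "AE x in bd. (\<lambda>n. indicator (edge a \<union> edge b) x *\<^sub>R (of_real (\<eta> x) * cdot (tv x) (f n x))) \<longlonglongrightarrow> 0"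
      using AE_bd_nonzero
    proof eventually_elim
      case (elim x)
      then obtain m :: nat where m: "2 / norm x < real m" using reals_Archimedean2 by blast
      have "f n x = 0" if "m \<le> n" for n
      proof -
        have "2 / norm x < real (Suc n)" using m that by simp
        then have "norm (real (Suc n) *\<^sub>R x) \<ge> 2" using elim by (simp add: field_simps del: of_nat_Suc)
        then show ?thesis unfolding f_def using \<kappa>(3) by simp
      qed
      then show ?case by (intro tendsto_eventually) (auto simp: eventually_sequentially cdot_def intro!: exI[of _ m])
    qed
    show "AE x in bd. norm (indicator (edge a \<union> edge b) x *\<^sub>R (of_real (\<eta> x) * cdot (tv x) (f n x)))
        \<le> norm (indicator (edge a \<union> edge b) x *\<^sub>R (of_real (\<eta> x) * cdot (tv x) (\<phi> x)))" for n
    proof (rule AE_I2)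
      fix x
      have e: "cdot (tv x) (f n x) = \<kappa> (real (Suc n) *\<^sub>R x) *\<^sub>R cdot (tv x) (\<phi> x)"
        unfolding f_def by (rule bounded_bilinear.scaleR_right[OF bounded_bilinear_cdot])
      show "norm (indicator (edge a \<union> edge b) x *\<^sub>R (of_real (\<eta> x) * cdot (tv x) (f n x)))
        \<le> norm (indicator (edge a \<union> edge b) x *\<^sub>R (of_real (\<eta> x) * cdot (tv x) (\<phi> x)))"
        using k1[of "real (Suc n) *\<^sub>R x"] unfolding e norm_scaleR norm_mult
        by (intro mult_left_mono mult_left_le_one_le) auto
    qed
    show "integrable bd (\<lambda>x. norm (indicator (edge a \<union> edge b) x *\<^sub>R (of_real (\<eta> x) * cdot (tv x) (\<phi> x))))"
      by (rule integrable_norm[OF ib1])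
    show "(\<lambda>x. indicator (edge a \<union> edge b) x *\<^sub>R (of_real (\<eta> x) * cdot (tv x) (f n x))) \<in> borel_measurable bd" for n
      by (rule borel_measurable_integrable[OF ib2])
  qed simp
  \<comment> \<open>The field minus its part near the vertex has a support that avoids the vertex
    and so meets the boundary inside \<open>\<Gamma>\<close>; to this difference \<open>weak\<close>
    applies.\<close>
  have eq: "traction_pairing lam \<mu> \<Omega> v fv \<phi> - traction_pairing lam \<mu> \<Omega> v fv (f n) + (?J \<phi> - ?J (f n))
      = traction_pairing lam \<mu> \<Omega> w fw \<phi> - traction_pairing lam \<mu> \<Omega> w fw (f n)" for n
  proof -
    let ?d = "\<lambda>x. \<phi> x - f n x"
    have d: "smooth ?d" by (rule smoothI) (intro C_k_diff smoothD[OF \<phi>(1)] smoothD[OF sf])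
    have dz: "?d x = 0" if "norm x \<ge> R" for x using \<phi>(2)[OF that] by (simp add: f_def)
    have near: "tsupport ?d \<subseteq> - ball 0 (1 / real (Suc n))"
      unfolding tsupport_def
    proof (rule closure_minimal)
      show "{x. ?d x \<noteq> 0} \<subseteq> - ball 0 (1 / real (Suc n))"
      proof (rule subsetI, rule ComplI)
        fix x assume x: "x \<in> {x. ?d x \<noteq> 0}" "x \<in> ball 0 (1 / real (Suc n))"
        then have "norm (real (Suc n) *\<^sub>R x) \<le> 1" by (simp add: field_simps del: of_nat_Suc)
        then have "?d x = 0" unfolding f_def using \<kappa>(2) by simp
        then show False using x by simp
      qed
    qed (rule closed_Compl[OF open_ball])
    have cs: "compact (tsupport ?d)" "tsupport ?d \<subseteq> cball 0 R"
      by (rule compact_tsupport, erule dz)+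
    have "tsupport ?d \<inter> frontier \<Omega> \<subseteq> \<Gamma>"
    proof
      fix x assume x: "x \<in> tsupport ?d \<inter> frontier \<Omega>"
      then have "norm x \<le> R" "x \<noteq> 0" using cs(2) near by auto
      then have "x \<in> edge a \<union> edge b" using frontier_near_corner[of x] x R by auto
      then show "x \<in> \<Gamma>" using edge_subset(1)[of a] edge_subset(1)[of b] by auto
    qed
    from weak[OF d cs(1) this]
    have "traction_pairing lam \<mu> \<Omega> v fv ?d + ?J ?d = traction_pairing lam \<mu> \<Omega> w fw ?d"
      using boundary_form_eq(1)[of ?d] z C_k_continuous[OF smoothD[OF d, of 0]] by simp
    moreover have "?J ?d = ?J \<phi> - ?J (f n)"
      unfolding bounded_bilinear.diff_right[OF bounded_bilinear_cdot] right_diff_distrib scaleR_diff_right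
      by (rule Bochner_Integration.integral_diff[OF ib1 ib2])
    ultimately show ?thesis
      by (simp add: traction_pairing_diff[OF v fv C1(1,2)] traction_pairing_diff[OF w fw C1(1,2)])
  qed
  have l: "(\<lambda>n. traction_pairing lam \<mu> \<Omega> v fv \<phi> - traction_pairing lam \<mu> \<Omega> v fv (f n) + (?J \<phi> - ?J (f n)))
      \<longlonglongrightarrow> traction_pairing lam \<mu> \<Omega> v fv \<phi> - 0 + (?J \<phi> - (LINT x|bd. 0))"
    by (intro tendsto_intros lims limJ)
  have r: "(\<lambda>n. traction_pairing lam \<mu> \<Omega> w fw \<phi> - traction_pairing lam \<mu> \<Omega> w fw (f n))
      \<longlonglongrightarrow> traction_pairing lam \<mu> \<Omega> w fw \<phi> - 0"
    by (intro tendsto_intros lims)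
  show ?thesis using LIMSEQ_unique[OF l[unfolded eq] r] by simp
qed

text \<open>\<open>Green_trace\<close> along either edge direction has the same boundary term for
  \<open>v\<close> and \<open>w\<close>, as their traces agree on the edges. The two resulting
  equations are independent because \<open>sin (b - a)\<close> is nonzero, so the edge terms cancel
  in every coordinate direction.\<close>

lemma Green_difference:
  fixes \<psi> :: "real^2 \<Rightarrow> complex"
  assumes \<psi>: "C_k 1 \<psi>" "\<And>x. norm x \<ge> R \<Longrightarrow> \<psi> x = 0" and R: "R < h"
  shows "(LINT x|lebesgue_on \<Omega>. \<psi> x * weak_partial \<Omega> l w x $ i) - (LINT x|lebesgue_on \<Omega>. \<psi> x * weak_partial \<Omega> l v x $ i)
    = (LINT x|lebesgue_on \<Omega>. partial l \<psi> x * (v x - w x) $ i)"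
proof -
  define X where "X u l = (LINT x|lebesgue_on \<Omega>. \<psi> x * weak_partial \<Omega> l u x $ i) + (LINT x|lebesgue_on \<Omega>. partial l \<psi> x * u x $ i)" for u l
  have L: "L2 (lebesgue_on \<Omega>) (partial l \<psi>)" for l by (rule has_weak_partial_C1(1)[OF \<psi>(1) open_\<Omega> bounded_\<Omega>])
  have v2: "L2 (lebesgue_on \<Omega>) v" "L2 (lebesgue_on \<Omega>) w" using v w by (auto simp: H1_def)
  have int: "integrable (lebesgue_on \<Omega>) (\<lambda>x. partial l \<psi> x * u x $ i)" if "L2 (lebesgue_on \<Omega>) u" for u l
    using integrable_bilinear_L2[OF bounded_bilinear_mult_nth L that] by (simp add: mult_nth_def)
  have G: "of_real (cos s) * X u 1 + of_real (sin s) * X u 2 = - sin (b - a) *\<^sub>R (LINT x|bd. (indicator (edge t) x *\<^sub>R \<psi> x) * tu x $ i)"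
    if "(s, t) \<in> {(a, b), (b, a)}" "H1 \<Omega> u" "has_trace \<Omega> u tu" for s t u tu
  proof -
    have "L2 (lebesgue_on \<Omega>) u" using that by (simp add: H1_def)
    then have "(LINT x|lebesgue_on \<Omega>. dird (dir s) \<psi> x * u x $ i)
        = of_real (cos s) * (LINT x|lebesgue_on \<Omega>. partial 1 \<psi> x * u x $ i) + of_real (sin s) * (LINT x|lebesgue_on \<Omega>. partial 2 \<psi> x * u x $ i)"
      using int[of u] by (simp add: dird_def scaleR_conv_of_real distrib_right mult.assoc)
    moreover have "of_real (cos s) * (LINT x|lebesgue_on \<Omega>. \<psi> x * weak_partial \<Omega> 1 u x $ i)
        + of_real (sin s) * (LINT x|lebesgue_on \<Omega>. \<psi> x * weak_partial \<Omega> 2 u x $ i)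
        + (LINT x|lebesgue_on \<Omega>. dird (dir s) \<psi> x * u x $ i)
      = - sin (b - a) *\<^sub>R (LINT x|bd. (indicator (edge t) x *\<^sub>R \<psi> x) * tu x $ i)"
      by (rule Green_trace[OF that \<psi>(1) _ R]) (rule \<psi>(2))
    ultimately show ?thesis by (simp add: X_def algebra_simps)
  qed
  have bdeq: "(LINT x|bd. (indicator (edge t) x *\<^sub>R \<psi> x) * tv x $ i) = (LINT x|bd. (indicator (edge t) x *\<^sub>R \<psi> x) * tw x $ i)"
    if t: "t \<in> {a, b}" for t
  proof (rule integral_cong_AE)
    have t2: "L2 bd tv" "L2 bd tw" using tv tw by (auto simp: has_trace_def)
    have e2: "L2 bd (\<lambda>x. indicator (edge t) x *\<^sub>R \<psi> x)"
      by (rule indicator_edge_L2[OF continuous_L2_bd[OF C_k_continuous[OF \<psi>(1)]]])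
    show "(\<lambda>x. (indicator (edge t) x *\<^sub>R \<psi> x) * tv x $ i) \<in> borel_measurable bd"
      "(\<lambda>x. (indicator (edge t) x *\<^sub>R \<psi> x) * tw x $ i) \<in> borel_measurable bd"
      using integrable_bilinear_L2[OF bounded_bilinear_mult_nth e2 t2(1), of i, THEN borel_measurable_integrable]
        integrable_bilinear_L2[OF bounded_bilinear_mult_nth e2 t2(2), of i, THEN borel_measurable_integrable]
      unfolding mult_nth_def by auto
    show "AE x in bd. (indicator (edge t) x *\<^sub>R \<psi> x) * tv x $ i = (indicator (edge t) x *\<^sub>R \<psi> x) * tw x $ i"
      using AE_\<Gamma>_imp_bd[OF tvw] by eventually_elim (use edge_subset(1)[OF t] in \<open>auto split: split_indicator\<close>)
  qed
  define Y where "Y l = X v l - X w l" for l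
  have Y: "of_real (cos s) * Y 1 + of_real (sin s) * Y 2 = 0" if s: "s \<in> {a, b}" for s
  proof -
    obtain t where st: "(s, t) \<in> {(a, b), (b, a)}" using s by blast
    then have "t \<in> {a, b}" by auto
    then show ?thesis using G[OF st v tv] G[OF st w tw] bdeq by (simp add: Y_def algebra_simps)
  qed
  have Ya: "of_real (cos a) * Y 1 + of_real (sin a) * Y 2 = 0" and Yb: "of_real (cos b) * Y 1 + of_real (sin b) * Y 2 = 0"
    using Y[of a] Y[of b] by auto
  have sn: "of_real (sin (b - a)) = of_real (sin b) * of_real (cos a) - of_real (cos b) * (of_real (sin a) :: complex)"
    by (simp only: sin_diff of_real_diff of_real_mult)
  \<comment> \<open>Cramer's rule, with \<open>sin (b - a)\<close> as the determinant of the two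
    edge directions.\<close>
  have "of_real (sin (b - a)) * Y 1 = of_real (sin b) * (of_real (cos a) * Y 1 + of_real (sin a) * Y 2)
      - of_real (sin a) * (of_real (cos b) * Y 1 + of_real (sin b) * Y 2)"
    unfolding sn by (simp only: algebra_simps)
  then have "Y 1 = 0" unfolding Ya Yb using sin_neq_0 by simp
  have "of_real (sin (b - a)) * Y 2 = of_real (cos a) * (of_real (cos b) * Y 1 + of_real (sin b) * Y 2)
      - of_real (cos b) * (of_real (cos a) * Y 1 + of_real (sin a) * Y 2)"
    unfolding sn by (simp only: algebra_simps)
  then have "Y 2 = 0" unfolding Ya Yb using sin_neq_0 by simp
  with \<open>Y 1 = 0\<close> have "X v l = X w l" using exhaust_2[of l] by (auto simp: Y_def)
  then show ?thesis
    using int[OF v2(1), of l] int[OF v2(2), of l] by (simp add: X_def right_diff_distrib algebra_simps)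
qed

end

section \<open>Test fields concentrating at the vertex\<close>

lemma imag_unit_cases: assumes "I * I = - (1 :: complex)" shows "I = \<i> \<or> I = - \<i>"
proof -
  have "(I - \<i>) * (I + \<i>) = 0" using assms by (simp add: algebra_simps)
  then show ?thesis by (auto simp: eq_neg_iff_add_eq_0)
qed

lemma norm_imag_unit: "I * I = - (1 :: complex) \<Longrightarrow> norm I = 1"
  using imag_unit_cases[of I] by auto

definition pole_factor :: "complex \<Rightarrow> real \<Rightarrow> real^2 \<Rightarrow> complex" where
  "pole_factor I t x = 1 + of_real t * (of_real (x $ 1) + I * of_real (x $ 2))"

text \<open>The squared modulus of \<open>pole_factor\<close> for either sign of \<open>I\<close>,
  written as a real polynomial.\<close>

definition pole_norm2 :: "real \<Rightarrow> real^2 \<Rightarrow> real" where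
  "pole_norm2 t x = (1 + t * x $ 1)\<^sup>2 + (t * x $ 2)\<^sup>2"

lemma pole_factor_mult:
  assumes "I * I = - 1"
  shows "pole_factor I t x * pole_factor (- I) t x = of_real (pole_norm2 t x)"
proof -
  have "pole_factor I t x * pole_factor (- I) t x = (1 + of_real t * of_real (x $ 1))\<^sup>2 - (I * I) * (of_real t * of_real (x $ 2))\<^sup>2"
    unfolding pole_factor_def by (simp add: algebra_simps power2_eq_square)
  then show ?thesis using assms by (simp add: pole_norm2_def)
qed

lemma norm_pole_factor: "I * I = - 1 \<Longrightarrow> norm (pole_factor I t x) = sqrt (pole_norm2 t x)"
  using imag_unit_cases[of I] by (auto simp: pole_factor_def pole_norm2_def cmod_def)

text \<open>Away from the pole this is \<open>1 / pole_factor I t x\<close>; the bump makes it smooth on the plane.\<close>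

definition pole_inverse :: "real \<Rightarrow> complex \<Rightarrow> real \<Rightarrow> real^2 \<Rightarrow> complex" where
  "pole_inverse c I t x = pole_factor (- I) t x * inverse (of_real (pole_norm2 t x + bump (c - pole_norm2 t x)))"

lemma C_k_pole_factor: "C_k n (pole_factor I t)"
  unfolding pole_factor_def
  by (intro C_k_add C_k_mult C_k_const C_k_of_real C_k_coord)

lemma C_k_pole_norm2: "C_k n (pole_norm2 t)"
  unfolding pole_norm2_def
  by (intro C_k_add C_k_power C_k_mult C_k_const C_k_coord)

text \<open>Where the squared modulus is below \<open>c\<close> the bump is positive, elsewhere the
  squared modulus itself is; the denominator therefore vanishes nowhere, not even at the
  pole.\<close>

lemma C_k_pole_inverse:
  assumes "0 < c" shows "C_k n (pole_inverse c I t)"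
proof -
  have "pole_norm2 t x + bump (c - pole_norm2 t x) > 0" for x
  proof (cases "pole_norm2 t x < c")
    case True
    then have "bump (c - pole_norm2 t x) > 0" by (simp add: bump_pos_iff)
    moreover have "pole_norm2 t x \<ge> 0" by (simp add: pole_norm2_def)
    ultimately show ?thesis by linarith
  next
    case False
    then show ?thesis using assms bump_nonneg[of "c - pole_norm2 t x"] by linarith
  qed
  then have "(of_real (pole_norm2 t x + bump (c - pole_norm2 t x)) :: complex) \<noteq> 0" for x
    by (metis less_irrefl of_real_eq_0_iff)
  then show ?thesis unfolding pole_inverse_def
    by (intro C_k_mult C_k_pole_factor C_k_inverse C_k_of_real C_k_add C_k_pole_norm2 C_k_bump C_k_diff C_k_const)
qed

lemma pole_inverse_eq:
  assumes "I * I = - 1" "0 < c" "c \<le> pole_norm2 t x"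
  shows "pole_inverse c I t x = inverse (pole_factor I t x)" "pole_factor I t x \<noteq> 0"
proof -
  have b: "bump (c - pole_norm2 t x) = 0" using assms by (simp add: bump_eq_0_iff)
  have p: "pole_norm2 t x > 0" using assms by linarith
  have m: "pole_factor I t x * pole_factor (- I) t x = of_real (pole_norm2 t x)" by (rule pole_factor_mult[OF assms(1)])
  with p show nz: "pole_factor I t x \<noteq> 0" by auto
  have "pole_factor (- I) t x \<noteq> 0" using m p by auto
  then show "pole_inverse c I t x = inverse (pole_factor I t x)"
    unfolding pole_inverse_def b by (simp add: m[symmetric] nz field_simps)
qed

text \<open>The gradient of \<open>x\<^sub>1 + I x\<^sub>2\<close>. The squares of its two entries
  add up to 0, which makes holomorphic functions of that variable harmonic.\<close>

definition dcoef :: "complex \<Rightarrow> 2 \<Rightarrow> complex" where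
  "dcoef I k = (if k = 1 then 1 else I)"

lemma partial_pole_factor: "pole_factor I t differentiable (at x)" "partial k (pole_factor I t) x = of_real t * dcoef I k"
proof -
  have *: "(pole_factor I t has_derivative (\<lambda>d. of_real t * (of_real (d $ 1) + I * of_real (d $ 2)))) (at x)"
    unfolding pole_factor_def
    by (auto intro!: derivative_eq_intros bounded_linear.has_derivative[OF bounded_linear_of_real] bounded_linear.has_derivative[OF bounded_linear_vec_nth])
  then show "pole_factor I t differentiable (at x)" by (auto simp: differentiable_def)
  show "partial k (pole_factor I t) x = of_real t * dcoef I k"
    unfolding partial_eq[OF *] using exhaust_2[of k] by (auto simp: dcoef_def axis_def)
qed

lemma partial_inverse:
  fixes f :: "real^2 \<Rightarrow> complex"
  assumes "f differentiable (at x)" "f x \<noteq> 0"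
  shows "(\<lambda>x. inverse (f x)) differentiable (at x)" "partial k (\<lambda>x. inverse (f x)) x = - partial k f x * (inverse (f x))\<^sup>2"
proof -
  note * = Deriv.has_derivative_inverse[OF assms(2) frechet_derivative_works[THEN iffD1, OF assms(1)]]
  then show "(\<lambda>x. inverse (f x)) differentiable (at x)" unfolding differentiable_def by blast
  show "partial k (\<lambda>x. inverse (f x)) x = - partial k f x * (inverse (f x))\<^sup>2"
    unfolding partial_eq[OF *] by (simp add: partial_def power2_eq_square algebra_simps)
qed

lemma partial_power:
  fixes f :: "real^2 \<Rightarrow> complex"
  assumes "f differentiable (at x)"
  shows "(\<lambda>x. f x ^ n) differentiable (at x)" "partial k (\<lambda>x. f x ^ n) x = of_nat n * f x ^ (n - 1) * partial k f x"
proof -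
  note * = has_derivative_power[OF frechet_derivative_works[THEN iffD1, OF assms], of n]
  then show "(\<lambda>x. f x ^ n) differentiable (at x)" unfolding differentiable_def by blast
  show "partial k (\<lambda>x. f x ^ n) x = of_nat n * f x ^ (n - 1) * partial k f x"
    unfolding partial_eq[OF *] by (simp add: partial_def algebra_simps)
qed

lemma partial_off_zero:
  fixes f :: "real^2 \<Rightarrow> 'a::real_normed_vector"
  assumes "norm x < r" "\<And>x. norm x \<le> r \<Longrightarrow> f x = c"
  shows "partial k f x = 0"
proof -
  have "partial k f x = partial k (\<lambda>_. c) x"
    by (rule partial_cong_open(1)[of "ball 0 r"]) (use assms in \<open>auto intro: differentiable_const\<close>)
  then show ?thesis by (simp add: partial_eq[OF has_derivative_const])
qed

section \<open>The test field and its pole relative to the sector\<close>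

context corner
begin

text \<open>A lower bound for the cosine on the sector, where it is least at an end of the angular
  interval. It exceeds -1 because neither side points along the negative real axis.\<close>

definition kap :: real where "kap = min 0 (min (cos a) (cos b))"

text \<open>The constant comes from the identity \<open>1 + 2 s k + s\<^sup>2 = (1+k)/2
  (1+s)\<^sup>2 + (1-k)/2 (1-s)\<^sup>2\<close> with \<open>k = kap\<close>, whose last term is
  dropped.\<close>

definition c0 :: real where "c0 = (1 + kap) / 2"

lemma c0_pos: "0 < c0"
proof -
  have "cos a > -1" "cos b > -1"
  proof -
    have gt: "cos x > -1" if "- pi < x" "x < pi" for x
    proof -
      have "cos \<bar>x\<bar> > cos pi" using that by (intro cos_monotone_0_pi) auto
      then show ?thesis by simp
    qed
    show "cos a > -1" "cos b > -1" using ab by (auto intro!: gt)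
  qed
  then show ?thesis by (simp add: c0_def kap_def)
qed

lemma cos_ge_kap:
  assumes "a \<le> t" "t \<le> b" shows "kap \<le> cos t"
proof -
  have "\<bar>t\<bar> \<le> max \<bar>a\<bar> \<bar>b\<bar>" using assms by auto
  moreover have "max \<bar>a\<bar> \<bar>b\<bar> \<le> pi" using ab by auto
  ultimately have "cos (max \<bar>a\<bar> \<bar>b\<bar>) \<le> cos \<bar>t\<bar>" by (intro cos_monotone_0_pi_le) auto
  moreover have "kap \<le> cos (max \<bar>a\<bar> \<bar>b\<bar>)" by (auto simp: kap_def max_def)
  ultimately show ?thesis by simp
qed

text \<open>By the law of cosines the squared modulus is
  \<open>1 + 2 s cos \<theta> + s\<^sup>2\<close> with \<open>s = t * r\<close>. Hence
  \<open>pole_factor\<close> is bounded below by a multiple of \<open>1 + t * norm x\<close> on the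
  closed sector, uniformly in \<open>t\<close>.\<close>

lemma pole_norm2_ge:
  assumes "a \<le> \<theta>" "\<theta> \<le> b" "0 \<le> r" "0 \<le> t"
  shows "c0 * (1 + t * r)\<^sup>2 \<le> pole_norm2 t (r *\<^sub>R dir \<theta>)"
proof -
  let ?s = "t * r"
  have s: "0 \<le> ?s" using assms by simp
  have k: "kap \<le> 0" by (simp add: kap_def)
  have sc: "(sin \<theta>)\<^sup>2 = 1 - (cos \<theta>)\<^sup>2" by (simp add: sin_squared_eq)
  have "pole_norm2 t (r *\<^sub>R dir \<theta>) = (1 + ?s * cos \<theta>)\<^sup>2 + (?s * sin \<theta>)\<^sup>2"
    by (simp add: pole_norm2_def mult.assoc)
  also have "\<dots> = 1 + 2 * ?s * cos \<theta> + ?s\<^sup>2 * ((cos \<theta>)\<^sup>2 + (sin \<theta>)\<^sup>2)"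
    unfolding distrib_left power2_sum power_mult_distrib by simp
  finally have "pole_norm2 t (r *\<^sub>R dir \<theta>) = 1 + 2 * ?s * cos \<theta> + ?s\<^sup>2 * ((cos \<theta>)\<^sup>2 + (sin \<theta>)\<^sup>2)" .
  then have eq: "pole_norm2 t (r *\<^sub>R dir \<theta>) = 1 + 2 * ?s * cos \<theta> + ?s\<^sup>2" by (simp add: sc)
  have "?s * kap \<le> ?s * cos \<theta>" by (rule mult_left_mono[OF cos_ge_kap[OF assms(1,2)] s])
  then have "1 + 2 * ?s * kap + ?s\<^sup>2 \<le> pole_norm2 t (r *\<^sub>R dir \<theta>)" unfolding eq by simp
  moreover have "1 + 2 * ?s * kap + ?s\<^sup>2 - c0 * (1 + ?s)\<^sup>2 = (1 - kap) / 2 * (1 - ?s)\<^sup>2"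
    by (simp add: c0_def power2_eq_square field_simps)
  moreover have "0 \<le> (1 - kap) / 2 * (1 - ?s)\<^sup>2" using k by simp
  ultimately show ?thesis by linarith
qed

text \<open>Described in polar coordinates so as to include the edges and the vertex, where the
  bounds for the edge integrals are taken.\<close>

definition closed_sector where "closed_sector = {r *\<^sub>R dir \<theta> |r \<theta>. 0 \<le> r \<and> a \<le> \<theta> \<and> \<theta> \<le> b}"

lemma S_closed_sector: "S \<subseteq> closed_sector"
proof
  fix x assume "x \<in> S"
  then have "a \<le> angle x" "angle x \<le> b" by (auto simp: S_def sector_def)
  then show "x \<in> closed_sector" unfolding closed_sector_def using polar_angle[of x] norm_ge_zero[of x] by blast
qed

lemma edge_closed_sector: "t \<in> {a, b} \<Longrightarrow> 0 \<le> r \<Longrightarrow> r *\<^sub>R dir t \<in> closed_sector"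
  using ab unfolding closed_sector_def by fastforce

abbreviation E where "E I t \<equiv> pole_inverse c0 I t"

lemma closed_sector_pole:
  assumes x: "x \<in> closed_sector" and t: "0 \<le> t" and I: "I * I = - 1"
  shows "E I t x = inverse (pole_factor I t x)" "pole_factor I t x \<noteq> 0"
    "norm (E I t x) \<le> 1 / (sqrt c0 * (1 + t * norm x))"
proof -
  obtain r \<theta> where r: "x = r *\<^sub>R dir \<theta>" "0 \<le> r" "a \<le> \<theta>" "\<theta> \<le> b" using x by (auto simp: closed_sector_def)
  have n: "norm x = r" using r by simp
  have ge: "c0 * (1 + t * norm x)\<^sup>2 \<le> pole_norm2 t x"
    unfolding n unfolding r(1) by (rule pole_norm2_ge[OF r(3,4,2) t])
  have "1 \<le> (1 + t * norm x)\<^sup>2" using t by (intro one_le_power) auto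
  then have "c0 * 1 \<le> c0 * (1 + t * norm x)\<^sup>2" using c0_pos by (intro mult_left_mono) auto
  then have c: "c0 \<le> pole_norm2 t x" using ge by simp
  show eq: "E I t x = inverse (pole_factor I t x)" and nz: "pole_factor I t x \<noteq> 0"
    by (rule pole_inverse_eq[OF I c0_pos c])+
  have "sqrt c0 * (1 + t * norm x) = sqrt (c0 * (1 + t * norm x)\<^sup>2)"
    using t c0_pos by (simp add: real_sqrt_mult)
  also have "\<dots> \<le> sqrt (pole_norm2 t x)" using ge by simp
  finally have "sqrt c0 * (1 + t * norm x) \<le> norm (pole_factor I t x)" by (simp add: norm_pole_factor[OF I])
  moreover have "0 < sqrt c0 * (1 + t * norm x)" using c0_pos t by (intro mult_pos_pos) (auto intro: add_pos_nonneg)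
  ultimately have "inverse (norm (pole_factor I t x)) \<le> inverse (sqrt c0 * (1 + t * norm x))"
    by (rule le_imp_inverse_le)
  then show "norm (E I t x) \<le> 1 / (sqrt c0 * (1 + t * norm x))"
    by (simp only: eq norm_inverse) (simp only: inverse_eq_divide)
qed

lemma E_differentiable: "E I t differentiable (at x)"
  using C_k_pole_inverse[OF c0_pos, of 1 I t] by simp

text \<open>Restricted to the open set \<open>S\<close>, since differentiating needs a neighbourhood
  on which the smoothed inverse is the true one.\<close>

lemma partial_E:
  assumes x: "x \<in> S" and t: "0 \<le> t" and I: "I * I = - 1"
  shows "partial k (E I t) x = - of_real t * dcoef I k * (E I t x)\<^sup>2"
proof -
  note cs = closed_sector_pole[OF subsetD[OF S_closed_sector] t I]
  have "partial k (E I t) x = partial k (\<lambda>y. inverse (pole_factor I t y)) x"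
    by (rule partial_cong_open(1)[OF open_S x cs(1) partial_inverse(1)[OF partial_pole_factor(1) cs(2)[OF x]]])
  also have "\<dots> = - (of_real t * dcoef I k) * (inverse (pole_factor I t x))\<^sup>2"
    by (simp add: partial_inverse(2)[OF partial_pole_factor(1) cs(2)[OF x]] partial_pole_factor(2))
  finally show ?thesis by (simp add: cs(1)[OF x])
qed

text \<open>Named after complex geometrical optics solutions, whose role this field takes.\<close>

definition cgo :: "(real^2 \<Rightarrow> real) \<Rightarrow> complex \<Rightarrow> real \<Rightarrow> real^2 \<Rightarrow> complex" where
  "cgo c I t x = of_real (c x) * E I t x ^ 3"

lemma smooth_cgo: "smooth c \<Longrightarrow> smooth (cgo c I t)"
  unfolding cgo_def
  by (rule smoothI) (intro C_k_mult C_k_of_real C_k_power C_k_pole_inverse c0_pos, erule smoothD)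

lemma partial_of_real:
  fixes f :: "real^2 \<Rightarrow> real"
  assumes "f differentiable (at x)"
  shows "(\<lambda>x. of_real (f x) :: complex) differentiable (at x)" "partial k (\<lambda>x. of_real (f x) :: complex) x = of_real (partial k f x)"
  using bounded_linear.has_derivative[OF bounded_linear_of_real frechet_derivative_works[THEN iffD1, OF assms]]
    partial_linear[OF bounded_linear_of_real assms, of k] by (auto simp: differentiable_def)

lemma partial_times_E_power:
  assumes x: "x \<in> S" and t: "0 \<le> t" and I: "I * I = - 1" and f: "f differentiable (at x)"
  shows "(\<lambda>x. of_real (f x) * E I t x ^ n) differentiable (at x)"
    "partial k (\<lambda>x. of_real (f x) * E I t x ^ n) x
      = of_real (partial k f x) * E I t x ^ n - of_nat n * of_real t * dcoef I k * (of_real (f x) * E I t x ^ Suc n)"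
proof -
  note d = partial_of_real(1)[OF f] partial_power(1)[OF E_differentiable, of I t n x]
  show "(\<lambda>x. of_real (f x) * E I t x ^ n) differentiable (at x)" by (rule differentiable_mult[OF d])
  have e: "of_nat n * E I t x ^ (n - 1) * (- of_real t * dcoef I k * (E I t x)\<^sup>2)
      = - (of_nat n * of_real t * dcoef I k * E I t x ^ Suc n)"
    by (cases n) (auto simp: power2_eq_square algebra_simps)
  show "partial k (\<lambda>x. of_real (f x) * E I t x ^ n) x
      = of_real (partial k f x) * E I t x ^ n - of_nat n * of_real t * dcoef I k * (of_real (f x) * E I t x ^ Suc n)"
    unfolding partial_bilinear[OF bounded_bilinear_mult d] partial_of_real(2)[OF f]
      partial_power(2)[OF E_differentiable] partial_E[OF x t I]
    unfolding e by (simp only: mult_ac diff_conv_add_uminus mult_minus_right add.commute)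
qed

text \<open>The coefficients 3 and 12 = 3 times 4 come from differentiating the powers. Where the
  cutoff is constant only the last term is left, and it depends on the directions only through the
  product of two \<open>dcoef\<close>.\<close>

lemma second_partial_cgo:
  assumes c: "smooth c" and x: "x \<in> S" and t: "0 \<le> t" and I: "I * I = - 1"
  shows "partial l (partial k (cgo c I t)) x
    = of_real (partial l (partial k c) x) * E I t x ^ 3
      - 3 * of_real t * (dcoef I l * of_real (partial k c x) + dcoef I k * of_real (partial l c x)) * E I t x ^ 4
      + 12 * (of_real t)\<^sup>2 * (dcoef I k * dcoef I l) * (of_real (c x) * E I t x ^ 5)"
proof -
  have C: "c differentiable (at y)" "partial k c differentiable (at y)" for y
    using smoothD[OF c, of 1] smoothD[OF smooth_partial[OF c, of k], of 1] by auto
  let ?h = "\<lambda>y. of_real (partial k c y) * E I t y ^ 3 - (3 * of_real t * dcoef I k) * (of_real (c y) * E I t y ^ 4)"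
  have 1: "partial k (cgo c I t) y = ?h y" if "y \<in> S" for y
    unfolding cgo_def using partial_times_E_power(2)[OF that t I C(1), where k = k and n = 3] by simp
  note p3 = partial_times_E_power[OF x t I C(2), where n = 3]
  note p4 = partial_times_E_power[OF x t I C(1), where n = 4]
  have d4: "(\<lambda>y. (3 * of_real t * dcoef I k) * (of_real (c y) * E I t y ^ 4)) differentiable (at x)"
    by (rule differentiable_mult[OF differentiable_const p4(1)])
  have "partial l (partial k (cgo c I t)) x = partial l ?h x"
    by (rule partial_cong_open(1)[OF open_S x 1 differentiable_diff[OF p3(1) d4]])
  also have "\<dots> = partial l (\<lambda>y. of_real (partial k c y) * E I t y ^ 3) x
      - (3 * of_real t * dcoef I k) * partial l (\<lambda>y. of_real (c y) * E I t y ^ 4) x"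
    unfolding partial_diff[OF p3(1) d4] partial_linear[OF bounded_linear_mult_right p4(1)] ..
  finally show ?thesis unfolding p3(2) p4(2) by (simp add: algebra_simps power2_eq_square eval_nat_numeral)
qed

text \<open>The stress tensor of the vector field \<open>(g, I g)\<close>. By the symmetry of
  Hooke's law it can be paired with the gradient of a solution in place of the stress of the
  solution with the gradient of the field.\<close>

definition stress :: "real \<Rightarrow> real \<Rightarrow> complex \<Rightarrow> (real^2 \<Rightarrow> complex) \<Rightarrow> 2 \<Rightarrow> 2 \<Rightarrow> real^2 \<Rightarrow> complex" where
  "stress lam \<mu> I g l m x =
    (if l = 1 \<and> m = 1 then of_real (2 * \<mu> + lam) * partial 1 g x + of_real lam * I * partial 2 g x
     else if l = 2 \<and> m = 2 then of_real lam * partial 1 g x + of_real (2 * \<mu> + lam) * I * partial 2 g x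
     else of_real \<mu> * I * partial 1 g x + of_real \<mu> * partial 2 g x)"

lemma smooth_stress: "smooth g \<Longrightarrow> smooth (stress lam \<mu> I g l m)"
proof (rule smoothI)
  fix n assume "smooth g"
  then have g: "C_k n (partial k g)" for k using smooth_partial smoothD by blast
  have "stress lam \<mu> I g l m = (if l = 1 \<and> m = 1 then (\<lambda>x. of_real (2 * \<mu> + lam) * partial 1 g x + of_real lam * I * partial 2 g x)
     else if l = 2 \<and> m = 2 then (\<lambda>x. of_real lam * partial 1 g x + of_real (2 * \<mu> + lam) * I * partial 2 g x)
     else (\<lambda>x. of_real \<mu> * I * partial 1 g x + of_real \<mu> * partial 2 g x))"
    by (auto simp: stress_def fun_eq_iff)
  moreover have "C_k n \<dots>" by (auto intro!: C_k_add C_k_mult C_k_const g)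
  ultimately show "C_k n (stress lam \<mu> I g l m)" by simp
qed

lemma partial_lincomb:
  fixes f g :: "real^2 \<Rightarrow> complex"
  assumes "f differentiable (at x)" "g differentiable (at x)"
  shows "partial k (\<lambda>x. p * f x + q * g x) x = p * partial k f x + q * partial k g x"
proof -
  have d: "(\<lambda>x. p * f x) differentiable (at x)" "(\<lambda>x. q * g x) differentiable (at x)"
    using assms by (auto intro: differentiable_mult differentiable_const)
  show ?thesis
    using partial_add[OF d] partial_linear[OF bounded_linear_mult_right assms(1), of k p] partial_linear[OF bounded_linear_mult_right assms(2), of k q] by simp
qed

text \<open>The holomorphic part of the test field is a Lame solution, so only terms with derivatives of
  the cutoff survive in the divergence of its stress, and these live away from the vertex.\<close>

lemma div_stress_cgo_bound:
  assumes c: "smooth c" "\<And>x. norm x \<le> r0 \<Longrightarrow> c x = 1" "\<And>x. norm x \<ge> R \<Longrightarrow> c x = 0" and r0: "0 < r0"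
    and I: "I * I = - 1"
  obtains C where "0 \<le> C"
    "\<And>t m x. 1 \<le> t \<Longrightarrow> x \<in> S \<Longrightarrow>
      norm (partial 1 (stress lam \<mu> I (cgo c I t) 1 m) x + partial 2 (stress lam \<mu> I (cgo c I t) 2 m) x) \<le> C / t ^ 3"
proof -
  have sm: "smooth (partial k c)" "smooth (partial l (partial k c))" for k l using smooth_partial c(1) by auto
  have z1: "partial k c x = 0" if "norm x \<ge> R + 1" for k x
    using dird_eq_0[OF smoothD[OF c(1)] c(3), where x = x and p = "axis k 1"] that by (simp add: partial_eq_dird)
  have z2: "partial l (partial k c) x = 0" if "norm x \<ge> R + 2" for k l x
    using dird_eq_0[OF smoothD[OF sm(1)], of "R + 1" k x "axis l 1"] z1 that by (simp add: partial_eq_dird[symmetric])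
  have cont: "continuous_on UNIV (partial k c)" "continuous_on UNIV (partial l (partial k c))" for k l
    using C_k_continuous[OF smoothD[OF sm(1), of 0]] C_k_continuous[OF smoothD[OF sm(2), of 0]] by auto
  have "\<exists>B. 0 \<le> B \<and> (\<forall>x. norm (partial k c x) \<le> B)" for k
    by (rule bounded_if_zero_outside[OF cont(1)], erule z1, blast)
  then obtain B1 where B1: "\<And>k. 0 \<le> B1 k" "\<And>k x. norm (partial k c x) \<le> B1 k" by metis
  have "\<exists>B. 0 \<le> B \<and> (\<forall>x. norm (partial (fst kl) (partial (snd kl) c) x) \<le> B)" for kl :: "2 \<times> 2"
    by (rule bounded_if_zero_outside[OF cont(2)], erule z2, blast)
  then obtain B2 where B2: "\<And>kl. 0 \<le> B2 kl" "\<And>kl x. norm (partial (fst kl) (partial (snd kl) c) x) \<le> B2 kl" by metis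
  define B where "B = (\<Sum>k\<in>UNIV. B1 k) + (\<Sum>kl\<in>UNIV. B2 kl)"
  have B0: "0 \<le> B" unfolding B_def using B1 B2 by (intro add_nonneg_nonneg sum_nonneg) auto
  have B: "\<bar>partial k c x\<bar> \<le> B" "\<bar>partial l (partial k c) x\<bar> \<le> B" for k l x
  proof -
    have "B1 k \<le> (\<Sum>k\<in>UNIV. B1 k)" "B2 (l, k) \<le> (\<Sum>kl\<in>UNIV. B2 kl)"
      using B1 B2 by (auto intro!: member_le_sum)
    moreover have "0 \<le> (\<Sum>k\<in>UNIV. B1 k)" "0 \<le> (\<Sum>kl\<in>UNIV. B2 kl)" using B1 B2 by (auto intro!: sum_nonneg)
    ultimately show "\<bar>partial k c x\<bar> \<le> B" "\<bar>partial l (partial k c) x\<bar> \<le> B"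
      using B1(2)[of k x] B2(2)[of "(l, k)" x] unfolding B_def by auto
  qed
  define s where "s = sqrt c0 * r0"
  have s: "0 < s" using c0_pos r0 by (simp add: s_def)
  \<comment> \<open>Off the ball of radius \<open>r0\<close> the factor \<open>E I t x\<close> is at
    most \<open>1 / (s * t)\<close>: the cubic terms give \<open>t\<close> to the power -3, and the
    quartic ones carry a prefactor \<open>t\<close> and give the same power.\<close>
  define K where "K = B / s ^ 3 + 6 * B / s ^ 4"
  have K0: "0 \<le> K" using B0 s by (simp add: K_def)
  define M where "M = \<bar>2 * \<mu> + lam\<bar> + \<bar>lam\<bar> + 2 * \<bar>\<mu>\<bar>"
  have nI: "norm I = 1" by (rule norm_imag_unit[OF I])
  have nd: "norm (dcoef I k) = 1" for k by (simp add: dcoef_def nI)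
  have main: "norm (partial 1 (stress lam \<mu> I (cgo c I t) 1 m) x + partial 2 (stress lam \<mu> I (cgo c I t) 2 m) x) \<le> M * K / t ^ 3"
    if t: "1 \<le> t" and x: "x \<in> S" for t m x
  proof -
    let ?g = "cgo c I t"
    have t0: "0 \<le> t" using t by simp
    let ?e = "E I t x"
    \<comment> \<open>\<open>Rm\<close> collects the terms with derivatives of the cutoff; what
      remains is \<open>T\<close> times the product of two \<open>dcoef\<close>.\<close>
    define Rm where "Rm k l = of_real (partial l (partial k c) x) * ?e ^ 3
      - 3 * of_real t * (dcoef I l * of_real (partial k c x) + dcoef I k * of_real (partial l c x)) * ?e ^ 4" for k l
    define T where "T = 12 * (of_real t)\<^sup>2 * (of_real (c x) * ?e ^ 5)"
    have G: "partial l (partial k ?g) x = Rm k l + dcoef I k * dcoef I l * T" for k l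
      unfolding second_partial_cgo[OF c(1) x t0 I] Rm_def T_def by (simp only: algebra_simps)
    have d: "partial k ?g differentiable (at x)" for k
      using smoothD[OF smooth_partial[OF smooth_cgo[OF c(1), of I t], of k], of 1] by simp
    have II: "I * (I * z) = - z" for z using I by (simp add: mult.assoc[symmetric])
    have R: "norm (Rm k l) \<le> K / t ^ 3" for k l
    proof (cases "norm x < r0")
      case True
      have 1: "partial k c x = 0" if "norm x < r0" for k x
        by (rule partial_off_zero[OF that]) (rule c(2))
      have "partial l (partial k c) x = partial l (\<lambda>_. 0) x"
        by (rule partial_cong_open(1)[of "ball 0 r0"]) (use 1 True in \<open>auto intro: differentiable_const\<close>)
      then have "partial l (partial k c) x = 0" by (simp add: partial_eq[OF has_derivative_const])
      then show ?thesis using 1[OF True] K0 t by (simp add: Rm_def)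
    next
      case False
      have "norm ?e \<le> 1 / (sqrt c0 * (1 + t * norm x))"
        by (rule closed_sector_pole(3)[OF subsetD[OF S_closed_sector x] t0 I])
      also have "\<dots> \<le> 1 / (s * t)"
      proof (rule divide_left_mono)
        have "r0 * t \<le> norm x * t" using False t by (intro mult_right_mono) auto
        then have "r0 * t \<le> 1 + t * norm x" by (simp add: mult.commute)
        then show "s * t \<le> sqrt c0 * (1 + t * norm x)"
          unfolding s_def mult.assoc using c0_pos by (intro mult_left_mono) auto
        then show "0 < sqrt c0 * (1 + t * norm x) * (s * t)"
          using s t less_le_trans[of 0 "s * t" "sqrt c0 * (1 + t * norm x)"] by (intro mult_pos_pos[of _ "s * t"]) auto
      qed (use s t in auto)
      finally have e: "norm ?e \<le> 1 / (s * t)" .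
      have e3: "norm ?e ^ 3 \<le> (1 / (s * t)) ^ 3" and e4: "norm ?e ^ 4 \<le> (1 / (s * t)) ^ 4"
        using e by (auto intro: power_mono)
      have "norm (Rm k l) \<le> norm (of_real (partial l (partial k c) x) * ?e ^ 3)
        + norm (3 * of_real t * (dcoef I l * of_real (partial k c x) + dcoef I k * of_real (partial l c x)) * ?e ^ 4)"
        unfolding Rm_def by (rule norm_triangle_ineq4)
      also have "\<dots> \<le> B * (1 / (s * t)) ^ 3 + (3 * t * (2 * B)) * (1 / (s * t)) ^ 4"
      proof (rule add_mono)
        show "norm (of_real (partial l (partial k c) x) * ?e ^ 3) \<le> B * (1 / (s * t)) ^ 3"
          unfolding norm_mult norm_power norm_of_real by (intro mult_mono B e3) (use B0 in auto)
        have "norm (dcoef I l * of_real (partial k c x) + dcoef I k * of_real (partial l c x)) \<le> B + B"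
          by (rule order_trans[OF norm_triangle_ineq]) (use add_mono[OF B(1)[of k x] B(1)[of l x]] in \<open>simp add: norm_mult nd\<close>)
        then show "norm (3 * of_real t * (dcoef I l * of_real (partial k c x) + dcoef I k * of_real (partial l c x)) * ?e ^ 4)
          \<le> (3 * t * (2 * B)) * (1 / (s * t)) ^ 4"
          unfolding norm_mult[of _ "?e ^ 4"] norm_mult[of "3 * of_real t"] norm_power
          using t B0 by (intro mult_mono e4) auto
      qed
      also have "\<dots> = K / t ^ 3"
        using s t by (simp add: K_def field_simps eval_nat_numeral)
      finally show ?thesis .
    qed
    have comb: "norm (p1 * Rm 1 1 + p2 * Rm 2 1 + (p3 * Rm 1 2 + p4 * Rm 2 2)) \<le> (norm p1 + norm p2 + (norm p3 + norm p4)) * (K / t ^ 3)" for p1 p2 p3 p4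
    proof -
      have n: "norm (p * Rm k l) \<le> norm p * (K / t ^ 3)" for p k l
        unfolding norm_mult by (intro mult_left_mono R) auto
      have "norm (p1 * Rm 1 1 + p2 * Rm 2 1 + (p3 * Rm 1 2 + p4 * Rm 2 2))
        \<le> norm (p1 * Rm 1 1) + norm (p2 * Rm 2 1) + (norm (p3 * Rm 1 2) + norm (p4 * Rm 2 2))"
        by (intro norm_triangle_le add_mono norm_triangle_ineq)
      also have "\<dots> \<le> (norm p1 + norm p2 + (norm p3 + norm p4)) * (K / t ^ 3)"
        unfolding distrib_right by (intro add_mono n)
      finally show ?thesis .
    qed
    \<comment> \<open>\<open>T\<close> cancels: since \<open>I * I = - 1\<close>, its total
      coefficient is \<open>(2 * \<mu> + lam) - lam - 2 * \<mu>\<close> up to a unit factor, in both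
      components.\<close>
    have "partial 1 (stress lam \<mu> I ?g 1 m) x + partial 2 (stress lam \<mu> I ?g 2 m) x
        = (if m = 1 then of_real (2 * \<mu> + lam) * Rm 1 1 + of_real lam * I * Rm 2 1 + (of_real \<mu> * I * Rm 1 2 + of_real \<mu> * Rm 2 2)
           else of_real \<mu> * I * Rm 1 1 + of_real \<mu> * Rm 2 1 + (of_real lam * Rm 1 2 + of_real (2 * \<mu> + lam) * I * Rm 2 2))"
      using exhaust_2[of m]
    proof
      assume m: "m = 1"
      have st: "stress lam \<mu> I ?g 1 m = (\<lambda>x. of_real (2 * \<mu> + lam) * partial 1 ?g x + of_real lam * I * partial 2 ?g x)"
        "stress lam \<mu> I ?g 2 m = (\<lambda>x. of_real \<mu> * I * partial 1 ?g x + of_real \<mu> * partial 2 ?g x)"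
        using m by (simp_all add: stress_def fun_eq_iff)
      show ?thesis unfolding st partial_lincomb[OF d d] G using m
        by (simp add: dcoef_def algebra_simps II)
    next
      assume m: "m = 2"
      have st: "stress lam \<mu> I ?g 1 m = (\<lambda>x. of_real \<mu> * I * partial 1 ?g x + of_real \<mu> * partial 2 ?g x)"
        "stress lam \<mu> I ?g 2 m = (\<lambda>x. of_real lam * partial 1 ?g x + of_real (2 * \<mu> + lam) * I * partial 2 ?g x)"
        using m by (simp_all add: stress_def fun_eq_iff)
      show ?thesis unfolding st partial_lincomb[OF d d] G using m
        by (simp add: dcoef_def algebra_simps II)
    qed
    moreover have "norm (of_real (2 * \<mu> + lam) * Rm 1 1 + of_real lam * I * Rm 2 1 + (of_real \<mu> * I * Rm 1 2 + of_real \<mu> * Rm 2 2)) \<le> M * (K / t ^ 3)"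
      using comb[of "of_real (2 * \<mu> + lam)" "of_real lam * I" "of_real \<mu> * I" "of_real \<mu>"]
      by (simp add: norm_mult nI M_def del: of_real_add of_real_mult)
    moreover have "norm (of_real \<mu> * I * Rm 1 1 + of_real \<mu> * Rm 2 1 + (of_real lam * Rm 1 2 + of_real (2 * \<mu> + lam) * I * Rm 2 2)) \<le> M * (K / t ^ 3)"
      using comb[of "of_real \<mu> * I" "of_real \<mu>" "of_real lam" "of_real (2 * \<mu> + lam) * I"]
      by (simp add: norm_mult nI M_def add_ac del: of_real_add of_real_mult)
    ultimately show ?thesis by simp
  qed
  show ?thesis by (rule that[OF _ main]) (use K0 in \<open>auto simp: M_def\<close>)
qed

end

section \<open>Pairing with the vector \<open>(1, I)\<close>, and the kernel of the volume
  term\<close>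

definition pair_unit :: "complex \<Rightarrow> complex^2 \<Rightarrow> complex" where
  "pair_unit I u = u $ 1 + I * u $ 2"

lemma bounded_linear_pair_unit: "bounded_linear (pair_unit I)"
  unfolding pair_unit_def
  by (intro bounded_linear_add bounded_linear_vec_nth bounded_linear_compose[OF bounded_linear_mult_right bounded_linear_vec_nth])

lemma norm_pair_unit_le: "norm I = 1 \<Longrightarrow> norm (pair_unit I u) \<le> 2 * norm u"
proof -
  assume I: "norm I = 1"
  have "norm (pair_unit I u) \<le> norm (u $ 1) + norm (I * u $ 2)" unfolding pair_unit_def by (rule norm_triangle_ineq)
  also have "\<dots> \<le> norm u + norm u" unfolding norm_mult I mult_1 by (intro add_mono Finite_Cartesian_Product.norm_nth_le)
  finally show ?thesis by simp
qed

definition unit_field :: "complex \<Rightarrow> complex \<Rightarrow> complex^2" where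
  "unit_field I c = vector [c, I * c]"

lemma unit_field_nth [simp]: "unit_field I c $ 1 = c" "unit_field I c $ 2 = I * c"
  by (simp_all add: unit_field_def)

lemma bounded_linear_unit_field: "bounded_linear (unit_field I)"
  by (rule linear_conv_bounded_linear[THEN iffD1], rule linearI)
    (simp_all add: vec_eq_iff forall_2 algebra_simps)

lemma cdot_unit_field: "cdot u (unit_field I c) = c * pair_unit I u"
  by (simp add: cdot_def UNIV_2 pair_unit_def algebra_simps)

lemma integral_arctan_kernel:
  assumes "0 < t" "0 < h"
  shows "(\<integral>\<^sup>+x. ennreal (t / (1 + (t * x)\<^sup>2)) * indicator {-h..h} x \<partial>lborel) \<le> ennreal pi"
proof -
  have "(\<integral>\<^sup>+x. ennreal (t / (1 + (t * x)\<^sup>2)) * indicator {-h..h} x \<partial>lborel) = arctan (t * h) - arctan (t * (- h))"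
  proof (rule nn_integral_FTC_Icc)
    show "((\<lambda>x. arctan (t * x)) has_real_derivative t / (1 + (t * x)\<^sup>2)) (at x)" for x
      by (auto intro!: derivative_eq_intros simp: field_simps)
    show "0 \<le> t / (1 + (t * x)\<^sup>2)" for x using assms by (intro divide_nonneg_nonneg) (auto intro: add_nonneg_nonneg)
  qed (use assms in auto)
  also have "\<dots> \<le> ennreal pi"
    using arctan_ubound[of "t * h"] arctan_minus[of "t * h"] by (intro ennreal_leI) simp
  finally show ?thesis .
qed

text \<open>With \<open>r = t * norm x\<close>, the fourth power of \<open>1 + r\<close> dominates
  the product of \<open>1 + (t x\<^sub>1)\<^sup>2\<close> and
  \<open>1 + (t x\<^sub>2)\<^sup>2\<close>. The squared kernel thus lies below a product of two
  Cauchy kernels, each of integral at most pi, which makes the bound uniform in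
  \<open>t\<close>.\<close>

lemma L2_kernel_bound:
  fixes S \<Omega> :: "(real^2) set"
  assumes S: "open S" "S \<subseteq> ball 0 h" and t: "0 < t" and h: "0 < h" and \<Omega>: "open \<Omega>" "bounded \<Omega>"
  shows "L2 (lebesgue_on \<Omega>) (\<lambda>x. indicator S x * (t / (1 + t * norm x)\<^sup>2))"
    and "L2_norm (lebesgue_on \<Omega>) (\<lambda>x. indicator S x * (t / (1 + t * norm x)\<^sup>2)) \<le> pi"
proof -
  let ?k = "\<lambda>x::real^2. indicator S x * (t / (1 + t * norm x)\<^sup>2)"
  have cont: "continuous_on UNIV (\<lambda>x::real^2. t / (1 + t * norm x)\<^sup>2)"
  proof (intro continuous_intros ballI)
    fix x :: "real^2"
    have "0 < 1 + t * norm x" using t by (intro add_pos_nonneg) auto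
    then show "(1 + t * norm x)\<^sup>2 \<noteq> 0" by simp
  qed
  have m: "?k \<in> borel_measurable borel"
    by (intro borel_measurable_times borel_measurable_indicator borel_measurable_continuous_onI[OF cont]) (simp add: S borel_open)
  have k0: "0 \<le> ?k x" for x using t by (auto split: split_indicator)
  have le: "(?k x)\<^sup>2 \<le> (\<Prod>b\<in>Basis. t / (1 + (t * (x \<bullet> b))\<^sup>2) * indicator {-h..h} (x \<bullet> b))" for x
  proof (cases "x \<in> S")
    case True
    then have n: "norm x \<le> h" using S(2) by auto
    then have c: "\<bar>x $ 1\<bar> \<le> h" "\<bar>x $ 2\<bar> \<le> h" using component_le_norm_cart[of x 1] component_le_norm_cart[of x 2] by linarith+
    let ?r = "t * norm x"
    have r: "0 \<le> ?r" using t by simp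
    have "?r\<^sup>2 \<le> (1 + ?r)\<^sup>2 - 1" using r by (simp add: power2_sum)
    then have 1: "1 + ?r\<^sup>2 \<le> (1 + ?r)\<^sup>2" by simp
    have x: "(t * x $ i)\<^sup>2 \<le> ?r\<^sup>2" for i
      using component_le_norm_cart[of x i] t by (simp add: power_mult_distrib abs_le_square_iff[symmetric])
    have "(1 + (t * x $ 1)\<^sup>2) * (1 + (t * x $ 2)\<^sup>2) \<le> (1 + ?r)\<^sup>2 * (1 + ?r)\<^sup>2"
      using x[of 1] x[of 2] 1 by (intro mult_mono) (auto intro: order_trans)
    moreover have "0 < (1 + (t * x $ 1)\<^sup>2) * (1 + (t * x $ 2)\<^sup>2)" by (intro mult_pos_pos add_pos_nonneg) auto
    ultimately have "t\<^sup>2 / ((1 + ?r)\<^sup>2 * (1 + ?r)\<^sup>2) \<le> t\<^sup>2 / ((1 + (t * x $ 1)\<^sup>2) * (1 + (t * x $ 2)\<^sup>2))"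
      by (intro divide_left_mono) (auto intro: mult_pos_pos less_le_trans)
    then show ?thesis using True c
      by (simp add: Basis_real2 axis_12_neq inner_axis power_divide abs_le_iff minus_le_iff power2_eq_square)
  next
    case False
    then show ?thesis using t by (auto intro!: prod_nonneg divide_nonneg_nonneg add_nonneg_nonneg)
  qed
  have bound: "(\<integral>\<^sup>+x. ennreal ((?k x)\<^sup>2) \<partial>lborel) \<le> ennreal (pi\<^sup>2)"
  proof -
    have "(\<integral>\<^sup>+x. ennreal ((?k x)\<^sup>2) \<partial>lborel)
        \<le> (\<integral>\<^sup>+x. (\<Prod>b\<in>Basis. ennreal (t / (1 + (t * (x \<bullet> b))\<^sup>2)) * indicator {-h..h} (x \<bullet> b)) \<partial>(lborel :: (real^2) measure))"
    proof (rule nn_integral_mono)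
      fix x :: "real^2"
      have p: "0 \<le> t / (1 + (t * (x \<bullet> b))\<^sup>2) * indicator {-h..h} (x \<bullet> b)" for b
        using t by (auto intro!: mult_nonneg_nonneg divide_nonneg_nonneg add_nonneg_nonneg)
      have "ennreal ((?k x)\<^sup>2) \<le> ennreal (\<Prod>b\<in>Basis. t / (1 + (t * (x \<bullet> b))\<^sup>2) * indicator {-h..h} (x \<bullet> b))"
        by (rule ennreal_leI[OF le])
      also have "\<dots> = (\<Prod>b\<in>Basis. ennreal (t / (1 + (t * (x \<bullet> b))\<^sup>2) * indicator {-h..h} (x \<bullet> b)))"
        by (rule prod_ennreal[symmetric]) (rule p)
      also have "\<dots> = (\<Prod>b\<in>Basis. ennreal (t / (1 + (t * (x \<bullet> b))\<^sup>2)) * indicator {-h..h} (x \<bullet> b))"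
        by (intro prod.cong refl) (auto split: split_indicator)
      finally show "ennreal ((?k x)\<^sup>2) \<le> (\<Prod>b\<in>Basis. ennreal (t / (1 + (t * (x \<bullet> b))\<^sup>2)) * indicator {-h..h} (x \<bullet> b))" .
    qed
    also have "\<dots> = (\<Prod>b\<in>(Basis :: (real^2) set). (\<integral>\<^sup>+x. ennreal (t / (1 + (t * x)\<^sup>2)) * indicator {-h..h} x \<partial>lborel))"
      by (rule nn_integral_lborel_prod) auto
    also have "\<dots> \<le> (\<Prod>b\<in>(Basis :: (real^2) set). ennreal pi)"
      unfolding prod_constant by (intro power_mono_ennreal integral_arctan_kernel t h)
    also have "\<dots> = ennreal (pi\<^sup>2)" by (simp add: ennreal_power)
    finally show ?thesis .
  qed
  have m2: "(\<lambda>x. (?k x)\<^sup>2) \<in> borel_measurable lborel" using m by (intro borel_measurable_power) simp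
  have i: "integrable lborel (\<lambda>x. (?k x)\<^sup>2)"
    by (rule integrableI_nonneg[OF m2 AE_I2 le_less_trans[OF bound]]) auto
  have I: "(LINT x|lborel. (?k x)\<^sup>2) \<le> pi\<^sup>2"
    using bound by (subst (asm) nn_integral_eq_integral[OF i]) (auto simp: ennreal_le_iff)
  show "L2 (lebesgue_on \<Omega>) ?k" "L2_norm (lebesgue_on \<Omega>) ?k \<le> pi"
  proof -
    have i': "integrable lborel (\<lambda>x. indicator \<Omega> x *\<^sub>R (?k x)\<^sup>2)"
      by (rule integrable_mult_indicator[OF _ i]) (simp add: \<Omega> borel_open)
    show "L2 (lebesgue_on \<Omega>) ?k"
      unfolding L2_def real_norm_def power2_abs
      using integral_lebesgue_on_eq_lborel(2)[of "\<lambda>x. (?k x)\<^sup>2", OF _ \<Omega>(1)] m2 i' m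
      by (auto intro!: measurable_restrict_space1 measurable_completion)
    have "(LINT x|lebesgue_on \<Omega>. (?k x)\<^sup>2) = (LINT x|lborel. indicator \<Omega> x *\<^sub>R (?k x)\<^sup>2)"
      by (rule integral_lebesgue_on_eq_lborel(1)[OF _ \<Omega>(1)]) (use m2 in simp)
    also have "\<dots> \<le> (LINT x|lborel. (?k x)\<^sup>2)"
      by (rule integral_mono[OF i' i]) (auto split: split_indicator)
    also have "\<dots> \<le> pi\<^sup>2" by (rule I)
    finally have "sqrt (LINT x|lebesgue_on \<Omega>. (?k x)\<^sup>2) \<le> sqrt (pi\<^sup>2)" by (rule real_sqrt_le_mono)
    then show "L2_norm (lebesgue_on \<Omega>) ?k \<le> pi" unfolding L2_norm_def real_norm_def power2_abs by simp
  qed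
qed

section \<open>The boundary form as a volume integral, and its limit\<close>

context transmission
begin

text \<open>The symmetry of the elastic moduli exchanges the roles of solution and test field: the
  gradient of \<open>u\<close> appears against a smooth weight, the form that
  \<open>Green_difference\<close> handles.\<close>

lemma traction_pairing_stress:
  assumes u: "H1 \<Omega> u" and f: "L2 (lebesgue_on \<Omega>) f" and g: "smooth g" and I: "I * I = - 1"
  shows "traction_pairing lam \<mu> \<Omega> u f (\<lambda>x. unit_field I (g x))
    = (\<Sum>m\<in>UNIV. \<Sum>l\<in>UNIV. LINT x|lebesgue_on \<Omega>. stress lam \<mu> I g l m x * weak_partial \<Omega> l u x $ m)
      + (LINT x|lebesgue_on \<Omega>. g x * pair_unit I (f x))"
proof -
  have d: "g differentiable (at x)" for x using smoothD[OF g, of 1] by simp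
  have p: "partial k (\<lambda>x. unit_field I (g x)) x = unit_field I (partial k g x)" for k x
    by (rule partial_linear[OF bounded_linear_unit_field d])
  have II: "I * (I * z) = - z" for z using I by (simp add: mult.assoc[symmetric])
  have Ls: "L2 (lebesgue_on \<Omega>) (stress lam \<mu> I g l m)" for l m
    by (rule test_function_partial_L2(1)[OF smooth_stress[OF g] open_\<Omega> bounded_\<Omega>])
  have i: "integrable (lebesgue_on \<Omega>) (\<lambda>x. stress lam \<mu> I g l m x * weak_partial \<Omega> l u x $ m)" for l m
    using integrable_bilinear_L2[OF bounded_bilinear_mult_nth Ls H1_weak_partial(1)[OF u]] by (simp add: mult_nth_def)
  have ig: "integrable (lebesgue_on \<Omega>) (\<lambda>x. g x * pair_unit I (f x))"
    by (rule integrable_bilinear_L2[OF bounded_bilinear_mult test_function_partial_L2(1)[OF g open_\<Omega> bounded_\<Omega>]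
        L2_bounded_linear[OF bounded_linear_pair_unit f]])
  have pt: "(\<Sum>k\<in>UNIV. cdot (traction lam \<mu> (axis k 1) D) (unit_field I (partial k g x)))
      = (\<Sum>m\<in>UNIV. \<Sum>l\<in>UNIV. stress lam \<mu> I g l m x * D l $ m)" for D x
    by (simp add: UNIV_2 cdot_unit_field pair_unit_def traction_axis stress_def algebra_simps II)
  show ?thesis
    unfolding traction_pairing_def p pt cdot_unit_field[of "f _"]
    using i ig by (simp add: Bochner_Integration.integral_sum Bochner_Integration.integral_add Bochner_Integration.integrable_sum)
qed

text \<open>Subtracting the two Green formulas leaves the gradients of \<open>v\<close> and
  \<open>w\<close> against the same stress, and \<open>Green_difference\<close> moves the derivative
  onto that stress without an edge term.\<close>

lemma vertex_identity:
  assumes g: "smooth g" "\<And>x. norm x \<ge> R \<Longrightarrow> g x = 0" and R: "R < h" and I: "I * I = - 1"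
  shows "(LINT x|bd. indicator (edge a \<union> edge b) x *\<^sub>R (of_real (\<eta> x) * (g x * pair_unit I (tv x))))
    = (\<Sum>m\<in>UNIV. LINT x|lebesgue_on \<Omega>. (partial 1 (stress lam \<mu> I g 1 m) x + partial 2 (stress lam \<mu> I g 2 m) x) * (v x - w x) $ m)
      + (LINT x|lebesgue_on \<Omega>. g x * pair_unit I (fw x - fv x))"
proof -
  let ?J = "LINT x|bd. indicator (edge a \<union> edge b) x *\<^sub>R (of_real (\<eta> x) * (g x * pair_unit I (tv x)))"
  have sm: "smooth (\<lambda>x. unit_field I (g x))"
    by (rule smoothI) (intro C_k_bounded_linear[OF bounded_linear_unit_field] smoothD[OF g(1)])
  have z: "unit_field I (g x) = 0" if "norm x \<ge> R" for x
    using g(2)[OF that] by (simp add: vec_eq_iff forall_2)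
  have W: "traction_pairing lam \<mu> \<Omega> v fv (\<lambda>x. unit_field I (g x)) + ?J = traction_pairing lam \<mu> \<Omega> w fw (\<lambda>x. unit_field I (g x))"
    using weak_at_vertex[OF sm _ R] z unfolding cdot_unit_field by blast
  \<comment> \<open>Halfway between \<open>R\<close> and \<open>h\<close>: the derivatives of
    \<open>g\<close> vanish strictly outside radius \<open>R\<close>, and the support has to stay
    inside the ball.\<close>
  have sz: "stress lam \<mu> I g l m x = 0" if "norm x \<ge> (R + h) / 2" for l m x
  proof -
    have "norm x > R" using that R by simp
    then have "partial k g x = 0" for k
      using dird_eq_0[OF smoothD[OF g(1)] g(2), where x = x and p = "axis k 1"] by (simp add: partial_eq_dird)
    then show ?thesis by (simp add: stress_def)
  qed
  have Rh: "(R + h) / 2 < h" using R by simp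
  have C1: "C_k 1 (stress lam \<mu> I g l m)" for l m by (rule smoothD[OF smooth_stress[OF g(1)]])
  have G: "(LINT x|lebesgue_on \<Omega>. stress lam \<mu> I g l m x * weak_partial \<Omega> l w x $ m) - (LINT x|lebesgue_on \<Omega>. stress lam \<mu> I g l m x * weak_partial \<Omega> l v x $ m)
      = (LINT x|lebesgue_on \<Omega>. partial l (stress lam \<mu> I g l m) x * (v x - w x) $ m)" for l m
    by (rule Green_difference[OF C1 _ Rh]) (rule sz)
  have v2: "L2 (lebesgue_on \<Omega>) v" "L2 (lebesgue_on \<Omega>) w" using v w by (auto simp: H1_def)
  have i: "integrable (lebesgue_on \<Omega>) (\<lambda>x. partial l (stress lam \<mu> I g l m) x * (v x - w x) $ m)" for l m
    using integrable_bilinear_L2[OF bounded_bilinear_mult_nth has_weak_partial_C1(1)[OF C1 open_\<Omega> bounded_\<Omega>] L2_diff[OF v2]]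
    by (simp add: mult_nth_def)
  have ig: "integrable (lebesgue_on \<Omega>) (\<lambda>x. g x * pair_unit I (f x))" if "L2 (lebesgue_on \<Omega>) f" for f
    by (rule integrable_bilinear_L2[OF bounded_bilinear_mult test_function_partial_L2(1)[OF g(1) open_\<Omega> bounded_\<Omega>]
        L2_bounded_linear[OF bounded_linear_pair_unit that]])
  have "(LINT x|lebesgue_on \<Omega>. g x * pair_unit I (fw x - fv x)) = (LINT x|lebesgue_on \<Omega>. g x * pair_unit I (fw x)) - (LINT x|lebesgue_on \<Omega>. g x * pair_unit I (fv x))"
    using ig[OF fw] ig[OF fv] by (simp add: pair_unit_def algebra_simps)
  moreover have "(LINT x|lebesgue_on \<Omega>. (partial 1 (stress lam \<mu> I g 1 m) x + partial 2 (stress lam \<mu> I g 2 m) x) * (v x - w x) $ m)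
      = (\<Sum>l\<in>UNIV. LINT x|lebesgue_on \<Omega>. partial l (stress lam \<mu> I g l m) x * (v x - w x) $ m)" for m
    unfolding distrib_right UNIV_2 using i[of 1 m] i[of 2 m] by (simp add: Bochner_Integration.integral_add)
  moreover have "?J = traction_pairing lam \<mu> \<Omega> w fw (\<lambda>x. unit_field I (g x)) - traction_pairing lam \<mu> \<Omega> v fv (\<lambda>x. unit_field I (g x))"
    using W by (simp add: algebra_simps)
  ultimately show ?thesis
    unfolding traction_pairing_stress[OF v fv g(1) I] traction_pairing_stress[OF w fw g(1) I] G[symmetric]
    by (simp add: sum_subtractf)
qed

lemma cgo_bound:
  assumes x: "x \<in> closed_sector" and t: "0 \<le> t" and I: "I * I = - 1" and c: "\<bar>c x\<bar> \<le> 1"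
  shows "norm (cgo c I t x) \<le> (1 / sqrt c0) ^ 3 * (1 / (1 + t * norm x)) ^ 3"
proof -
  have "norm (cgo c I t x) \<le> 1 * norm (E I t x) ^ 3"
    unfolding cgo_def norm_mult norm_power norm_of_real by (rule mult_right_mono[OF c]) simp
  also have "\<dots> \<le> (1 / (sqrt c0 * (1 + t * norm x))) ^ 3"
    using closed_sector_pole(3)[OF x t I] by (simp only: mult_1) (intro power_mono, auto)
  also have "\<dots> = (1 / sqrt c0) ^ 3 * (1 / (1 + t * norm x)) ^ 3" by (simp add: power_mult_distrib power_divide)
  finally show ?thesis .
qed

text \<open>After multiplication by \<open>t n\<close> the divergence of the stress contributes at
  most the order \<open>1 / t n\<close>. In the volume term, \<open>t n\<close> and two of the three
  decay factors form a kernel bounded by \<open>L2_kernel_bound\<close>, and the third tends to 0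
  off the vertex, so \<open>L2_concentrating\<close> applies.\<close>

lemma boundary_form_tendsto_0:
  assumes c: "smooth c" "\<And>x. norm x \<le> r0 \<Longrightarrow> c x = 1" "\<And>x. norm x \<ge> R \<Longrightarrow> c x = 0" "\<And>x. \<bar>c x\<bar> \<le> 1"
    and r0: "0 < r0" and R: "R < h" and I: "I * I = - 1"
    and t: "\<And>n. 1 \<le> t n" "filterlim t at_top sequentially"
  shows "(\<lambda>n. of_real (t n) * (LINT x|bd. indicator (edge a \<union> edge b) x *\<^sub>R (of_real (\<eta> x) * (cgo c I (t n) x * pair_unit I (tv x))))) \<longlonglongrightarrow> 0"
proof -
  obtain C where C: "0 \<le> C"
    "\<And>t m x. 1 \<le> t \<Longrightarrow> x \<in> S \<Longrightarrow>
      norm (partial 1 (stress lam \<mu> I (cgo c I t) 1 m) x + partial 2 (stress lam \<mu> I (cgo c I t) 2 m) x) \<le> C / t ^ 3"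
    by (rule div_stress_cgo_bound[OF c(1) _ _ r0 I], erule c(2), erule c(3), rule that)
  let ?D = "\<lambda>n m x. partial 1 (stress lam \<mu> I (cgo c I (t n)) 1 m) x + partial 2 (stress lam \<mu> I (cgo c I (t n)) 2 m) x"
  have v2: "L2 (lebesgue_on \<Omega>) v" "L2 (lebesgue_on \<Omega>) w" using v w by (auto simp: H1_def)
  note fm = finite_measure_lebesgue_on_bounded[OF bounded_\<Omega> open_\<Omega>]
  define N where "N = (LINT x|lebesgue_on \<Omega>. norm (v x - w x))"
  have iN: "integrable (lebesgue_on \<Omega>) (\<lambda>x. norm (v x - w x))"
    by (rule integrable_norm[OF L2_integrable[OF fm L2_diff[OF v2]]])
  have tp: "0 < t n" for n using t(1)[of n] by simp
  have gz: "cgo c I (t n) x = 0" if "norm x \<ge> R" for n x using c(3)[OF that] by (simp add: cgo_def)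
  have D0: "?D n m x = 0" if "norm x \<ge> h" for n m x
  proof -
    have "stress lam \<mu> I (cgo c I (t n)) l m y = 0" if "norm y \<ge> (R + h) / 2" for l m y
    proof -
      have "norm y > R" using that R by simp
      then have "partial k (cgo c I (t n)) y = 0" for k
        using dird_eq_0[OF smoothD[OF smooth_cgo[OF c(1)]] gz, where x = y and p = "axis k 1"] by (simp add: partial_eq_dird)
      then show ?thesis by (simp add: stress_def)
    qed
    then have "partial k (stress lam \<mu> I (cgo c I (t n)) l m) x = 0" for k l
      using dird_eq_0[OF smoothD[OF smooth_stress[OF smooth_cgo[OF c(1)]]], of "(R + h) / 2", where x = x and p = "axis k 1"] that R
      by (simp add: partial_eq_dird)
    then show ?thesis by simp
  qed
  have Db: "norm (?D n m x) \<le> C / t n ^ 3" if "x \<in> \<Omega>" for n m x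
  proof (cases "norm x < h")
    case True
    then show ?thesis using C(2)[OF t(1)] S_iff(1)[OF True] that by blast
  next
    case False
    then show ?thesis using D0[of x n m] C(1) tp[of n] by simp
  qed
  have first: "norm (LINT x|lebesgue_on \<Omega>. ?D n m x * (v x - w x) $ m) \<le> C / t n ^ 3 * N" for n m
  proof -
    have "norm (LINT x|lebesgue_on \<Omega>. ?D n m x * (v x - w x) $ m) \<le> (LINT x|lebesgue_on \<Omega>. C / t n ^ 3 * norm (v x - w x))"
    proof (rule integral_norm_le)
      fix x assume "x \<in> space (lebesgue_on \<Omega>)"
      then have "x \<in> \<Omega>" by (simp add: space_restrict_space)
      then show "norm (?D n m x * (v x - w x) $ m) \<le> C / t n ^ 3 * norm (v x - w x)"
        unfolding norm_mult using C(1) tp[of n] by (intro mult_mono Db Finite_Cartesian_Product.norm_nth_le) auto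
    qed (use iN in simp)
    then show ?thesis by (simp add: N_def)
  qed
  define G where "G x = norm (pair_unit I (fw x - fv x))" for x
  have G: "L2 (lebesgue_on \<Omega>) G"
  proof -
    have "L2 (lebesgue_on \<Omega>) (\<lambda>x. pair_unit I (fw x - fv x))"
      by (rule L2_bounded_linear[OF bounded_linear_pair_unit L2_diff[OF fw fv]])
    then show ?thesis unfolding G_def by (rule L2_bound[of _ _ _ 1]) (use \<open>L2 (lebesgue_on \<Omega>) (\<lambda>x. pair_unit I (fw x - fv x))\<close>[THEN L2_measurable] in auto)
  qed
  let ?A = "\<lambda>n (x::real^2). indicator S x * (t n / (1 + t n * norm x)\<^sup>2)" and ?B = "\<lambda>n (x::real^2). 1 / (1 + t n * norm x)"
  have pos: "1 \<le> 1 + t n * norm x" for n and x :: "real^2" using tp[of n] by simp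
  have cB: "continuous_on UNIV (\<lambda>x::real^2. ?B n x)" for n
  proof (intro continuous_intros ballI)
    show "1 + t n * norm x \<noteq> 0" for x :: "real^2" using pos[of n x] by linarith
  qed
  have SB: "S \<subseteq> ball 0 h" by (simp add: S_def)
  have lim: "(\<lambda>n. LINT x|lebesgue_on \<Omega>. ?A n x * (?B n x * G x)) \<longlonglongrightarrow> 0"
  proof (rule L2_concentrating[OF G])
    show "L2 (lebesgue_on \<Omega>) (?A n)" "L2_norm (lebesgue_on \<Omega>) (?A n) \<le> pi" for n
      by (rule L2_kernel_bound[OF open_S SB tp h open_\<Omega> bounded_\<Omega>])+
    show "?B n \<in> borel_measurable (lebesgue_on \<Omega>)" for n by (rule continuous_measurable_lebesgue_on[OF cB])
    show "\<bar>?B n x\<bar> \<le> 1" for n x using pos[of n x] by (simp add: abs_divide)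
    show "AE x in lebesgue_on \<Omega>. (\<lambda>n. ?B n x) \<longlonglongrightarrow> 0"
      using AE_lebesgue_on_nonzero[OF open_\<Omega>]
    proof eventually_elim
      case (elim x)
      have "filterlim (\<lambda>n. 1 + t n * norm x) at_top sequentially"
        using elim by (intro filterlim_tendsto_add_at_top[OF tendsto_const] filterlim_at_top_mult_tendsto_pos[OF tendsto_const _ t(2)]) auto
      then show ?case by (rule tendsto_divide_0[OF tendsto_const filterlim_at_top_imp_at_infinity])
    qed
  qed
  let ?s = "(1 / sqrt c0) ^ 3"
  have second: "t n * norm (LINT x|lebesgue_on \<Omega>. cgo c I (t n) x * pair_unit I (fw x - fv x)) \<le> ?s * (LINT x|lebesgue_on \<Omega>. ?A n x * (?B n x * G x))" for n
  proof -
    have "L2 (lebesgue_on \<Omega>) (\<lambda>x. ?B n x * G x)"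
    proof (rule L2_bound[OF G, of _ 1])
      show "(\<lambda>x. ?B n x * G x) \<in> borel_measurable (lebesgue_on \<Omega>)"
        by (intro borel_measurable_times continuous_measurable_lebesgue_on[OF cB] L2_measurable[OF G])
      show "AE x in lebesgue_on \<Omega>. norm (?B n x * G x) \<le> 1 * norm (G x)"
      proof (rule AE_I2)
        fix x
        have "\<bar>?B n x\<bar> \<le> 1" using pos[of n x] by (simp add: abs_divide)
        then show "norm (?B n x * G x) \<le> 1 * norm (G x)" unfolding real_norm_def abs_mult by (intro mult_right_mono) auto
      qed
    qed
    then have i: "integrable (lebesgue_on \<Omega>) (\<lambda>x. ?A n x * (?B n x * G x))"
      by (rule integrable_bilinear_L2[OF bounded_bilinear_mult L2_kernel_bound(1)[OF open_S SB tp h open_\<Omega> bounded_\<Omega>]])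
    have "norm (LINT x|lebesgue_on \<Omega>. cgo c I (t n) x * pair_unit I (fw x - fv x)) \<le> (LINT x|lebesgue_on \<Omega>. ?s / t n * (?A n x * (?B n x * G x)))"
    proof (rule integral_norm_le)
      fix x assume "x \<in> space (lebesgue_on \<Omega>)"
      then have x: "x \<in> \<Omega>" by (simp add: space_restrict_space)
      show "norm (cgo c I (t n) x * pair_unit I (fw x - fv x)) \<le> ?s / t n * (?A n x * (?B n x * G x))"
      proof (cases "norm x < h")
        case True
        then have xS: "x \<in> S" using S_iff(1) x by blast
        have "norm (cgo c I (t n) x * pair_unit I (fw x - fv x)) \<le> (?s * (1 / (1 + t n * norm x)) ^ 3) * G x"
          unfolding norm_mult G_def
          by (intro mult_right_mono cgo_bound subsetD[OF S_closed_sector xS] I c) (use tp[of n] in auto)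
        also have "\<dots> = ?s / t n * (?A n x * (?B n x * G x))"
          using xS tp[of n] by (simp add: power2_eq_square power3_eq_cube)
        finally show ?thesis .
      next
        case False
        then have "cgo c I (t n) x = 0" using R by (intro gz) simp
        moreover have "x \<notin> S" using False by (auto simp: S_def)
        ultimately show ?thesis by simp
      qed
    qed (rule integrable_mult_right, rule i)
    then have "norm (LINT x|lebesgue_on \<Omega>. cgo c I (t n) x * pair_unit I (fw x - fv x)) \<le> ?s / t n * (LINT x|lebesgue_on \<Omega>. ?A n x * (?B n x * G x))"
      unfolding Bochner_Integration.integral_mult_right_zero .
    then have "t n * norm (LINT x|lebesgue_on \<Omega>. cgo c I (t n) x * pair_unit I (fw x - fv x)) \<le> t n * (?s / t n * (LINT x|lebesgue_on \<Omega>. ?A n x * (?B n x * G x)))"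
      by (rule mult_left_mono) (use tp[of n] in simp)
    moreover have "t n * (s / t n * X) = s * X" for s X using tp[of n] by simp
    ultimately show ?thesis by (simp only:)
  qed
  have le: "norm (of_real (t n) * (LINT x|bd. indicator (edge a \<union> edge b) x *\<^sub>R (of_real (\<eta> x) * (cgo c I (t n) x * pair_unit I (tv x)))))
      \<le> 2 * C * N * (1 / t n) + ?s * (LINT x|lebesgue_on \<Omega>. ?A n x * (?B n x * G x))" for n
  proof -
    have id: "(LINT x|bd. indicator (edge a \<union> edge b) x *\<^sub>R (of_real (\<eta> x) * (cgo c I (t n) x * pair_unit I (tv x))))
      = (\<Sum>m\<in>UNIV. LINT x|lebesgue_on \<Omega>. ?D n m x * (v x - w x) $ m) + (LINT x|lebesgue_on \<Omega>. cgo c I (t n) x * pair_unit I (fw x - fv x))"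
      by (rule vertex_identity[OF smooth_cgo[OF c(1)] _ R I]) (rule gz)
    have "norm (\<Sum>m\<in>UNIV. LINT x|lebesgue_on \<Omega>. ?D n m x * (v x - w x) $ m) \<le> (\<Sum>m\<in>(UNIV :: 2 set). C / t n ^ 3 * N)"
      by (rule order_trans[OF norm_sum sum_mono]) (rule first)
    then have "norm (\<Sum>m\<in>UNIV. LINT x|lebesgue_on \<Omega>. ?D n m x * (v x - w x) $ m) \<le> 2 * (C / t n ^ 3 * N)" by simp
    then have "t n * norm (\<Sum>m\<in>UNIV. LINT x|lebesgue_on \<Omega>. ?D n m x * (v x - w x) $ m) \<le> t n * (2 * (C / t n ^ 3 * N))"
      using tp[of n] by (intro mult_left_mono) auto
    also have "\<dots> \<le> 2 * C * N * (1 / t n)"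
    proof -
      have "0 \<le> N" unfolding N_def by simp
      then have "2 * C * N * (1 / (t n)\<^sup>2) \<le> 2 * C * N * (1 / t n)"
        using C(1) t(1)[of n] by (intro mult_left_mono divide_left_mono) (auto simp: power2_eq_square)
      then show ?thesis using tp[of n] by (simp add: power2_eq_square power3_eq_cube)
    qed
    finally have f: "t n * norm (\<Sum>m\<in>UNIV. LINT x|lebesgue_on \<Omega>. ?D n m x * (v x - w x) $ m) \<le> 2 * C * N * (1 / t n)" .
    have "norm (of_real (t n) * (LINT x|bd. indicator (edge a \<union> edge b) x *\<^sub>R (of_real (\<eta> x) * (cgo c I (t n) x * pair_unit I (tv x)))))
      \<le> t n * (norm (\<Sum>m\<in>UNIV. LINT x|lebesgue_on \<Omega>. ?D n m x * (v x - w x) $ m) + norm (LINT x|lebesgue_on \<Omega>. cgo c I (t n) x * pair_unit I (fw x - fv x)))"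
      unfolding id norm_mult using tp[of n] by (simp only: norm_of_real abs_of_pos) (intro mult_left_mono norm_triangle_ineq, simp)
    then show ?thesis using f second[of n] unfolding distrib_left by linarith
  qed
  have "(\<lambda>n. 1 / t n) \<longlonglongrightarrow> 0" by (rule tendsto_divide_0[OF tendsto_const filterlim_at_top_imp_at_infinity[OF t(2)]])
  then have "(\<lambda>n. 2 * C * N * (1 / t n) + ?s * (LINT x|lebesgue_on \<Omega>. ?A n x * (?B n x * G x))) \<longlonglongrightarrow> 2 * C * N * 0 + ?s * 0"
    by (intro tendsto_intros lim)
  then have l0: "(\<lambda>n. 2 * C * N * (1 / t n) + ?s * (LINT x|lebesgue_on \<Omega>. ?A n x * (?B n x * G x))) \<longlonglongrightarrow> 0" by simp
  show ?thesis by (rule Lim_null_comparison[OF always_eventually[OF allI[OF le]] l0])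
qed

end

section \<open>Herglotz waves\<close>

lemma continuous_dir: "continuous_on A dir"
proof -
  have "dir = (\<lambda>t. cos t *\<^sub>R axis 1 1 + sin t *\<^sub>R axis 2 1)"
    by (auto simp: fun_eq_iff vec_eq_iff forall_2 axis_def)
  then show ?thesis by (rule ssubst) (intro continuous_intros)
qed

lemma circle_measure_measurable: "(\<lambda>t. vector [cos t, sin t] :: real^2) \<in> lebesgue_on {0..2 * pi} \<rightarrow>\<^sub>M borel"
  unfolding dir_def[symmetric]
  by (rule continuous_imp_measurable_on_sets_lebesgue[OF continuous_dir]) simp

lemma finite_measure_circle: "finite_measure circle_measure"
proof -
  have "finite_measure (lebesgue_on {0..2 * pi})"
    by (rule finite_measureI) (simp add: emeasure_restrict_space space_restrict_space)
  then show ?thesis unfolding circle_measure_def by (rule finite_measure.finite_measure_distr[OF _ circle_measure_measurable])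
qed

lemma sets_circle_measure [measurable_cong]: "sets circle_measure = sets borel"
  by (simp add: circle_measure_def)

lemma AE_circle_measure: "AE d in circle_measure. norm d = 1"
  unfolding circle_measure_def
  by (subst AE_distr_iff[OF circle_measure_measurable]) (auto simp: dir_def[symmetric])

text \<open>A scalar superposition of plane waves. Each component of a Herglotz wave combines two of
  them, with the kernels multiplied by the components of \<open>d\<close> and of
  \<open>perp d\<close>.\<close>

definition plane_wave :: "real \<Rightarrow> (real^2 \<Rightarrow> complex) \<Rightarrow> real^2 \<Rightarrow> complex" where
  "plane_wave k G x = (LINT d|circle_measure. exp (\<i> * of_real (k * (d \<bullet> x))) * G d)"

lemma norm_cis_minus_1: "norm (exp (\<i> * of_real s) - 1) \<le> \<bar>s\<bar>"
  using Taylor_exp[of "\<i> * of_real s" 0] by (simp add: norm_mult)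

lemma norm_cis_minus_linear: "norm (exp (\<i> * of_real s) - 1 - \<i> * of_real s) \<le> s\<^sup>2"
  using Taylor_exp[of "\<i> * of_real s" 1] by (simp add: norm_mult power2_eq_square algebra_simps)

lemma integrable_plane_wave:
  assumes "integrable circle_measure G"
  shows "integrable circle_measure (\<lambda>d. exp (\<i> * of_real (k * (d \<bullet> x))) * G d)"
proof (rule Bochner_Integration.integrable_bound[OF assms])
  note [measurable] = borel_measurable_integrable[OF assms]
  have [measurable]: "(\<lambda>d. exp (\<i> * of_real (k * (d \<bullet> x)))) \<in> borel_measurable circle_measure"
    unfolding measurable_cong_sets[OF sets_circle_measure refl]
    by (intro borel_measurable_continuous_onI continuous_intros)
  show "(\<lambda>d. exp (\<i> * of_real (k * (d \<bullet> x))) * G d) \<in> borel_measurable circle_measure" by measurable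
qed (simp add: norm_mult)

lemma norm_inner_circle: "norm d = 1 \<Longrightarrow> \<bar>k * (d \<bullet> x)\<bar> \<le> \<bar>k\<bar> * norm x" for d :: "real^2"
  using Cauchy_Schwarz_ineq2[of d x] by (simp add: abs_mult mult_left_mono)

lemma integral_norm_le_AE:
  fixes f :: "'a \<Rightarrow> 'b::{banach, second_countable_topology}"
  assumes f: "integrable M f" and g: "integrable M g" and le: "AE x in M. norm (f x) \<le> g x"
  shows "norm (integral\<^sup>L M f) \<le> integral\<^sup>L M g"
  by (rule order_trans[OF integral_norm_bound integral_mono_AE[OF integrable_norm[OF f] g le]])

lemma plane_wave_bounds:
  assumes G: "integrable circle_measure G"
  shows "norm (plane_wave k G x) \<le> (LINT d|circle_measure. norm (G d))"
    and "norm (plane_wave k G x - plane_wave k G 0) \<le> \<bar>k\<bar> * norm x * (LINT d|circle_measure. norm (G d))"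
proof -
  note i = integrable_plane_wave[OF G]
  show "norm (plane_wave k G x) \<le> (LINT d|circle_measure. norm (G d))"
    unfolding plane_wave_def by (rule integral_norm_le_AE[OF i]) (use G in \<open>auto simp: norm_mult\<close>)
  have "plane_wave k G x - plane_wave k G 0 = (LINT d|circle_measure. (exp (\<i> * of_real (k * (d \<bullet> x))) - 1) * G d)"
    unfolding plane_wave_def using Bochner_Integration.integral_diff[OF i[of k x] i[of k 0]]
    by (simp add: left_diff_distrib)
  moreover have "norm (LINT d|circle_measure. (exp (\<i> * of_real (k * (d \<bullet> x))) - 1) * G d)
      \<le> (LINT d|circle_measure. \<bar>k\<bar> * norm x * norm (G d))"
  proof (rule integral_norm_le_AE)
    show "integrable circle_measure (\<lambda>d. (exp (\<i> * of_real (k * (d \<bullet> x))) - 1) * G d)"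
      using Bochner_Integration.integrable_diff[OF i[of k x] G] by (simp add: left_diff_distrib)
    show "AE d in circle_measure. norm ((exp (\<i> * of_real (k * (d \<bullet> x))) - 1) * G d) \<le> \<bar>k\<bar> * norm x * norm (G d)"
      using AE_circle_measure
    proof eventually_elim
      case (elim d)
      show ?case unfolding norm_mult
        by (intro mult_right_mono order_trans[OF norm_cis_minus_1 norm_inner_circle[OF elim]]) simp
    qed
  qed (use G in simp)
  ultimately show "norm (plane_wave k G x - plane_wave k G 0) \<le> \<bar>k\<bar> * norm x * (LINT d|circle_measure. norm (G d))" by simp
qed

lemma integrable_circle_bounded:
  fixes G :: "real^2 \<Rightarrow> complex"
  assumes G: "integrable circle_measure G" and q: "continuous_on UNIV q" "\<And>d. norm d = 1 \<Longrightarrow> norm (q d) \<le> K"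
  shows "integrable circle_measure (\<lambda>d. q d * G d)"
    and "(LINT d|circle_measure. norm (q d * G d)) \<le> K * (LINT d|circle_measure. norm (G d))"
proof -
  note [measurable] = borel_measurable_integrable[OF G]
  have [measurable]: "q \<in> borel_measurable circle_measure"
    unfolding measurable_cong_sets[OF sets_circle_measure refl] by (rule borel_measurable_continuous_onI[OF q(1)])
  have le: "AE d in circle_measure. norm (q d * G d) \<le> K * norm (G d)"
    using AE_circle_measure by eventually_elim (auto simp: norm_mult intro!: mult_right_mono q(2))
  have iK: "integrable circle_measure (\<lambda>d. K * norm (G d))" using G by simp
  show i: "integrable circle_measure (\<lambda>d. q d * G d)"
    by (rule Bochner_Integration.integrable_bound[OF iK]) (use le in \<open>auto elim: eventually_mono\<close>)
  show "(LINT d|circle_measure. norm (q d * G d)) \<le> K * (LINT d|circle_measure. norm (G d))"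
    using integral_mono_AE[OF integrable_norm[OF i] iK le] by simp
qed

text \<open>The Taylor remainder of the exponential is quadratic uniformly over the unit circle, so
  the difference quotient is estimated directly under the integral. The derivatives are again plane
  waves, with kernels multiplied by \<open>\<i> k d\<^sub>j\<close>, which yields smoothness by
  induction.\<close>

lemma plane_wave_has_derivative:
  fixes k :: real and x :: "real^2"
  assumes G: "integrable circle_measure G"
  defines "P \<equiv> \<lambda>j. plane_wave k (\<lambda>d. \<i> * of_real (k * d $ j) * G d)"
  shows "(plane_wave k G has_derivative (\<lambda>u. of_real (u $ 1) * P 1 x + of_real (u $ 2) * P 2 x)) (at x)"
proof (rule has_derivativeI_sandwich[where e = 1])
  let ?N = "LINT d|circle_measure. norm (G d)" and ?L = "\<lambda>u::real^2. of_real (u $ 1) * P 1 x + of_real (u $ 2) * P 2 x"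
  note i = integrable_plane_wave[OF G]
  have Gj: "integrable circle_measure (\<lambda>d. \<i> * of_real (k * d $ j) * G d)" for j
    by (rule integrable_circle_bounded(1)[OF G, where K = "\<bar>k\<bar>"])
      (auto intro!: continuous_intros mult_left_le simp: norm_mult intro: order_trans[OF component_le_norm_cart])
  note ij = integrable_plane_wave[OF Gj]
  show "bounded_linear ?L"
    by (intro bounded_linear_add bounded_linear_compose[OF bounded_linear_mult_left]
        bounded_linear_compose[OF bounded_linear_of_real bounded_linear_vec_nth])
  show "norm (plane_wave k G y - plane_wave k G x - ?L (y - x)) / norm (y - x) \<le> (k\<^sup>2 * ?N) * norm (y - x)" for y
  proof -
    let ?u = "y - x"
    let ?R = "\<lambda>d. exp (\<i> * of_real (k * (d \<bullet> y))) * G d - exp (\<i> * of_real (k * (d \<bullet> x))) * G d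
      - (of_real (?u $ 1) * (exp (\<i> * of_real (k * (d \<bullet> x))) * (\<i> * of_real (k * d $ 1) * G d))
        + of_real (?u $ 2) * (exp (\<i> * of_real (k * (d \<bullet> x))) * (\<i> * of_real (k * d $ 2) * G d)))"
    have iR: "integrable circle_measure ?R"
      by (intro Bochner_Integration.integrable_diff Bochner_Integration.integrable_add integrable_mult_right i ij)
    have "plane_wave k G y - plane_wave k G x - ?L ?u = (LINT d|circle_measure. ?R d)"
      unfolding P_def plane_wave_def
      using i[of k y] i[of k x] ij[of k x 1] ij[of k x 2]
      by (simp only: Bochner_Integration.integral_diff Bochner_Integration.integral_add Bochner_Integration.integral_mult_right_zero
          Bochner_Integration.integrable_diff Bochner_Integration.integrable_add integrable_mult_right)
    moreover have "norm (LINT d|circle_measure. ?R d) \<le> (LINT d|circle_measure. (k\<^sup>2 * (norm ?u)\<^sup>2) * norm (G d))"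
    proof (rule integral_norm_le_AE[OF iR])
      show "AE d in circle_measure. norm (?R d) \<le> (k\<^sup>2 * (norm ?u)\<^sup>2) * norm (G d)"
        using AE_circle_measure
      proof eventually_elim
        case (elim d)
        let ?s = "k * (d \<bullet> ?u)"
        have e: "exp (\<i> * of_real (k * (d \<bullet> y))) = exp (\<i> * of_real (k * (d \<bullet> x))) * exp (\<i> * of_real ?s)"
          by (simp add: exp_add[symmetric] inner_diff_right algebra_simps)
        have s: "?s = k * d $ 1 * ?u $ 1 + k * d $ 2 * ?u $ 2"
          by (simp add: inner_vec_def UNIV_2 algebra_simps)
        have "?R d = exp (\<i> * of_real (k * (d \<bullet> x))) * (exp (\<i> * of_real ?s) - 1 - \<i> * of_real ?s) * G d"
          unfolding e s by (simp add: algebra_simps)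
        then have "norm (?R d) = norm (exp (\<i> * of_real ?s) - 1 - \<i> * of_real ?s) * norm (G d)"
          by (simp only: norm_mult norm_exp_i_times mult_1)
        also have "\<dots> \<le> ?s\<^sup>2 * norm (G d)"
          by (intro mult_right_mono norm_cis_minus_linear) simp
        also have "\<dots> \<le> (k\<^sup>2 * (norm ?u)\<^sup>2) * norm (G d)"
          using power_mono[OF norm_inner_circle[OF elim, of k ?u] abs_ge_zero, of 2]
          by (intro mult_right_mono) (auto simp: power_mult_distrib)
        finally show ?case .
      qed
    qed (use G in simp)
    ultimately have "norm (plane_wave k G y - plane_wave k G x - ?L ?u) \<le> (k\<^sup>2 * ?N * norm ?u) * norm ?u"
      by (simp add: power2_eq_square mult_ac)
    then show ?thesis by (cases "?u = 0") (auto simp: divide_le_eq)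
  qed
  show "((\<lambda>y. (k\<^sup>2 * ?N) * norm (y - x)) \<longlongrightarrow> 0) (at x)"
    by (auto intro!: tendsto_eq_intros)
qed simp

lemma C_k_plane_wave:
  assumes "integrable circle_measure G"
  shows "C_k n (plane_wave k G)"
  using assms
proof (induction n arbitrary: G)
  case 0
  show ?case
    using plane_wave_has_derivative[OF 0] by (auto intro!: continuous_at_imp_continuous_on has_derivative_continuous)
next
  case (Suc n)
  have Gj: "integrable circle_measure (\<lambda>d. \<i> * of_real (k * d $ j) * G d)" for j
    by (rule integrable_circle_bounded(1)[OF Suc.prems, where K = "\<bar>k\<bar>"])
      (auto intro!: continuous_intros mult_left_le simp: norm_mult intro: order_trans[OF component_le_norm_cart])
  show ?case
  proof (rule C_k_SucI[OF plane_wave_has_derivative[OF Suc.prems]])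
    fix j :: 2
    show "C_k n (\<lambda>x. of_real (axis j (1::real) $ 1) * plane_wave k (\<lambda>d. \<i> * of_real (k * d $ 1) * G d) x
        + of_real (axis j (1::real) $ 2) * plane_wave k (\<lambda>d. \<i> * of_real (k * d $ 2) * G d) x)"
      by (intro C_k_add C_k_mult C_k_const Suc.IH Gj)
  qed
qed

lemma integral_norm_circle_le:
  fixes g :: "real^2 \<Rightarrow> complex"
  assumes g: "L2 circle_measure g"
  shows "(LINT d|circle_measure. norm (g d)) \<le> L2_norm circle_measure (\<lambda>_. 1 :: real) * L2_norm circle_measure g"
proof -
  have n: "L2 circle_measure (\<lambda>d. norm (g d))" using g by (auto simp: L2_def)
  have c: "L2 circle_measure (\<lambda>_. 1 :: real)" by (rule L2_const_finite[OF finite_measure_circle])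
  have "\<bar>LINT d|circle_measure. 1 * norm (g d)\<bar> \<le> L2_norm circle_measure (\<lambda>_. 1 :: real) * L2_norm circle_measure (\<lambda>d. norm (g d))"
    by (rule Cauchy_Schwarz_L2[OF c n])
  then show ?thesis by (simp add: L2_norm_def)
qed

lemma herglotz_nth:
  assumes g: "L2 circle_measure gp" "L2 circle_measure gs"
  shows "herglotz lam \<mu> \<omega> gp gs x $ i = exp (- (\<i> * of_real pi / 4)) *
    (of_real (sqrt (\<omega> / sqrt (lam + 2 * \<mu>) / \<omega>)) * plane_wave (\<omega> / sqrt (lam + 2 * \<mu>)) (\<lambda>d. of_real (d $ i) * gp d) x
     + of_real (sqrt (\<omega> / sqrt \<mu> / \<omega>)) * plane_wave (\<omega> / sqrt \<mu>) (\<lambda>d. of_real (perp d $ i) * gs d) x)"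
    and "integrable circle_measure (\<lambda>d. of_real (d $ i) * gp d)" "integrable circle_measure (\<lambda>d. of_real (perp d $ i) * gs d)"
    and "(LINT d|circle_measure. norm (of_real (d $ i) * gp d)) \<le> L2_norm circle_measure (\<lambda>_. 1 :: real) * L2_norm circle_measure gp"
    and "(LINT d|circle_measure. norm (of_real (perp d $ i) * gs d)) \<le> L2_norm circle_measure (\<lambda>_. 1 :: real) * L2_norm circle_measure gs"
proof -
  note gi = g[THEN L2_integrable[OF finite_measure_circle]]
  have p: "perp d $ i = (if i = 1 then - d $ 2 else d $ 1)" for d :: "real^2"
    using exhaust_2[of i] by (auto simp: perp_def)
  have c1: "continuous_on UNIV (\<lambda>d::real^2. complex_of_real (d $ i))" by (intro continuous_intros)
  have c2: "continuous_on UNIV (\<lambda>d::real^2. complex_of_real (perp d $ i))"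
    unfolding p by (cases "i = 1") (auto intro!: continuous_intros)
  have b1: "norm (complex_of_real (d $ i)) \<le> 1" if "norm d = 1" for d :: "real^2"
    using component_le_norm_cart[of d i] that by simp
  have b2: "norm (complex_of_real (perp d $ i)) \<le> 1" if "norm d = 1" for d :: "real^2"
    using component_le_norm_cart[of d 1] component_le_norm_cart[of d 2] that by (simp add: p)
  show i: "integrable circle_measure (\<lambda>d. of_real (d $ i) * gp d)" "integrable circle_measure (\<lambda>d. of_real (perp d $ i) * gs d)"
    by (rule integrable_circle_bounded(1)[OF gi(1) c1 b1] integrable_circle_bounded(1)[OF gi(2) c2 b2], assumption)+
  show "(LINT d|circle_measure. norm (of_real (d $ i) * gp d)) \<le> L2_norm circle_measure (\<lambda>_. 1 :: real) * L2_norm circle_measure gp"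
    using integrable_circle_bounded(2)[OF gi(1) c1 b1] integral_norm_circle_le[OF g(1)] by simp
  show "(LINT d|circle_measure. norm (of_real (perp d $ i) * gs d)) \<le> L2_norm circle_measure (\<lambda>_. 1 :: real) * L2_norm circle_measure gs"
    using integrable_circle_bounded(2)[OF gi(2) c2 b2] integral_norm_circle_le[OF g(2)] by simp
  define kp ks where k_def: "kp = \<omega> / sqrt (lam + 2 * \<mu>)" "ks = \<omega> / sqrt \<mu>"
  define cp cs where c_def: "cp = complex_of_real (sqrt (kp / \<omega>))" "cs = complex_of_real (sqrt (ks / \<omega>))"
  have "cp * plane_wave kp (\<lambda>d. of_real (d $ i) * gp d) x + cs * plane_wave ks (\<lambda>d. of_real (perp d $ i) * gs d) x
    = (LINT d|circle_measure. cp * (exp (\<i> * of_real (kp * (d \<bullet> x))) * (of_real (d $ i) * gp d))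
      + cs * (exp (\<i> * of_real (ks * (d \<bullet> x))) * (of_real (perp d $ i) * gs d)))"
    unfolding plane_wave_def using integrable_plane_wave[OF i(1)] integrable_plane_wave[OF i(2)]
    by (simp only: Bochner_Integration.integral_add Bochner_Integration.integral_mult_right_zero integrable_mult_right)
  then show "herglotz lam \<mu> \<omega> gp gs x $ i = exp (- (\<i> * of_real pi / 4)) *
    (of_real (sqrt (\<omega> / sqrt (lam + 2 * \<mu>) / \<omega>)) * plane_wave (\<omega> / sqrt (lam + 2 * \<mu>)) (\<lambda>d. of_real (d $ i) * gp d) x
     + of_real (sqrt (\<omega> / sqrt \<mu> / \<omega>)) * plane_wave (\<omega> / sqrt \<mu>) (\<lambda>d. of_real (perp d $ i) * gs d) x)"
    unfolding herglotz_def Let_def vec_lambda_beta k_def[symmetric] c_def[symmetric] by (simp only: mult_ac)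
qed

lemma C_k_herglotz:
  assumes g: "L2 circle_measure gp" "L2 circle_measure gs"
  shows "C_k n (herglotz lam \<mu> \<omega> gp gs)"
proof -
  have "herglotz lam \<mu> \<omega> gp gs = (\<lambda>x. axis 1 (herglotz lam \<mu> \<omega> gp gs x $ 1) + axis 2 (herglotz lam \<mu> \<omega> gp gs x $ 2))"
    by (auto simp: fun_eq_iff vec_eq_iff forall_2 axis_def)
  moreover have c: "C_k n (\<lambda>x. herglotz lam \<mu> \<omega> gp gs x $ i)" for i
    unfolding herglotz_nth(1)[OF g] by (intro C_k_mult C_k_add C_k_const C_k_plane_wave herglotz_nth(2,3)[OF g])
  moreover have b: "bounded_linear (axis i :: complex \<Rightarrow> complex^2)" for i
    unfolding linear_conv_bounded_linear[symmetric] by (rule linearI) (auto simp: vec_eq_iff axis_def)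
  ultimately show ?thesis
    using C_k_add[OF C_k_bounded_linear[OF b c] C_k_bounded_linear[OF b c], of 1 1 2 2] by simp
qed

text \<open>On the circle, of finite measure, \<open>L\<^sup>2\<close> norms control
  \<open>L\<^sup>1\<close> norms, and the phase changes by at most the wave number times
  \<open>norm x\<close>. The second bound limits the variation of the waves near the vertex by the
  growth of their kernels.\<close>

lemma herglotz_bounds:
  obtains C where "0 \<le> C"
    "\<And>gp gs x. L2 circle_measure gp \<Longrightarrow> L2 circle_measure gs \<Longrightarrow>
      norm (herglotz lam \<mu> \<omega> gp gs 0) \<le> C * (L2_norm circle_measure gp + L2_norm circle_measure gs)"
    "\<And>gp gs x. L2 circle_measure gp \<Longrightarrow> L2 circle_measure gs \<Longrightarrow>
      norm (herglotz lam \<mu> \<omega> gp gs x - herglotz lam \<mu> \<omega> gp gs 0) \<le> C * (L2_norm circle_measure gp + L2_norm circle_measure gs) * norm x"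
proof -
  define kp ks where k_def: "kp = \<omega> / sqrt (lam + 2 * \<mu>)" "ks = \<omega> / sqrt \<mu>"
  define cp cs where c_def: "cp = complex_of_real (sqrt (kp / \<omega>))" "cs = complex_of_real (sqrt (ks / \<omega>))"
  define Q where "Q = L2_norm circle_measure (\<lambda>_. 1 :: real)"
  define A where "A = (norm cp + norm cs) * (1 + \<bar>kp\<bar> + \<bar>ks\<bar>) * Q"
  have Q: "0 \<le> Q" by (simp add: Q_def L2_norm_def)
  have A: "0 \<le> A" using Q by (simp add: A_def)
  have e: "norm (exp (- (\<i> * of_real pi / 4))) = 1" by (simp add: norm_exp_eq_Re)
  have comb: "norm (exp (- (\<i> * of_real pi / 4)) * (cp * p + cs * s)) \<le> A * (X + Y) * m"
    if p: "norm p \<le> (1 + \<bar>kp\<bar> + \<bar>ks\<bar>) * m * (Q * X)" and s: "norm s \<le> (1 + \<bar>kp\<bar> + \<bar>ks\<bar>) * m * (Q * Y)"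
      and nn: "0 \<le> X" "0 \<le> Y" "0 \<le> m" for p s X Y m
  proof -
    let ?k = "(1 + \<bar>kp\<bar> + \<bar>ks\<bar>) * m * Q"
    have k: "0 \<le> ?k" using Q nn by simp
    have "norm (cp * p + cs * s) \<le> norm cp * norm p + norm cs * norm s"
      by (rule order_trans[OF norm_triangle_ineq]) (simp add: norm_mult)
    also have "\<dots> \<le> norm cp * (?k * X) + norm cs * (?k * Y)"
      using p s by (intro add_mono mult_left_mono) (auto simp: mult_ac)
    also have "\<dots> \<le> norm cp * (?k * (X + Y)) + norm cs * (?k * (X + Y))"
      using k nn by (intro add_mono mult_left_mono) auto
    also have "\<dots> = A * (X + Y) * m" by (simp add: A_def algebra_simps)
    finally show ?thesis by (simp only: norm_mult e mult_1)
  qed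
  have comp: "norm u \<le> (2 * A) * Z * m" if "\<And>i. norm (u $ i) \<le> A * Z * m" for u :: "complex^2" and Z m
  proof -
    have "norm u \<le> (\<Sum>i\<in>UNIV. norm (u $ i))" by (simp add: norm_vec_def L2_set_le_sum)
    also have "\<dots> \<le> (\<Sum>i\<in>(UNIV :: 2 set). A * Z * m)" by (rule sum_mono) (rule that)
    finally show ?thesis by simp
  qed
  show ?thesis
  proof (rule that[of "2 * A"])
    show "0 \<le> 2 * A" using A by simp
    fix gp gs :: "real^2 \<Rightarrow> complex" and x assume g: "L2 circle_measure gp" "L2 circle_measure gs"
    note H1 = herglotz_nth(1)[OF g, where lam = lam and \<mu> = \<mu> and \<omega> = \<omega>, folded k_def, folded c_def]
    note H = herglotz_nth[OF g, folded Q_def]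
    have nn: "0 \<le> L2_norm circle_measure gp" "0 \<le> L2_norm circle_measure gs" by (simp_all add: L2_norm_def)
    have big: "Z \<le> (1 + \<bar>kp\<bar> + \<bar>ks\<bar>) * Z" "\<bar>kp\<bar> * Z \<le> (1 + \<bar>kp\<bar> + \<bar>ks\<bar>) * Z" "\<bar>ks\<bar> * Z \<le> (1 + \<bar>kp\<bar> + \<bar>ks\<bar>) * Z"
      if "0 \<le> Z" for Z using that by (simp_all add: algebra_simps)
    have "norm (herglotz lam \<mu> \<omega> gp gs 0) \<le> (2 * A) * (L2_norm circle_measure gp + L2_norm circle_measure gs) * 1"
    proof (rule comp, unfold H1, rule comb)
      show "norm (plane_wave kp (\<lambda>d. of_real (d $ i) * gp d) 0) \<le> (1 + \<bar>kp\<bar> + \<bar>ks\<bar>) * 1 * (Q * L2_norm circle_measure gp)" for i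
        using order_trans[OF plane_wave_bounds(1)[OF H(2)] H(4)] big(1)[of "Q * L2_norm circle_measure gp"] Q nn
        by (fastforce intro: order_trans)
      show "norm (plane_wave ks (\<lambda>d. of_real (perp d $ i) * gs d) 0) \<le> (1 + \<bar>kp\<bar> + \<bar>ks\<bar>) * 1 * (Q * L2_norm circle_measure gs)" for i
        using order_trans[OF plane_wave_bounds(1)[OF H(3)] H(5)] big(1)[of "Q * L2_norm circle_measure gs"] Q nn
        by (fastforce intro: order_trans)
    qed (use nn in auto)
    then show "norm (herglotz lam \<mu> \<omega> gp gs 0) \<le> 2 * A * (L2_norm circle_measure gp + L2_norm circle_measure gs)" by simp
    have d: "(herglotz lam \<mu> \<omega> gp gs x - herglotz lam \<mu> \<omega> gp gs 0) $ i = exp (- (\<i> * of_real pi / 4)) *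
      (cp * (plane_wave kp (\<lambda>d. of_real (d $ i) * gp d) x - plane_wave kp (\<lambda>d. of_real (d $ i) * gp d) 0)
       + cs * (plane_wave ks (\<lambda>d. of_real (perp d $ i) * gs d) x - plane_wave ks (\<lambda>d. of_real (perp d $ i) * gs d) 0))" for i
      unfolding vector_minus_component H1 by (simp add: algebra_simps)
    show "norm (herglotz lam \<mu> \<omega> gp gs x - herglotz lam \<mu> \<omega> gp gs 0) \<le> 2 * A * (L2_norm circle_measure gp + L2_norm circle_measure gs) * norm x"
    proof (rule comp, unfold d, rule comb)
      fix i
      have "norm (plane_wave kp (\<lambda>d. of_real (d $ i) * gp d) x - plane_wave kp (\<lambda>d. of_real (d $ i) * gp d) 0)
          \<le> \<bar>kp\<bar> * norm x * (Q * L2_norm circle_measure gp)"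
        by (rule order_trans[OF plane_wave_bounds(2)[OF H(2)] mult_left_mono[OF H(4)]]) simp
      also have "\<dots> \<le> (1 + \<bar>kp\<bar> + \<bar>ks\<bar>) * norm x * (Q * L2_norm circle_measure gp)"
        using Q nn by (intro mult_right_mono) auto
      finally show "norm (plane_wave kp (\<lambda>d. of_real (d $ i) * gp d) x - plane_wave kp (\<lambda>d. of_real (d $ i) * gp d) 0)
          \<le> (1 + \<bar>kp\<bar> + \<bar>ks\<bar>) * norm x * (Q * L2_norm circle_measure gp)" .
      have "norm (plane_wave ks (\<lambda>d. of_real (perp d $ i) * gs d) x - plane_wave ks (\<lambda>d. of_real (perp d $ i) * gs d) 0)
          \<le> \<bar>ks\<bar> * norm x * (Q * L2_norm circle_measure gs)"
        by (rule order_trans[OF plane_wave_bounds(2)[OF H(3)] mult_left_mono[OF H(5)]]) simp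
      also have "\<dots> \<le> (1 + \<bar>kp\<bar> + \<bar>ks\<bar>) * norm x * (Q * L2_norm circle_measure gs)"
        using Q nn by (intro mult_right_mono) auto
      finally show "norm (plane_wave ks (\<lambda>d. of_real (perp d $ i) * gs d) x - plane_wave ks (\<lambda>d. of_real (perp d $ i) * gs d) 0)
          \<le> (1 + \<bar>kp\<bar> + \<bar>ks\<bar>) * norm x * (Q * L2_norm circle_measure gs)" .
    qed (use nn in auto)
  qed
qed

section \<open>The value at the vertex\<close>

lemma integral_open_interval_FTC:
  fixes f :: "real \<Rightarrow> 'a::euclidean_space"
  assumes h: "0 < h" and F: "\<And>x. 0 \<le> x \<Longrightarrow> x \<le> h \<Longrightarrow> (F has_vector_derivative f x) (at x)"
    and f: "continuous_on {0..h} f"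
  shows "(LINT x|lborel. indicator {0<..<h} x *\<^sub>R f x) = F h - F 0"
proof -
  have m: "(\<lambda>x. indicator {0..h} x *\<^sub>R f x) \<in> borel_measurable lborel"
    using borel_measurable_continuous_on_indicator[OF _ f] by simp
  have eq: "(\<lambda>x. indicator {0<..<h} x *\<^sub>R f x) = (\<lambda>x. indicator {0<..<h} x *\<^sub>R (indicator {0..h} x *\<^sub>R f x))"
    by (auto simp: fun_eq_iff indicator_def)
  have m': "(\<lambda>x. indicator {0<..<h} x *\<^sub>R f x) \<in> borel_measurable lborel"
    by (subst eq) (rule borel_measurable_scaleR[OF _ m], auto intro: borel_measurable_indicator)
  have "(LINT x|lborel. indicator {0<..<h} x *\<^sub>R f x) = (LINT x|lborel. indicator {0..h} x *\<^sub>R f x)"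
  proof (rule integral_cong_AE[OF m' m])
    show "AE x in lborel. indicator {0<..<h} x *\<^sub>R f x = indicator {0..h} x *\<^sub>R f x"
      using AE_lborel_singleton[of 0] AE_lborel_singleton[of h]
      by eventually_elim (auto simp: indicator_def)
  qed
  also have "\<dots> = F h - F 0"
    by (rule integral_FTC_atLeastAtMost) (use h F f in \<open>auto intro: has_vector_derivative_at_within\<close>)
  finally show ?thesis .
qed

text \<open>A single sign of \<open>I\<close> sees only one combination of the components; both
  together recover the vector, which is why the estimate at the vertex is carried out twice.\<close>

lemma norm_le_pair_units: "norm u \<le> norm (pair_unit \<i> u) + norm (pair_unit (- \<i>) u)"
proof -
  have 1: "u $ 1 = (pair_unit \<i> u + pair_unit (- \<i>) u) / 2" and 2: "u $ 2 = (pair_unit \<i> u - pair_unit (- \<i>) u) / (2 * \<i>)"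
    by (simp_all add: pair_unit_def)
  have "norm u \<le> norm (u $ 1) + norm (u $ 2)" using L2_set_le_sum[of UNIV "\<lambda>i. norm (u $ i)"] by (simp add: norm_vec_def UNIV_2)
  moreover have "norm (u $ 1) \<le> (norm (pair_unit \<i> u) + norm (pair_unit (- \<i>) u)) / 2"
    unfolding 1 by (simp add: norm_divide norm_triangle_ineq)
  moreover have "norm (u $ 2) \<le> (norm (pair_unit \<i> u) + norm (pair_unit (- \<i>) u)) / 2"
    unfolding 2 by (simp add: norm_divide norm_mult norm_triangle_ineq4)
  ultimately show ?thesis by simp
qed

lemma has_field_derivative_pole_power:
  fixes T s :: complex
  assumes w: "1 + T * s \<noteq> 0" and T: "T \<noteq> 0"
  shows "((\<lambda>s. - (inverse (1 + T * s))\<^sup>2 / (2 * T)) has_field_derivative 1 / (1 + T * s) ^ 3) (at s)"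
proof -
  let ?w = "1 + T * s"
  have "((\<lambda>s. inverse (1 + T * s)) has_field_derivative - (inverse ?w * T * inverse ?w)) (at s)"
    using w by (auto intro!: derivative_eq_intros)
  from DERIV_cdivide[OF DERIV_minus[OF DERIV_power[OF this, of 2]], of "2 * T"]
  have "((\<lambda>s. - (inverse (1 + T * s))\<^sup>2 / (2 * T)) has_field_derivative
    - (of_nat 2 * (- (inverse ?w * T * inverse ?w) * inverse ?w ^ (2 - Suc 0))) / (2 * T)) (at s)" .
  moreover have "- (of_nat 2 * (- (inverse w * T * inverse w) * inverse w ^ (2 - Suc 0))) / (2 * T) = 1 / w ^ 3" for w
    using T by (simp add: inverse_eq_divide power3_eq_cube)
  ultimately show ?thesis by simp
qed

section \<open>Edge integrals of the test field\<close>

context transmission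
begin

definition decay :: "real \<Rightarrow> real^2 \<Rightarrow> real" where "decay t x = 1 / (1 + t * norm x)"

lemma decay:
  assumes "0 < t"
  shows "0 < decay t x" "decay t x \<le> 1" "decay t x * norm x \<le> 1 / t" "continuous_on UNIV (decay t)"
    "0 \<le> \<alpha> \<Longrightarrow> \<alpha> \<le> 1 \<Longrightarrow> decay t x * norm x powr \<alpha> \<le> t powr (- \<alpha>)"
proof -
  have p: "1 \<le> 1 + t * norm x" for x :: "real^2" using assms by simp
  show d: "0 < decay t x" "decay t x \<le> 1" using p[of x] by (simp_all add: decay_def)
  show n: "decay t x * norm x \<le> 1 / t" using assms p[of x] less_le_trans[OF zero_less_one p[of x]] by (simp add: decay_def field_simps)
  show "continuous_on UNIV (decay t)"
    unfolding decay_def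
  proof (intro continuous_intros ballI)
    show "1 + t * norm x \<noteq> 0" for x :: "real^2" using p[of x] by linarith
  qed
  show "decay t x * norm x powr \<alpha> \<le> t powr (- \<alpha>)" if "0 \<le> \<alpha>" "\<alpha> \<le> 1"
  proof -
    \<comment> \<open>\<open>decay t x\<close> is at most 1, so lowering its exponent from 1 to
      \<open>\<alpha>\<close> can only increase it.\<close>
    have "decay t x * norm x powr \<alpha> \<le> decay t x powr \<alpha> * norm x powr \<alpha>"
      using powr_mono'[of \<alpha> 1 "decay t x"] d that by (intro mult_right_mono) auto
    also have "\<dots> = (decay t x * norm x) powr \<alpha>" using d by (simp add: powr_mult)
    also have "\<dots> \<le> (1 / t) powr \<alpha>" using n d that by (intro powr_mono2) auto
    also have "\<dots> = t powr (- \<alpha>)" using assms by (simp add: powr_divide powr_minus_divide)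
    finally show ?thesis .
  qed
qed

lemma edge_decay:
  assumes t: "0 < t" and \<theta>: "\<theta> \<in> {a, b}"
  shows "integrable bd (\<lambda>x. indicator (edge \<theta>) x *\<^sub>R (decay t x)\<^sup>2)"
    and "(LINT x|bd. indicator (edge \<theta>) x *\<^sub>R (decay t x)\<^sup>2) \<le> 1 / t"
proof -
  have cd: "continuous_on UNIV (\<lambda>x. (decay t x)\<^sup>2)" by (intro continuous_intros decay(4) t)
  show "integrable bd (\<lambda>x. indicator (edge \<theta>) x *\<^sub>R (decay t x)\<^sup>2)"
    by (rule L2_integrable[OF finite_measure_bd indicator_edge_L2[OF continuous_L2_bd[OF cd]]])
  have "(LINT x|bd. indicator (edge \<theta>) x *\<^sub>R (decay t x)\<^sup>2)
      = (LINT s|lborel. indicator {0<..<h} s *\<^sub>R (decay t (s *\<^sub>R dir \<theta>))\<^sup>2)"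
    by (rule integral_edge[OF \<theta> continuous_measurable_bd[OF cd]])
  also have "\<dots> = (LINT s|lborel. indicator {0<..<h} s *\<^sub>R (1 / (1 + t * s)\<^sup>2))"
    by (rule Bochner_Integration.integral_cong[OF refl]) (auto simp: decay_def power_divide indicator_def)
  also have "\<dots> = - (1 / (t * (1 + t * h))) - (- (1 / (t * (1 + t * 0))))"
  proof (rule integral_open_interval_FTC[OF h])
    have p: "0 < 1 + t * x" if "0 \<le> x" for x using t that by (intro add_pos_nonneg) auto
    show "((\<lambda>x. - (1 / (t * (1 + t * x)))) has_vector_derivative 1 / (1 + t * x)\<^sup>2) (at x)" if "0 \<le> x" for x
      unfolding has_real_derivative_iff_has_vector_derivative[symmetric]
      using p[OF that] t by (auto intro!: derivative_eq_intros simp: power2_eq_square)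
    show "continuous_on {0..h} (\<lambda>x. 1 / (1 + t * x)\<^sup>2)"
      using p by (intro continuous_intros) (auto simp: less_imp_neq[symmetric])
  qed
  also have "\<dots> \<le> 1 / t" using t h by (simp add: add_pos_pos)
  finally show "(LINT x|bd. indicator (edge \<theta>) x *\<^sub>R (decay t x)\<^sup>2) \<le> 1 / t" .
qed

text \<open>Two factors of \<open>decay\<close> integrate to at most \<open>1 / t\<close> along an
  edge, exactly what the factor \<open>t\<close> compensates.\<close>

lemma norm_edge_integral_le:
  fixes F :: "real^2 \<Rightarrow> complex"
  assumes t: "0 < t" and \<theta>: "\<theta> \<in> {a, b}" and F: "\<And>x. x \<in> edge \<theta> \<Longrightarrow> norm (F x) \<le> C * (decay t x)\<^sup>2" and C: "0 \<le> C"
  shows "t * norm (LINT x|bd. indicator (edge \<theta>) x *\<^sub>R F x) \<le> C"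
proof -
  have "norm (LINT x|bd. indicator (edge \<theta>) x *\<^sub>R F x) \<le> (LINT x|bd. C * (indicator (edge \<theta>) x *\<^sub>R (decay t x)\<^sup>2))"
  proof (rule integral_norm_le)
    show "integrable bd (\<lambda>x. C * (indicator (edge \<theta>) x *\<^sub>R (decay t x)\<^sup>2))"
      by (rule integrable_mult_right) (rule edge_decay(1)[OF t \<theta>])
    show "norm (indicator (edge \<theta>) x *\<^sub>R F x) \<le> C * (indicator (edge \<theta>) x *\<^sub>R (decay t x)\<^sup>2)" for x
      using F[of x] by (cases "x \<in> edge \<theta>") auto
  qed
  also have "\<dots> = C * (LINT x|bd. indicator (edge \<theta>) x *\<^sub>R (decay t x)\<^sup>2)"
    by (rule Bochner_Integration.integral_mult_right_zero)
  also have "\<dots> \<le> C * (1 / t)" by (intro mult_left_mono edge_decay(2) t \<theta> C)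
  finally have "t * norm (LINT x|bd. indicator (edge \<theta>) x *\<^sub>R F x) \<le> t * (C * (1 / t))"
    using t by (intro mult_left_mono) auto
  then show ?thesis using t by simp
qed

abbreviation "\<Theta> \<equiv> (1 / sqrt c0) ^ 3"

lemma cgo_decay:
  assumes x: "x \<in> edge \<theta>" and \<theta>: "\<theta> \<in> {a, b}" and t: "0 < t" and I: "I * I = - 1" and c: "\<bar>c x\<bar> \<le> 1"
  shows "norm (cgo c I t x) \<le> \<Theta> * decay t x ^ 3"
proof -
  obtain r where "0 < r" "x = r *\<^sub>R dir \<theta>" using x by (auto simp: edge_def)
  then have "x \<in> closed_sector" using edge_closed_sector[OF \<theta>, of r] by simp
  from cgo_bound[where c = c, OF this less_imp_le[OF t] I] show ?thesis using c by (simp add: decay_def)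
qed

text \<open>On an edge the pole factor is affine in arc length, so its inverse cube has the
  elementary antiderivative of \<open>has_field_derivative_pole_power\<close>.\<close>

lemma edge_pole_integral:
  assumes \<theta>: "\<theta> \<in> {a, b}" and t: "0 < t" and I: "I * I = - 1"
  shows "of_real t * (LINT x|bd. indicator (edge \<theta>) x *\<^sub>R (E I t x) ^ 3)
    = (1 - 1 / (1 + of_real t * of_real h * (of_real (cos \<theta>) + I * of_real (sin \<theta>)))\<^sup>2) / (2 * (of_real (cos \<theta>) + I * of_real (sin \<theta>)))"
proof -
  define z where "z = of_real (cos \<theta>) + I * of_real (sin \<theta>)"
  have z0: "z \<noteq> 0"
  proof
    assume "z = 0"
    then have "cos \<theta> = 0" "sin \<theta> = 0"
      using imag_unit_cases[OF I] by (auto simp: z_def complex_eq_iff)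
    then show False using sin_cos_squared_add[of \<theta>] by simp
  qed
  define T where "T = of_real t * z"
  have T0: "T \<noteq> 0" using z0 t by (simp add: T_def)
  have pf: "pole_factor I t (s *\<^sub>R dir \<theta>) = 1 + T * of_real s" for s
    by (simp add: pole_factor_def z_def T_def algebra_simps)
  note P = closed_sector_pole[OF edge_closed_sector[OF \<theta>] less_imp_le[OF t] I]
  have nz: "1 + T * of_real s \<noteq> 0" if "0 \<le> s" for s using P(2)[OF that] by (simp add: pf)
  have cE: "continuous_on UNIV (\<lambda>x. E I t x ^ 3)"
    using C_k_continuous[OF C_k_pole_inverse[OF c0_pos, of 1]] by (intro continuous_intros) auto
  have "(LINT x|bd. indicator (edge \<theta>) x *\<^sub>R (E I t x) ^ 3) = (LINT s|lborel. indicator {0<..<h} s *\<^sub>R (E I t (s *\<^sub>R dir \<theta>)) ^ 3)"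
    by (rule integral_edge[OF \<theta> continuous_measurable_bd[OF cE]])
  also have "\<dots> = (LINT s|lborel. indicator {0<..<h} s *\<^sub>R (1 / (1 + T * of_real s) ^ 3))"
    by (rule Bochner_Integration.integral_cong[OF refl]) (auto simp: P(1) pf indicator_def inverse_eq_divide power_divide)
  also have "\<dots> = - (inverse (1 + T * of_real h))\<^sup>2 / (2 * T) - (- (inverse (1 + T * of_real 0))\<^sup>2 / (2 * T))"
  proof (rule integral_open_interval_FTC[OF h])
    show "((\<lambda>s. - (inverse (1 + T * of_real s))\<^sup>2 / (2 * T)) has_vector_derivative 1 / (1 + T * of_real s) ^ 3) (at s)"
      if s: "0 \<le> s" for s
      by (rule has_vector_derivative_real_field[where f = "\<lambda>s. - (inverse (1 + T * s))\<^sup>2 / (2 * T)"])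
        (rule has_field_derivative_pole_power[OF nz[OF s] T0])
    show "continuous_on {0..h} (\<lambda>s. 1 / (1 + T * of_real s) ^ 3)"
      using nz by (intro continuous_intros) auto
  qed
  also have "of_real t * \<dots> = (1 - 1 / (1 + T * of_real h)\<^sup>2) / (2 * z)"
    using z0 t by (simp add: T_def inverse_eq_divide power_divide diff_divide_distrib right_diff_distrib)
  finally show ?thesis by (simp only: z_def T_def mult_ac)
qed

text \<open>Without the cutoff the integral is explicit. The cutoff changes it only beyond distance
  \<open>r0\<close> from the vertex, where one of the three decay factors is at most
  \<open>1 / (1 + t n * r0)\<close>.\<close>

lemma cgo_edge_tendsto:
  assumes c: "smooth c" "\<And>x. norm x \<le> r0 \<Longrightarrow> c x = 1" "\<And>x. 0 \<le> c x" "\<And>x. c x \<le> 1" and r0: "0 < r0"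
    and \<theta>: "\<theta> \<in> {a, b}" and I: "I * I = - 1"
    and t: "\<And>n. 1 \<le> t n" "filterlim t at_top sequentially"
  shows "(\<lambda>n. of_real (t n) * (LINT x|bd. indicator (edge \<theta>) x *\<^sub>R cgo c I (t n) x)) \<longlonglongrightarrow> 1 / (2 * (of_real (cos \<theta>) + I * of_real (sin \<theta>)))"
proof -
  define z where "z = of_real (cos \<theta>) + I * of_real (sin \<theta>)"
  have tp: "0 < t n" for n using t(1)[of n] by simp
  have z: "norm z = 1"
    using imag_unit_cases[OF I] by (auto simp: z_def cmod_def)
  have lim1: "(\<lambda>n. (1 - 1 / (1 + of_real (t n) * of_real h * z)\<^sup>2) / (2 * z)) \<longlonglongrightarrow> (1 - 0) / (2 * z)"
  proof (intro tendsto_intros)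
    have "filterlim (\<lambda>n. norm (1 + of_real (t n) * of_real h * z)) at_top sequentially"
    proof (rule filterlim_at_top_mono)
      show "filterlim (\<lambda>n. t n * h - 1) at_top sequentially"
        unfolding diff_conv_add_uminus
        by (subst add.commute) (intro filterlim_tendsto_add_at_top[OF tendsto_const] filterlim_at_top_mult_tendsto_pos[OF tendsto_const h t(2)])
      show "\<forall>\<^sub>F n in sequentially. t n * h - 1 \<le> norm (1 + of_real (t n) * of_real h * z)"
      proof (rule always_eventually, rule allI)
        fix n
        have "norm (of_real (t n) * of_real h * z) \<le> norm (1 + of_real (t n) * of_real h * z) + norm (1 :: complex)"
          using norm_triangle_ineq4[of "1 + of_real (t n) * of_real h * z" 1] by simp
        then show "t n * h - 1 \<le> norm (1 + of_real (t n) * of_real h * z)"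
          using z tp[of n] h by (simp add: norm_mult)
      qed
    qed
    then have "filterlim (\<lambda>n. norm ((1 + of_real (t n) * of_real h * z)\<^sup>2)) at_top sequentially"
      unfolding norm_power by (rule filterlim_pow_at_top[rotated]) simp
    then show "(\<lambda>n. 1 / (1 + of_real (t n) * of_real h * z)\<^sup>2) \<longlonglongrightarrow> 0"
      by (intro tendsto_divide_0[OF tendsto_const] filterlim_norm_at_top_imp_at_infinity)
    show "2 * z \<noteq> 0" using z by auto
  qed
  let ?d = "\<lambda>n x. of_real (1 - c x) * E I (t n) x ^ 3"
  have cc: "continuous_on UNIV c" using C_k_continuous[OF smoothD[OF c(1), of 1]] by simp
  have cE: "continuous_on UNIV (\<lambda>x. E I s x ^ 3)" for s
    using C_k_continuous[OF C_k_pole_inverse[OF c0_pos, of 1]] by (intro continuous_intros) auto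
  have bound: "t n * norm (LINT x|bd. indicator (edge \<theta>) x *\<^sub>R ?d n x) \<le> \<Theta> * (1 / (1 + t n * r0))" for n
  proof (rule norm_edge_integral_le[OF tp \<theta>])
    show "0 \<le> \<Theta> * (1 / (1 + t n * r0))" using c0_pos tp[of n] r0 by (intro mult_nonneg_nonneg) auto
    fix x assume x: "x \<in> edge \<theta>"
    show "norm (?d n x) \<le> \<Theta> * (1 / (1 + t n * r0)) * (decay (t n) x)\<^sup>2"
    proof (cases "norm x \<le> r0")
      case True
      then show ?thesis using c(2)[of x] c0_pos tp[of n] r0 by (auto intro!: mult_nonneg_nonneg)
    next
      case False
      \<comment> \<open>The complement \<open>1 - c\<close> also has values between 0 and 1, so the
        pointwise bound for \<open>cgo\<close> applies to it.\<close>
      have "?d n x = cgo (\<lambda>x. 1 - c x) I (t n) x" by (simp add: cgo_def)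
      also have "norm \<dots> \<le> \<Theta> * decay (t n) x ^ 3"
        by (rule cgo_decay[OF x \<theta> tp I]) (use c(3)[of x] c(4)[of x] in simp)
      also have "\<dots> = \<Theta> * decay (t n) x * (decay (t n) x)\<^sup>2" by (simp add: power2_eq_square power3_eq_cube)
      also have "\<dots> \<le> \<Theta> * (1 / (1 + t n * r0)) * (decay (t n) x)\<^sup>2"
        unfolding decay_def using False tp[of n] r0 c0_pos
        by (intro mult_right_mono mult_left_mono divide_left_mono) (auto intro!: mult_pos_pos add_pos_nonneg)
      finally show ?thesis .
    qed
  qed
  have b0: "(\<lambda>n. \<Theta> * (1 / (1 + t n * r0))) \<longlonglongrightarrow> \<Theta> * 0"
    by (intro tendsto_mult tendsto_const tendsto_divide_0[OF tendsto_const] filterlim_at_top_imp_at_infinity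
        filterlim_tendsto_add_at_top[OF tendsto_const] filterlim_at_top_mult_tendsto_pos[OF tendsto_const r0 t(2)])
  have lim2: "(\<lambda>n. of_real (t n) * (LINT x|bd. indicator (edge \<theta>) x *\<^sub>R ?d n x)) \<longlonglongrightarrow> 0"
    by (rule Lim_null_comparison[OF always_eventually b0[simplified]])
      (use bound tp in \<open>auto simp: norm_mult abs_of_pos\<close>)
  have split: "(LINT x|bd. indicator (edge \<theta>) x *\<^sub>R cgo c I (t n) x)
      = (LINT x|bd. indicator (edge \<theta>) x *\<^sub>R E I (t n) x ^ 3) - (LINT x|bd. indicator (edge \<theta>) x *\<^sub>R ?d n x)" for n
  proof -
    have i: "integrable bd (\<lambda>x. indicator (edge \<theta>) x *\<^sub>R E I (t n) x ^ 3)" "integrable bd (\<lambda>x. indicator (edge \<theta>) x *\<^sub>R ?d n x)"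
      by (intro L2_integrable[OF finite_measure_bd] indicator_edge_L2 continuous_L2_bd cE continuous_intros cc)+
    have "indicator (edge \<theta>) x *\<^sub>R cgo c I (t n) x = indicator (edge \<theta>) x *\<^sub>R E I (t n) x ^ 3 - indicator (edge \<theta>) x *\<^sub>R ?d n x" for x
      by (simp add: cgo_def algebra_simps)
    then show ?thesis using Bochner_Integration.integral_diff[OF i] by simp
  qed
  have "(\<lambda>n. of_real (t n) * (LINT x|bd. indicator (edge \<theta>) x *\<^sub>R cgo c I (t n) x)) \<longlonglongrightarrow> (1 - 0) / (2 * z) - 0"
    unfolding split right_diff_distrib edge_pole_integral[OF \<theta> tp I] z_def[symmetric]
    by (rule tendsto_diff[OF lim1 lim2])
  then show ?thesis by (simp add: z_def)
qed

end

lemma powr_neg_Suc_tendsto_0: "s < 0 \<Longrightarrow> (\<lambda>n. real (Suc n) powr s) \<longlonglongrightarrow> 0"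
  by (rule tendsto_neg_powr, assumption) (rule filterlim_compose[OF filterlim_real_sequentially filterlim_Suc])

lemma powr_pos_Suc_at_top:
  assumes "0 < s" shows "filterlim (\<lambda>n. real (Suc n) powr s) at_top sequentially"
proof -
  have "filterlim (\<lambda>n. inverse (real (Suc n) powr (- s))) at_top sequentially"
    by (rule filterlim_inverse_at_top[OF powr_neg_Suc_tendsto_0]) (use assms in auto)
  then show ?thesis by (simp add: powr_minus)
qed

section \<open>Replacing the trace by the value of the wave at the vertex\<close>

context transmission
begin

definition edge_weight :: "(real^2 \<Rightarrow> real) \<Rightarrow> complex \<Rightarrow> real \<Rightarrow> real \<Rightarrow> real^2 \<Rightarrow> complex" where
  "edge_weight c I t \<theta> x = indicator (edge \<theta>) x *\<^sub>R (of_real (\<eta> x) * cgo c I t x)"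

lemma continuous_cgo: "smooth c \<Longrightarrow> continuous_on UNIV (cgo c I t)"
  using C_k_continuous[OF smoothD[OF smooth_cgo, of c 1]] by blast

text \<open>Only one decay factor is kept: its \<open>L\<^sup>2\<close> norm on an edge is already
  at most \<open>1 / sqrt t\<close>, the size wanted next to the trace inequality.\<close>

lemma edge_weight_bound:
  assumes c: "smooth c" "\<And>x. \<bar>c x\<bar> \<le> 1" and I: "I * I = - 1"
  obtains M where "0 \<le> M"
    "\<And>t \<theta>. 0 < t \<Longrightarrow> \<theta> \<in> {a, b} \<Longrightarrow> AE x in bd. norm (edge_weight c I t \<theta> x) \<le> M * (indicator (edge \<theta>) x *\<^sub>R decay t x)"
    "\<And>t \<theta>. 0 < t \<Longrightarrow> \<theta> \<in> {a, b} \<Longrightarrow> L2 bd (edge_weight c I t \<theta>)"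
proof -
  obtain M0 where M0: "AE x in bd. norm (\<eta> x) \<le> M0" using \<eta> by (auto simp: Linfty_def)
  have \<Theta>: "0 \<le> \<Theta>" using c0_pos by simp
  have 1: "AE x in bd. norm (edge_weight c I t \<theta> x) \<le> (\<bar>M0\<bar> * \<Theta>) * (indicator (edge \<theta>) x *\<^sub>R decay t x)"
    if t: "0 < t" and \<theta>: "\<theta> \<in> {a, b}" for t \<theta>
    using M0
  proof eventually_elim
    case (elim x)
    show ?case
    proof (cases "x \<in> edge \<theta>")
      case True
      have "norm (cgo c I t x) \<le> \<Theta> * decay t x ^ 3" by (rule cgo_decay[OF True \<theta> t I c(2)])
      also have "\<dots> \<le> \<Theta> * decay t x ^ 1"
        using decay(1,2)[OF t, of x] \<Theta> by (intro mult_left_mono power_decreasing) auto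
      finally have "norm (\<eta> x) * norm (cgo c I t x) \<le> \<bar>M0\<bar> * (\<Theta> * decay t x)"
        using elim by (intro mult_mono) auto
      then show ?thesis using True by (simp add: edge_weight_def norm_mult mult.assoc)
    qed (simp add: edge_weight_def)
  qed
  have m: "edge_weight c I t \<theta> \<in> borel_measurable bd" for t \<theta>
  proof -
    have [measurable]: "\<eta> \<in> borel_measurable bd" using \<eta> by (simp add: Linfty_def)
    note [measurable] = continuous_measurable_bd[OF continuous_cgo[OF c(1)]]
    have "(\<lambda>x. of_real (\<eta> x) * cgo c I t x) \<in> borel_measurable bd" by measurable
    then show ?thesis unfolding edge_weight_def by (rule borel_measurable_scaleR[OF bd_indicator_measurable])
  qed
  show ?thesis
  proof (rule that[of "\<bar>M0\<bar> * \<Theta>"])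
    show "0 \<le> \<bar>M0\<bar> * \<Theta>" using \<Theta> by simp
    fix t \<theta> :: real assume t: "0 < t" and \<theta>: "\<theta> \<in> {a, b}"
    show "AE x in bd. norm (edge_weight c I t \<theta> x) \<le> \<bar>M0\<bar> * \<Theta> * (indicator (edge \<theta>) x *\<^sub>R decay t x)" by (rule 1[OF t \<theta>])
    then have "AE x in bd. norm (edge_weight c I t \<theta> x) \<le> \<bar>M0\<bar> * \<Theta>"
    proof eventually_elim
      case (elim x)
      have "indicator (edge \<theta>) x *\<^sub>R decay t x \<le> 1" using decay(2)[OF t, of x] by (auto split: split_indicator)
      then have "\<bar>M0\<bar> * \<Theta> * (indicator (edge \<theta>) x *\<^sub>R decay t x) \<le> \<bar>M0\<bar> * \<Theta> * 1" by (rule mult_left_mono) (use \<Theta> in simp)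
      then show ?case using elim by simp
    qed
    then show "L2 bd (edge_weight c I t \<theta>)" by (rule L2_bounded_finite[OF finite_measure_bd m])
  qed
qed

lemma tv_L2: "L2 bd tv"
  using tv by (simp add: has_trace_def)

text \<open>Cauchy-Schwarz on the edge: the weight has \<open>L\<^sup>2\<close> norm of order
  \<open>1 / sqrt t\<close>, and the trace of the difference is bounded by its
  \<open>H\<^sup>1\<close> norm on \<open>S\<close>. Multiplication by \<open>t\<close> leaves
  \<open>sqrt t\<close>.\<close>

lemma trace_error:
  assumes c: "smooth c" "\<And>x. norm x \<ge> R \<Longrightarrow> c x = 0" "\<And>x. \<bar>c x\<bar> \<le> 1" and R: "0 < R" "R < h" and I: "I * I = - 1"
  obtains C where "0 \<le> C"
    "\<And>t \<theta> w. 1 \<le> t \<Longrightarrow> \<theta> \<in> {a, b} \<Longrightarrow> C_k 1 w \<Longrightarrow>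
      t * norm (LINT x|bd. edge_weight c I t \<theta> x * pair_unit I (tv x - w x)) \<le> C * (sqrt t * H1_norm S (\<lambda>x. v x - w x))"
proof -
  have R2: "R < (R + h) / 2" "(R + h) / 2 < h" using R by auto
  \<comment> \<open>A second cutoff, equal to 1 on the support of \<open>c\<close>: the trace
    inequality needs a weight supported in the ball, and this one leaves the integrand
    unchanged.\<close>
  obtain c' :: "real^2 \<Rightarrow> real" where c': "smooth c'" "\<And>x. norm x \<le> R \<Longrightarrow> c' x = 1" "\<And>x. norm x \<ge> (R + h) / 2 \<Longrightarrow> c' x = 0"
    "\<And>x. 0 \<le> c' x" "\<And>x. c' x \<le> 1"
    by (rule cutoff_exists[OF R(1) R2(1)], rule that)
  obtain K where K: "0 \<le> K" "\<And>(w :: real^2 \<Rightarrow> complex^2) t. C_k 1 w \<Longrightarrow> t \<in> {a, b} \<Longrightarrow>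
      (LINT x|bd. indicator (edge t) x *\<^sub>R (c' x * (norm (tv x - w x))\<^sup>2)) \<le> K * (H1_norm S (\<lambda>x. v x - w x))\<^sup>2"
    by (rule trace_diff_bound[OF smoothD[OF c'(1)] _ R2(2) c'(4,5) v tv], erule c'(3), rule that)
  obtain M where M: "0 \<le> M"
    "\<And>t \<theta>. 0 < t \<Longrightarrow> \<theta> \<in> {a, b} \<Longrightarrow> AE x in bd. norm (edge_weight c I t \<theta> x) \<le> M * (indicator (edge \<theta>) x *\<^sub>R decay t x)"
    "\<And>t \<theta>. 0 < t \<Longrightarrow> \<theta> \<in> {a, b} \<Longrightarrow> L2 bd (edge_weight c I t \<theta>)"
    by (rule edge_weight_bound[OF c(1,3) I], rule that)
  have nI: "norm I = 1" by (rule norm_imag_unit[OF I])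
  show ?thesis
  proof (rule that[of "2 * M * sqrt K"])
    show "0 \<le> 2 * M * sqrt K" using M(1) K(1) by simp
    fix t \<theta> :: real and w :: "real^2 \<Rightarrow> complex^2" assume t1: "1 \<le> t" and \<theta>: "\<theta> \<in> {a, b}" and w: "C_k 1 w"
    have t: "0 < t" using t1 by simp
    have d: "L2 bd (\<lambda>x. tv x - w x)" by (rule L2_diff[OF tv_L2 continuous_L2_bd[OF C_k_continuous[OF w]]])
    define f where "f x = indicator (edge \<theta>) x *\<^sub>R decay t x" for x
    define g where "g x = indicator (edge \<theta>) x *\<^sub>R (sqrt (c' x) * norm (tv x - w x))" for x
    have f: "L2 bd f" unfolding f_def by (rule indicator_edge_L2[OF continuous_L2_bd[OF decay(4)[OF t]]])
    have cs: "continuous_on UNIV (\<lambda>x. sqrt (c' x))"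
      using C_k_continuous[OF smoothD[OF c'(1), of 1]] by (intro continuous_intros) auto
    have "L2 bd (\<lambda>x. sqrt (c' x) * norm (tv x - w x))"
    proof (rule L2_bound[OF d, of _ 1])
      note [measurable] = continuous_measurable_bd[OF cs] L2_measurable[OF d]
      show "(\<lambda>x. sqrt (c' x) * norm (tv x - w x)) \<in> borel_measurable bd" by measurable
      show "AE x in bd. norm (sqrt (c' x) * norm (tv x - w x)) \<le> 1 * norm (tv x - w x)"
        using c'(4,5) by (intro AE_I2) (auto simp: abs_mult intro!: mult_left_le_one_le)
    qed
    then have g: "L2 bd g" unfolding g_def by (rule indicator_edge_L2)
    have nf: "L2_norm bd f \<le> sqrt (1 / t)"
    proof -
      have "(norm (f x))\<^sup>2 = indicator (edge \<theta>) x *\<^sub>R (decay t x)\<^sup>2" for x by (simp add: f_def split: split_indicator)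
      then show ?thesis unfolding L2_norm_def using edge_decay(2)[OF t \<theta>] by (simp only: real_sqrt_le_iff)
    qed
    have ng: "L2_norm bd g \<le> sqrt K * H1_norm S (\<lambda>x. v x - w x)"
    proof -
      have "(norm (g x))\<^sup>2 = indicator (edge \<theta>) x *\<^sub>R (c' x * (norm (tv x - w x))\<^sup>2)" for x
        using c'(4)[of x] by (simp add: g_def power_mult_distrib split: split_indicator)
      then have "(LINT x|bd. (norm (g x))\<^sup>2) \<le> K * (H1_norm S (\<lambda>x. v x - w x))\<^sup>2" using K(2)[OF w \<theta>] by (simp only:)
      then have "L2_norm bd g \<le> sqrt (K * (H1_norm S (\<lambda>x. v x - w x))\<^sup>2)" unfolding L2_norm_def by (rule real_sqrt_le_mono)
      then show ?thesis by (simp add: real_sqrt_mult H1_norm_def sum_nonneg)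
    qed
    have ifg: "integrable bd (\<lambda>x. f x * g x)" by (rule integrable_bilinear_L2[OF bounded_bilinear_mult f g])
    have "norm (LINT x|bd. edge_weight c I t \<theta> x * pair_unit I (tv x - w x)) \<le> (LINT x|bd. (2 * M) * (f x * g x))"
    proof (rule integral_norm_le_AE)
      show "integrable bd (\<lambda>x. edge_weight c I t \<theta> x * pair_unit I (tv x - w x))"
        by (rule integrable_bilinear_L2[OF bounded_bilinear_mult M(3)[OF t \<theta>] L2_bounded_linear[OF bounded_linear_pair_unit d]])
      show "integrable bd (\<lambda>x. (2 * M) * (f x * g x))" by (rule integrable_mult_right) (rule ifg)
      show "AE x in bd. norm (edge_weight c I t \<theta> x * pair_unit I (tv x - w x)) \<le> (2 * M) * (f x * g x)"
        using M(2)[OF t \<theta>]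
      proof eventually_elim
        case (elim x)
        show ?case
        proof (cases "x \<in> edge \<theta> \<and> norm x < R")
          case True
          have "norm (edge_weight c I t \<theta> x) * norm (pair_unit I (tv x - w x)) \<le> (M * decay t x) * (2 * norm (tv x - w x))"
            using elim True decay(1)[OF t, of x] M(1) by (intro mult_mono norm_pair_unit_le nI) auto
          then show ?thesis using True c'(2)[of x] by (simp add: f_def g_def norm_mult mult_ac)
        next
          case False
          then have "edge_weight c I t \<theta> x = 0" using c(2)[of x] by (auto simp: edge_weight_def cgo_def)
          then show ?thesis using M(1) decay(1)[OF t, of x] c'(4)[of x]
            by (auto simp: f_def g_def split: split_indicator intro!: mult_nonneg_nonneg)
        qed
      qed
    qed
    also have "\<dots> = 2 * M * (LINT x|bd. f x * g x)" by (rule Bochner_Integration.integral_mult_right_zero)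
    also have "\<dots> \<le> 2 * M * (sqrt (1 / t) * (sqrt K * H1_norm S (\<lambda>x. v x - w x)))"
    proof (rule mult_left_mono)
      have "(LINT x|bd. f x * g x) \<le> L2_norm bd f * L2_norm bd g" using Cauchy_Schwarz_L2[OF f g] by simp
      also have "\<dots> \<le> sqrt (1 / t) * (sqrt K * H1_norm S (\<lambda>x. v x - w x))"
        using t by (intro mult_mono nf ng) (auto simp: L2_norm_def)
      finally show "(LINT x|bd. f x * g x) \<le> sqrt (1 / t) * (sqrt K * H1_norm S (\<lambda>x. v x - w x))" .
    qed (use M(1) in simp)
    finally have "t * norm (LINT x|bd. edge_weight c I t \<theta> x * pair_unit I (tv x - w x))
      \<le> t * (2 * M * (sqrt (1 / t) * (sqrt K * H1_norm S (\<lambda>x. v x - w x))))" using t by (intro mult_left_mono) auto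
    also have "\<dots> = 2 * M * sqrt K * (t * sqrt (1 / t) * H1_norm S (\<lambda>x. v x - w x))" by (simp only: mult_ac)
    also have "t * sqrt (1 / t) = sqrt t"
      using t by (simp add: real_sqrt_divide real_div_sqrt)
    finally show "t * norm (LINT x|bd. edge_weight c I t \<theta> x * pair_unit I (tv x - w x)) \<le> 2 * M * sqrt K * (sqrt t * H1_norm S (\<lambda>x. v x - w x))" .
  qed
qed

text \<open>One decay factor turns \<open>norm x\<close> into \<open>1 / t\<close> and
  \<open>norm x powr \<alpha>\<close> into \<open>t powr (- \<alpha>)\<close>; the other two are
  integrated and cancel the factor \<open>t\<close>.\<close>

lemma variation_error:
  assumes c: "\<And>x. \<bar>c x\<bar> \<le> 1" and I: "I * I = - 1" and \<alpha>: "0 < \<alpha>" "\<alpha> \<le> 1"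
    and H: "\<And>\<theta> r. \<theta> \<in> {a, b} \<Longrightarrow> 0 < r \<Longrightarrow> r < h \<Longrightarrow> \<bar>\<eta> (r *\<^sub>R dir \<theta>) - \<eta> 0\<bar> \<le> H * r powr \<alpha>"
  obtains C where "0 \<le> C"
    "\<And>t \<theta> w L. 1 \<le> t \<Longrightarrow> \<theta> \<in> {a, b} \<Longrightarrow> 0 \<le> L \<Longrightarrow> (\<forall>x. norm (w x - w 0) \<le> L * norm x) \<Longrightarrow>
      t * norm (LINT x|bd. indicator (edge \<theta>) x *\<^sub>R (cgo c I t x * (of_real (\<eta> x) * pair_unit I (w x) - of_real (\<eta> 0) * pair_unit I (w 0))))
      \<le> C * (norm (w 0) * t powr (- \<alpha>) + L / t)"
proof -
  \<comment> \<open>The first two summands bound \<open>\<eta>\<close> on the edges; the last one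
    makes \<open>M\<close> an upper bound for the Holder constant \<open>H\<close> of either
    sign.\<close>
  define M where "M = \<bar>\<eta> 0\<bar> + \<bar>H\<bar> * h powr \<alpha> + \<bar>H\<bar>"
  have \<Theta>: "0 \<le> \<Theta>" using c0_pos by simp
  have M0: "0 \<le> M" by (simp add: M_def)
  have nI: "norm I = 1" by (rule norm_imag_unit[OF I])
  show ?thesis
  proof (rule that[of "2 * \<Theta> * M"])
    show "0 \<le> 2 * \<Theta> * M" using \<Theta> M0 by simp
    fix t \<theta> L :: real and w :: "real^2 \<Rightarrow> complex^2"
    assume t1: "1 \<le> t" and \<theta>: "\<theta> \<in> {a, b}" and L: "0 \<le> L" and w: "\<forall>x. norm (w x - w 0) \<le> L * norm x"
    have t: "0 < t" using t1 by simp
    let ?Z = "norm (w 0) * t powr (- \<alpha>) + L / t"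
    show "t * norm (LINT x|bd. indicator (edge \<theta>) x *\<^sub>R (cgo c I t x * (of_real (\<eta> x) * pair_unit I (w x) - of_real (\<eta> 0) * pair_unit I (w 0))))
      \<le> 2 * \<Theta> * M * ?Z"
    proof (rule norm_edge_integral_le[OF t \<theta>])
      show "0 \<le> 2 * \<Theta> * M * ?Z" using \<Theta> M0 L t by simp
      fix x assume x: "x \<in> edge \<theta>"
      obtain r where r: "0 < r" "r < h" "x = r *\<^sub>R dir \<theta>" using x by (auto simp: edge_def)
      have n: "norm x = r" using r by simp
      have Hx: "\<bar>\<eta> x - \<eta> 0\<bar> \<le> M * norm x powr \<alpha>"
      proof -
        have "\<bar>\<eta> x - \<eta> 0\<bar> \<le> H * r powr \<alpha>" using H[OF \<theta> r(1,2)] r(3) by simp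
        also have "\<dots> \<le> M * r powr \<alpha>" by (rule mult_right_mono) (auto simp: M_def intro: add_increasing)
        finally show ?thesis by (simp add: n)
      qed
      have \<eta>x: "\<bar>\<eta> x\<bar> \<le> M"
      proof -
        have "\<bar>\<eta> x - \<eta> 0\<bar> \<le> H * r powr \<alpha>" using H[OF \<theta> r(1,2)] r(3) by simp
        also have "\<dots> \<le> \<bar>H\<bar> * h powr \<alpha>" using r \<alpha> by (intro mult_mono powr_mono2) auto
        finally show ?thesis unfolding M_def by linarith
      qed
      have "of_real (\<eta> x) * pair_unit I (w x) - of_real (\<eta> 0) * pair_unit I (w 0)
        = of_real (\<eta> x) * pair_unit I (w x - w 0) + of_real (\<eta> x - \<eta> 0) * pair_unit I (w 0)"
        by (simp add: pair_unit_def algebra_simps)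
      also have "norm \<dots> \<le> \<bar>\<eta> x\<bar> * norm (pair_unit I (w x - w 0)) + \<bar>\<eta> x - \<eta> 0\<bar> * norm (pair_unit I (w 0))"
        by (rule order_trans[OF norm_triangle_ineq]) (simp only: norm_mult norm_of_real order_refl)
      also have "\<dots> \<le> M * (2 * (L * norm x)) + (M * norm x powr \<alpha>) * (2 * norm (w 0))"
        using w[rule_format, of x] norm_pair_unit_le[OF nI, of "w x - w 0"] norm_pair_unit_le[OF nI, of "w 0"] M0
        by (intro add_mono mult_mono \<eta>x Hx) auto
      finally have B: "norm (of_real (\<eta> x) * pair_unit I (w x) - of_real (\<eta> 0) * pair_unit I (w 0))
        \<le> 2 * M * (L * norm x + norm (w 0) * norm x powr \<alpha>)" by (simp add: algebra_simps)
      have "norm (cgo c I t x * (of_real (\<eta> x) * pair_unit I (w x) - of_real (\<eta> 0) * pair_unit I (w 0)))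
        \<le> (\<Theta> * decay t x ^ 3) * (2 * M * (L * norm x + norm (w 0) * norm x powr \<alpha>))"
        unfolding norm_mult using \<Theta> decay(1)[OF t, of x]
        by (intro mult_mono B cgo_decay[OF x \<theta> t I c]) auto
      also have "\<dots> = 2 * \<Theta> * M * (L * (decay t x * norm x) + norm (w 0) * (decay t x * norm x powr \<alpha>)) * (decay t x)\<^sup>2"
        by (simp add: power2_eq_square power3_eq_cube algebra_simps)
      also have "\<dots> \<le> 2 * \<Theta> * M * (L * (1 / t) + norm (w 0) * t powr (- \<alpha>)) * (decay t x)\<^sup>2"
        using \<Theta> M0 L \<alpha> by (intro mult_right_mono mult_left_mono add_mono decay t) auto
      finally show "norm (cgo c I t x * (of_real (\<eta> x) * pair_unit I (w x) - of_real (\<eta> 0) * pair_unit I (w 0))) \<le> 2 * \<Theta> * M * ?Z * (decay t x)\<^sup>2"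
        by (simp add: add.commute)
    qed
  qed
qed

lemma edges_disjoint: "edge a \<inter> edge b = {}"
  using edge_eq[of a] edge_eq[of b] ab by (auto simp: ray_def)

text \<open>The trace is first replaced by \<open>u\<close>, then \<open>u\<close> and
  \<open>\<eta>\<close> are frozen at the vertex: two errors and a multiple of the explicit edge
  integral.\<close>

lemma edge_splitting:
  fixes u :: "real^2 \<Rightarrow> complex^2"
  assumes c: "smooth c" "\<And>x. \<bar>c x\<bar> \<le> 1" and I: "I * I = - 1" and t: "0 < t" and u: "C_k 1 u"
  shows "(LINT x|bd. indicator (edge a \<union> edge b) x *\<^sub>R (of_real (\<eta> x) * (cgo c I t x * pair_unit I (tv x))))
    = (\<Sum>\<theta>\<in>{a, b}. (LINT x|bd. edge_weight c I t \<theta> x * pair_unit I (tv x - u x))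
        + (LINT x|bd. indicator (edge \<theta>) x *\<^sub>R (cgo c I t x * (of_real (\<eta> x) * pair_unit I (u x) - of_real (\<eta> 0) * pair_unit I (u 0))))
        + of_real (\<eta> 0) * pair_unit I (u 0) * (LINT x|bd. indicator (edge \<theta>) x *\<^sub>R cgo c I t x))"
proof -
  obtain M where M: "0 \<le> M"
    "\<And>t \<theta>. 0 < t \<Longrightarrow> \<theta> \<in> {a, b} \<Longrightarrow> AE x in bd. norm (edge_weight c I t \<theta> x) \<le> M * (indicator (edge \<theta>) x *\<^sub>R decay t x)"
    "\<And>t \<theta>. 0 < t \<Longrightarrow> \<theta> \<in> {a, b} \<Longrightarrow> L2 bd (edge_weight c I t \<theta>)"
    by (rule edge_weight_bound[OF c I], rule that)
  have u2: "L2 bd u" by (rule continuous_L2_bd[OF C_k_continuous[OF u]])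
  have ip: "integrable bd (\<lambda>x. edge_weight c I t \<theta> x * pair_unit I (f x))" if "\<theta> \<in> {a, b}" "L2 bd f" for \<theta> f
    by (rule integrable_bilinear_L2[OF bounded_bilinear_mult M(3)[OF t that(1)] L2_bounded_linear[OF bounded_linear_pair_unit that(2)]])
  have i0: "integrable bd (\<lambda>x. indicator (edge \<theta>) x *\<^sub>R cgo c I t x)" for \<theta>
    by (intro L2_integrable[OF finite_measure_bd] indicator_edge_L2 continuous_L2_bd continuous_cgo c)
  have one: "(LINT x|bd. edge_weight c I t \<theta> x * pair_unit I (tv x))
      = (LINT x|bd. edge_weight c I t \<theta> x * pair_unit I (tv x - u x))
        + (LINT x|bd. indicator (edge \<theta>) x *\<^sub>R (cgo c I t x * (of_real (\<eta> x) * pair_unit I (u x) - of_real (\<eta> 0) * pair_unit I (u 0))))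
        + of_real (\<eta> 0) * pair_unit I (u 0) * (LINT x|bd. indicator (edge \<theta>) x *\<^sub>R cgo c I t x)" if \<theta>: "\<theta> \<in> {a, b}" for \<theta>
  proof -
    let ?k = "of_real (\<eta> 0) * pair_unit I (u 0)"
    have e: "indicator (edge \<theta>) x *\<^sub>R (cgo c I t x * (of_real (\<eta> x) * pair_unit I (u x) - of_real (\<eta> 0) * pair_unit I (u 0)))
      = edge_weight c I t \<theta> x * pair_unit I (u x) - ?k * (indicator (edge \<theta>) x *\<^sub>R cgo c I t x)" for x
      by (simp add: edge_weight_def algebra_simps split: split_indicator)
    have ik: "integrable bd (\<lambda>x. ?k * (indicator (edge \<theta>) x *\<^sub>R cgo c I t x))" by (rule integrable_mult_right) (rule i0)
    have p: "edge_weight c I t \<theta> x * pair_unit I (tv x - u x) = edge_weight c I t \<theta> x * pair_unit I (tv x) - edge_weight c I t \<theta> x * pair_unit I (u x)" for x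
      by (simp add: pair_unit_def algebra_simps)
    show ?thesis unfolding e p
      Bochner_Integration.integral_diff[OF ip[OF \<theta> tv_L2] ip[OF \<theta> u2]] Bochner_Integration.integral_diff[OF ip[OF \<theta> u2] ik]
      Bochner_Integration.integral_mult_right_zero by simp
  qed
  have "indicator (edge a \<union> edge b) x *\<^sub>R (of_real (\<eta> x) * (cgo c I t x * pair_unit I (tv x)))
      = edge_weight c I t a x * pair_unit I (tv x) + edge_weight c I t b x * pair_unit I (tv x)" for x
    using edges_disjoint by (auto simp: edge_weight_def mult.assoc split: split_indicator)
  then have "(LINT x|bd. indicator (edge a \<union> edge b) x *\<^sub>R (of_real (\<eta> x) * (cgo c I t x * pair_unit I (tv x))))
      = (LINT x|bd. edge_weight c I t a x * pair_unit I (tv x)) + (LINT x|bd. edge_weight c I t b x * pair_unit I (tv x))"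
    using Bochner_Integration.integral_add[OF ip[OF _ tv_L2] ip[OF _ tv_L2], of a b] by simp
  also have "\<dots> = (\<Sum>\<theta>\<in>{a, b}. LINT x|bd. edge_weight c I t \<theta> x * pair_unit I (tv x))" using ab by simp
  also have "\<dots> = (\<Sum>\<theta>\<in>{a, b}. (LINT x|bd. edge_weight c I t \<theta> x * pair_unit I (tv x - u x))
        + (LINT x|bd. indicator (edge \<theta>) x *\<^sub>R (cgo c I t x * (of_real (\<eta> x) * pair_unit I (u x) - of_real (\<eta> 0) * pair_unit I (u 0))))
        + of_real (\<eta> 0) * pair_unit I (u 0) * (LINT x|bd. indicator (edge \<theta>) x *\<^sub>R cgo c I t x))"
    by (rule sum.cong[OF refl one])
  finally show ?thesis .
qed

text \<open>The reciprocals add up to the sum of two numbers of modulus 1 divided by a nonzero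
  product, and such numbers cancel only if their angles differ by an odd multiple of pi.\<close>

lemma cgo_edges_limit_nonzero:
  assumes I: "I * I = - 1"
  shows "(\<Sum>\<theta>\<in>{a, b}. 1 / (2 * (of_real (cos \<theta>) + I * of_real (sin \<theta>)))) \<noteq> (0 :: complex)"
proof -
  let ?z = "\<lambda>\<theta>. of_real (cos \<theta>) + I * of_real (sin \<theta>)"
  have nz: "?z \<theta> \<noteq> 0" for \<theta>
  proof
    assume "?z \<theta> = 0"
    then have "cos \<theta> = 0" "sin \<theta> = 0" using imag_unit_cases[OF I] by (auto simp: complex_eq_iff)
    then show False using sin_cos_squared_add[of \<theta>] by simp
  qed
  have s: "?z a + ?z b \<noteq> 0"
  proof
    assume "?z a + ?z b = 0"
    then have "cos a + cos b = 0" "sin a + sin b = 0"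
      using imag_unit_cases[OF I] by (auto simp: complex_eq_iff)
    then have "cos b = - cos a" "sin b = - sin a" by linarith+
    then have "sin (b - a) = 0" by (simp add: sin_diff)
    then show False using sin_neq_0 by simp
  qed
  have "1 / (2 * x) + 1 / (2 * y) = (x + y) / (2 * x * y)" if "x \<noteq> 0" "y \<noteq> 0" for x y :: complex
    using that by (simp add: field_simps)
  from this[OF nz[of a] nz[of b]] have eq: "(\<Sum>\<theta>\<in>{a, b}. 1 / (2 * ?z \<theta>)) = (?z a + ?z b) / (2 * ?z a * ?z b)" using ab by simp
  have "(2 :: complex) \<noteq> 0" by simp
  with s nz[of a] nz[of b] show ?thesis unfolding eq divide_eq_0_iff mult_eq_0_iff by blast
qed

text \<open>\<open>e\<close> gathers the errors that tend to 0 by themselves, \<open>d\<close> the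
  Holder error, which multiplies the unknown size of the vertex value. \<open>Suc n\<close> avoids
  the index 0, about which nothing is assumed.\<close>

lemma vertex_value_estimate:
  fixes vj :: "nat \<Rightarrow> real^2 \<Rightarrow> complex^2"
  assumes I: "I * I = - 1" and \<alpha>: "0 < \<alpha>" "\<alpha> \<le> 1"
    and H: "\<And>\<theta> r. \<theta> \<in> {a, b} \<Longrightarrow> 0 < r \<Longrightarrow> r < h \<Longrightarrow> \<bar>\<eta> (r *\<^sub>R dir \<theta>) - \<eta> 0\<bar> \<le> H * r powr \<alpha>"
    and \<eta>0: "\<eta> 0 \<noteq> 0" and L: "0 \<le> L" and \<beta>\<gamma>: "\<beta> < \<gamma>" "0 < \<gamma>"
    and vj: "\<And>j. 1 \<le> j \<Longrightarrow> C_k 1 (vj j)" "\<And>j. 1 \<le> j \<Longrightarrow> H1_norm S (\<lambda>x. v x - vj j x) \<le> real j powr (- \<gamma>)"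
      "\<And>j x. 1 \<le> j \<Longrightarrow> norm (vj j x - vj j 0) \<le> L * real j powr \<beta> * norm x"
  obtains e d where "e \<longlonglongrightarrow> 0" "d \<longlonglongrightarrow> 0"
    "\<forall>\<^sub>F n in sequentially. norm (pair_unit I (vj (Suc n) 0)) \<le> e n + d n * norm (vj (Suc n) 0)"
proof -
  have r: "0 < h / 4" "h / 4 < h / 2" "0 < h / 2" "h / 2 < h" using h by auto
  obtain c :: "real^2 \<Rightarrow> real" where c: "smooth c" "\<And>x. norm x \<le> h / 4 \<Longrightarrow> c x = 1" "\<And>x. norm x \<ge> h / 2 \<Longrightarrow> c x = 0"
    "\<And>x. 0 \<le> c x" "\<And>x. c x \<le> 1"
    by (rule cutoff_exists[OF r(1,2)], rule that)
  have c1: "\<bar>c x\<bar> \<le> 1" for x using c(4,5)[of x] by simp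
  define J t where "J n = real (Suc n)" and "t n = real (Suc n) powr \<gamma>" for n
  have t1: "1 \<le> t n" for n unfolding t_def using \<beta>\<gamma> by (intro ge_one_powr_ge_zero) auto
  have tp: "0 < t n" for n using t1[of n] by simp
  have ti: "filterlim t at_top sequentially" unfolding t_def by (rule powr_pos_Suc_at_top[OF \<beta>\<gamma>(2)])
  obtain C1 where C1: "0 \<le> C1" "\<And>t \<theta> w. 1 \<le> t \<Longrightarrow> \<theta> \<in> {a, b} \<Longrightarrow> C_k 1 w \<Longrightarrow>
      t * norm (LINT x|bd. edge_weight c I t \<theta> x * pair_unit I (tv x - w x)) \<le> C1 * (sqrt t * H1_norm S (\<lambda>x. v x - w x))"
    by (rule trace_error[OF c(1) _ c1 r(3,4) I], erule c(3), rule that)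
  obtain C2 where C2: "0 \<le> C2" "\<And>t \<theta> w L. 1 \<le> t \<Longrightarrow> \<theta> \<in> {a, b} \<Longrightarrow> 0 \<le> L \<Longrightarrow> (\<forall>x. norm (w x - w 0) \<le> L * norm x) \<Longrightarrow>
      t * norm (LINT x|bd. indicator (edge \<theta>) x *\<^sub>R (cgo c I t x * (of_real (\<eta> x) * pair_unit I (w x) - of_real (\<eta> 0) * pair_unit I (w 0))))
      \<le> C2 * (norm (w 0) * t powr (- \<alpha>) + L / t)"
    by (rule variation_error[OF c1 I \<alpha>], erule H, assumption, assumption, rule that)
  define B where "B n = of_real (t n) * (LINT x|bd. indicator (edge a \<union> edge b) x *\<^sub>R (of_real (\<eta> x) * (cgo c I (t n) x * pair_unit I (tv x))))" for n
  have B0: "B \<longlonglongrightarrow> 0"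
    unfolding B_def by (rule boundary_form_tendsto_0[OF c(1) _ _ c1 r(1,4) I t1 ti]) (erule c(2), erule c(3))
  define Q where "Q n = (\<Sum>\<theta>\<in>{a, b}. of_real (t n) * (LINT x|bd. indicator (edge \<theta>) x *\<^sub>R cgo c I (t n) x))" for n
  define l where "l = (\<Sum>\<theta>\<in>{a, b}. 1 / (2 * (of_real (cos \<theta>) + I * of_real (sin \<theta>))) :: complex)"
  have Q: "Q \<longlonglongrightarrow> l"
    unfolding Q_def l_def by (intro tendsto_sum cgo_edge_tendsto[OF c(1) _ c(4,5) r(1) _ I t1 ti]) (auto intro: c(2))
  \<comment> \<open>Half of the limit of the coefficient, a lower bound that holds
    eventually.\<close>
  define k where "k = \<bar>\<eta> 0\<bar> * norm l / 2"
  have k: "0 < k" using cgo_edges_limit_nonzero[OF I] \<eta>0 by (simp add: k_def l_def)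
  have "\<forall>\<^sub>F n in sequentially. norm l / 2 < norm (Q n)"
    by (rule order_tendstoD(1)[OF tendsto_norm[OF Q]]) (use cgo_edges_limit_nonzero[OF I] in \<open>simp add: l_def\<close>)
  then have ev: "\<forall>\<^sub>F n in sequentially. k \<le> \<bar>\<eta> 0\<bar> * norm (Q n)"
    by eventually_elim (use \<eta>0 in \<open>simp add: k_def\<close>)
  \<comment> \<open>With \<open>t = J powr \<gamma>\<close>, the trace error
    \<open>sqrt t * J powr (- \<gamma>)\<close> has exponent \<open>- (\<gamma> / 2)\<close>, and
    the variation of the wave is \<open>J powr \<beta> / t\<close>. The factor 2 counts the
    edges.\<close>
  define e where "e n = (norm (B n) + 2 * (C1 * J n powr (- (\<gamma> / 2)) + C2 * L * J n powr (\<beta> - \<gamma>))) / k" for n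
  define d where "d n = 2 * C2 * J n powr (- (\<gamma> * \<alpha>)) / k" for n
  have est: "\<bar>\<eta> 0\<bar> * norm (Q n) * norm (pair_unit I (vj (Suc n) 0)) \<le> k * (e n + d n * norm (vj (Suc n) 0))" for n
  proof -
    let ?w = "vj (Suc n)"
    let ?T = "\<lambda>\<theta>. LINT x|bd. edge_weight c I (t n) \<theta> x * pair_unit I (tv x - ?w x)"
    let ?V = "\<lambda>\<theta>. LINT x|bd. indicator (edge \<theta>) x *\<^sub>R (cgo c I (t n) x * (of_real (\<eta> x) * pair_unit I (?w x) - of_real (\<eta> 0) * pair_unit I (?w 0)))"
    have w: "C_k 1 ?w" by (rule vj(1)) simp
    have J: "0 < J n" by (simp add: J_def)
    have tJ: "t n = J n powr \<gamma>" by (simp add: t_def J_def)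
    have T: "t n * norm (?T \<theta>) \<le> C1 * J n powr (- (\<gamma> / 2))" if "\<theta> \<in> {a, b}" for \<theta>
    proof -
      have "t n * norm (?T \<theta>) \<le> C1 * (sqrt (t n) * H1_norm S (\<lambda>x. v x - ?w x))" by (rule C1(2)[OF t1 that w])
      also have "\<dots> \<le> C1 * (sqrt (t n) * J n powr (- \<gamma>))"
        using vj(2)[of "Suc n"] tp[of n] C1(1) by (intro mult_left_mono) (auto simp: J_def)
      also have "sqrt (t n) = J n powr (\<gamma> / 2)"
        using J by (simp add: tJ powr_half_sqrt[symmetric] powr_powr)
      also have "J n powr (\<gamma> / 2) * J n powr (- \<gamma>) = J n powr (- (\<gamma> / 2))"
        by (simp add: powr_add[symmetric])
      finally show ?thesis .
    qed
    have V: "t n * norm (?V \<theta>) \<le> C2 * (norm (?w 0) * J n powr (- (\<gamma> * \<alpha>)) + L * J n powr (\<beta> - \<gamma>))" if "\<theta> \<in> {a, b}" for \<theta>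
    proof -
      have "t n * norm (?V \<theta>) \<le> C2 * (norm (?w 0) * t n powr (- \<alpha>) + L * J n powr \<beta> / t n)"
        by (rule C2(2)[OF t1 that]) (use L vj(3)[of "Suc n"] in \<open>auto simp: J_def\<close>)
      then show ?thesis using J by (simp add: tJ powr_powr powr_diff)
    qed
    have "B n = (\<Sum>\<theta>\<in>{a, b}. of_real (t n) * ?T \<theta> + of_real (t n) * ?V \<theta>) + of_real (\<eta> 0) * pair_unit I (?w 0) * Q n"
      unfolding B_def Q_def edge_splitting[OF c(1) c1 I tp w] by (simp add: sum_distrib_left sum.distrib algebra_simps)
    then have "of_real (\<eta> 0) * pair_unit I (?w 0) * Q n = B n - (\<Sum>\<theta>\<in>{a, b}. of_real (t n) * ?T \<theta> + of_real (t n) * ?V \<theta>)" by simp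
    then have "norm (of_real (\<eta> 0) * pair_unit I (?w 0) * Q n) \<le> norm (B n) + norm (\<Sum>\<theta>\<in>{a, b}. of_real (t n) * ?T \<theta> + of_real (t n) * ?V \<theta>)"
      by (simp only: norm_triangle_ineq4)
    also have "norm (\<Sum>\<theta>\<in>{a, b}. of_real (t n) * ?T \<theta> + of_real (t n) * ?V \<theta>)
      \<le> (\<Sum>\<theta>\<in>{a, b}. C1 * J n powr (- (\<gamma> / 2)) + C2 * (norm (?w 0) * J n powr (- (\<gamma> * \<alpha>)) + L * J n powr (\<beta> - \<gamma>)))"
    proof (rule order_trans[OF norm_sum sum_mono])
      fix \<theta> assume \<theta>: "\<theta> \<in> {a, b}"
      have "norm (of_real (t n) * ?T \<theta> + of_real (t n) * ?V \<theta>) \<le> t n * norm (?T \<theta>) + t n * norm (?V \<theta>)"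
        by (rule order_trans[OF norm_triangle_ineq]) (use tp[of n] in \<open>simp add: norm_mult\<close>)
      then show "norm (of_real (t n) * ?T \<theta> + of_real (t n) * ?V \<theta>)
        \<le> C1 * J n powr (- (\<gamma> / 2)) + C2 * (norm (?w 0) * J n powr (- (\<gamma> * \<alpha>)) + L * J n powr (\<beta> - \<gamma>))"
        using T[OF \<theta>] V[OF \<theta>] by linarith
    qed
    also have "norm (B n) + \<dots> = k * (e n + d n * norm (?w 0))"
      using ab k by (simp add: e_def d_def field_simps)
    finally show ?thesis by (simp add: norm_mult mult_ac)
  qed
  show ?thesis
  proof (rule that)
    have "(\<lambda>n. (norm (B n) + 2 * (C1 * J n powr (- (\<gamma> / 2)) + C2 * L * J n powr (\<beta> - \<gamma>))) / k) \<longlonglongrightarrow> (norm (0::complex) + 2 * (C1 * 0 + C2 * L * 0)) / k"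
      unfolding J_def using \<beta>\<gamma> k by (intro tendsto_intros B0 powr_neg_Suc_tendsto_0) auto
    then show "e \<longlonglongrightarrow> 0" by (simp add: e_def[abs_def])
    have "(\<lambda>n. 2 * C2 * J n powr (- (\<gamma> * \<alpha>)) / k) \<longlonglongrightarrow> 2 * C2 * 0 / k"
      unfolding J_def using \<beta>\<gamma> k \<alpha> by (intro tendsto_intros powr_neg_Suc_tendsto_0) auto
    then show "d \<longlonglongrightarrow> 0" by (simp add: d_def[abs_def])
    show "\<forall>\<^sub>F n in sequentially. norm (pair_unit I (vj (Suc n) 0)) \<le> e n + d n * norm (vj (Suc n) 0)"
      using ev
    proof eventually_elim
      case (elim n)
      have "k * norm (pair_unit I (vj (Suc n) 0)) \<le> k * (e n + d n * norm (vj (Suc n) 0))"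
        using est[of n] mult_right_mono[OF elim norm_ge_zero[of "pair_unit I (vj (Suc n) 0)"]] by linarith
      then show ?case using k by (simp only: mult_le_cancel_left_pos)
    qed
  qed
qed

text \<open>The estimates for both signs of \<open>I\<close> together bound the vector by a null
  sequence plus \<open>d n + d' n\<close> times its own norm. Once this coefficient is below 1/2,
  the term is absorbed into the left side.\<close>

lemma vertex_values_tendsto_0:
  fixes vj :: "nat \<Rightarrow> real^2 \<Rightarrow> complex^2"
  assumes \<alpha>: "0 < \<alpha>" "\<alpha> \<le> 1"
    and H: "\<And>\<theta> r. \<theta> \<in> {a, b} \<Longrightarrow> 0 < r \<Longrightarrow> r < h \<Longrightarrow> \<bar>\<eta> (r *\<^sub>R dir \<theta>) - \<eta> 0\<bar> \<le> H * r powr \<alpha>"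
    and \<eta>0: "\<eta> 0 \<noteq> 0" and L: "0 \<le> L" and \<beta>\<gamma>: "\<beta> < \<gamma>" "0 < \<gamma>"
    and vj: "\<And>j. 1 \<le> j \<Longrightarrow> C_k 1 (vj j)" "\<And>j. 1 \<le> j \<Longrightarrow> H1_norm S (\<lambda>x. v x - vj j x) \<le> real j powr (- \<gamma>)"
      "\<And>j x. 1 \<le> j \<Longrightarrow> norm (vj j x - vj j 0) \<le> L * real j powr \<beta> * norm x"
  shows "(\<lambda>j. vj j 0) \<longlonglongrightarrow> 0"
proof -
  obtain e d where 1: "e \<longlonglongrightarrow> 0" "d \<longlonglongrightarrow> 0"
    "\<forall>\<^sub>F n in sequentially. norm (pair_unit \<i> (vj (Suc n) 0)) \<le> e n + d n * norm (vj (Suc n) 0)"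
    by (rule vertex_value_estimate[where I = "\<i>" and vj = vj, OF _ \<alpha> _ \<eta>0 L \<beta>\<gamma>], simp, erule (2) H,
      erule vj(1), erule vj(2), erule vj(3), rule that)
  obtain e' d' where 2: "e' \<longlonglongrightarrow> 0" "d' \<longlonglongrightarrow> 0"
    "\<forall>\<^sub>F n in sequentially. norm (pair_unit (- \<i>) (vj (Suc n) 0)) \<le> e' n + d' n * norm (vj (Suc n) 0)"
    by (rule vertex_value_estimate[where I = "- \<i>" and vj = vj, OF _ \<alpha> _ \<eta>0 L \<beta>\<gamma>], simp, erule (2) H,
      erule vj(1), erule vj(2), erule vj(3), rule that)
  have "(\<lambda>n. d n + d' n) \<longlonglongrightarrow> 0 + 0" by (intro tendsto_add 1 2)
  then have "\<forall>\<^sub>F n in sequentially. d n + d' n < 1 / 2" by (rule order_tendstoD) simp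
  with 1(3) 2(3) have le: "\<forall>\<^sub>F n in sequentially. norm (vj (Suc n) 0) \<le> 2 * (e n + e' n)"
  proof eventually_elim
    case (elim n)
    have "norm (vj (Suc n) 0) \<le> e n + e' n + (d n + d' n) * norm (vj (Suc n) 0)"
      using elim(1,2) norm_le_pair_units[of "vj (Suc n) 0"] by (simp add: distrib_right)
    also have "(d n + d' n) * norm (vj (Suc n) 0) \<le> 1 / 2 * norm (vj (Suc n) 0)"
      using elim(3) by (intro mult_right_mono) auto
    finally show ?case by simp
  qed
  have "(\<lambda>n. 2 * (e n + e' n)) \<longlonglongrightarrow> 2 * (0 + 0)" by (intro tendsto_intros 1 2)
  then have "(\<lambda>n. 2 * (e n + e' n)) \<longlonglongrightarrow> 0" by simp
  then have "(\<lambda>n. vj (Suc n) 0) \<longlonglongrightarrow> 0" by (rule Lim_null_comparison[OF le])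
  then show ?thesis by (rule LIMSEQ_imp_Suc)
qed

end

section \<open>Averages at the vertex\<close>

lemma scaleR_sector:
  assumes "0 < \<rho>" "x \<in> sector a b" shows "\<rho> *\<^sub>R x \<in> sector a b"
proof -
  have x: "x \<noteq> 0" "a < angle x" "angle x < b" using assms(2) by (auto simp: sector_def)
  have "\<rho> *\<^sub>R x = (\<rho> * norm x) *\<^sub>R dir (angle x)"
    using polar_angle[of x] by (metis scaleR_scaleR)
  moreover have "angle ((\<rho> * norm x) *\<^sub>R dir (angle x)) = angle x"
    by (rule angle_dir) (use assms x angle_bounds[of x] in auto)
  ultimately have "angle (\<rho> *\<^sub>R x) = angle x" by simp
  then show ?thesis using x assms(1) by (simp add: sector_def)
qed

context transmission
begin

text \<open>The sector is invariant under dilations, so a fixed disk inside it, scaled by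
  \<open>\<rho>\<close>, fits into the part of \<open>\<Omega>\<close> near the vertex.\<close>

lemma measure_vertex_ball_ge:
  obtains \<kappa> where "0 < \<kappa>" "\<And>\<rho>. 0 < \<rho> \<Longrightarrow> \<rho> < h \<Longrightarrow> \<kappa> * \<rho>\<^sup>2 \<le> measure lebesgue (ball 0 \<rho> \<inter> \<Omega>)"
proof -
  \<comment> \<open>A point on the bisector inside the unit disk.\<close>
  define q where "q = (1 / 2) *\<^sub>R dir ((a + b) / 2)"
  have "angle q = (a + b) / 2" unfolding q_def by (rule angle_dir) (use ab in auto)
  then have "q \<in> sector a b \<inter> ball 0 1" using ab by (auto simp: sector_def q_def dest: arg_cong[of _ _ norm])
  moreover have "open (sector a b \<inter> ball 0 1)" using open_sector[of a b] ab by (intro open_Int open_ball) auto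
  ultimately obtain \<epsilon> where \<epsilon>: "0 < \<epsilon>" "ball q \<epsilon> \<subseteq> sector a b \<inter> ball 0 1" by (meson open_contains_ball)
  define \<kappa> where "\<kappa> = unit_ball_vol (real DIM(real^2)) * \<epsilon>\<^sup>2"
  show ?thesis
  proof (rule that)
    show "0 < \<kappa>" using \<epsilon> by (simp add: \<kappa>_def unit_ball_vol_pos)
    fix \<rho> :: real assume \<rho>: "0 < \<rho>" "\<rho> < h"
    have sub: "ball (\<rho> *\<^sub>R q) (\<rho> * \<epsilon>) \<subseteq> ball 0 \<rho> \<inter> \<Omega>"
    proof
      fix y assume y: "y \<in> ball (\<rho> *\<^sub>R q) (\<rho> * \<epsilon>)"
      define z where "z = (1 / \<rho>) *\<^sub>R y"
      have yz: "y = \<rho> *\<^sub>R z" using \<rho> by (simp add: z_def)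
      have "dist (\<rho> *\<^sub>R q) (\<rho> *\<^sub>R z) = \<rho> * dist q z"
        using \<rho> by (simp add: dist_norm scaleR_right_diff_distrib[symmetric])
      then have "z \<in> ball q \<epsilon>" using y \<rho> by (simp add: yz)
      then have z: "z \<in> sector a b" "norm z < 1" using \<epsilon>(2) by auto
      have ny: "norm y < \<rho>" using z(2) \<rho> by (simp add: yz)
      moreover have "y \<in> sector a b" unfolding yz by (rule scaleR_sector[OF \<rho>(1) z(1)])
      ultimately have "y \<in> \<Omega>" using S_iff[of y] \<rho> by auto
      then show "y \<in> ball 0 \<rho> \<inter> \<Omega>" using ny by simp
    qed
    have "\<kappa> * \<rho>\<^sup>2 = measure lebesgue (ball (\<rho> *\<^sub>R q) (\<rho> * \<epsilon>))"
      using \<rho> \<epsilon> by (simp add: \<kappa>_def content_ball power_mult_distrib)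
    also have "\<dots> \<le> measure lebesgue (ball 0 \<rho> \<inter> \<Omega>)"
      by (rule measure_mono_fmeasurable[OF sub])
        (use open_\<Omega> in \<open>auto intro!: lmeasurable_open bounded_Int open_Int\<close>)
    finally show "\<kappa> * \<rho>\<^sup>2 \<le> measure lebesgue (ball 0 \<rho> \<inter> \<Omega>)" .
  qed
qed

text \<open>Cauchy-Schwarz for the difference produces \<open>sqrt m\<close>; since \<open>m\<close>
  is at least of order \<open>\<rho>\<^sup>2\<close>, the later division by \<open>m\<close> costs a
  factor of order \<open>1 / \<rho>\<close>.\<close>

lemma vertex_average_le:
  assumes \<rho>: "0 < \<rho>" "\<rho> < h" and u: "C_k 1 u" "\<And>x. norm (u x - u 0) \<le> L * norm x" and L: "0 \<le> L"
  defines "m \<equiv> measure lebesgue (ball 0 \<rho> \<inter> \<Omega>)"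
  shows "(LINT x|lebesgue_on (ball 0 \<rho> \<inter> \<Omega>). norm (v x)) \<le> H1_norm S (\<lambda>x. v x - u x) * sqrt m + (norm (u 0) + L * \<rho>) * m"
proof -
  define U where "U = ball 0 \<rho> \<inter> \<Omega>"
  have U: "open U" "bounded U" "U \<subseteq> \<Omega>" "U \<subseteq> S"
    using open_\<Omega> \<rho> S_iff(1) by (auto simp: U_def)
  have fm: "finite_measure (lebesgue_on U)" by (rule finite_measure_lebesgue_on_bounded[OF U(2,1)])
  have m: "measure (lebesgue_on U) U = m"
    unfolding m_def U_def[symmetric] using U(1) by (simp add: measure_restrict_space open_in_lebesgue)
  have v2: "L2 (lebesgue_on \<Omega>) v" using v by (simp add: H1_def)
  have u2: "L2 (lebesgue_on \<Omega>) u" by (rule continuous_L2_lebesgue_on[OF C_k_continuous[OF u(1)] bounded_\<Omega> open_\<Omega>])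
  note d\<Omega> = L2_diff[OF v2 u2]
  have dS: "L2 (lebesgue_on S) (\<lambda>x. v x - u x)" by (rule L2_restrict[OF d\<Omega> S_subset open_S open_\<Omega>])
  have dU: "L2 (lebesgue_on U) (\<lambda>x. v x - u x)" by (rule L2_restrict[OF d\<Omega> U(3,1) open_\<Omega>])
  have vU: "L2 (lebesgue_on U) v" by (rule L2_restrict[OF v2 U(3,1) open_\<Omega>])
  have nd: "L2 (lebesgue_on U) (\<lambda>x. norm (v x - u x))" using dU by (auto simp: L2_def)
  have one: "L2 (lebesgue_on U) (\<lambda>_. 1 :: real)" by (rule L2_const_finite[OF fm])
  have id: "integrable (lebesgue_on U) (\<lambda>x. norm (v x - u x))" by (rule L2_integrable[OF fm nd])
  have "(LINT x|lebesgue_on U. norm (v x)) \<le> (LINT x|lebesgue_on U. norm (v x - u x) + (norm (u 0) + L * \<rho>))"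
  proof (rule integral_mono)
    show "integrable (lebesgue_on U) (\<lambda>x. norm (v x))" using L2_integrable[OF fm vU] by simp
    show "integrable (lebesgue_on U) (\<lambda>x. norm (v x - u x) + (norm (u 0) + L * \<rho>))"
      by (intro Bochner_Integration.integrable_add id finite_measure.integrable_const[OF fm])
    fix x assume "x \<in> space (lebesgue_on U)"
    then have "norm x \<le> \<rho>" by (simp add: space_restrict_space U_def)
    then have "norm (u x - u 0) \<le> L * \<rho>" using u(2)[of x] mult_left_mono[OF _ L, of "norm x" \<rho>] by linarith
    moreover have "norm (v x) \<le> norm (v x - u x) + norm (u x)" using norm_triangle_ineq[of "v x - u x" "u x"] by simp
    moreover have "norm (u x) \<le> norm (u x - u 0) + norm (u 0)" using norm_triangle_ineq[of "u x - u 0" "u 0"] by simp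
    ultimately show "norm (v x) \<le> norm (v x - u x) + (norm (u 0) + L * \<rho>)" by linarith
  qed
  also have "\<dots> = (LINT x|lebesgue_on U. norm (v x - u x)) + (norm (u 0) + L * \<rho>) * m"
    using Bochner_Integration.integral_add[OF id finite_measure.integrable_const[OF fm, of "norm (u 0) + L * \<rho>"]] m by simp
  also have "(LINT x|lebesgue_on U. norm (v x - u x)) \<le> H1_norm S (\<lambda>x. v x - u x) * sqrt m"
  proof -
    have CS: "\<bar>LINT x|lebesgue_on U. norm (v x - u x) * 1\<bar> \<le> L2_norm (lebesgue_on U) (\<lambda>x. norm (v x - u x)) * L2_norm (lebesgue_on U) (\<lambda>_. 1 :: real)"
      by (rule Cauchy_Schwarz_L2[OF nd one])
    have one: "L2_norm (lebesgue_on U) (\<lambda>_. 1 :: real) = sqrt m" by (simp add: L2_norm_def m)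
    have le: "L2_norm (lebesgue_on U) (\<lambda>x. norm (v x - u x)) \<le> H1_norm S (\<lambda>x. v x - u x)"
    proof -
      have "(L2_norm (lebesgue_on U) (\<lambda>x. v x - u x))\<^sup>2 \<le> (L2_norm (lebesgue_on S) (\<lambda>x. v x - u x))\<^sup>2"
        by (rule L2_norm_restrict_le[OF dS U(4,1) open_S])
      also have "\<dots> \<le> (H1_norm S (\<lambda>x. v x - u x))\<^sup>2" unfolding H1_norm_def by (subst real_sqrt_pow2) (auto simp: sum_nonneg)
      finally have "L2_norm (lebesgue_on U) (\<lambda>x. v x - u x) \<le> H1_norm S (\<lambda>x. v x - u x)"
        by (rule power2_le_imp_le) (simp add: H1_norm_def sum_nonneg)
      then show ?thesis by (simp add: L2_norm_def)
    qed
    have "(LINT x|lebesgue_on U. norm (v x - u x)) \<le> L2_norm (lebesgue_on U) (\<lambda>x. norm (v x - u x)) * sqrt m"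
      using CS unfolding one by simp
    also have "\<dots> \<le> H1_norm S (\<lambda>x. v x - u x) * sqrt m" by (rule mult_right_mono[OF le]) (simp add: m_def)
    finally show ?thesis .
  qed
  finally show ?thesis by (simp add: U_def)
qed

lemma vertex_average_tendsto_0:
  fixes vj :: "nat \<Rightarrow> real^2 \<Rightarrow> complex^2"
  assumes L: "0 \<le> L" and \<beta>\<gamma>: "0 < \<beta>" "\<beta> < \<gamma>"
    and vj: "\<And>j. 1 \<le> j \<Longrightarrow> C_k 1 (vj j)" "\<And>j. 1 \<le> j \<Longrightarrow> H1_norm S (\<lambda>x. v x - vj j x) \<le> real j powr (- \<gamma>)"
      "\<And>j x. 1 \<le> j \<Longrightarrow> norm (vj j x - vj j 0) \<le> L * real j powr \<beta> * norm x"
    and lim: "(\<lambda>j. vj j 0) \<longlonglongrightarrow> 0"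
  shows "((\<lambda>\<rho>. (LINT x|lebesgue_on (ball 0 \<rho> \<inter> \<Omega>). norm (v x)) / measure lebesgue (ball 0 \<rho> \<inter> \<Omega>)) \<longlongrightarrow> 0) (at_right 0)"
proof -
  obtain \<kappa> where \<kappa>: "0 < \<kappa>" "\<And>\<rho>. 0 < \<rho> \<Longrightarrow> \<rho> < h \<Longrightarrow> \<kappa> * \<rho>\<^sup>2 \<le> measure lebesgue (ball 0 \<rho> \<inter> \<Omega>)"
    by (rule measure_vertex_ball_ge, rule that)
  \<comment> \<open>The reciprocal of the mean of the exponents lies strictly between
    \<open>1 / \<gamma>\<close> and \<open>1 / \<beta>\<close>. The approximation error divided by
    \<open>\<rho>\<close> and the variation of the wave over the ball therefore both keep a positive
    power of \<open>\<rho>\<close>.\<close>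
  define \<sigma> where "\<sigma> = 2 / (\<beta> + \<gamma>)"
  have \<sigma>: "0 < \<sigma>" "0 < \<sigma> * \<gamma> - 1" "0 < 1 - \<sigma> * \<beta>" using \<beta>\<gamma> by (auto simp: \<sigma>_def field_simps)
  \<comment> \<open>For \<open>\<rho>\<close> below 1 the rounding keeps the index between
    \<open>\<rho> powr (- \<sigma>)\<close> and twice that value.\<close>
  define j where "j \<rho> = nat \<lceil>\<rho> powr (- \<sigma>)\<rceil>" for \<rho> :: real
  let ?b = "\<lambda>\<rho>. \<rho> powr (\<sigma> * \<gamma> - 1) / sqrt \<kappa> + norm (vj (j \<rho>) 0) + L * 2 powr \<beta> * \<rho> powr (1 - \<sigma> * \<beta>)"
  have le: "norm ((LINT x|lebesgue_on (ball 0 \<rho> \<inter> \<Omega>). norm (v x)) / measure lebesgue (ball 0 \<rho> \<inter> \<Omega>)) \<le> ?b \<rho>"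
    if \<rho>: "0 < \<rho>" "\<rho> < min h 1" for \<rho>
  proof -
    let ?m = "measure lebesgue (ball 0 \<rho> \<inter> \<Omega>)" and ?u = "vj (j \<rho>)"
    have m: "\<kappa> * \<rho>\<^sup>2 \<le> ?m" using \<kappa>(2) \<rho> by simp
    have mp: "0 < ?m" using m \<kappa>(1) \<rho> by (auto intro: less_le_trans[rotated])
    have p1: "1 \<le> \<rho> powr (- \<sigma>)" using \<rho> \<sigma> powr_mono2'[of \<sigma> \<rho> 1] by (simp add: powr_minus one_le_inverse powr_le1)
    have jl: "\<rho> powr (- \<sigma>) \<le> real (j \<rho>)" using p1 by (simp add: j_def) 
    have "real (j \<rho>) = of_int \<lceil>\<rho> powr (- \<sigma>)\<rceil>" using p1 by (simp add: j_def)
    then have ju: "real (j \<rho>) \<le> 2 * \<rho> powr (- \<sigma>)"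
      using p1 of_int_ceiling_le_add_one[of "\<rho> powr (- \<sigma>)"] by linarith
    have j1: "1 \<le> j \<rho>" using p1 jl by (metis of_nat_1 of_nat_le_iff order_trans)
    have H: "H1_norm S (\<lambda>x. v x - ?u x) \<le> \<rho> powr (\<sigma> * \<gamma>)"
    proof -
      have "H1_norm S (\<lambda>x. v x - ?u x) \<le> real (j \<rho>) powr (- \<gamma>)" by (rule vj(2)[OF j1])
      also have "\<dots> \<le> (\<rho> powr (- \<sigma>)) powr (- \<gamma>)" using jl \<rho> \<beta>\<gamma> by (intro powr_mono2') auto
      finally show ?thesis by (simp add: powr_powr)
    qed
    have Lb: "L * real (j \<rho>) powr \<beta> \<le> L * (2 powr \<beta> * \<rho> powr (- (\<sigma> * \<beta>)))"
    proof (rule mult_left_mono[OF _ L])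
      have "real (j \<rho>) powr \<beta> \<le> (2 * \<rho> powr (- \<sigma>)) powr \<beta>" using ju \<beta>\<gamma> by (intro powr_mono2) auto
      then show "real (j \<rho>) powr \<beta> \<le> 2 powr \<beta> * \<rho> powr (- (\<sigma> * \<beta>))" by (simp add: powr_mult powr_powr)
    qed
    have r1: "\<rho> powr s * \<rho> = \<rho> powr (s + 1)" for s using \<rho> by (simp add: powr_add)
    have div: "A / M \<le> B / sqrt M + k" if "A \<le> B * sqrt M + k * M" "0 < M" for A B k M :: real
    proof -
      have "A / M \<le> (B * sqrt M + k * M) / M" using that by (intro divide_right_mono) auto
      also have "\<dots> = B * (sqrt M / M) + k" using that by (simp add: add_divide_distrib)
      also have "\<dots> = B / sqrt M + k" using sqrt_divide_self_eq[OF less_imp_le[OF that(2)]] by (simp only: divide_inverse)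
      finally show ?thesis .
    qed
    have "(LINT x|lebesgue_on (ball 0 \<rho> \<inter> \<Omega>). norm (v x)) \<le> H1_norm S (\<lambda>x. v x - ?u x) * sqrt ?m + (norm (?u 0) + (L * real (j \<rho>) powr \<beta>) * \<rho>) * ?m"
      by (rule vertex_average_le) (use \<rho> L vj(1)[OF j1] vj(3)[OF j1] in auto)
    then have "(LINT x|lebesgue_on (ball 0 \<rho> \<inter> \<Omega>). norm (v x)) / ?m \<le> H1_norm S (\<lambda>x. v x - ?u x) / sqrt ?m + (norm (?u 0) + (L * real (j \<rho>) powr \<beta>) * \<rho>)"
      by (rule div[OF _ mp])
    also have "\<dots> \<le> \<rho> powr (\<sigma> * \<gamma>) / (sqrt \<kappa> * \<rho>) + (norm (?u 0) + (L * (2 powr \<beta> * \<rho> powr (- (\<sigma> * \<beta>)))) * \<rho>)"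
    proof (intro add_mono order_refl mult_right_mono Lb frac_le H)
      have "sqrt \<kappa> * \<rho> = sqrt (\<kappa> * \<rho>\<^sup>2)" using \<rho> by (simp add: real_sqrt_mult)
      also have "\<dots> \<le> sqrt ?m" using m by simp
      finally show "sqrt \<kappa> * \<rho> \<le> sqrt ?m" .
    qed (use \<rho> \<kappa>(1) in auto)
    also have "\<dots> = ?b \<rho>"
    proof -
      have "\<rho> powr (\<sigma> * \<gamma>) / (sqrt \<kappa> * \<rho>) = \<rho> powr (\<sigma> * \<gamma> - 1) / sqrt \<kappa>"
        using \<rho> by (simp add: powr_diff)
      then show ?thesis using r1[of "- (\<sigma> * \<beta>)"] by (simp add: mult.assoc)
    qed
    finally show ?thesis using mp by simp
  qed
  have ev: "eventually ((\<le>) 0) (at_right (0::real))" by (rule eventually_mono[OF eventually_at_right_less]) simp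
  have pw: "((\<lambda>\<rho>. \<rho> powr s) \<longlongrightarrow> 0) (at_right (0::real))" if "0 < s" for s
    using tendsto_powr'[of "\<lambda>x. x" 0 "at_right (0::real)" "\<lambda>_. s" s] that ev
    by (auto simp: tendsto_ident_at)
  have j: "filterlim j at_top (at_right 0)"
  proof -
    have "filterlim (\<lambda>\<rho>::real. inverse (\<rho> powr \<sigma>)) at_top (at_right 0)"
      by (rule filterlim_inverse_at_top[OF pw[OF \<sigma>(1)]], rule eventually_mono[OF eventually_at_right_less]) simp
    then have "filterlim (\<lambda>\<rho>::real. \<rho> powr (- \<sigma>)) at_top (at_right 0)" by (simp add: powr_minus)
    then show ?thesis
      unfolding filterlim_sequentially_iff_filterlim_real j_def
      by (rule filterlim_at_top_mono) (auto intro: real_nat_ceiling_ge)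
  qed
  have "((\<lambda>\<rho>. ?b \<rho>) \<longlongrightarrow> 0 / sqrt \<kappa> + norm (0 :: complex^2) + L * 2 powr \<beta> * 0) (at_right 0)"
    using \<kappa>(1) by (intro tendsto_intros pw \<sigma> filterlim_compose[OF lim j]) auto
  then have b0: "((\<lambda>\<rho>. ?b \<rho>) \<longlongrightarrow> 0) (at_right 0)" by simp
  show ?thesis
  proof (rule Lim_null_comparison[OF _ b0])
    show "\<forall>\<^sub>F \<rho> in at_right 0. norm ((LINT x|lebesgue_on (ball 0 \<rho> \<inter> \<Omega>). norm (v x)) / measure lebesgue (ball 0 \<rho> \<inter> \<Omega>)) \<le> ?b \<rho>"
      unfolding eventually_at_right_field using h le by (intro exI[of _ "min h 1"]) auto
  qed
qed

lemma zero_in_closure_edge: "0 \<in> closure (edge \<theta>)"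
  unfolding closure_approachable
proof (intro allI impI)
  fix e :: real assume e: "0 < e"
  let ?r = "min (e / 2) (h / 2)"
  have "0 < ?r" "?r < h" "?r < e" using e h by auto
  then show "\<exists>y\<in>edge \<theta>. dist y 0 < e"
    by (intro bexI[of _ "?r *\<^sub>R dir \<theta>"]) (auto simp: edge_def)
qed

text \<open>The vertex is a limit point of each edge, so the Holder condition on the closed edges
  also compares with \<open>\<eta> 0\<close>; the larger of the two constants serves both
  edges.\<close>

lemma holder_on_edge:
  assumes "holder_on \<alpha> (closure (edge a)) \<eta>" "holder_on \<alpha> (closure (edge b)) \<eta>"
  obtains H where "\<And>\<theta> r. \<theta> \<in> {a, b} \<Longrightarrow> 0 < r \<Longrightarrow> r < h \<Longrightarrow> \<bar>\<eta> (r *\<^sub>R dir \<theta>) - \<eta> 0\<bar> \<le> H * r powr \<alpha>"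
proof -
  have "\<exists>C. \<forall>r. 0 < r \<longrightarrow> r < h \<longrightarrow> \<bar>\<eta> (r *\<^sub>R dir \<theta>) - \<eta> 0\<bar> \<le> C * r powr \<alpha>" if "\<theta> \<in> {a, b}" for \<theta>
  proof -
    obtain C where C: "\<And>x y. x \<in> closure (edge \<theta>) \<Longrightarrow> y \<in> closure (edge \<theta>) \<Longrightarrow> dist (\<eta> x) (\<eta> y) \<le> C * dist x y powr \<alpha>"
      using assms \<open>\<theta> \<in> {a, b}\<close> unfolding holder_on_def by blast
    have "\<bar>\<eta> (r *\<^sub>R dir \<theta>) - \<eta> 0\<bar> \<le> C * r powr \<alpha>" if "0 < r" "r < h" for r
    proof -
      have "r *\<^sub>R dir \<theta> \<in> closure (edge \<theta>)" using that closure_subset[of "edge \<theta>"] by (auto simp: edge_def)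
      from C[OF this zero_in_closure_edge] show ?thesis using that by (simp add: dist_real_def)
    qed
    then show ?thesis by blast
  qed
  then obtain C where C: "\<And>\<theta> r. \<theta> \<in> {a, b} \<Longrightarrow> 0 < r \<Longrightarrow> r < h \<Longrightarrow> \<bar>\<eta> (r *\<^sub>R dir \<theta>) - \<eta> 0\<bar> \<le> C \<theta> * r powr \<alpha>"
    by metis
  show ?thesis
  proof (rule that[of "max (C a) (C b)"])
    fix \<theta> r :: real assume *: "\<theta> \<in> {a, b}" "0 < r" "r < h"
    have "C \<theta> * r powr \<alpha> \<le> max (C a) (C b) * r powr \<alpha>" by (rule mult_right_mono) (use * in auto)
    then show "\<bar>\<eta> (r *\<^sub>R dir \<theta>) - \<eta> 0\<bar> \<le> max (C a) (C b) * r powr \<alpha>" using C[OF *] by linarith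
  qed
qed

end

section \<open>Entering the abstract setting with the given eigenfunctions and waves\<close>

lemma L2_potential_mult:
  fixes w :: "'a \<Rightarrow> complex^2"
  assumes V: "Linfty M V" and w: "L2 M w"
  shows "L2 M (\<lambda>x. - ((c * (1 + V x)) *\<^sub>R w x))"
proof -
  obtain C where C: "AE x in M. norm (V x) \<le> C" using V by (auto simp: Linfty_def)
  show ?thesis
  proof (rule L2_bound[OF w, of _ "\<bar>c\<bar> * (1 + C)"])
    have [measurable]: "V \<in> borel_measurable M" using V by (simp add: Linfty_def)
    note [measurable] = L2_measurable[OF w]
    show "(\<lambda>x. - ((c * (1 + V x)) *\<^sub>R w x)) \<in> borel_measurable M" by measurable
    show "AE x in M. norm (- ((c * (1 + V x)) *\<^sub>R w x)) \<le> \<bar>c\<bar> * (1 + C) * norm (w x)"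
      using C
    proof eventually_elim
      case (elim x)
      then have "\<bar>c * (1 + V x)\<bar> \<le> \<bar>c\<bar> * (1 + C)" unfolding abs_mult by (intro mult_left_mono) auto
      then show ?case unfolding norm_minus_cancel norm_scaleR by (rule mult_right_mono) simp
    qed
  qed
qed

theorem theorem2p1:
  fixes lam \<mu> \<omega> h \<theta>m \<theta>M \<alpha> \<gamma> \<beta>1 \<beta>2 :: real
    and \<Omega> \<Gamma> :: "(real^2) set"
    and V \<eta> :: "real^2 \<Rightarrow> real"
    and v w :: "real^2 \<Rightarrow> complex^2"
    and gp gs :: "nat \<Rightarrow> real^2 \<Rightarrow> complex"
  defines "S \<equiv> sector \<theta>m \<theta>M \<inter> ball 0 h"
    and "\<Gamma>m \<equiv> ray \<theta>m \<inter> ball 0 h"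
    and "\<Gamma>p \<equiv> ray \<theta>M \<inter> ball 0 h"
  assumes "\<mu> > 0" and "2 * lam + 2 * \<mu> > 0" and "\<omega> > 0"
    and "bounded_lipschitz_domain \<Omega>" and "connected (- closure \<Omega>)"
    and "0 \<in> frontier \<Omega>" and "h > 0" and "\<Omega> \<inter> ball 0 h = S"
    and "Linfty (lebesgue_on \<Omega>) V" and "\<not> (AE x in lebesgue_on \<Omega>. V x = 0)"
    and "Linfty (arclength_on (frontier \<Omega>)) \<eta>"
    and "openin (top_of_set (frontier \<Omega>)) \<Gamma>" and "\<Gamma>p \<union> \<Gamma>m \<subseteq> \<Gamma>"
    and "generalized_elastic_transmission_pair lam \<mu> \<omega> V \<eta> \<Omega> \<Gamma> v w"
    and "0 < \<alpha>" and "\<alpha> < 1"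
    and "\<exists>f. holder_on \<alpha> (closure S) f \<and> (AE x in lebesgue_on S. (1 + V x) *\<^sub>R w x = f x)"
    and "holder_on \<alpha> (closure \<Gamma>p) \<eta>" and "holder_on \<alpha> (closure \<Gamma>m) \<eta>"
    and "\<gamma> > max \<beta>1 \<beta>2" and "max \<beta>1 \<beta>2 > 0"
    and "\<forall>j\<ge>1. L2 circle_measure (gp j) \<and> L2 circle_measure (gs j) \<and>
           H1_norm S (\<lambda>x. v x - herglotz lam \<mu> \<omega> (gp j) (gs j) x) \<le> real j powr (- \<gamma>) \<and>
           L2_norm circle_measure (gp j) \<le> real j powr \<beta>1 \<and>
           L2_norm circle_measure (gs j) \<le> real j powr \<beta>2"
    and "\<eta> 0 \<noteq> 0"
    and "- pi < \<theta>m" and "\<theta>m < \<theta>M" and "\<theta>M < pi" and "\<theta>M - \<theta>m \<noteq> pi"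
  shows "((\<lambda>\<rho>. (LINT x|lebesgue_on (ball 0 \<rho> \<inter> \<Omega>). norm (v x)) / measure lebesgue (ball 0 \<rho> \<inter> \<Omega>))
           \<longlongrightarrow> 0) (at_right 0)"
proof -
  define fv where "fv = (\<lambda>x. - (\<omega>\<^sup>2 *\<^sub>R v x))"
  define fw where "fw = (\<lambda>x. - ((\<omega>\<^sup>2 * (1 + V x)) *\<^sub>R w x))"
  have G: "H1 \<Omega> v" "H1 \<Omega> w" and ex: "\<exists>tv tw. has_trace \<Omega> v tv \<and> has_trace \<Omega> w tw \<and>
           (AE x in arclength_on \<Gamma>. tw x = tv x) \<and>
           (\<forall>\<phi>. smooth \<phi> \<and> compact (tsupport \<phi>) \<and> tsupport \<phi> \<inter> frontier \<Omega> \<subseteq> \<Gamma> \<longrightarrow>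
              traction_pairing lam \<mu> \<Omega> v fv \<phi> + (LINT x|arclength_on \<Gamma>. of_real (\<eta> x) * cdot (tv x) (\<phi> x))
              = traction_pairing lam \<mu> \<Omega> w fw \<phi>)"
    using \<open>generalized_elastic_transmission_pair lam \<mu> \<omega> V \<eta> \<Omega> \<Gamma> v w\<close>
    unfolding generalized_elastic_transmission_pair_def Let_def fv_def fw_def by blast+
  obtain tv tw where t: "has_trace \<Omega> v tv" "has_trace \<Omega> w tw" "AE x in arclength_on \<Gamma>. tw x = tv x"
    "\<And>\<phi>. smooth \<phi> \<Longrightarrow> compact (tsupport \<phi>) \<Longrightarrow> tsupport \<phi> \<inter> frontier \<Omega> \<subseteq> \<Gamma> \<Longrightarrow>
      traction_pairing lam \<mu> \<Omega> v fv \<phi> + (LINT x|arclength_on \<Gamma>. of_real (\<eta> x) * cdot (tv x) (\<phi> x))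
        = traction_pairing lam \<mu> \<Omega> w fw \<phi>"
    using ex by blast
  have vw: "L2 (lebesgue_on \<Omega>) v" "L2 (lebesgue_on \<Omega>) w" using G by (auto simp: H1_def)
  have fv: "L2 (lebesgue_on \<Omega>) fv"
    unfolding fv_def by (rule L2_bounded_linear[OF bounded_linear_minus[OF bounded_linear_scaleR_right] vw(1)])
  have fw: "L2 (lebesgue_on \<Omega>) fw"
    unfolding fw_def by (rule L2_potential_mult[OF \<open>Linfty (lebesgue_on \<Omega>) V\<close> vw(2)])
  have \<Gamma>mp: "ray \<theta>m \<inter> ball 0 h \<subseteq> \<Gamma>" "ray \<theta>M \<inter> ball 0 h \<subseteq> \<Gamma>"
    using \<open>\<Gamma>p \<union> \<Gamma>m \<subseteq> \<Gamma>\<close> unfolding \<Gamma>p_def \<Gamma>m_def by auto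
  have loc: "\<Omega> \<inter> ball 0 h = sector \<theta>m \<theta>M \<inter> ball 0 h" using \<open>\<Omega> \<inter> ball 0 h = S\<close> unfolding S_def .
  interpret T: transmission \<Omega> \<Gamma> \<theta>m \<theta>M h lam \<mu> \<eta> v w fv fw tv tw
  proof (unfold_locales)
    show "bounded_lipschitz_domain \<Omega>" "0 < h" "- pi < \<theta>m" "\<theta>m < \<theta>M" "\<theta>M < pi" "\<theta>M - \<theta>m \<noteq> pi"
      "openin (top_of_set (frontier \<Omega>)) \<Gamma>" "Linfty (arclength_on (frontier \<Omega>)) \<eta>"
      by fact+
  qed (fact loc \<Gamma>mp G fv fw t)+
  have S: "T.S = S" by (simp add: T.S_def S_def)
  obtain H where H: "\<And>\<theta> r. \<theta> \<in> {\<theta>m, \<theta>M} \<Longrightarrow> 0 < r \<Longrightarrow> r < h \<Longrightarrow> \<bar>\<eta> (r *\<^sub>R dir \<theta>) - \<eta> 0\<bar> \<le> H * r powr \<alpha>"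
  proof (rule T.holder_on_edge)
    show "holder_on \<alpha> (closure (T.edge \<theta>m)) \<eta>" "holder_on \<alpha> (closure (T.edge \<theta>M)) \<eta>"
      using \<open>holder_on \<alpha> (closure \<Gamma>p) \<eta>\<close> \<open>holder_on \<alpha> (closure \<Gamma>m) \<eta>\<close>
      by (simp_all add: T.edge_eq \<Gamma>p_def \<Gamma>m_def)
  qed (rule that)
  obtain C where C: "0 \<le> C"
    "\<And>gp gs x. L2 circle_measure gp \<Longrightarrow> L2 circle_measure gs \<Longrightarrow>
      norm (herglotz lam \<mu> \<omega> gp gs x - herglotz lam \<mu> \<omega> gp gs 0) \<le> C * (L2_norm circle_measure gp + L2_norm circle_measure gs) * norm x"
    by (rule herglotz_bounds[of lam \<mu> \<omega>], rule that)
  \<comment> \<open>The larger rate dominates the growth of both kernels, as \<open>j\<close> is at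
    least 1.\<close>
  define \<beta> where "\<beta> = max \<beta>1 \<beta>2"
  define vj where "vj j = herglotz lam \<mu> \<omega> (gp j) (gs j)" for j
  have g: "L2 circle_measure (gp j)" "L2 circle_measure (gs j)"
    "H1_norm T.S (\<lambda>x. v x - vj j x) \<le> real j powr (- \<gamma>)"
    "L2_norm circle_measure (gp j) \<le> real j powr \<beta>1" "L2_norm circle_measure (gs j) \<le> real j powr \<beta>2" if "1 \<le> j" for j
    using \<open>\<forall>j\<ge>1. L2 circle_measure (gp j) \<and> L2 circle_measure (gs j) \<and>
           H1_norm S (\<lambda>x. v x - herglotz lam \<mu> \<omega> (gp j) (gs j) x) \<le> real j powr (- \<gamma>) \<and>
           L2_norm circle_measure (gp j) \<le> real j powr \<beta>1 \<and>
           L2_norm circle_measure (gs j) \<le> real j powr \<beta>2\<close> that unfolding S vj_def by auto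
  have \<beta>: "0 < \<beta>" "\<beta> < \<gamma>" "0 < \<gamma>" using \<open>\<gamma> > max \<beta>1 \<beta>2\<close> \<open>max \<beta>1 \<beta>2 > 0\<close> by (auto simp: \<beta>_def)
  have v1: "C_k 1 (vj j)" if "1 \<le> j" for j unfolding vj_def by (rule C_k_herglotz[OF g(1,2)[OF that]])
  have v3: "norm (vj j x - vj j 0) \<le> (2 * C) * real j powr \<beta> * norm x" if j: "1 \<le> j" for j x
  proof -
    have "real j powr \<beta>1 \<le> real j powr \<beta>" "real j powr \<beta>2 \<le> real j powr \<beta>"
      using j by (auto intro!: powr_mono simp: \<beta>_def)
    then have "L2_norm circle_measure (gp j) + L2_norm circle_measure (gs j) \<le> 2 * real j powr \<beta>"
      using g(4,5)[OF j] by linarith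
    then have "C * (L2_norm circle_measure (gp j) + L2_norm circle_measure (gs j)) * norm x \<le> C * (2 * real j powr \<beta>) * norm x"
      using C(1) by (intro mult_right_mono mult_left_mono) auto
    with C(2)[OF g(1,2)[OF j], of x] show ?thesis unfolding vj_def by (simp add: mult_ac)
  qed
  have C2: "0 \<le> 2 * C" using C(1) by simp
  have "\<alpha> \<le> 1" using \<open>\<alpha> < 1\<close> by simp
  have "(\<lambda>j. vj j 0) \<longlonglongrightarrow> 0"
    by (rule T.vertex_values_tendsto_0[OF \<open>0 < \<alpha>\<close> \<open>\<alpha> \<le> 1\<close> _ \<open>\<eta> 0 \<noteq> 0\<close> C2 \<beta>(2,3)])
      (fact H, erule v1, erule g(3), erule v3)
  then show ?thesis
    by (rule T.vertex_average_tendsto_0[OF C2 \<beta>(1,2), rotated 3]) (erule v1, erule g(3), erule v3)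
qed

end
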